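(* Let $n\ge1$, $m\ge2$, $1<r<\infty$, $0<p_1,\dots,p_m\le\infty$, $0<p<\infty$, and $1/p_1+\dots+1/p_m=1/p$. Let $\vec{s}=(s_1,\dots,s_m)$ with $s_1,\dots,s_m\ge0$, and suppose that $$s_1\le s_2,\dots,s_m\quad\text{(that is, } s_1\le s_j \text{ for all } 2\le j\le m)\qquad\text{and}\qquad s_1\le n/r.$$ Then there exists a bounded function $\sigma$ on $(\mathbb{R}^n)^m$ such that $\mathcal{L}_{\vec{s}}^{r,\Psi^{(m)}}[\sigma]<\infty$, but $$\Vert T_\sigma\Vert_{H^{p_1}\times\cdots\times H^{p_m}\to L^p}=\infty.$$
   Context: Fourier transform: $\widehat{f}(\xi)=\int f(x)e^{-2\pi i\langle x,\xi\rangle}dx$, and $F^\vee(\xi)=\widehat F(-\xi)$. For a bounded function $\sigma$ on $(\mathbb{R}^n)^m$ and Schwartz functions $f_j$ on $\mathbb{R}^n$, $$T_\sigma(f_1,\dots,f_m)(x)=\int_{(\mathbb{R}^n)^m}\sigma(\xi_1,\dots,\xi_m)\prod_{j=1}^m\widehat{f_j}(\xi_j)\,e^{2\pi i\langle x,\xi_1+\dots+\xi_m\rangle}\,d\xi_1\cdots d\xi_m.$$ For $s_i\ge0$ and $0<r<\infty$, the product-type Sobolev norm is $$\Vert F\Vert_{L^r_{\vec{s}}((\mathbb{R}^n)^m)}=\Big\Vert\big((1+4\pi^2|\cdot_1|^2)^{s_1/2}\cdots(1+4\pi^2|\cdot_m|^2)^{s_m/2}\widehat F\,\big)^\vee\Big\Vert_{L^r((\mathbb{R}^n)^m)},$$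 where $\cdot_i$ denotes the $i$th $\mathbb{R}^n$-variable. $\Psi^{(m)}$ is a fixed Schwartz function on $(\mathbb{R}^n)^m$ with $\widehat{\Psi^{(m)}}$ supported in $\{1/2\le|\vec\xi|\le2\}$ and $\sum_{j\in\mathbb{Z}}\widehat{\Psi^{(m)}}(\vec\xi/2^j)=1$ for $\vec\xi\ne0$, and $$\mathcal{L}_{\vec{s}}^{r,\Psi^{(m)}}[\sigma]=\sup_{j\in\mathbb{Z}}\big\Vert\sigma(2^j\cdot_1,\dots,2^j\cdot_m)\widehat{\Psi^{(m)}}\big\Vert_{L^r_{\vec{s}}((\mathbb{R}^n)^m)}.$$ For $0<p\le\infty$, $H^p(\mathbb{R}^n)$ is the real Hardy space, $\Vert f\Vert_{H^p}=\Vert\sup_{j\in\mathbb{Z}}|\phi_j*f|\Vert_{L^p}$, where $\phi$ is a fixed Schwartz function with $\widehat\phi(0)=1$ and $\phi_j=2^{jn}\phi(2^j\cdot)$; $H^p=L^p$ for $1<p\le\infty$. $\Vert T_\sigma\Vert_{H^{p_1}\times\cdots\times H^{p_m}\to L^p}=\infty$ means that there is no finite constant $C$ with $\Vert T_\sigma(f_1,\dots,f_m)\Vert_{L^p}\le C\prod_i\Vert f_i\Vert_{H^{p_i}}$ for all Schwartz functions $f_i\in H^{p_i}(\mathbb{R}^n)$. *)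

theory Defs
  imports "HOL-Analysis.Analysis" "HOL-Probability.Essential_Supremum"
begin

section \<open>Schwartz functions and the Fourier transform\<close>

primrec iter_partial ::
  "'a::euclidean_space list \<Rightarrow> ('a \<Rightarrow> complex) \<Rightarrow> 'a \<Rightarrow> complex" where
  "iter_partial [] f = f"
| "iter_partial (b # bs) f = (\<lambda>x. frechet_derivative (iter_partial bs f) (at x) b)"

definition schwartz :: "('a::euclidean_space \<Rightarrow> complex) \<Rightarrow> bool" where
  "schwartz f \<longleftrightarrow>
     (\<forall>bs. set bs \<subseteq> Basis \<longrightarrow>
        (\<forall>x. iter_partial bs f differentiable (at x)) \<and>
        (\<forall>N::nat. bounded (range (\<lambda>x. norm x ^ N *\<^sub>R iter_partial bs f x))))"

definition fourier :: "('a::euclidean_space \<Rightarrow> complex) \<Rightarrow> 'a \<Rightarrow> complex" where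
  "fourier f \<xi> = (LINT x|lborel. f x * cis (- 2 * pi * (x \<bullet> \<xi>)))"

definition inv_fourier :: "('a::euclidean_space \<Rightarrow> complex) \<Rightarrow> 'a \<Rightarrow> complex" where
  "inv_fourier F \<xi> = fourier F (- \<xi>)"


section \<open>Lebesgue (quasi-)norms\<close>

definition ennreal_rpow :: "ennreal \<Rightarrow> real \<Rightarrow> ennreal" where
  "ennreal_rpow x a = (if x = \<infinity> then \<infinity> else ennreal (enn2real x powr a))"

text \<open>Meant for exponents \<open>0 < p \<le> \<infinity>\<close>; the function is \<open>[0,\<infinity>]\<close>-valued so that
  the definition applies directly to suprema.\<close>

definition Lnorm :: "ennreal \<Rightarrow> ('a::euclidean_space \<Rightarrow> ennreal) \<Rightarrow> ennreal" where
  "Lnorm p g =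
     (if p = \<infinity> then esssup lborel g
      else ennreal_rpow (\<integral>\<^sup>+ x. ennreal_rpow (g x) (enn2real p) \<partial>lborel) (1 / enn2real p))"


section \<open>Tempered distributions and product-type Sobolev norms\<close>

text \<open>For a bounded compactly supported \<open>F\<close>, the inverse transform in the Sobolev norm is in
  general only a tempered distribution. Distributions are represented by functionals of which
  only the values on Schwartz functions matter; the operations below are the transposes of the
  operations on test functions, and the \<open>L\<^sup>r\<close> norm of a distribution is that of the function
  representing it, or \<open>\<infinity>\<close> if there is none (as \<open>Inf {} = \<infinity>\<close>).\<close>

type_synonym 'a distr = "('a \<Rightarrow> complex) \<Rightarrow> complex"

definition distr_of :: "('a::euclidean_space \<Rightarrow> complex) \<Rightarrow> 'a distr" where
  "distr_of F = (\<lambda>\<phi>. LINT x|lborel. F x * \<phi> x)"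

definition distr_fourier :: "'a::euclidean_space distr \<Rightarrow> 'a distr" where
  "distr_fourier u = (\<lambda>\<phi>. u (fourier \<phi>))"

definition distr_inv_fourier :: "'a::euclidean_space distr \<Rightarrow> 'a distr" where
  "distr_inv_fourier u = (\<lambda>\<phi>. u (inv_fourier \<phi>))"

definition distr_mult :: "('a \<Rightarrow> real) \<Rightarrow> 'a::euclidean_space distr \<Rightarrow> 'a distr" where
  "distr_mult w u = (\<lambda>\<phi>. u (\<lambda>x. complex_of_real (w x) * \<phi> x))"

definition represents :: "('a::euclidean_space \<Rightarrow> complex) \<Rightarrow> 'a distr \<Rightarrow> bool" where
  "represents g u \<longleftrightarrow>
     g \<in> borel_measurable borel \<and>
     (\<forall>\<phi>. schwartz \<phi> \<longrightarrow> integrable lborel (\<lambda>x. g x * \<phi> x) \<and> u \<phi> = distr_of g \<phi>)"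

definition distr_Lnorm :: "real \<Rightarrow> 'a::euclidean_space distr \<Rightarrow> ennreal" where
  "distr_Lnorm r u = Inf {Lnorm (ennreal r) (\<lambda>x. ennreal (norm (g x))) | g. represents g u}"

definition sobolev_weight :: "('m::finite \<Rightarrow> real) \<Rightarrow> real ^ 'n ^ 'm \<Rightarrow> real" where
  "sobolev_weight s \<xi> = (\<Prod>i\<in>UNIV. (1 + 4 * pi\<^sup>2 * (norm (\<xi> $ i))\<^sup>2) powr (s i / 2))"

definition sobolev_norm ::
  "real \<Rightarrow> ('m::finite \<Rightarrow> real) \<Rightarrow> (real ^ 'n ^ 'm \<Rightarrow> complex) \<Rightarrow> ennreal" where
  "sobolev_norm r s F =
     distr_Lnorm r
       (distr_inv_fourier (distr_mult (sobolev_weight s) (distr_fourier (distr_of F))))"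

definition admissible_bump :: "('a::euclidean_space \<Rightarrow> complex) \<Rightarrow> bool" where
  "admissible_bump \<Psi> \<longleftrightarrow>
     schwartz \<Psi> \<and>
     closure {\<xi>. fourier \<Psi> \<xi> \<noteq> 0} \<subseteq> {\<xi>. 1 / 2 \<le> norm \<xi> \<and> norm \<xi> \<le> 2} \<and>
     (\<forall>\<xi>. \<xi> \<noteq> 0 \<longrightarrow>
        ((\<lambda>j::int. fourier \<Psi> ((1 / 2 powi j) *\<^sub>R \<xi>)) has_sum 1) UNIV)"

definition multiplier_sobolev ::
  "real \<Rightarrow> ('m::finite \<Rightarrow> real) \<Rightarrow> (real ^ 'n ^ 'm \<Rightarrow> complex) \<Rightarrow>
   (real ^ 'n ^ 'm \<Rightarrow> complex) \<Rightarrow> ennreal" where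
  "multiplier_sobolev r s \<Psi> \<sigma> =
     (SUP j::int. sobolev_norm r s (\<lambda>\<xi>. \<sigma> ((2 powi j) *\<^sub>R \<xi>) * fourier \<Psi> \<xi>))"


section \<open>Hardy norms and multilinear multiplier operators\<close>

definition dyadic_dilate :: "('a::euclidean_space \<Rightarrow> complex) \<Rightarrow> int \<Rightarrow> 'a \<Rightarrow> complex" where
  "dyadic_dilate \<phi> j x = 2 powi (j * int DIM('a)) * \<phi> ((2 powi j) *\<^sub>R x)"

definition convolve ::
  "('a::euclidean_space \<Rightarrow> complex) \<Rightarrow> ('a \<Rightarrow> complex) \<Rightarrow> 'a \<Rightarrow> complex" where
  "convolve f g x = (LINT y|lborel. f (x - y) * g y)"

definition hardy_norm ::
  "('a::euclidean_space \<Rightarrow> complex) \<Rightarrow> ennreal \<Rightarrow> ('a \<Rightarrow> complex) \<Rightarrow> ennreal" where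
  "hardy_norm \<phi> p f =
     Lnorm p (\<lambda>x. SUP j::int. ennreal (norm (convolve (dyadic_dilate \<phi> j) f x)))"

definition multiplier_op ::
  "(real ^ 'n ^ 'm \<Rightarrow> complex) \<Rightarrow> ('m::finite \<Rightarrow> real ^ 'n \<Rightarrow> complex) \<Rightarrow> real ^ 'n \<Rightarrow> complex"
  where
  "multiplier_op \<sigma> f x =
     (LINT \<xi>|lborel. \<sigma> \<xi> * (\<Prod>j\<in>UNIV. fourier (f j) (\<xi> $ j)) *
        cis (2 * pi * (x \<bullet> (\<Sum>j\<in>UNIV. \<xi> $ j))))"

definition multiplier_bounded ::
  "(real ^ 'n \<Rightarrow> complex) \<Rightarrow> ('m::finite \<Rightarrow> ennreal) \<Rightarrow> ennreal \<Rightarrow>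
   (real ^ 'n ^ 'm \<Rightarrow> complex) \<Rightarrow> bool" where
  "multiplier_bounded \<phi> P p \<sigma> \<longleftrightarrow>
     (\<exists>C::real. \<forall>f. (\<forall>i. schwartz (f i) \<and> hardy_norm \<phi> (P i) (f i) < \<infinity>) \<longrightarrow>
        Lnorm p (\<lambda>x. ennreal (norm (multiplier_op \<sigma> f x)))
          \<le> ennreal C * (\<Prod>i\<in>UNIV. hardy_norm \<phi> (P i) (f i)))"

end

theory Submission
  imports Defs "HOL-Probability.Characteristic_Functions"
begin

text \<open>For \<open>s i\<^sub>1 \<le> n / r\<close> points of \<open>\<real>\<^sup>n\<close> have zero capacity in the \<open>\<xi>\<^sub>i\<^sub>1\<close>-variable: the average of
  the Gaussians \<open>exp (- pi 4\<^sup>L |z|\<^sup>2)\<close> over many consecutive scales \<open>L\<close> equals \<open>1\<close> at the origin, while its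
  Sobolev potential is arbitrarily small in \<open>L\<^sup>r\<close>. So on each of a lacunary sequence of dyadic shells the
  multiplier may be prescribed at finitely many values of \<open>\<xi>\<^sub>i\<^sub>1\<close>, at no cost in the Sobolev norm.
  Dilated Gaussian envelopes reduce the operator norm to its action on trigonometric polynomials.
  The \<open>i\<^sub>1\<close>-th function is a Rudin-Shapiro polynomial with \<open>M\<close> frequencies; the prescribed values
  remove its signs and turn it, on the \<open>j\<close>-th shell, into a Dirichlet kernel centred at \<open>j / M\<close> of height
  \<open>sqrt M\<close>. The second function has on the \<open>j\<close>-th shell the weight \<open>|D\<^sub>M|\<^sup>2 / M\<^sup>2\<close> with the same centre; these
  weights add up to \<open>1\<close>. The output is of size \<open>sqrt M\<close> on a set of proportion at least \<open>1/100\<close>, whereas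
  the Hardy norms stay bounded, since all frequencies are odd and the envelopes are averaged so that
  moments cancel.\<close>

section \<open>Directional derivatives and decay of Fourier transforms\<close>

text \<open>A single shell would not do: undoing the signs of a Rudin-Shapiro polynomial produces a
  peak of height \<open>sqrt M\<close>, but on a set of proportion about \<open>1 / M\<close>, so
  the \<open>L^p\<close> norm would grow only for \<open>p > 2\<close>. Hence \<open>M\<close>
  shells, whose peaks together cover a fixed proportion of the period; the second function has to
  select the shell according to the position, and does so through its frequency
  \<open>32^\<nu>\<close> while staying bounded. The bound \<open>s \<le> n / r\<close> for the
  distinguished index enters as follows. Shrinking a bump to width \<open>2^-L\<close> in n
  variables multiplies the r-th power of the \<open>L^r\<close> norm of its potential by about
  \<open>2^(L (s r - n)) \<le> 1\<close>. Potentials of different widths hardly interact, so the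
  r-th power for a sum of \<open>N\<close> of them is \<open>O(N)\<close>, and for their average
  \<open>O(N^(1 - r))\<close>, which tends to \<open>0\<close> as \<open>r > 1\<close>; the endpoint
  \<open>s = n / r\<close> is covered. The envelopes widen while the frequencies stay fixed, so only
  the values of the multiplier at finitely many points matter. One multiplier serves every
  \<open>M\<close>, because the shells are numbered by pairs \<open>(M, j)\<close>.\<close>

lemma continuous_borel_complex:
  fixes f :: "'a::euclidean_space \<Rightarrow> 'b::{banach,second_countable_topology}"
  shows "continuous_on UNIV f \<Longrightarrow> f \<in> borel_measurable borel"
  by (rule borel_measurable_continuous_onI)

lemma lborel_integrable_translation:
  fixes f :: "'a::euclidean_space \<Rightarrow> 'b::{banach,second_countable_topology}"
  assumes "integrable lborel f"
  shows "integrable lborel (\<lambda>x. f (x + a))"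
proof -
  have m[measurable]: "f \<in> borel_measurable borel" using borel_measurable_integrable[OF assms] by simp
  have "integrable (distr lborel borel ((+) a)) f" using assms by (simp add: lborel_distr_plus)
  then show ?thesis by (subst (asm) integrable_distr_eq) (auto simp: add.commute)
qed

lemma lborel_integral_translation:
  fixes f :: "'a::euclidean_space \<Rightarrow> 'b::{banach,second_countable_topology}"
  assumes m[measurable]: "f \<in> borel_measurable borel"
  shows "(LINT x|lborel. f (x + a)) = (LINT x|lborel. f x)"
proof -
  have "(LINT x|lborel. f x) = (LINT x|distr lborel borel ((+) a). f x)" by (simp add: lborel_distr_plus)
  also have "\<dots> = (LINT x|lborel. f (a + x))" by (subst integral_distr) auto
  finally show ?thesis by (simp add: add.commute)
qed

lemma nn_integral_lborel_translation:
  fixes f :: "'a::euclidean_space \<Rightarrow> ennreal"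
  assumes m[measurable]: "f \<in> borel_measurable borel"
  shows "(\<integral>\<^sup>+x. f (x + a) \<partial>lborel) = (\<integral>\<^sup>+x. f x \<partial>lborel)"
proof -
  have "(\<integral>\<^sup>+x. f x \<partial>lborel) = (\<integral>\<^sup>+x. f x \<partial>distr lborel borel ((+) a))" by (simp add: lborel_distr_plus)
  also have "\<dots> = (\<integral>\<^sup>+x. f (a + x) \<partial>lborel)" by (subst nn_integral_distr) auto
  finally show ?thesis by (simp add: add.commute)
qed

lemma integrable_bounded_by:
  fixes f :: "'a::euclidean_space \<Rightarrow> complex"
  assumes "continuous_on UNIV f" "integrable lborel S" "\<And>x. norm (f x) \<le> S x"
  shows "integrable lborel f"
  by (rule Bochner_Integration.integrable_bound[OF assms(2)])
     (use assms in \<open>auto intro!: continuous_borel_complex AE_I2 order_trans[OF _ abs_ge_self]\<close>)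

lemma fubini_lborel:
  fixes f :: "'a::euclidean_space \<Rightarrow> 'b::euclidean_space \<Rightarrow> complex"
  assumes m: "(\<lambda>(x,y). f x y) \<in> borel_measurable (borel \<Otimes>\<^sub>M borel)"
    and i1: "integrable lborel A" and i2: "integrable lborel B"
    and b: "\<And>x y. norm (f x y) \<le> A x * B y"
  shows "(LINT y|lborel. LINT x|lborel. f x y) = (LINT x|lborel. LINT y|lborel. f x y)"
proof -
  have "integrable (lborel \<Otimes>\<^sub>M lborel) (\<lambda>(x,y). A x * B y)"
    by (rule lborel_pair.Fubini_integrable) (use i1 i2 in \<open>auto simp: abs_mult\<close>)
  then have "integrable (lborel \<Otimes>\<^sub>M lborel) (\<lambda>(x,y). f x y)"
    by (rule Bochner_Integration.integrable_bound) (use m b in \<open>auto intro!: AE_I2 order_trans[OF b]\<close>)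
  from lborel_pair.Fubini_integral[OF this] show ?thesis .
qed

text \<open>The increment \<open>f (x + v) - f x\<close> is the integral of
  \<open>f' (x + s v)\<close> over \<open>0 \<le> s \<le> 1\<close>. Integrating over x and
  exchanging the integrals gives \<open>0\<close> on one side and, by translation invariance, the
  integral of \<open>f'\<close> on the other.\<close>

lemma integral_directional_derivative_zero:
  fixes f f' :: "'a::euclidean_space \<Rightarrow> complex"
  assumes f': "continuous_on UNIV f'"
    and d: "\<And>x. ((\<lambda>t. f (x + t *\<^sub>R v)) has_vector_derivative f' x) (at 0)"
    and i: "integrable lborel f" and i': "integrable lborel f'"
  shows "(LINT x|lborel. f' x) = 0"
proof -
  have m[measurable]: "f \<in> borel_measurable borel" using borel_measurable_integrable[OF i] by simp
  have m'[measurable]: "f' \<in> borel_measurable borel" using f' by (rule continuous_borel_complex)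
  have D: "((\<lambda>t. f (x + t *\<^sub>R v)) has_vector_derivative f' (x + s *\<^sub>R v)) (at s within T)" for x s T
  proof -
    have "((\<lambda>t. f (x + s *\<^sub>R v + t *\<^sub>R v)) \<circ> (\<lambda>u. u - s) has_vector_derivative (1 *\<^sub>R f' (x + s *\<^sub>R v))) (at s within T)"
      by (rule vector_diff_chain_within)
         (use has_vector_derivative_at_within[OF d[of "x + s *\<^sub>R v"]] in \<open>auto intro!: derivative_eq_intros\<close>)
    then show ?thesis by (simp add: o_def algebra_simps)
  qed
  have FTC: "(LINT s|lborel. indicator {0..1} s *\<^sub>R f' (x + s *\<^sub>R v)) = f (x + v) - f x" for x
    by (subst integral_FTC_atLeastAtMost[where F="\<lambda>t. f (x + t *\<^sub>R v)"])
       (auto intro!: D continuous_on_compose2[OF f'] continuous_intros)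
  have int: "integrable (lborel \<Otimes>\<^sub>M lborel) (\<lambda>(s::real,x). indicator {0..1} s *\<^sub>R f' (x + s *\<^sub>R v))"
  proof (rule lborel_pair.Fubini_integrable)
    show "AE s in lborel. integrable lborel (\<lambda>y. case (s, y) of (s, x) \<Rightarrow> indicat_real {0..1} s *\<^sub>R f' (x + s *\<^sub>R v))"
      using lborel_integrable_translation[OF i'] by auto
    have "(\<lambda>s. LINT y|lborel. norm (case (s, y) of (s, x) \<Rightarrow> indicat_real {0..1} s *\<^sub>R f' (x + s *\<^sub>R v)))
       = (\<lambda>s. indicat_real {0..1} s * (LINT y|lborel. norm (f' y)))"
      using lborel_integral_translation[of "\<lambda>x. norm (f' x)"] by auto
    then show "integrable lborel (\<lambda>s. LINT y|lborel. norm (case (s, y) of (s, x) \<Rightarrow> indicat_real {0..1} s *\<^sub>R f' (x + s *\<^sub>R v)))"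
      by simp
  qed measurable
  have "0 = (LINT x|lborel. f (x + v) - f x)"
    using lborel_integrable_translation[OF i, of v] i by (simp add: lborel_integral_translation)
  also have "\<dots> = (LINT x|lborel. LINT s|lborel. indicator {0..1} s *\<^sub>R f' (x + s *\<^sub>R v))"
    by (simp only: FTC)
  also have "\<dots> = (LINT s|lborel. LINT x|lborel. indicator {0..1} s *\<^sub>R f' (x + s *\<^sub>R v))"
    using lborel_pair.Fubini_integral[OF int] by simp
  also have "\<dots> = (LINT s|lborel. indicator {0..1::real} s *\<^sub>R (LINT x|lborel. f' x))"
    by (simp add: lborel_integral_translation)
  also have "\<dots> = (LINT x|lborel. f' x)"
  proof -
    have "(LINT s|lborel. indicat_real {0..1::real} s *\<^sub>R (LINT x|lborel. f' x)) = (LINT s|lborel. indicat_real {0..1::real} s) *\<^sub>R (LINT x|lborel. f' x)"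
      by (rule integral_scaleR_left) simp
    then show ?thesis by simp
  qed
  finally show ?thesis by simp
qed

text \<open>Regularity of order \<open>K\<close> along a single direction, all derivatives having
  one common majorant \<open>S\<close>. Decay of a Fourier transform in the direction
  \<open>v\<close> requires derivatives in that direction only, so mixed partial derivatives never
  occur; a majorant depending on the point keeps decay and smoothness in one statement.\<close>

primrec dir_bounded :: "'a::euclidean_space \<Rightarrow> nat \<Rightarrow> ('a \<Rightarrow> complex) \<Rightarrow> ('a \<Rightarrow> real) \<Rightarrow> bool" where
  "dir_bounded v 0 f S \<longleftrightarrow> continuous_on UNIV f \<and> (\<forall>x. norm (f x) \<le> S x)"
| "dir_bounded v (Suc K) f S \<longleftrightarrow> continuous_on UNIV f \<and> (\<forall>x. norm (f x) \<le> S x) \<and>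
     (\<exists>f'. (\<forall>x. ((\<lambda>t. f (x + t *\<^sub>R v)) has_vector_derivative f' x) (at 0)) \<and> dir_bounded v K f' S)"

lemma dir_bounded_SucI:
  assumes "continuous_on UNIV f" "\<And>x. norm (f x) \<le> S x"
    "\<And>x. ((\<lambda>t. f (x + t *\<^sub>R v)) has_vector_derivative f' x) (at 0)" "dir_bounded v K f' S"
  shows "dir_bounded v (Suc K) f S"
  using assms by auto

lemma dir_bounded_cont: "dir_bounded v K f S \<Longrightarrow> continuous_on UNIV f"
  by (cases K) auto

lemma dir_bounded_bound: "dir_bounded v K f S \<Longrightarrow> norm (f x) \<le> S x"
  by (cases K) auto

lemma dir_bounded_nonneg: "dir_bounded v K f S \<Longrightarrow> 0 \<le> S x"
  using dir_bounded_bound norm_ge_zero order_trans by metis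

lemma dir_bounded_mono:
  "dir_bounded v K f S \<Longrightarrow> (\<And>x. S x \<le> T x) \<Longrightarrow> dir_bounded v K f T"
proof (induction K arbitrary: f)
  case (Suc K) then show ?case by (auto intro: order_trans)
qed (auto intro: order_trans)

lemma dir_bounded_le:
  "dir_bounded v K f S \<Longrightarrow> L \<le> K \<Longrightarrow> dir_bounded v L f S"
proof (induction K arbitrary: f L)
  case (Suc K)
  show ?case
  proof (cases L)
    case (Suc L') then show ?thesis using Suc.prems Suc.IH by auto
  qed (use Suc.prems in auto)
qed auto

lemma dir_bounded_add:
  "dir_bounded v K f S \<Longrightarrow> dir_bounded v K g T \<Longrightarrow> dir_bounded v K (\<lambda>x. f x + g x) (\<lambda>x. S x + T x)"
proof (induction K arbitrary: f g)
  case (Suc K)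
  then obtain f' g' where f: "\<And>x. ((\<lambda>t. f (x + t *\<^sub>R v)) has_vector_derivative f' x) (at 0)" "dir_bounded v K f' S"
    and g: "\<And>x. ((\<lambda>t. g (x + t *\<^sub>R v)) has_vector_derivative g' x) (at 0)" "dir_bounded v K g' T" by auto
  have "dir_bounded v K (\<lambda>x. f' x + g' x) (\<lambda>x. S x + T x)" using Suc.IH f g by blast
  then show ?case using Suc.prems f g
    by (auto intro!: continuous_intros norm_triangle_mono exI[of _ "\<lambda>x. f' x + g' x"] has_vector_derivative_add)
qed (auto intro!: continuous_intros norm_triangle_mono)

lemma dir_bounded_cmult:
  "dir_bounded v K f S \<Longrightarrow> dir_bounded v K (\<lambda>x. c * f x) (\<lambda>x. norm c * S x)"
proof (induction K arbitrary: f)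
  case (Suc K)
  then obtain f' where f: "\<And>x. ((\<lambda>t. f (x + t *\<^sub>R v)) has_vector_derivative f' x) (at 0)" "dir_bounded v K f' S" by auto
  have "dir_bounded v K (\<lambda>x. c * f' x) (\<lambda>x. norm c * S x)" using Suc.IH f by blast
  then show ?case using Suc.prems f
    by (auto intro!: continuous_intros exI[of _ "\<lambda>x. c * f' x"] has_vector_derivative_mult_right mult_left_mono simp: norm_mult)
qed (auto intro!: continuous_intros mult_left_mono simp: norm_mult)

lemma dir_bounded_zero: "(\<And>x. 0 \<le> S x) \<Longrightarrow> dir_bounded v K (\<lambda>x. 0) S"
proof (induction K)
  case (Suc K)
  then show ?case by (auto intro!: exI[of _ "\<lambda>x. 0"] has_vector_derivative_const)
qed auto

lemma dir_bounded_const: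
  assumes "\<And>x t. f (x + t *\<^sub>R v) = f x" "continuous_on UNIV f" "\<And>x. norm (f x) \<le> S x"
  shows "dir_bounded v K f S"
proof (cases K)
  case (Suc L)
  have "0 \<le> S x" for x using assms(3)[of x] norm_ge_zero order_trans by blast
  then have "dir_bounded v L (\<lambda>x. 0) S" by (rule dir_bounded_zero)
  then show ?thesis using assms Suc by (auto intro!: exI[of _ "\<lambda>x. 0"] has_vector_derivative_const)
qed (use assms in auto)

text \<open>Leibniz' rule; each derivative doubles the number of terms, whence
  \<open>2 ^ K\<close>.\<close>

lemma dir_bounded_mult:
  "dir_bounded v K f S \<Longrightarrow> dir_bounded v K g T \<Longrightarrow> dir_bounded v K (\<lambda>x. f x * g x) (\<lambda>x. 2 ^ K * (S x * T x))"
proof (induction K arbitrary: f g)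
  case (Suc K)
  then obtain f' g' where f: "\<And>x. ((\<lambda>t. f (x + t *\<^sub>R v)) has_vector_derivative f' x) (at 0)" "dir_bounded v K f' S"
    and g: "\<And>x. ((\<lambda>t. g (x + t *\<^sub>R v)) has_vector_derivative g' x) (at 0)" "dir_bounded v K g' T" by auto
  have fg: "dir_bounded v K f S" "dir_bounded v K g T"     by (rule dir_bounded_le[OF Suc.prems(1)], simp, rule dir_bounded_le[OF Suc.prems(2)], simp)
  have "dir_bounded v K (\<lambda>x. f x * g' x + f' x * g x) (\<lambda>x. 2 ^ K * (S x * T x) + 2 ^ K * (S x * T x))"
    by (rule dir_bounded_add[OF Suc.IH[OF fg(1) g(2)] Suc.IH[OF f(2) fg(2)]])
  then have 1: "dir_bounded v K (\<lambda>x. f x * g' x + f' x * g x) (\<lambda>x. 2 ^ Suc K * (S x * T x))"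
    by (rule dir_bounded_mono) auto
  have b: "norm (f x * g x) \<le> 2 ^ Suc K * (S x * T x)" for x
  proof -
    have "norm (f x * g x) \<le> S x * T x"
      using Suc.prems by (auto simp: norm_mult intro!: mult_mono dir_bounded_nonneg[OF fg(1)])
    also have "\<dots> \<le> 2 ^ Suc K * (S x * T x)"
      using dir_bounded_nonneg[OF fg(1)] dir_bounded_nonneg[OF fg(2)]
      using mult_right_mono[of 1 "2 ^ Suc K" "S x * T x"] one_le_power[of "2::real" "Suc K"]
      unfolding mult_1 by (meson mult_nonneg_nonneg one_le_numeral)
    finally show ?thesis .
  qed
  have d: "((\<lambda>t. f (x + t *\<^sub>R v) * g (x + t *\<^sub>R v)) has_vector_derivative f x * g' x + f' x * g x) (at 0)" for x
    using has_vector_derivative_mult[OF f(1)[of x] g(1)[of x]] by simp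
  have c: "continuous_on UNIV (\<lambda>x. f x * g x)"
    using Suc.prems by (intro continuous_intros) (auto dest: dir_bounded_cont)
  show ?case by (rule dir_bounded_SucI[OF c b d 1])
next
  case 0
  then have "continuous_on UNIV (\<lambda>x. f x * g x)" by (intro continuous_intros) auto
  moreover have "norm (f x * g x) \<le> S x * T x" for x
    unfolding norm_mult using 0 by (intro mult_mono') auto
  ultimately show ?case by simp
qed

text \<open>The inner map turns the direction \<open>v\<close> into \<open>c\<close> times
  \<open>w\<close>, so j derivatives bring a factor \<open>c ^ j\<close>; because of
  \<open>\<bar>c\<bar> \<le> 1\<close> the majorant is not enlarged. This makes estimates for
  contractions of one block of variables uniform in the contraction factor.\<close>

lemma dir_bounded_compose:
  assumes "dir_bounded w K f S" "continuous_on UNIV h" "\<bar>c\<bar> \<le> 1"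
    and h: "\<And>x t. h (x + t *\<^sub>R v) = h x + (c * t) *\<^sub>R w"
  shows "dir_bounded v K (\<lambda>x. f (h x)) (\<lambda>x. S (h x))"
  using assms(1)
proof (induction K arbitrary: f)
  case 0 then show ?case using continuous_on_compose2[of UNIV f UNIV h] assms by auto
next
  case (Suc K)
  then obtain f' where f: "\<And>x. ((\<lambda>t. f (x + t *\<^sub>R w)) has_vector_derivative f' x) (at 0)" "dir_bounded w K f' S" by auto
  have "dir_bounded v K (\<lambda>x. f' (h x)) (\<lambda>x. S (h x))" using Suc.IH f by blast
  from dir_bounded_cmult[OF this, of "of_real c"]
  have 1: "dir_bounded v K (\<lambda>x. of_real c * f' (h x)) (\<lambda>x. S (h x))"
    by (rule dir_bounded_mono) (use assms(3) dir_bounded_nonneg[OF f(2)] in \<open>auto intro: mult_left_le_one_le\<close>)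
  have d: "((\<lambda>t. f (h (x + t *\<^sub>R v))) has_vector_derivative of_real c * f' (h x)) (at 0)" for x
  proof -
    have "(((\<lambda>t. f (h x + t *\<^sub>R w)) \<circ> (\<lambda>t. c * t)) has_vector_derivative (c *\<^sub>R f' (h x))) (at 0)"
      by (rule vector_diff_chain_at) (auto intro!: derivative_eq_intros f simp: has_real_derivative_iff_has_vector_derivative[symmetric])
    then show ?thesis by (simp add: h o_def scaleR_conv_of_real)
  qed
  have c: "continuous_on UNIV (\<lambda>x. f (h x))" using continuous_on_compose2[of UNIV f UNIV h] assms(2) Suc.prems by auto
  have b: "norm (f (h x)) \<le> S (h x)" for x using Suc.prems by simp
  show ?case by (rule dir_bounded_SucI[OF c b d 1])
qed

text \<open>Integration by parts: the directional derivative of \<open>f\<close> times the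
  exponential has integral zero, and the product rule splits it into the two sides.\<close>

lemma fourier_derivative:
  fixes f :: "'a::euclidean_space \<Rightarrow> complex"
  assumes "continuous_on UNIV f'" "\<And>x. ((\<lambda>t. f (x + t *\<^sub>R v)) has_vector_derivative f' x) (at 0)"
    and i: "integrable lborel f" and i': "integrable lborel f'" and c: "continuous_on UNIV f"
  shows "fourier f' \<xi> = 2 * pi * \<i> * (\<xi> \<bullet> v) * fourier f \<xi>"
proof -
  let ?e = "\<lambda>x. cis (- 2 * pi * (x \<bullet> \<xi>))"
  let ?g = "\<lambda>x. f x * ?e x"
  let ?g' = "\<lambda>x. f x * (- 2 * pi * \<i> * (\<xi> \<bullet> v) * ?e x) + f' x * ?e x"
  have ce: "continuous_on UNIV ?e" by (intro continuous_intros)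
  have ie: "integrable lborel (\<lambda>x. h x * ?e x)" if "continuous_on UNIV h" "integrable lborel h" for h
    by (rule integrable_bounded_by[OF _ integrable_norm[OF that(2)]])
       (auto intro!: continuous_intros that ce simp: norm_mult)
  have "(LINT x|lborel. ?g' x) = 0"
  proof (rule integral_directional_derivative_zero[where v=v])
    show "continuous_on UNIV ?g'" by (intro continuous_intros assms ce)
    show "integrable lborel ?g" by (rule ie[OF c i])
    have "integrable lborel (\<lambda>x. (- 2 * pi * \<i> * (\<xi> \<bullet> v)) * ?g x + f' x * ?e x)"
      by (intro Bochner_Integration.integrable_add integrable_mult_right ie assms)
    then show "integrable lborel ?g'" by (simp add: mult_ac)
    fix x
    have "((\<lambda>t. ?e (x + t *\<^sub>R v)) has_vector_derivative (- 2 * pi * \<i> * (\<xi> \<bullet> v) * ?e x)) (at 0)"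
    proof -
      have "((\<lambda>t. cis (- 2 * pi * (x \<bullet> \<xi>) + t * (- 2 * pi * (v \<bullet> \<xi>)))) has_vector_derivative (- 2 * pi * \<i> * (\<xi> \<bullet> v) * ?e x)) (at 0)"
        unfolding cis_conv_exp
        by (auto intro!: derivative_eq_intros has_vector_derivative_real_field simp: inner_commute has_vector_derivative_complex_iff)
      then show ?thesis by (simp add: inner_add_left algebra_simps)
    qed
    from has_vector_derivative_mult[OF assms(2)[of x] this]
    show "((\<lambda>t. ?g (x + t *\<^sub>R v)) has_vector_derivative ?g' x) (at 0)" by simp
  qed
  moreover have "(LINT x|lborel. ?g' x) = (LINT x|lborel. (- 2 * pi * \<i> * (\<xi> \<bullet> v)) * ?g x) + fourier f' \<xi>"
    unfolding fourier_def
  proof -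
    have "(LINT x|lborel. ?g' x) = (LINT x|lborel. (- 2 * pi * \<i> * (\<xi> \<bullet> v)) * ?g x + f' x * ?e x)"
      by (intro Bochner_Integration.integral_cong) (auto simp: mult_ac)
    also have "\<dots> = (LINT x|lborel. (- 2 * pi * \<i> * (\<xi> \<bullet> v)) * ?g x) + (LINT x|lborel. f' x * ?e x)"
      by (rule Bochner_Integration.integral_add[OF integrable_mult_right[OF ie[OF c i]] ie[OF assms(1) i']])
    finally show "(LINT x|lborel. ?g' x) = (LINT x|lborel. (- 2 * pi * \<i> * (\<xi> \<bullet> v)) * ?g x) + (LINT x|lborel. f' x * ?e x)" .
  qed
  moreover have "(LINT x|lborel. (- 2 * pi * \<i> * (\<xi> \<bullet> v)) * ?g x) = (- 2 * pi * \<i> * (\<xi> \<bullet> v)) * fourier f \<xi>"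
    unfolding fourier_def by (rule integral_mult_right_zero)
  ultimately show ?thesis by (simp add: algebra_simps)
qed

lemma norm_fourier_le:
  fixes f :: "'a::euclidean_space \<Rightarrow> complex"
  assumes "continuous_on UNIV f" "integrable lborel S" "\<And>x. norm (f x) \<le> S x"
  shows "norm (fourier f \<xi>) \<le> (LINT x|lborel. S x)"
  unfolding fourier_def
  by (rule Bochner_Integration.integral_norm_bound_integral[OF _ assms(2)])
     (auto intro!: integrable_bounded_by[OF _ assms(2)] continuous_intros assms simp: norm_mult)

lemma fourier_decay:
  fixes f :: "'a::euclidean_space \<Rightarrow> complex"
  assumes "dir_bounded v K f S" "integrable lborel S"
  shows "\<bar>\<xi> \<bullet> v\<bar> ^ K * norm (fourier f \<xi>) \<le> (LINT x|lborel. S x)"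
  using assms(1)
proof (induction K arbitrary: f)
  case 0
  then show ?case using norm_fourier_le[OF _ assms(2)] by auto
next
  case (Suc K)
  then obtain f' where f: "\<And>x. ((\<lambda>t. f (x + t *\<^sub>R v)) has_vector_derivative f' x) (at 0)" "dir_bounded v K f' S"
    and c: "continuous_on UNIV f" "\<And>x. norm (f x) \<le> S x" by auto
  have i: "integrable lborel f" using integrable_bounded_by[OF c(1) assms(2)] c by auto
  have i': "integrable lborel f'" using integrable_bounded_by[OF dir_bounded_cont[OF f(2)] assms(2)] dir_bounded_bound[OF f(2)] by auto
  \<comment> \<open>A derivative brings \<open>2 * pi * \<bar>\<xi> \<bullet> v\<bar>\<close>; the
    constant exceeds one and is given away.\<close>
  have "\<bar>\<xi> \<bullet> v\<bar> ^ Suc K * norm (fourier f \<xi>) \<le> \<bar>\<xi> \<bullet> v\<bar> ^ K * ((2 * pi * \<bar>\<xi> \<bullet> v\<bar>) * norm (fourier f \<xi>))"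
  proof -
    have "\<bar>\<xi> \<bullet> v\<bar> \<le> 2 * pi * \<bar>\<xi> \<bullet> v\<bar>" using mult_right_mono[of 1 "2 * pi" "\<bar>\<xi> \<bullet> v\<bar>"] pi_gt3 by simp
    then have "\<bar>\<xi> \<bullet> v\<bar> * norm (fourier f \<xi>) \<le> (2 * pi * \<bar>\<xi> \<bullet> v\<bar>) * norm (fourier f \<xi>)" by (rule mult_right_mono) simp
    from mult_left_mono[OF this, of "\<bar>\<xi> \<bullet> v\<bar> ^ K"] show ?thesis by (simp add: mult_ac)
  qed
  also have "\<dots> = \<bar>\<xi> \<bullet> v\<bar> ^ K * norm (fourier f' \<xi>)"
    by (subst fourier_derivative[OF dir_bounded_cont[OF f(2)] f(1) i i' c(1)]) (simp add: norm_mult)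
  also have "\<dots> \<le> (LINT x|lborel. S x)" by (rule Suc.IH[OF f(2)])
  finally show ?case .
qed

section \<open>One-dimensional weights and their tensor products\<close>

lemma nn_integral_powr_weight_finite:
  fixes \<beta> \<gamma> :: real
  assumes "0 \<le> \<beta>" "\<beta> < 1" "1 < \<beta> + \<gamma>"
  shows "(\<integral>\<^sup>+t. ennreal (\<bar>t\<bar> powr (-\<beta>) * (1 + \<bar>t\<bar>) powr (-\<gamma>)) \<partial>lborel) < \<infinity>"
proof -
  \<comment> \<open>A majorant on the half-line made of pure powers: the singularity counts up to
    \<open>1\<close>, the total decay exponent \<open>\<beta> + \<gamma>\<close> beyond it. The
    negative half-line is reached by reflection.\<close>
  define u where "u t = (if t \<in> {0..1} then t powr (-\<beta>) else 0) + (if t \<in> {1..} then t powr (-(\<beta>+\<gamma>)) else 0)" for t :: real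
  have [measurable]: "u \<in> borel_measurable borel" unfolding u_def by measurable
  have u0: "0 \<le> u t" for t by (auto simp: u_def)
  have "(u has_integral (1 powr (-\<beta>+1) / (-\<beta>+1) + -(1 powr (-(\<beta>+\<gamma>)+1)) / (-(\<beta>+\<gamma>)+1))) UNIV"
    unfolding u_def
  proof (intro has_integral_add)
    show "((\<lambda>t. if t \<in> {0..1} then t powr (-\<beta>) else 0) has_integral (1 powr (-\<beta>+1) / (-\<beta>+1))) UNIV"
      unfolding has_integral_restrict_UNIV by (rule has_integral_powr_from_0) (use assms in auto)
    show "((\<lambda>t. if t \<in> {1..} then t powr (-(\<beta>+\<gamma>)) else 0) has_integral (-(1 powr (-(\<beta>+\<gamma>)+1)) / (-(\<beta>+\<gamma>)+1))) UNIV"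
      unfolding has_integral_restrict_UNIV by (rule has_integral_powr_to_inf) (use assms in auto)
  qed
  from nn_integral_has_integral_lborel[OF _ u0 this]
  have fin: "(\<integral>\<^sup>+t. ennreal (u t) \<partial>lborel) < \<infinity>" by simp
  have "(\<integral>\<^sup>+t. ennreal (u t) \<partial>lborel) = (\<integral>\<^sup>+t. ennreal (u (- t)) \<partial>lborel)"
    by (subst nn_integral_real_affine[where c="-1" and t=0]) auto
  then have fin': "(\<integral>\<^sup>+t. ennreal (u (-t)) \<partial>lborel) < \<infinity>" using fin by simp
  have "\<bar>t\<bar> powr (-\<beta>) * (1 + \<bar>t\<bar>) powr (-\<gamma>) \<le> u t + u (-t)" for t
  proof -
    have *: "s powr (-\<beta>) * (1 + s) powr (-\<gamma>) \<le> u s" if "0 \<le> s" for s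
    proof (cases "s \<le> 1")
      case True
      have "(1 + s) powr (-\<gamma>) \<le> 1" using that assms
        by (subst powr_minus) (auto intro!: inverse_le_1_iff[THEN iffD2] ge_one_powr_ge_zero simp: not_le)
      then have "s powr (-\<beta>) * (1 + s) powr (-\<gamma>) \<le> s powr (-\<beta>) * 1" by (rule mult_left_mono) simp
      then show ?thesis using True that by (auto simp: u_def)
    next
      case False
      have "(1 + s) powr (-\<gamma>) \<le> s powr (-\<gamma>)" using False assms by (intro powr_mono2') auto
      then have "s powr (-\<beta>) * (1 + s) powr (-\<gamma>) \<le> s powr (-\<beta>) * s powr (-\<gamma>)" by (rule mult_left_mono) simp
      also have "\<dots> = s powr (-(\<beta>+\<gamma>))" by (simp add: powr_add[symmetric])
      finally show ?thesis using False by (auto simp: u_def)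
    qed
    show ?thesis using *[of t] *[of "-t"] u0[of t] u0[of "-t"] by (cases "t \<ge> 0") auto
  qed
  then have "(\<integral>\<^sup>+t. ennreal (\<bar>t\<bar> powr (-\<beta>) * (1 + \<bar>t\<bar>) powr (-\<gamma>)) \<partial>lborel) \<le> (\<integral>\<^sup>+t. ennreal (u t) + ennreal (u (-t)) \<partial>lborel)"
    by (intro nn_integral_mono) (auto simp: ennreal_plus[symmetric] u0 simp del: ennreal_plus)
  also have "\<dots> < \<infinity>" using fin fin' by (subst nn_integral_add) (auto simp: ennreal_add_eq_top less_top)
  finally show ?thesis .
qed

lemma integrable_prod_Basis:
  fixes f :: "'a::euclidean_space \<Rightarrow> real \<Rightarrow> real"
  assumes m: "\<And>b. b \<in> Basis \<Longrightarrow> f b \<in> borel_measurable borel" and nn: "\<And>b t. b \<in> Basis \<Longrightarrow> 0 \<le> f b t"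
    and fin: "\<And>b. b \<in> Basis \<Longrightarrow> (\<integral>\<^sup>+t. ennreal (f b t) \<partial>lborel) < \<infinity>"
  shows "integrable lborel (\<lambda>x::'a. \<Prod>b\<in>Basis. f b (x \<bullet> b))"
proof (rule integrableI_nonneg)
  show "(\<lambda>x. \<Prod>b\<in>Basis. f b (x \<bullet> b)) \<in> borel_measurable lborel"
    by (intro borel_measurable_prod measurable_compose[OF _ m]) auto
  have "(\<integral>\<^sup>+x. ennreal (\<Prod>b\<in>Basis. f b (x \<bullet> b)) \<partial>lborel) = (\<integral>\<^sup>+x. (\<Prod>b\<in>Basis. ennreal (f b (x \<bullet> b))) \<partial>lborel)"
    by (simp add: prod_ennreal nn)
  also have "\<dots> = (\<Prod>b\<in>(Basis::'a set). (\<integral>\<^sup>+t. ennreal (f b t) \<partial>lborel))"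
    by (intro nn_integral_lborel_prod measurable_compose[OF m]) auto
  also have "\<dots> < \<infinity>" using fin by (auto simp: ennreal_prod_eq_top less_top[symmetric])
  finally show "(\<integral>\<^sup>+x. ennreal (\<Prod>b\<in>Basis. f b (x \<bullet> b)) \<partial>lborel) < \<infinity>" .
qed (auto intro!: AE_I2 prod_nonneg nn)

lemma nn_integral_inverse_square_finite:
  "(\<integral>\<^sup>+t. ennreal (1 / (1 + \<bar>t\<bar>)^2) \<partial>lborel) < \<infinity>" for N :: nat
proof -
  have "(1 + \<bar>t\<bar>) powr (-2) = 1 / (1 + \<bar>t\<bar>)^2" for t :: real
    by (simp add: powr_minus powr_numeral divide_inverse)
  \<comment> \<open>\<open>0 powr 0\<close> is \<open>0\<close>, so the weight with exponent
    \<open>0\<close> vanishes at the origin; the discrepancy is a null set.\<close>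
  moreover have "\<bar>t\<bar> powr (-0) = (if t = 0 then 0 else 1)" for t :: real by simp
  ultimately have "(\<integral>\<^sup>+t. ennreal ((if t = 0 then 0 else 1) * (1 / (1 + \<bar>t\<bar>)^2)) \<partial>lborel) < \<infinity>"
    using nn_integral_powr_weight_finite[of 0 2] by simp
  moreover have "(\<integral>\<^sup>+t. ennreal ((if t = 0 then 0 else 1) * (1 / (1 + \<bar>t\<bar>)^2)) \<partial>lborel) = (\<integral>\<^sup>+t. ennreal (1 / (1 + \<bar>t\<bar>)^2) \<partial>lborel)"
    by (rule nn_integral_cong_AE) (use AE_lborel_singleton[of "0::real"] in \<open>auto elim!: eventually_mono\<close>)
  ultimately show ?thesis by simp
qed

lemma prod_Basis_le_norm:
  "(\<Prod>b\<in>Basis. (1 + \<bar>x \<bullet> b\<bar>)) \<le> (1 + norm (x::'a::euclidean_space)) ^ DIM('a)"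
  using prod_mono[of Basis "\<lambda>b. 1 + \<bar>x \<bullet> b\<bar>" "\<lambda>b. 1 + norm x"] by (simp add: Basis_le_norm)

lemma norm_le_prod_Basis:
  "1 + norm (x::'a::euclidean_space) \<le> (\<Prod>b\<in>Basis. (1 + \<bar>x \<bullet> b\<bar>))"
proof -
  have *: "1 + (\<Sum>b\<in>A. g b) \<le> (\<Prod>b\<in>A. 1 + g b)" if "finite A" "\<And>b. 0 \<le> g b" for A and g :: "'a \<Rightarrow> real"
    using that
  proof (induction A rule: finite_induct)
    case (insert a A)
    have "1 + (\<Sum>b\<in>insert a A. g b) \<le> (1 + g a) * (1 + (\<Sum>b\<in>A. g b))"
      using insert by (auto simp: algebra_simps sum_nonneg)
    also have "\<dots> \<le> (1 + g a) * (\<Prod>b\<in>A. 1 + g b)" using insert by (intro mult_left_mono) auto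
    finally show ?case using insert by simp
  qed simp
  show ?thesis using norm_le_l1[of x] *[of Basis "\<lambda>b. \<bar>x \<bullet> b\<bar>"] by simp
qed

text \<open>The comparison is with the product of
  \<open>1 / (1 + \<bar>x \<bullet> b\<bar>)^2\<close> over the coordinates, each factor of which is
  integrable on the line. This is the origin of the exponent \<open>2 * DIM('a)\<close>, which
  recurs as the standard integrable decay.\<close>

lemma integrable_norm_weight:
  assumes "2 * DIM('a) \<le> N"
  shows "integrable lborel (\<lambda>x::'a::euclidean_space. C / (1 + norm x) ^ N)"
proof -
  have "integrable lborel (\<lambda>x::'a. \<Prod>b\<in>Basis. 1 / (1 + \<bar>x \<bullet> b\<bar>)^2)"
    by (rule integrable_prod_Basis) (use nn_integral_inverse_square_finite in \<open>auto simp: less_top\<close>)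
  then have i: "integrable lborel (\<lambda>x::'a. \<bar>C\<bar> * (\<Prod>b\<in>Basis. 1 / (1 + \<bar>x \<bullet> b\<bar>)^2))" by simp
  have *: "1 / (1 + norm x) ^ N \<le> (\<Prod>b\<in>Basis. 1 / (1 + \<bar>x \<bullet> b\<bar>)^2)" for x :: 'a
  proof -
    have "(\<Prod>b\<in>Basis. (1 + \<bar>x \<bullet> b\<bar>))^2 \<le> ((1 + norm x) ^ DIM('a))^2"
      by (intro power_mono prod_Basis_le_norm prod_nonneg) auto
    also have "\<dots> = (1 + norm x) ^ (2 * DIM('a))" by (simp add: power_mult[symmetric] mult.commute)
    also have "\<dots> \<le> (1 + norm x) ^ N" by (intro power_increasing assms) auto
    finally have "1 / (1 + norm x) ^ N \<le> 1 / (\<Prod>b\<in>Basis. (1 + \<bar>x \<bullet> b\<bar>))^2"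
      by (intro divide_left_mono mult_pos_pos) (auto intro!: prod_pos add_pos_nonneg zero_less_power)
    also have "\<dots> = (\<Prod>b\<in>Basis. 1 / (1 + \<bar>x \<bullet> b\<bar>)^2)"
      by (simp add: prod_dividef prod_power_distrib)
    finally show ?thesis .
  qed
  show ?thesis
  proof (rule Bochner_Integration.integrable_bound[OF i])
    show "AE x::'a in lborel. norm (C / (1 + norm x) ^ N) \<le> norm (\<bar>C\<bar> * (\<Prod>b\<in>Basis. 1 / (1 + \<bar>x \<bullet> b\<bar>)\<^sup>2))"
    proof (rule AE_I2)
      fix x :: 'a
      have "\<bar>C\<bar> * (1 / (1 + norm x) ^ N) \<le> \<bar>C\<bar> * (\<Prod>b\<in>Basis. 1 / (1 + \<bar>x \<bullet> b\<bar>)^2)"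
        by (rule mult_left_mono[OF *]) simp
      then show "norm (C / (1 + norm x) ^ N) \<le> norm (\<bar>C\<bar> * (\<Prod>b\<in>Basis. 1 / (1 + \<bar>x \<bullet> b\<bar>)\<^sup>2))"
        by (simp add: abs_mult abs_prod prod_nonneg)
    qed
  qed measurable
qed

section \<open>Rapid decay and differentiation of Fourier transforms\<close>

definition rapidly_decreasing :: "('a::euclidean_space \<Rightarrow> complex) \<Rightarrow> bool" where
  "rapidly_decreasing f \<longleftrightarrow> continuous_on UNIV f \<and> (\<forall>N. \<exists>C\<ge>0. \<forall>x. norm (f x) \<le> C / (1 + norm x) ^ N)"

lemma rapidly_decreasing_bound:
  assumes "rapidly_decreasing f"
  obtains C where "0 \<le> C" "\<And>x. norm (f x) \<le> C / (1 + norm x) ^ N"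
  using assms unfolding rapidly_decreasing_def by metis

lemma rapidly_decreasing_cont: "rapidly_decreasing f \<Longrightarrow> continuous_on UNIV f"
  unfolding rapidly_decreasing_def by simp

lemma rapidly_decreasing_integrable:
  assumes "rapidly_decreasing f" shows "integrable lborel f"
proof -
  obtain C where "0 \<le> C" "\<And>x. norm (f x) \<le> C / (1 + norm x) ^ (2 * DIM('a))"
    using rapidly_decreasing_bound[OF assms, of "2 * DIM('a)"] by blast
  then show ?thesis
    by (intro integrable_bounded_by[OF rapidly_decreasing_cont[OF assms] integrable_norm_weight]) auto
qed

lemma rapidly_decreasing_mult_growth:
  assumes "rapidly_decreasing f" "continuous_on UNIV g" "\<And>x. norm (g x) \<le> A * (1 + norm x) ^ k"
  shows "rapidly_decreasing (\<lambda>x. g x * f x)"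
  unfolding rapidly_decreasing_def
proof (intro conjI allI)
  show "continuous_on UNIV (\<lambda>x. g x * f x)" by (intro continuous_intros assms rapidly_decreasing_cont)
  fix N
  obtain C where C: "0 \<le> C" "\<And>x. norm (f x) \<le> C / (1 + norm x) ^ (N + k)"
    using rapidly_decreasing_bound[OF assms(1)] by blast
  have A: "0 \<le> A" using order_trans[OF norm_ge_zero assms(3)[of 0]] by simp
  have "norm (g x * f x) \<le> (A * C) / (1 + norm x) ^ N" for x
  proof -
    have "norm (g x * f x) \<le> (A * (1 + norm x) ^ k) * (C / (1 + norm x) ^ (N + k))"
      unfolding norm_mult using A C by (intro mult_mono assms) auto
    also have "\<dots> = (A * C) / (1 + norm x) ^ N"
      using norm_ge_zero[of x] by (simp add: power_add field_simps add_nonneg_eq_0_iff)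
    finally show ?thesis .
  qed
  then show "\<exists>C\<ge>0. \<forall>x. norm (g x * f x) \<le> C / (1 + norm x) ^ N" using A C by (intro exI[of _ "A * C"]) auto
qed

lemma norm_pow_prod_bound: "norm (complex_of_real (x \<bullet> v) ^ k) \<le> norm v ^ k * (1 + norm x) ^ k"
proof -
  have "\<bar>x \<bullet> v\<bar> \<le> norm v * (1 + norm x)" using Cauchy_Schwarz_ineq2[of x v] norm_ge_zero[of v] mult.commute[of "norm x" "norm v"] unfolding distrib_left by linarith
  from power_mono[OF this, of k] show ?thesis by (simp add: norm_power power_mult_distrib norm_mult)
qed

lemma rapidly_decreasing_coord:
  assumes "rapidly_decreasing f"
  shows "rapidly_decreasing (\<lambda>x. (c * of_real (x \<bullet> v)) ^ k * f x)"
proof (rule rapidly_decreasing_mult_growth[OF assms, where A="norm c ^ k * norm v ^ k" and k=k])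
  fix x
  show "norm ((c * complex_of_real (x \<bullet> v)) ^ k) \<le> norm c ^ k * norm v ^ k * (1 + norm x) ^ k"
    using mult_left_mono[OF norm_pow_prod_bound[of x v k], of "norm c ^ k"]
    by (simp add: power_mult_distrib norm_mult norm_power mult_ac)
qed (intro continuous_intros)

lemma norm_cis_diff_le: "norm (cis a - cis b) \<le> \<bar>a - b\<bar>"
proof -
  have "cis a - cis b = cis b * (cis (a - b) - 1)" by (simp add: cis_mult right_diff_distrib)
  then have "norm (cis a - cis b) = norm (cis (a - b) - 1)" by (simp add: norm_mult)
  also have "\<dots> \<le> \<bar>a - b\<bar>" using iexp_approx1[of "a - b" 0] by (simp add: cis_conv_exp)
  finally show ?thesis .
qed

lemma norm_cis_quadratic: "norm (cis (a + h) - cis a - \<i> * h * cis a) \<le> h^2"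
proof -
  have "cis (a + h) - cis a - \<i> * h * cis a = cis a * (cis h - (1 + \<i> * h))" by (simp add: cis_mult[symmetric] algebra_simps)
  then have "norm (cis (a + h) - cis a - \<i> * h * cis a) = norm (cis h - (1 + \<i> * h))" by (simp add: norm_mult)
  also have "\<dots> \<le> \<bar>h\<bar>^2 / 2" using iexp_approx1[of h 1] by (simp add: cis_conv_exp numeral_2_eq_2)
  also have "\<dots> \<le> h^2" by simp
  finally show ?thesis .
qed

text \<open>The mean value bound for the exponential, integrated against \<open>f\<close>; the
  constant is a first moment. Besides continuity it later measures how far the transform of
  \<open>\<Psi>\<close> is from its value \<open>1\<close> on the unit sphere.\<close>

lemma fourier_lipschitz:
  fixes f :: "'a::euclidean_space \<Rightarrow> complex"
  assumes "rapidly_decreasing f"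
  shows "\<exists>A\<ge>0. \<forall>\<xi> \<eta>. norm (fourier f \<xi> - fourier f \<eta>) \<le> A * norm (\<xi> - \<eta>)"
proof -
  note cf = rapidly_decreasing_cont[OF assms]
  have r: "rapidly_decreasing (\<lambda>x. of_real (norm x) * f x)"
    by (rule rapidly_decreasing_mult_growth[OF assms, where A=1 and k=1]) (auto intro!: continuous_intros)
  define A where "A = 2 * pi * (LINT x|lborel. norm (of_real (norm x) * f x))"
  have i: "integrable lborel (\<lambda>x. f x * cis (- 2 * pi * (x \<bullet> \<xi>)))" for \<xi>
    by (rule integrable_bounded_by[OF _ integrable_norm[OF rapidly_decreasing_integrable[OF assms]]])
       (auto intro!: continuous_intros cf simp: norm_mult)
  have "norm (fourier f \<xi> - fourier f \<eta>) \<le> A * norm (\<xi> - \<eta>)" for \<xi> \<eta>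
  proof -
    have "fourier f \<xi> - fourier f \<eta> = (LINT x|lborel. f x * cis (- 2 * pi * (x \<bullet> \<xi>)) - f x * cis (- 2 * pi * (x \<bullet> \<eta>)))"
      unfolding fourier_def by (rule Bochner_Integration.integral_diff[symmetric]) (rule i)+
    also have "norm \<dots> \<le> (LINT x|lborel. 2 * pi * norm (\<xi> - \<eta>) * norm (of_real (norm x) * f x))"
    proof (rule Bochner_Integration.integral_norm_bound_integral)
      show "integrable lborel (\<lambda>x. f x * cis (- 2 * pi * (x \<bullet> \<xi>)) - f x * cis (- 2 * pi * (x \<bullet> \<eta>)))"
        using i by (intro Bochner_Integration.integrable_diff)
      show "integrable lborel (\<lambda>x. 2 * pi * norm (\<xi> - \<eta>) * norm (of_real (norm x) * f x))"
        by (intro integrable_mult_right integrable_norm rapidly_decreasing_integrable r)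
      fix x
      have "(- 2 * pi * (x \<bullet> \<xi>)) - (- 2 * pi * (x \<bullet> \<eta>)) = 2 * pi * (x \<bullet> (\<eta> - \<xi>))"
        by (simp add: inner_diff_right right_diff_distrib)
      then have "\<bar>(- 2 * pi * (x \<bullet> \<xi>)) - (- 2 * pi * (x \<bullet> \<eta>))\<bar> = 2 * pi * \<bar>x \<bullet> (\<eta> - \<xi>)\<bar>"
        by (simp only: abs_mult) simp
      also have "\<dots> \<le> 2 * pi * (norm x * norm (\<xi> - \<eta>))"
        using Cauchy_Schwarz_ineq2[of x "\<eta> - \<xi>"] by (intro mult_left_mono) (auto simp: norm_minus_commute)
      finally have *: "norm (cis (- 2 * pi * (x \<bullet> \<xi>)) - cis (- 2 * pi * (x \<bullet> \<eta>))) \<le> 2 * pi * (norm x * norm (\<xi> - \<eta>))"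
        using norm_cis_diff_le order_trans by blast
      show "norm (f x * cis (- 2 * pi * (x \<bullet> \<xi>)) - f x * cis (- 2 * pi * (x \<bullet> \<eta>))) \<le> 2 * pi * norm (\<xi> - \<eta>) * norm (of_real (norm x) * f x)"
        using mult_left_mono[OF *, of "norm (f x)"] unfolding right_diff_distrib[symmetric] norm_mult
        by (simp add: mult_ac)
    qed
    also have "\<dots> = A * norm (\<xi> - \<eta>)" by (simp add: A_def mult_ac)
    finally show ?thesis .
  qed
  moreover have "0 \<le> A" unfolding A_def by (intro mult_nonneg_nonneg integral_nonneg_AE) auto
  ultimately show ?thesis by blast
qed

lemma fourier_continuous:
  assumes "rapidly_decreasing f" shows "continuous_on UNIV (fourier f)"
proof -
  obtain A where A: "A \<ge> 0" "\<And>\<xi> \<eta>. norm (fourier f \<xi> - fourier f \<eta>) \<le> A * norm (\<xi> - \<eta>)"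
    using fourier_lipschitz[OF assms] by blast
  have "A-lipschitz_on UNIV (fourier f)"
    by (rule lipschitz_onI) (use A in \<open>auto simp: dist_norm\<close>)
  then show ?thesis by (rule lipschitz_on_continuous_on)
qed

text \<open>A second-order remainder estimate with an explicit constant replaces dominated
  convergence when the Fourier integral is differentiated: rapid decay makes the second moment
  finite, and that is the constant.\<close>

lemma has_vector_derivativeI_quadratic:
  fixes g :: "real \<Rightarrow> complex"
  assumes "\<And>t. norm (g t - g 0 - of_real t * L) \<le> A * t^2"
  shows "(g has_vector_derivative L) (at 0)"
proof -
  have A: "0 \<le> A" using order_trans[OF norm_ge_zero assms[of 1]] by simp
  have "((\<lambda>y. ((g y - g 0) - (y - 0) *\<^sub>R L) /\<^sub>R norm (y - 0)) \<longlongrightarrow> 0) (at 0)"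
  proof (rule Lim_null_comparison)
    show "\<forall>\<^sub>F y in at 0. norm (((g y - g 0) - (y - 0) *\<^sub>R L) /\<^sub>R norm (y - 0)) \<le> A * \<bar>y\<bar>"
    proof (rule always_eventually, rule allI)
      fix y :: real
      have "norm (g y - g 0 - of_real y * L) / \<bar>y\<bar> \<le> A * \<bar>y\<bar>"
        using assms[of y] A by (cases "y = 0") (auto simp: field_simps power2_eq_square abs_mult_self_eq)
      then show "norm (((g y - g 0) - (y - 0) *\<^sub>R L) /\<^sub>R norm (y - 0)) \<le> A * \<bar>y\<bar>"
        by (simp add: scaleR_conv_of_real divide_inverse mult.commute norm_mult norm_inverse)
    qed
    show "((\<lambda>y. A * \<bar>y\<bar>) \<longlongrightarrow> 0) (at 0)" by (auto intro!: tendsto_eq_intros)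
  qed
  then show ?thesis unfolding has_vector_derivative_def has_derivative_def
    by (auto intro!: bounded_linear_intros)
qed

lemma fourier_has_vector_derivative:
  fixes f :: "'a::euclidean_space \<Rightarrow> complex"
  assumes "rapidly_decreasing f"
  shows "((\<lambda>t. fourier f (\<xi> + t *\<^sub>R v)) has_vector_derivative
            fourier (\<lambda>x. (- 2 * pi * \<i> * of_real (x \<bullet> v)) * f x) \<xi>) (at 0)"
proof -
  let ?e = "\<lambda>x. cis (- 2 * pi * (x \<bullet> \<xi>))"
  note cf = rapidly_decreasing_cont[OF assms]
  have i: "integrable lborel (\<lambda>x. g x * cis (- 2 * pi * (x \<bullet> \<xi>)))" if "rapidly_decreasing g" for g \<xi>
    by (rule integrable_bounded_by[OF _ integrable_norm[OF rapidly_decreasing_integrable[OF that]]])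
       (auto intro!: continuous_intros rapidly_decreasing_cont[OF that] simp: norm_mult)
  have r1: "rapidly_decreasing (\<lambda>x. (- 2 * pi * \<i> * of_real (x \<bullet> v)) * f x)"
    using rapidly_decreasing_coord[OF assms, of "- 2 * pi * \<i>" v 1] by simp
  have r2: "rapidly_decreasing (\<lambda>x. (of_real (2 * pi * (x \<bullet> v)))^2 * f x)"
    using rapidly_decreasing_coord[OF assms, of "2 * pi" v 2] by (simp add: mult_ac)
  show ?thesis
  proof (rule has_vector_derivativeI_quadratic)
    fix t :: real
    have 1: "fourier f (\<xi> + t *\<^sub>R v) - fourier f (\<xi> + 0 *\<^sub>R v) - of_real t * fourier (\<lambda>x. (- 2 * pi * \<i> * of_real (x \<bullet> v)) * f x) \<xi>
      = (LINT x|lborel. f x * cis (- 2 * pi * (x \<bullet> (\<xi> + t *\<^sub>R v))) - f x * ?e x - of_real t * ((- 2 * pi * \<i> * of_real (x \<bullet> v)) * f x * ?e x))"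
      unfolding fourier_def
      by (simp add: Bochner_Integration.integral_diff[OF Bochner_Integration.integrable_diff[OF i[OF assms] i[OF assms]] integrable_mult_right[OF i[OF r1]], simplified]
          Bochner_Integration.integral_diff[OF i[OF assms] i[OF assms], simplified] del: mult_minus_left mult_minus_right)
    have 2: "norm (LINT x|lborel. f x * cis (- 2 * pi * (x \<bullet> (\<xi> + t *\<^sub>R v))) - f x * ?e x - of_real t * ((- 2 * pi * \<i> * of_real (x \<bullet> v)) * f x * ?e x)) \<le> (LINT x|lborel. t^2 * norm ((of_real (2 * pi * (x \<bullet> v)))^2 * f x))"
    proof (rule Bochner_Integration.integral_norm_bound_integral)
      show "integrable lborel (\<lambda>x. f x * cis (- 2 * pi * (x \<bullet> (\<xi> + t *\<^sub>R v))) - f x * ?e x - of_real t * ((- 2 * pi * \<i> * of_real (x \<bullet> v)) * f x * ?e x))"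
        by (intro Bochner_Integration.integrable_diff integrable_mult_right i assms r1)
      show "integrable lborel (\<lambda>x. t^2 * norm ((of_real (2 * pi * (x \<bullet> v)))^2 * f x))"
        by (intro integrable_mult_right integrable_norm rapidly_decreasing_integrable r2)
      fix x
      let ?a = "- 2 * pi * (x \<bullet> \<xi>)" and ?h = "- 2 * pi * (x \<bullet> v) * t"
      have eq: "- 2 * pi * (x \<bullet> (\<xi> + t *\<^sub>R v)) = ?a + ?h" by (simp add: inner_add_right algebra_simps)
      have "f x * cis (- 2 * pi * (x \<bullet> (\<xi> + t *\<^sub>R v))) - f x * ?e x - of_real t * ((- 2 * pi * \<i> * of_real (x \<bullet> v)) * f x * ?e x)
         = f x * (cis (?a + ?h) - cis ?a - \<i> * of_real ?h * cis ?a)"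
        unfolding eq by (simp add: algebra_simps)
      also have "norm \<dots> \<le> norm (f x) * ?h^2"
        using mult_left_mono[OF norm_cis_quadratic[of ?a ?h] norm_ge_zero[of "f x"]] by (simp only: norm_mult)
      also have "\<dots> = t^2 * norm ((of_real (2 * pi * (x \<bullet> v)))^2 * f x)"
      proof -
        have "norm ((of_real (2 * pi * (x \<bullet> v)))^2 * f x) = (2 * pi * (x \<bullet> v))^2 * norm (f x)"
          unfolding norm_mult[of _ "f x"] norm_power norm_of_real by simp
        moreover have "?h^2 = t^2 * (2 * pi * (x \<bullet> v))^2" by (simp add: power_mult_distrib)
        ultimately show ?thesis by (simp only: mult_ac)
      qed
      finally show "norm (f x * cis (- 2 * pi * (x \<bullet> (\<xi> + t *\<^sub>R v))) - f x * ?e x - of_real t * ((- 2 * pi * \<i> * of_real (x \<bullet> v)) * f x * ?e x))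
         \<le> t^2 * norm ((of_real (2 * pi * (x \<bullet> v)))^2 * f x)" .
    qed
    have 3: "(LINT x|lborel. t^2 * norm ((of_real (2 * pi * (x \<bullet> v)))^2 * f x)) = (LINT x|lborel. norm ((of_real (2 * pi * (x \<bullet> v)))^2 * f x)) * t^2"
      by (subst integral_mult_right_zero) (rule mult.commute)
    show "norm (fourier f (\<xi> + t *\<^sub>R v) - fourier f (\<xi> + 0 *\<^sub>R v) - of_real t * fourier (\<lambda>x. (- 2 * pi * \<i> * of_real (x \<bullet> v)) * f x) \<xi>)
        \<le> (LINT x|lborel. norm ((of_real (2 * pi * (x \<bullet> v)))^2 * f x)) * t^2"
      using 2 unfolding 1 3 .
  qed
qed

lemma dir_bounded_fourier:
  fixes f :: "'a::euclidean_space \<Rightarrow> complex"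
  assumes "rapidly_decreasing f"
    and "\<And>k \<xi>. k \<le> K \<Longrightarrow> norm (fourier (\<lambda>x. (- 2 * pi * \<i> * of_real (x \<bullet> v)) ^ k * f x) \<xi>) \<le> S \<xi>"
  shows "dir_bounded v K (fourier f) S"
  using assms
proof (induction K arbitrary: f)
  case 0
  then show ?case using fourier_continuous[OF 0(1)] 0(2)[of 0] by simp
next
  case (Suc K)
  let ?g = "\<lambda>x. (- 2 * pi * \<i> * of_real (x \<bullet> v)) * f x"
  have "rapidly_decreasing ?g" using rapidly_decreasing_coord[OF Suc.prems(1), of "- 2 * pi * \<i>" v 1] by simp
  moreover have "norm (fourier (\<lambda>x. (- 2 * pi * \<i> * of_real (x \<bullet> v)) ^ k * ?g x) \<xi>) \<le> S \<xi>" if "k \<le> K" for k \<xi>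
    using Suc.prems(2)[of "Suc k" \<xi>] that by (simp add: mult_ac del: mult_minus_left mult_minus_right)
  ultimately have "dir_bounded v K (fourier ?g) S" by (rule Suc.IH)
  then show ?case
    by (intro dir_bounded_SucI[where f'="fourier ?g"] fourier_continuous Suc.prems fourier_has_vector_derivative)
       (use Suc.prems(2)[of 0] in simp)
qed

section \<open>Schwartz functions and families with uniform constants\<close>

lemma schwartz_bound:
  assumes "schwartz f" "set bs \<subseteq> Basis"
  shows "\<exists>C\<ge>0. \<forall>x. norm (iter_partial bs f x) \<le> C / (1 + norm x) ^ N"
proof -
  let ?g = "iter_partial bs f"
  have "bounded (range (\<lambda>x. norm x ^ k *\<^sub>R ?g x))" for k using assms unfolding schwartz_def by blast
  then obtain B where B: "\<And>k x. norm (norm x ^ k *\<^sub>R ?g x) \<le> B k" unfolding bounded_iff by (metis rangeI)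
  have "norm (?g x) \<le> (\<Sum>k\<le>N. of_nat (N choose k) * B k) / (1 + norm x) ^ N" for x
  proof -
    \<comment> \<open>The definition of \<open>schwartz\<close> bounds each pure power
      \<open>norm x ^ k\<close> separately; the binomial expansion assembles them into a power of
      \<open>1 + norm x\<close>.\<close>
    have "norm (?g x) * (1 + norm x) ^ N = (\<Sum>k\<le>N. of_nat (N choose k) * (norm x ^ k * norm (?g x)))"
      by (subst add.commute, subst binomial_ring) (simp add: sum_distrib_left mult_ac)
    also have "\<dots> \<le> (\<Sum>k\<le>N. of_nat (N choose k) * B k)"
      using B by (intro sum_mono mult_left_mono) auto
    finally show ?thesis by (simp add: field_simps add_pos_nonneg)
  qed
  moreover have "0 \<le> (\<Sum>k\<le>N. of_nat (N choose k) * B k)"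
    using order_trans[OF norm_ge_zero B] by (intro sum_nonneg) auto
  ultimately show ?thesis by blast
qed

lemma schwartz_dir_bounded:
  fixes f :: "'a::euclidean_space \<Rightarrow> complex"
  assumes "schwartz f" "b \<in> Basis"
  shows "\<exists>C\<ge>0. dir_bounded b K f (\<lambda>x. C / (1 + norm x) ^ N)"
proof -
  \<comment> \<open>Only repeated derivatives along the one basis vector \<open>b\<close> are taken
    from the definition; the order \<open>k\<close> already reached is generalised for the
    induction.\<close>
  have *: "\<exists>C\<ge>0. dir_bounded b K (iter_partial (replicate k b) f) (\<lambda>x. C / (1 + norm x) ^ N)" for k
  proof (induction K arbitrary: k)
    case 0
    have s: "set (replicate k b) \<subseteq> Basis" using assms by (auto simp: set_replicate_conv_if)
    have "continuous_on UNIV (iter_partial (replicate k b) f)"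
      using assms s unfolding schwartz_def by (auto intro!: differentiable_imp_continuous_on simp: differentiable_on_def)
    then show ?case using schwartz_bound[OF assms(1) s, of N] by auto
  next
    case (Suc K)
    have s: "set (replicate k b) \<subseteq> Basis" using assms by (auto simp: set_replicate_conv_if)
    let ?g = "iter_partial (replicate k b) f"
    have d: "?g differentiable (at x)" for x using assms s unfolding schwartz_def by blast
    have c: "continuous_on UNIV ?g"
      using d by (auto intro!: differentiable_imp_continuous_on simp: differentiable_on_def)
    obtain C1 where C1: "C1 \<ge> 0" "\<And>x. norm (?g x) \<le> C1 / (1 + norm x) ^ N" using schwartz_bound[OF assms(1) s] by blast
    obtain C2 where C2: "C2 \<ge> 0" "dir_bounded b K (iter_partial (replicate (Suc k) b) f) (\<lambda>x. C2 / (1 + norm x) ^ N)" using Suc by blast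
    have le: "C1 / (1 + norm x) ^ N \<le> (C1 + C2) / (1 + norm x) ^ N" "C2 / (1 + norm x) ^ N \<le> (C1 + C2) / (1 + norm x) ^ N" for x :: 'a
      using C1 C2 by (auto intro!: divide_right_mono)
    have "((\<lambda>t. ?g (x + t *\<^sub>R b)) has_vector_derivative iter_partial (replicate (Suc k) b) f x) (at 0)" for x
    proof -
      have "(?g has_derivative frechet_derivative ?g (at x)) (at x)" using d by (simp add: frechet_derivative_works)
      then have "(?g has_derivative frechet_derivative ?g (at x)) (at (x + 0 *\<^sub>R b))" by simp
      then have "((\<lambda>t. ?g (x + t *\<^sub>R b)) has_derivative (\<lambda>t. frechet_derivative ?g (at x) (t *\<^sub>R b))) (at 0)"
        by (rule has_derivative_compose[where f="\<lambda>t. x + t *\<^sub>R b" and f'="\<lambda>t. t *\<^sub>R b" and x=0, rotated])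
           (auto intro!: derivative_eq_intros)
      moreover have "frechet_derivative ?g (at x) (t *\<^sub>R b) = t *\<^sub>R frechet_derivative ?g (at x) b" for t
        using linear_frechet_derivative[OF d] by (simp add: linear_cmul)
      ultimately show ?thesis unfolding has_vector_derivative_def by simp
    qed
    then have "dir_bounded b (Suc K) ?g (\<lambda>x. (C1 + C2) / (1 + norm x) ^ N)"
      using C1(2) le by (intro dir_bounded_SucI[OF c _ _ dir_bounded_mono[OF C2(2)]]) (auto intro: order_trans)
    then show ?case using C1 C2 by (intro exI[of _ "C1 + C2"]) auto
  qed
  show ?thesis using *[of 0] by simp
qed

lemma schwartz_rapidly_decreasing:
  fixes f :: "'a::euclidean_space \<Rightarrow> complex"
  assumes "schwartz f" shows "rapidly_decreasing f"
proof -
  have "\<exists>C\<ge>0. dir_bounded (SOME b. b \<in> Basis) 0 f (\<lambda>x. C / (1 + norm x) ^ N)" for N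
    using schwartz_dir_bounded[OF assms SOME_Basis] .
  then show ?thesis unfolding rapidly_decreasing_def by (auto simp: dir_bounded.simps)
qed

text \<open>Decay of order \<open>DIM('a) * q\<close> in each coordinate separately gives order
  \<open>q\<close> in all coordinates at once: multiplying the \<open>DIM('a)\<close> estimates
  bounds the power \<open>z ^ DIM('a)\<close>, and a root is extracted. The product form is
  convenient because it integrates coordinate by coordinate.\<close>

lemma prod_decay:
  fixes y :: "'a::euclidean_space"
  assumes "0 \<le> z" "z \<le> A" "\<And>b. b \<in> Basis \<Longrightarrow> \<bar>y \<bullet> b\<bar> ^ (DIM('a) * q) * z \<le> A"
  shows "z \<le> 2 ^ (DIM('a) * q) * A / (\<Prod>b\<in>Basis. (1 + \<bar>y \<bullet> b\<bar>) ^ q)"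
proof -
  let ?Q = "DIM('a) * q" and ?P = "\<Prod>b\<in>(Basis::'a set). (1 + \<bar>y \<bullet> b\<bar>) ^ q"
  have Q: "(1 + \<bar>y \<bullet> b\<bar>) ^ ?Q * z \<le> 2 ^ ?Q * A" if "b \<in> Basis" for b
  proof -
    have "(1 + \<bar>y \<bullet> b\<bar>) ^ ?Q \<le> (2 * max 1 \<bar>y \<bullet> b\<bar>) ^ ?Q" by (intro power_mono) auto
    also have "\<dots> = 2 ^ ?Q * max 1 \<bar>y \<bullet> b\<bar> ^ ?Q" by (simp add: power_mult_distrib)
    finally have "(1 + \<bar>y \<bullet> b\<bar>) ^ ?Q * z \<le> 2 ^ ?Q * (max 1 \<bar>y \<bullet> b\<bar> ^ ?Q * z)"
      using assms(1) by (metis mult_right_mono mult.assoc)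
    also have "max 1 \<bar>y \<bullet> b\<bar> ^ ?Q * z \<le> A" using assms that by (cases "\<bar>y \<bullet> b\<bar> \<le> 1") (auto simp: max_def)
    finally show ?thesis by simp
  qed
  have "(?P * z) ^ DIM('a) = (\<Prod>b\<in>(Basis::'a set). (1 + \<bar>y \<bullet> b\<bar>) ^ ?Q * z)"
    by (simp add: prod.distrib power_mult_distrib prod_power_distrib[symmetric] power_mult mult.commute)
  also have "\<dots> \<le> (\<Prod>b\<in>(Basis::'a set). 2 ^ ?Q * A)" using Q assms(1) by (intro prod_mono) auto
  also have "\<dots> = (2 ^ ?Q * A) ^ DIM('a)" by simp
  finally have "?P * z \<le> 2 ^ ?Q * A"
    by (rule power_le_imp_le_base[of _ "DIM('a) - 1", unfolded Suc_diff_1[OF DIM_positive]]) (use assms in auto)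
  moreover have "0 < ?P" by (intro prod_pos) (auto intro!: zero_less_power)
  ultimately show ?thesis by (simp add: field_simps)
qed

text \<open>The constants are shared by a whole family. The families that matter are singletons and
  the Gaussian bumps with \<open>0 < \<delta> \<le> 1\<close>, for which nothing may depend on
  \<open>\<delta>\<close>.\<close>

definition uniformly_schwartz :: "('a::euclidean_space \<Rightarrow> complex) set \<Rightarrow> bool" where
  "uniformly_schwartz F \<longleftrightarrow> (\<forall>K N. \<exists>C\<ge>0. \<forall>f\<in>F. \<forall>b\<in>Basis. dir_bounded b K f (\<lambda>x. C / (1 + norm x) ^ N))"

lemma uniformly_schwartz_bound:
  assumes "uniformly_schwartz F"
  obtains C where "0 \<le> C" "\<And>f b. f \<in> F \<Longrightarrow> b \<in> Basis \<Longrightarrow> dir_bounded b K f (\<lambda>x. C / (1 + norm x) ^ N)"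
  using assms unfolding uniformly_schwartz_def by metis

lemma uniformly_schwartz_rapidly_decreasing:
  fixes f :: "'a::euclidean_space \<Rightarrow> complex"
  assumes "uniformly_schwartz F" "f \<in> F" shows "rapidly_decreasing f"
proof -
  have "\<exists>C\<ge>0. continuous_on UNIV f \<and> (\<forall>x. norm (f x) \<le> C / (1 + norm x) ^ N)" for N
  proof -
    obtain C where C: "0 \<le> C" "\<And>f b. f \<in> F \<Longrightarrow> b \<in> Basis \<Longrightarrow> dir_bounded b 0 f (\<lambda>x. C / (1 + norm x) ^ N)"
      using uniformly_schwartz_bound[OF assms(1), of 0 N] by blast
    then show ?thesis using C(2)[OF assms(2) SOME_Basis] by auto
  qed
  then show ?thesis unfolding rapidly_decreasing_def by blast
qed

lemma schwartz_uniformly_schwartz: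
  fixes f :: "'a::euclidean_space \<Rightarrow> complex"
  assumes "schwartz f" shows "uniformly_schwartz {f}"
  unfolding uniformly_schwartz_def
proof (intro allI)
  fix K N
  have "\<forall>b\<in>Basis. \<exists>C\<ge>0. dir_bounded b K f (\<lambda>x. C / (1 + norm x) ^ N)"
    using schwartz_dir_bounded[OF assms] by blast
  then obtain C where C: "\<And>b. b \<in> Basis \<Longrightarrow> C b \<ge> 0" "\<And>b. b \<in> Basis \<Longrightarrow> dir_bounded b K f (\<lambda>x. C b / (1 + norm x) ^ N)" by metis
  have "dir_bounded b K f (\<lambda>x. (\<Sum>b\<in>Basis. C b) / (1 + norm x) ^ N)" if "b \<in> Basis" for b
    by (rule dir_bounded_mono[OF C(2)[OF that]]) (auto intro!: divide_right_mono member_le_sum that C)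
  then show "\<exists>C\<ge>0. \<forall>f\<in>{f}. \<forall>b\<in>Basis. dir_bounded b K f (\<lambda>x. C / (1 + norm x) ^ N)"
    using C(1) by (intro exI[of _ "\<Sum>b\<in>Basis. C b"]) (auto intro!: sum_nonneg)
qed

text \<open>These monomials appear when a Fourier transform is differentiated. The degree of growth
  stays \<open>k\<close>, whatever the number of derivatives.\<close>

lemma dir_bounded_monomial:
  "\<exists>A\<ge>0. \<forall>b\<in>Basis. \<forall>b'\<in>Basis.
     dir_bounded b K (\<lambda>x::'a::euclidean_space. (c * of_real (x \<bullet> b')) ^ k) (\<lambda>x. A * (1 + norm x) ^ k)"
proof (induction K arbitrary: k)
  case 0
  have "norm ((c * complex_of_real (x \<bullet> b')) ^ k) \<le> norm c ^ k * (1 + norm x) ^ k" if "b' \<in> Basis" for x b' :: 'a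
  proof -
    have "norm (c * complex_of_real (x \<bullet> b')) \<le> norm c * (1 + norm x)"
      unfolding norm_mult norm_of_real using Basis_le_norm[OF that, of x] by (intro mult_left_mono) auto
    from power_mono[OF this, of k] show ?thesis unfolding norm_power power_mult_distrib[of "norm c" "1 + norm x"] by simp
  qed
  then show ?case by (auto intro!: exI[of _ "norm c ^ k"] continuous_intros)
next
  case (Suc K)
  obtain A where A: "A \<ge> 0" "\<And>b b'. b \<in> Basis \<Longrightarrow> b' \<in> Basis \<Longrightarrow>
     dir_bounded b K (\<lambda>x::'a. (c * of_real (x \<bullet> b')) ^ (k-1)) (\<lambda>x. A * (1 + norm x) ^ (k-1))" using Suc by blast
  define A' where "A' = norm c ^ k + k * norm c * A"
  have "dir_bounded b (Suc K) (\<lambda>x::'a. (c * of_real (x \<bullet> b')) ^ k) (\<lambda>x. A' * (1 + norm x) ^ k)" if b: "b \<in> Basis" "b' \<in> Basis" for b b'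
  proof (rule dir_bounded_SucI)
    show "continuous_on UNIV (\<lambda>x. (c * complex_of_real (x \<bullet> b')) ^ k)" by (intro continuous_intros)
    fix x :: 'a
    have "norm (c * complex_of_real (x \<bullet> b')) \<le> norm c * (1 + norm x)"
      unfolding norm_mult norm_of_real using Basis_le_norm[OF b(2), of x] by (intro mult_left_mono) auto
    from power_mono[OF this, of k] have "norm ((c * complex_of_real (x \<bullet> b')) ^ k) \<le> norm c ^ k * (1 + norm x) ^ k"
      unfolding norm_power power_mult_distrib[of "norm c" "1 + norm x"] by simp
    also have "\<dots> \<le> A' * (1 + norm x) ^ k" unfolding A'_def using A by (intro mult_right_mono) auto
    finally show "norm ((c * complex_of_real (x \<bullet> b')) ^ k) \<le> A' * (1 + norm x) ^ k" .
    have "((\<lambda>t. complex_of_real (x \<bullet> b' + t * (b \<bullet> b'))) has_vector_derivative complex_of_real (b \<bullet> b')) (at 0)"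
      by (auto intro!: derivative_eq_intros has_vector_derivative_of_real simp: has_real_derivative_iff_has_vector_derivative[symmetric])
    from has_vector_derivative_mult_right[OF this, of c]
    have "((\<lambda>t. c * complex_of_real (x \<bullet> b' + t * (b \<bullet> b'))) has_vector_derivative c * complex_of_real (b \<bullet> b')) (at 0)" .
    moreover have "((\<lambda>z. z ^ k) has_field_derivative of_nat k * (c * complex_of_real (x \<bullet> b')) ^ (k - 1)) (at (c * complex_of_real (x \<bullet> b' + 0 * (b \<bullet> b'))))"
      by (auto intro!: derivative_eq_intros)
    ultimately have "(((\<lambda>z. z ^ k) \<circ> (\<lambda>t. c * complex_of_real (x \<bullet> b' + t * (b \<bullet> b')))) has_vector_derivative
       c * complex_of_real (b \<bullet> b') * (of_nat k * (c * complex_of_real (x \<bullet> b')) ^ (k - 1))) (at 0)"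
      by (rule field_vector_diff_chain_at)
    then show "((\<lambda>t. (c * complex_of_real ((x + t *\<^sub>R b) \<bullet> b')) ^ k) has_vector_derivative
       (of_nat k * c * of_real (b \<bullet> b')) * (c * complex_of_real (x \<bullet> b')) ^ (k - 1)) (at 0)"
      by (simp only: o_def inner_add_left inner_scaleR_left mult_ac)
  next
    show "dir_bounded b K (\<lambda>x. (of_nat k * c * of_real (b \<bullet> b')) * (c * complex_of_real (x \<bullet> b')) ^ (k - 1)) (\<lambda>x. A' * (1 + norm x) ^ k)"
    proof (rule dir_bounded_mono[OF dir_bounded_cmult[OF A(2)[OF b]]])
      fix x :: 'a
      have "\<bar>b \<bullet> b'\<bar> \<le> 1" using Basis_le_norm[OF b(2), of b] b by simp
      then have "norm (of_nat k * c * complex_of_real (b \<bullet> b')) \<le> k * norm c * 1"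
        unfolding norm_mult norm_of_real norm_of_nat by (intro mult_left_mono) auto
      moreover have "(1 + norm x) ^ (k-1) \<le> (1 + norm x) ^ k" by (intro power_increasing) auto
      ultimately have "norm (of_nat k * c * complex_of_real (b \<bullet> b')) * (A * (1 + norm x) ^ (k-1)) \<le> (k * norm c * 1) * (A * (1 + norm x) ^ k)"
        using A by (intro mult_mono) auto
      also have "\<dots> \<le> A' * (1 + norm x) ^ k" unfolding A'_def by (simp add: algebra_simps)
      finally show "norm (of_nat k * c * complex_of_real (b \<bullet> b')) * (A * (1 + norm x) ^ (k-1)) \<le> A' * (1 + norm x) ^ k" .
    qed
  qed
  moreover have "A' \<ge> 0" unfolding A'_def using A by auto
  ultimately show ?case by blast
qed

text \<open>Differentiating a transform multiplies the function by a monomial, and decay of the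
  transform comes from derivatives of that product; both are uniform over the family.\<close>

lemma uniformly_schwartz_fourier:
  fixes F :: "('a::euclidean_space \<Rightarrow> complex) set"
  assumes F: "uniformly_schwartz F"
  shows "\<exists>C\<ge>0. \<forall>f\<in>F. \<forall>b\<in>Basis. dir_bounded b K (fourier f) (\<lambda>y. C / (\<Prod>b\<in>Basis. (1 + \<bar>y \<bullet> b\<bar>) ^ q))"
proof -
  let ?c = "- 2 * pi * \<i>" and ?Q = "DIM('a) * q" and ?D = "2 * DIM('a)"
  have *: "\<exists>C\<ge>0. \<forall>f\<in>F. \<forall>b\<in>Basis. \<forall>y. norm (fourier (\<lambda>x. (?c * of_real (x \<bullet> b)) ^ k * f x) y) \<le> C / (\<Prod>b\<in>Basis. (1 + \<bar>y \<bullet> b\<bar>) ^ q)" for k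
  proof -
    obtain A where A: "A \<ge> 0" "\<And>b b'. b \<in> Basis \<Longrightarrow> b' \<in> Basis \<Longrightarrow>
       dir_bounded b ?Q (\<lambda>x::'a. (?c * of_real (x \<bullet> b')) ^ k) (\<lambda>x. A * (1 + norm x) ^ k)" using dir_bounded_monomial by blast
    \<comment> \<open>Of the decay \<open>k + ?D\<close>, the part \<open>k\<close> absorbs the
      growth of the monomial and \<open>?D\<close> leaves an integrable majorant; \<open>?Q\<close>
      is the number of derivatives that \<open>prod_decay\<close> asks for.\<close>
    obtain C where C: "C \<ge> 0" "\<And>f b. f \<in> F \<Longrightarrow> b \<in> Basis \<Longrightarrow> dir_bounded b ?Q f (\<lambda>x. C / (1 + norm x) ^ (k + ?D))"
      using uniformly_schwartz_bound[OF F] by blast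
    let ?S = "\<lambda>x::'a. (2 ^ ?Q * A * C) / (1 + norm x) ^ ?D"
    have S: "integrable lborel ?S" by (rule integrable_norm_weight) simp
    have d: "dir_bounded b' ?Q (\<lambda>x. (?c * of_real (x \<bullet> b)) ^ k * f x) ?S" if "f \<in> F" "b \<in> Basis" "b' \<in> Basis" for f b b'
    proof (rule dir_bounded_mono[OF dir_bounded_mult[OF A(2)[OF that(3,2)] C(2)[OF that(1,3)]]])
      fix x :: 'a
      show "2 ^ ?Q * (A * (1 + norm x) ^ k * (C / (1 + norm x) ^ (k + ?D))) \<le> ?S x"
        using norm_ge_zero[of x] by (simp add: power_add field_simps add_nonneg_eq_0_iff)
    qed
    define B where "B = 2 ^ ?Q * (LINT x|lborel. ?S x)"
    have "norm (fourier (\<lambda>x. (?c * of_real (x \<bullet> b)) ^ k * f x) y) \<le> B / (\<Prod>b\<in>Basis. (1 + \<bar>y \<bullet> b\<bar>) ^ q)"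
      if "f \<in> F" "b \<in> Basis" for f b y
      unfolding B_def
    proof (rule prod_decay)
      show "norm (fourier (\<lambda>x. (?c * of_real (x \<bullet> b)) ^ k * f x) y) \<le> (LINT x|lborel. ?S x)"
        using norm_fourier_le[OF dir_bounded_cont[OF d[OF that that(2)]] S dir_bounded_bound[OF d[OF that that(2)]]] .
      fix b' :: 'a assume "b' \<in> Basis"
      from fourier_decay[OF d[OF that this] S]
      show "\<bar>y \<bullet> b'\<bar> ^ ?Q * norm (fourier (\<lambda>x. (?c * of_real (x \<bullet> b)) ^ k * f x) y) \<le> (LINT x|lborel. ?S x)" .
    qed simp
    moreover have "B \<ge> 0" unfolding B_def using A C by (intro mult_nonneg_nonneg integral_nonneg_AE) auto
    ultimately show ?thesis by (intro exI[of _ B] conjI ballI allI)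
  qed
  have "\<exists>C. \<forall>k. C k \<ge> 0 \<and> (\<forall>f\<in>F. \<forall>b\<in>Basis. \<forall>y. norm (fourier (\<lambda>x. (?c * of_real (x \<bullet> b)) ^ k * f x) y) \<le> C k / (\<Prod>b\<in>Basis. (1 + \<bar>y \<bullet> b\<bar>) ^ q))"
    by (intro choice allI *)
  then obtain C where C0: "\<forall>k. C k \<ge> 0 \<and> (\<forall>f\<in>F. \<forall>b\<in>Basis. \<forall>y. norm (fourier (\<lambda>x. (?c * of_real (x \<bullet> b)) ^ k * f x) y) \<le> C k / (\<Prod>b\<in>Basis. (1 + \<bar>y \<bullet> b\<bar>) ^ q))"
    by (elim exE)
  note C = C0[THEN spec, THEN conjunct1] C0[THEN spec, THEN conjunct2, THEN bspec, THEN bspec, THEN spec]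
  have "dir_bounded b K (fourier f) (\<lambda>y. (\<Sum>k\<le>K. C k) / (\<Prod>b\<in>Basis. (1 + \<bar>y \<bullet> b\<bar>) ^ q))" if "f \<in> F" "b \<in> Basis" for f b
  proof (rule dir_bounded_fourier[OF uniformly_schwartz_rapidly_decreasing[OF F that(1)]])
    fix k :: nat and y :: 'a assume "k \<le> K"
    have "C k / (\<Prod>b\<in>Basis. (1 + \<bar>y \<bullet> b\<bar>) ^ q) \<le> (\<Sum>k\<le>K. C k) / (\<Prod>b\<in>Basis. (1 + \<bar>y \<bullet> b\<bar>) ^ q)"
      by (intro divide_right_mono member_le_sum prod_nonneg) (use C \<open>k \<le> K\<close> in auto)
    then show "norm (fourier (\<lambda>x. (?c * of_real (x \<bullet> b)) ^ k * f x) y) \<le> (\<Sum>k\<le>K. C k) / (\<Prod>b\<in>Basis. (1 + \<bar>y \<bullet> b\<bar>) ^ q)"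
      using C(2)[OF that, of k y] by linarith
  qed
  then show ?thesis using C(1) by (intro exI[of _ "\<Sum>k\<le>K. C k"]) (auto intro!: sum_nonneg)
qed

text \<open>Outside the closed ball the function vanishes on an open set, so its derivatives vanish
  there too.\<close>

lemma dir_bounded_restrict_support:
  assumes "dir_bounded v K f S" "\<And>x. norm x > R \<Longrightarrow> f x = 0"
  shows "dir_bounded v K f (\<lambda>x. if norm x \<le> R then S x else 0)"
  using assms
proof (induction K arbitrary: f)
  case (Suc K)
  then obtain f' where f: "\<And>x. ((\<lambda>t. f (x + t *\<^sub>R v)) has_vector_derivative f' x) (at 0)" "dir_bounded v K f' S" by auto
  have z: "f' x = 0" if "norm x > R" for x
  proof -
    have "((\<lambda>t::real. 0) has_vector_derivative f' x) (at 0)"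
    proof (rule has_vector_derivative_transform_within_open[OF f(1)[of x]])
      show "open {t. norm (x + t *\<^sub>R v) > R}" by (intro open_Collect_less continuous_intros)
    qed (use that Suc.prems in auto)
    then show ?thesis using vector_derivative_unique_at[OF _ has_vector_derivative_const] by blast
  qed
  show ?case by (rule dir_bounded_SucI[OF _ _ f(1) Suc.IH[OF f(2) z]]) (use Suc.prems in auto)
qed auto

text \<open>The source of the constant: \<open>1 + t \<le> (2 + N) * (1 + pi * t^2 / N) \<le> (2 +
  N) * exp (pi * t^2 / N)\<close>, raised to the power \<open>N\<close>.\<close>

lemma power_le_exp_square:
  fixes t :: real assumes "0 \<le> t"
  shows "(1 + t) ^ N * exp (- pi * t^2) \<le> (2 + real N) ^ N"
proof (cases "N = 0")
  case False
  have "t \<le> 1 + t^2" using zero_le_power2[of "t - 1"] assms by (simp add: power2_eq_square algebra_simps)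
  moreover have "t^2 \<le> (2 + real N) * (pi * t^2 / N)"
  proof -
    have "t^2 * 1 \<le> t^2 * ((2 + real N) * pi / N)"
    proof (rule mult_left_mono)
      have "real N \<le> (2 + real N) * 1" by simp
      also have "\<dots> \<le> (2 + real N) * pi" using pi_gt3 by (intro mult_left_mono) auto
      finally show "1 \<le> (2 + real N) * pi / N" using False by (simp add: field_simps)
    qed simp
    then show ?thesis by (simp add: field_simps)
  qed
  ultimately have "1 + t \<le> (2 + real N) * (1 + pi * t^2 / N)" by (simp add: distrib_left)
  also have "\<dots> \<le> (2 + real N) * exp (pi * t^2 / N)" by (intro mult_left_mono exp_ge_add_one_self) auto
  finally have "(1 + t) ^ N \<le> ((2 + real N) * exp (pi * t^2 / N)) ^ N" using assms by (intro power_mono) auto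
  also have "\<dots> = (2 + real N) ^ N * exp (pi * t^2)" using False by (simp add: power_mult_distrib exp_of_nat_mult[symmetric])
  finally have "(1 + t) ^ N * exp (- pi * t^2) \<le> ((2 + real N) ^ N * exp (pi * t^2)) * exp (- pi * t^2)" by (rule mult_right_mono) simp
  then show ?thesis by (simp add: mult.assoc exp_add[symmetric])
qed simp

section \<open>Product-type Sobolev weights\<close>

lemma Basis_vec_cases:
  fixes b :: "real ^ 'n ^ 'm"
  assumes "b \<in> Basis"
  obtains j u where "b = axis j u" "u \<in> Basis"
  using assms unfolding Basis_vec_def by auto

text \<open>The condition \<open>b $ i \<noteq> 0\<close> says that the basis vector
  \<open>b\<close> belongs to the i-th block of variables; all later case distinctions between this
  block and the others take this form.\<close>

lemma axis_nth_ne_zero_iff: "u \<in> Basis \<Longrightarrow> axis j u $ i \<noteq> 0 \<longleftrightarrow> i = j"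
  by (auto simp: axis_def nonzero_Basis)

text \<open>The bumps are narrow in one block of variables only, so the natural dilation acts on
  that block alone.\<close>

definition scale_block :: "'m \<Rightarrow> real \<Rightarrow> real ^ 'n ^ 'm \<Rightarrow> real ^ 'n ^ 'm" where
  "scale_block i \<delta> x = (\<chi> j. if j = i then \<delta> *\<^sub>R x $ j else x $ j)"

lemma scale_block_add_Basis:
  fixes b :: "real ^ 'n ^ 'm"
  assumes "b \<in> Basis"
  shows "scale_block i \<delta> (x + t *\<^sub>R b) = scale_block i \<delta> x + ((if b $ i \<noteq> 0 then \<delta> else 1) * t) *\<^sub>R b"
  using assms by (cases rule: Basis_vec_cases) (auto simp: scale_block_def vec_eq_iff axis_def algebra_simps nonzero_Basis)

lemma scale_block_inner_Basis:
  fixes b :: "real ^ 'n ^ 'm"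
  assumes "b \<in> Basis"
  shows "scale_block i \<delta> x \<bullet> b = (if b $ i \<noteq> 0 then \<delta> else 1) * (x \<bullet> b)"
  using assms by (cases rule: Basis_vec_cases) (auto simp: axis_nth_ne_zero_iff scale_block_def inner_axis)

lemma continuous_on_scale_block [continuous_intros]:
  "continuous_on S (scale_block i \<delta> :: real^'n^'m \<Rightarrow> real^'n^'m)"
proof -
  have "linear (scale_block i \<delta> :: real^'n^'m \<Rightarrow> real^'n^'m)"
    by (rule linearI) (auto simp: scale_block_def vec_eq_iff algebra_simps)
  then show ?thesis by (rule linear_continuous_on[OF linear_conv_bounded_linear[THEN iffD1]])
qed

lemma norm_nth_add_axis:
  fixes x :: "real ^ 'n ^ 'm"
  assumes "u \<in> Basis"
  shows "(norm ((x + t *\<^sub>R axis i u) $ i))\<^sup>2 = (norm (x $ i))\<^sup>2 + 2 * t * (x \<bullet> axis i u) + t\<^sup>2"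
proof -
  have "(norm ((x + t *\<^sub>R axis i u) $ i))\<^sup>2 = (x $ i + t *\<^sub>R u) \<bullet> (x $ i + t *\<^sub>R u)"
    by (simp add: power2_norm_eq_inner axis_def)
  also have "\<dots> = (norm (x $ i))\<^sup>2 + 2 * t * (x \<bullet> axis i u) + t\<^sup>2"
    using assms by (simp add: inner_add_left inner_add_right inner_axis power2_norm_eq_inner inner_commute inner_Basis algebra_simps) (simp add: power2_eq_square)
  finally show ?thesis .
qed

lemma abs_inner_Basis_le_nth:
  fixes x b :: "real ^ 'n ^ 'm"
  assumes "b \<in> Basis" "b $ i \<noteq> 0" shows "\<bar>x \<bullet> b\<bar> \<le> norm (x $ i)"
  using assms by (cases rule: Basis_vec_cases) (auto simp: inner_axis axis_nth_ne_zero_iff Basis_le_norm)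

section \<open>Gaussian factors in one block of variables\<close>

lemma has_vector_derivative_of_real_real:
  "(f has_real_derivative D) (at t) \<Longrightarrow> ((\<lambda>t. complex_of_real (f t)) has_vector_derivative complex_of_real D) (at t)"
  by (rule has_vector_derivative_of_real) (simp add: has_real_derivative_iff_has_vector_derivative)

text \<open>The monomial factor is there for the induction: a derivative of monomial times Gaussian
  is a combination of the same expressions with exponents \<open>j - 1\<close> and
  \<open>j + 1\<close>.\<close>

lemma gaussian_block_dir_bounded_aux:
  "\<exists>C\<ge>0. \<forall>b\<in>Basis. b $ i \<noteq> 0 \<longrightarrow> dir_bounded b K
     (\<lambda>x::real^'n^'m. complex_of_real ((x \<bullet> b) ^ j * exp (- pi * (norm (x $ i))\<^sup>2))) (\<lambda>x. C / (1 + norm (x $ i)) ^ N)"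
proof (induction K arbitrary: j)
  case 0
  have "norm (complex_of_real ((x \<bullet> b) ^ j * exp (- pi * (norm (x $ i))\<^sup>2))) \<le> (2 + real (j + N)) ^ (j + N) / (1 + norm (x $ i)) ^ N"
    if "b \<in> Basis" "b $ i \<noteq> 0" for b x :: "real^'n^'m"
  proof -
    let ?t = "norm (x $ i)"
    have "\<bar>x \<bullet> b\<bar> ^ j \<le> (1 + ?t) ^ j" using abs_inner_Basis_le_nth[OF that, of x] by (intro power_mono) auto
    then have "\<bar>x \<bullet> b\<bar> ^ j * exp (- pi * ?t\<^sup>2) * (1 + ?t) ^ N \<le> (1 + ?t) ^ j * exp (- pi * ?t\<^sup>2) * (1 + ?t) ^ N"
      by (intro mult_right_mono) auto
    also have "\<dots> = (1 + ?t) ^ (j + N) * exp (- pi * ?t\<^sup>2)" by (simp add: power_add)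
    also have "\<dots> \<le> (2 + real (j + N)) ^ (j + N)" by (rule power_le_exp_square) simp
    finally have "\<bar>x \<bullet> b\<bar> ^ j * exp (- pi * ?t\<^sup>2) \<le> (2 + real (j + N)) ^ (j + N) / (1 + ?t) ^ N"
      by (simp add: pos_le_divide_eq add_pos_nonneg)
    then show ?thesis unfolding norm_of_real abs_mult power_abs by simp
  qed
  then show ?case by (intro exI[of _ "(2 + real (j + N)) ^ (j + N)"]) (auto intro!: continuous_intros simp del: of_nat_add of_real_mult norm_of_real)
next
  case (Suc K)
  obtain C0 where C0: "C0 \<ge> 0" "\<And>b. b \<in> Basis \<Longrightarrow> b $ i \<noteq> 0 \<Longrightarrow> dir_bounded b K
     (\<lambda>x::real^'n^'m. complex_of_real ((x \<bullet> b) ^ j * exp (- pi * (norm (x $ i))\<^sup>2))) (\<lambda>x. C0 / (1 + norm (x $ i)) ^ N)" using Suc[of j] by blast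
  obtain C1 where C1: "C1 \<ge> 0" "\<And>b. b \<in> Basis \<Longrightarrow> b $ i \<noteq> 0 \<Longrightarrow> dir_bounded b K
     (\<lambda>x::real^'n^'m. complex_of_real ((x \<bullet> b) ^ (j-1) * exp (- pi * (norm (x $ i))\<^sup>2))) (\<lambda>x. C1 / (1 + norm (x $ i)) ^ N)" using Suc[of "j-1"] by blast
  obtain C2 where C2: "C2 \<ge> 0" "\<And>b. b \<in> Basis \<Longrightarrow> b $ i \<noteq> 0 \<Longrightarrow> dir_bounded b K
     (\<lambda>x::real^'n^'m. complex_of_real ((x \<bullet> b) ^ (j+1) * exp (- pi * (norm (x $ i))\<^sup>2))) (\<lambda>x. C2 / (1 + norm (x $ i)) ^ N)" using Suc[of "j+1"] by blast
  define C where "C = C0 + j * C1 + 2 * pi * C2"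
  have "dir_bounded b (Suc K) (\<lambda>x::real^'n^'m. complex_of_real ((x \<bullet> b) ^ j * exp (- pi * (norm (x $ i))\<^sup>2))) (\<lambda>x. C / (1 + norm (x $ i)) ^ N)"
    if b: "b \<in> Basis" "b $ i \<noteq> 0" for b
  proof (rule dir_bounded_SucI)
    show "continuous_on UNIV (\<lambda>x::real^'n^'m. complex_of_real ((x \<bullet> b) ^ j * exp (- pi * (norm (x $ i))\<^sup>2)))"
      by (intro continuous_intros)
    fix x :: "real^'n^'m"
    have "C0 / (1 + norm (x $ i)) ^ N \<le> C / (1 + norm (x $ i)) ^ N" using C1 C2 by (intro divide_right_mono) (auto simp: C_def)
    with dir_bounded_bound[OF C0(2)[OF b], of x]
    show "norm (complex_of_real ((x \<bullet> b) ^ j * exp (- pi * (norm (x $ i))\<^sup>2))) \<le> C / (1 + norm (x $ i)) ^ N" by (rule order_trans)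
    obtain u where u: "b = axis i u" "u \<in> Basis" using b by (metis Basis_vec_cases axis_nth_ne_zero_iff)
    have bb: "b \<bullet> b = 1" using b by (simp add: inner_Basis)
    have "((\<lambda>t. (x \<bullet> b + t) ^ j * exp (- pi * ((norm (x $ i))\<^sup>2 + 2 * t * (x \<bullet> b) + t\<^sup>2))) has_real_derivative
       (j * ((x \<bullet> b) ^ (j-1) * exp (- pi * (norm (x $ i))\<^sup>2)) + (-2 * pi) * ((x \<bullet> b) ^ (j+1) * exp (- pi * (norm (x $ i))\<^sup>2)))) (at 0)"
      by (rule derivative_eq_intros refl | simp add: algebra_simps)+
    moreover have "(x + t *\<^sub>R b) \<bullet> b = x \<bullet> b + t" for t by (simp add: inner_add_left bb)
    moreover have "(norm ((x + t *\<^sub>R b) $ i))\<^sup>2 = (norm (x $ i))\<^sup>2 + 2 * t * (x \<bullet> b) + t\<^sup>2" for t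
      unfolding u(1) by (rule norm_nth_add_axis[OF u(2)])
    ultimately have "((\<lambda>t. ((x + t *\<^sub>R b) \<bullet> b) ^ j * exp (- pi * (norm ((x + t *\<^sub>R b) $ i))\<^sup>2)) has_real_derivative
       (j * ((x \<bullet> b) ^ (j-1) * exp (- pi * (norm (x $ i))\<^sup>2)) + (-2 * pi) * ((x \<bullet> b) ^ (j+1) * exp (- pi * (norm (x $ i))\<^sup>2)))) (at 0)"
      by (simp only:)
    from has_vector_derivative_of_real_real[OF this]
    show "((\<lambda>t. complex_of_real (((x + t *\<^sub>R b) \<bullet> b) ^ j * exp (- pi * (norm ((x + t *\<^sub>R b) $ i))\<^sup>2))) has_vector_derivative
       (of_nat j * complex_of_real ((x \<bullet> b) ^ (j-1) * exp (- pi * (norm (x $ i))\<^sup>2)) +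
        complex_of_real (-2 * pi) * complex_of_real ((x \<bullet> b) ^ (j+1) * exp (- pi * (norm (x $ i))\<^sup>2)))) (at 0)"
      by (simp only: of_real_add of_real_mult of_real_of_nat_eq)
  next
    from dir_bounded_add[OF dir_bounded_cmult[OF C1(2)[OF b], of "of_nat j"] dir_bounded_cmult[OF C2(2)[OF b], of "complex_of_real (-2 * pi)"]]
    show "dir_bounded b K (\<lambda>x. of_nat j * complex_of_real ((x \<bullet> b) ^ (j-1) * exp (- pi * (norm (x $ i))\<^sup>2)) +
        complex_of_real (-2 * pi) * complex_of_real ((x \<bullet> b) ^ (j+1) * exp (- pi * (norm (x $ i))\<^sup>2))) (\<lambda>x. C / (1 + norm (x $ i)) ^ N)"
    proof (rule dir_bounded_mono)
      fix x :: "real^'n^'m"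
      have "cmod (of_nat j) * (C1 / (1 + norm (x $ i)) ^ N) + cmod (complex_of_real (- 2 * pi)) * (C2 / (1 + norm (x $ i)) ^ N)
         = (j * C1 + 2 * pi * C2) / (1 + norm (x $ i)) ^ N" by (simp add: add_divide_distrib norm_mult)
      also have "\<dots> \<le> C / (1 + norm (x $ i)) ^ N" using C0 by (intro divide_right_mono) (auto simp: C_def)
      finally show "cmod (of_nat j) * (C1 / (1 + norm (x $ i)) ^ N) + cmod (complex_of_real (- 2 * pi)) * (C2 / (1 + norm (x $ i)) ^ N)
         \<le> C / (1 + norm (x $ i)) ^ N" .
    qed
  qed
  moreover have "C \<ge> 0" using C0 C1 C2 by (auto simp: C_def)
  ultimately show ?case by blast
qed

lemma gaussian_block_dir_bounded:
  "\<exists>C\<ge>0. \<forall>b\<in>Basis. dir_bounded b K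
     (\<lambda>x::real^'n^'m. complex_of_real (exp (- pi * (norm (x $ i))\<^sup>2))) (\<lambda>x. C / (1 + norm (x $ i)) ^ N)"
proof -
  obtain C where C: "C \<ge> 0" "\<And>b. b \<in> Basis \<Longrightarrow> b $ i \<noteq> 0 \<Longrightarrow> dir_bounded b K
     (\<lambda>x::real^'n^'m. complex_of_real ((x \<bullet> b) ^ 0 * exp (- pi * (norm (x $ i))\<^sup>2))) (\<lambda>x. C / (1 + norm (x $ i)) ^ N)"
    using gaussian_block_dir_bounded_aux[of i K 0 N] by blast
  have "dir_bounded b K (\<lambda>x::real^'n^'m. complex_of_real (exp (- pi * (norm (x $ i))\<^sup>2))) (\<lambda>x. C / (1 + norm (x $ i)) ^ N)" if "b \<in> Basis" for b
  proof (cases "b $ i = 0")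
    case False then show ?thesis using C(2)[OF that] by simp
  next
    case True
    obtain b' :: "real^'n^'m" where b': "b' \<in> Basis" "b' $ i \<noteq> 0"
      using axis_in_Basis_iff[THEN iffD2, OF SOME_Basis, of i] by (metis axis_nth_ne_zero_iff SOME_Basis)
    show ?thesis
      by (rule dir_bounded_const) (use True dir_bounded_bound[OF C(2)[OF b']] in \<open>auto intro!: continuous_intros\<close>)
  qed
  then show ?thesis using C(1) by blast
qed

text \<open>In the rescaled picture the bump \<open>B (scale_block i \<delta> x)\<close> becomes
  ever wider in block i as \<open>\<delta>\<close> tends to \<open>0\<close>; there the Gaussian
  provides the decay, while the other variables remain in a fixed ball since \<open>B\<close> has
  compact support. Derivatives of the bump only gain from the contraction, so no constant depends on
  \<open>\<delta>\<close>.\<close>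

lemma gaussian_bump_uniformly_schwartz:
  fixes B :: "real^'n^'m \<Rightarrow> complex"
  assumes B: "\<And>K. \<exists>C\<ge>0. \<forall>b\<in>Basis. dir_bounded b K B (\<lambda>_. C)" and R: "\<And>x. norm x > R \<Longrightarrow> B x = 0"
  shows "uniformly_schwartz ((\<lambda>\<delta> x. complex_of_real (exp (- pi * (norm (x $ i))\<^sup>2)) * B (scale_block i \<delta> x)) ` {0<..1})"
  unfolding uniformly_schwartz_def
proof (intro allI)
  fix K N
  obtain Cg where Cg: "Cg \<ge> 0" "\<And>b. b \<in> Basis \<Longrightarrow> dir_bounded b K
     (\<lambda>x::real^'n^'m. complex_of_real (exp (- pi * (norm (x $ i))\<^sup>2))) (\<lambda>x. Cg / (1 + norm (x $ i)) ^ N)"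
    using gaussian_block_dir_bounded by blast
  obtain CB where CB: "CB \<ge> 0" "\<And>b. b \<in> Basis \<Longrightarrow> dir_bounded b K B (\<lambda>_. CB)" using B by blast
  define A where "A = 1 + CARD('m) * \<bar>R\<bar>"
  define C where "C = 2 ^ K * (Cg * CB * A ^ N)"
  have "dir_bounded b K (\<lambda>x. complex_of_real (exp (- pi * (norm (x $ i))\<^sup>2)) * B (scale_block i \<delta> x)) (\<lambda>x. C / (1 + norm x) ^ N)"
    if \<delta>: "0 < \<delta>" "\<delta> \<le> 1" and b: "b \<in> Basis" for \<delta> b
  proof (rule dir_bounded_mono)
    have "dir_bounded b K (\<lambda>x. B (scale_block i \<delta> x)) (\<lambda>x. if norm (scale_block i \<delta> x) \<le> R then CB else 0)"
      by (rule dir_bounded_compose[OF dir_bounded_restrict_support[OF CB(2)[OF b] R] _ _ scale_block_add_Basis[OF b]])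
         (use \<delta> in \<open>auto intro!: continuous_intros\<close>)
    from dir_bounded_mult[OF Cg(2)[OF b] this]
    show "dir_bounded b K (\<lambda>x. complex_of_real (exp (- pi * (norm (x $ i))\<^sup>2)) * B (scale_block i \<delta> x))
       (\<lambda>x. 2 ^ K * (Cg / (1 + norm (x $ i)) ^ N * (if norm (scale_block i \<delta> x) \<le> R then CB else 0)))" .
    fix x :: "real^'n^'m"
    show "2 ^ K * (Cg / (1 + norm (x $ i)) ^ N * (if norm (scale_block i \<delta> x) \<le> R then CB else 0)) \<le> C / (1 + norm x) ^ N"
    proof (cases "norm (scale_block i \<delta> x) \<le> R")
      case False then show ?thesis using Cg CB by (auto simp: C_def A_def)
    next
      case True
      have "norm (x $ j) \<le> \<bar>R\<bar>" if "j \<noteq> i" for j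
      proof -
        have "norm (x $ j) = norm (scale_block i \<delta> x $ j)" using that by (simp add: scale_block_def)
        also have "\<dots> \<le> norm (scale_block i \<delta> x)" by (rule Finite_Cartesian_Product.norm_nth_le)
        finally show ?thesis using True by linarith
      qed
      then have "norm (x $ j) \<le> (if j = i then norm (x $ i) else 0) + \<bar>R\<bar>" for j by auto
      then have "(\<Sum>j\<in>UNIV. norm (x $ j)) \<le> (\<Sum>j\<in>UNIV. (if j = i then norm (x $ i) else 0) + \<bar>R\<bar>)" by (intro sum_mono)
      also have "\<dots> = norm (x $ i) + CARD('m) * \<bar>R\<bar>" by (simp add: sum.distrib)
      finally have "(\<Sum>j\<in>UNIV. norm (x $ j)) \<le> norm (x $ i) + CARD('m) * \<bar>R\<bar>" .
      moreover have "norm x \<le> (\<Sum>j\<in>UNIV. norm (x $ j))" by (simp add: norm_vec_def L2_set_le_sum)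
      ultimately have "1 + norm x \<le> A + norm (x $ i)" by (simp add: A_def)
      also have "\<dots> \<le> (1 + norm (x $ i)) * A" using mult_nonneg_nonneg[of "norm (x $ i)" "CARD('m) * \<bar>R\<bar>"] by (simp add: A_def algebra_simps)
      finally have "(1 + norm x) ^ N \<le> ((1 + norm (x $ i)) * A) ^ N" by (intro power_mono) auto
      then have "(1 + norm x) ^ N \<le> (1 + norm (x $ i)) ^ N * A ^ N" by (simp add: power_mult_distrib)
      then have "1 / (1 + norm (x $ i)) ^ N \<le> A ^ N / (1 + norm x) ^ N"
        by (simp add: divide_simps add_pos_nonneg add_nonneg_eq_0_iff mult.commute)
      from mult_left_mono[OF this, of "2 ^ K * (Cg * CB)"] show ?thesis using True Cg CB by (simp add: C_def mult_ac)
    qed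
  qed
  moreover have "C \<ge> 0" using Cg CB by (auto simp: C_def A_def)
  ultimately show "\<exists>C\<ge>0. \<forall>f\<in>(\<lambda>\<delta> x. complex_of_real (exp (- pi * (norm (x $ i))\<^sup>2)) * B (scale_block i \<delta> x)) ` {0<..1}.
     \<forall>b\<in>Basis. dir_bounded b K f (\<lambda>x. C / (1 + norm x) ^ N)" by (intro exI[of _ C]) auto
qed

section \<open>Powers of quadratic forms and the rescaled weight\<close>

lemma powr_between:
  fixes q :: real assumes "q > 0" "a \<le> b" "b \<le> c" shows "q powr b \<le> q powr c + q powr a"
proof (cases "q \<ge> 1")
  case True then have "q powr b \<le> q powr c" using assms by (intro powr_mono) auto
  then show ?thesis by (simp add: add_increasing2)
next
  case False then have "q powr b \<le> q powr a" using assms by (intro powr_mono') auto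
  then show ?thesis by (simp add: add_increasing)
qed

lemma powr_between_double:
  fixes q :: real assumes "q > 0" "a \<le> b" "b \<le> c"
  shows "q powr c + q powr b \<le> 2 * (q powr c + q powr a)" "q powr b + q powr a \<le> 2 * (q powr c + q powr a)"
proof -
  have *: "y + x \<le> 2 * (y + z)" "x + z \<le> 2 * (y + z)" if "x \<le> y + z" "0 \<le> y" "0 \<le> z" for x y z :: real
    using that by auto
  show "q powr c + q powr b \<le> 2 * (q powr c + q powr a)" "q powr b + q powr a \<le> 2 * (q powr c + q powr a)"
    by (rule *[OF powr_between[OF assms] powr_ge_zero powr_ge_zero])+
qed

text \<open>Under joint scaling of \<open>\<delta>\<close> and x, each derivative costs
  \<open>1/2\<close> in the exponent of the quadratic form, and each monomial factor gains
  \<open>1/2\<close>. The majorant lists only the two extreme exponents, for no derivative and for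
  all \<open>K\<close>; as the form may be small or large, the intermediate ones are controlled by
  the sum of the two. Uniformity in \<open>\<delta>\<close> is the point.\<close>

lemma quadratic_powr_dir_bounded:
  "\<exists>C\<ge>0. \<forall>\<delta>. \<delta> \<noteq> 0 \<longrightarrow> (\<forall>b\<in>Basis. b $ i \<noteq> 0 \<longrightarrow> dir_bounded b K
     (\<lambda>x::real^'n^'m. complex_of_real ((x \<bullet> b) ^ j * (\<delta>\<^sup>2 + 4 * pi\<^sup>2 * (norm (x $ i))\<^sup>2) powr \<tau>))
     (\<lambda>x. C * ((\<delta>\<^sup>2 + 4 * pi\<^sup>2 * (norm (x $ i))\<^sup>2) powr (\<tau> + j / 2) + (\<delta>\<^sup>2 + 4 * pi\<^sup>2 * (norm (x $ i))\<^sup>2) powr (\<tau> + j / 2 - K / 2))))"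
proof (induction K arbitrary: j \<tau>)
  case 0
  have *: "norm (complex_of_real ((x \<bullet> b) ^ j * (\<delta>\<^sup>2 + 4 * pi\<^sup>2 * (norm (x $ i))\<^sup>2) powr \<tau>)) \<le> (\<delta>\<^sup>2 + 4 * pi\<^sup>2 * (norm (x $ i))\<^sup>2) powr (\<tau> + j / 2)"
    if "\<delta> \<noteq> 0" "b \<in> Basis" "b $ i \<noteq> 0" for \<delta> and b x :: "real^'n^'m"
  proof -
    let ?q = "\<delta>\<^sup>2 + 4 * pi\<^sup>2 * (norm (x $ i))\<^sup>2"
    have q: "?q > 0" using that by (intro add_pos_nonneg) auto
    have "\<bar>x \<bullet> b\<bar>\<^sup>2 \<le> (norm (x $ i))\<^sup>2" using abs_inner_Basis_le_nth[OF that(2,3), of x] by (intro power_mono) auto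
    also have "\<dots> \<le> 4 * pi\<^sup>2 * (norm (x $ i))\<^sup>2"
    proof -
      have "1 \<le> pi\<^sup>2" using pi_gt3 by (intro one_le_power) simp
      then have "1 \<le> 4 * pi\<^sup>2" by simp
      from mult_right_mono[OF this, of "(norm (x $ i))\<^sup>2"] show ?thesis by simp
    qed
    finally have "\<bar>x \<bullet> b\<bar>\<^sup>2 \<le> ?q" by (simp add: add_increasing)
    then have "\<bar>x \<bullet> b\<bar> \<le> ?q powr (1/2)" using q by (simp add: powr_half_sqrt real_le_rsqrt)
    then have "\<bar>x \<bullet> b\<bar> ^ j \<le> (?q powr (1/2)) ^ j" by (intro power_mono) auto
    also have "\<dots> = (?q powr (1/2)) powr j" by (rule powr_realpow[symmetric]) (use q in simp)
    also have "\<dots> = ?q powr (j / 2)" by (simp add: powr_powr)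
    finally have "\<bar>x \<bullet> b\<bar> ^ j * ?q powr \<tau> \<le> ?q powr (j / 2) * ?q powr \<tau>" by (rule mult_right_mono) simp
    then show ?thesis unfolding norm_of_real abs_mult power_abs by (simp add: powr_add mult.commute)
  qed
  have "dir_bounded b 0 (\<lambda>x::real^'n^'m. complex_of_real ((x \<bullet> b) ^ j * (\<delta>\<^sup>2 + 4 * pi\<^sup>2 * (norm (x $ i))\<^sup>2) powr \<tau>))
     (\<lambda>x. 1 * ((\<delta>\<^sup>2 + 4 * pi\<^sup>2 * (norm (x $ i))\<^sup>2) powr (\<tau> + j / 2) + (\<delta>\<^sup>2 + 4 * pi\<^sup>2 * (norm (x $ i))\<^sup>2) powr (\<tau> + j / 2 - real 0 / 2)))"
    if "\<delta> \<noteq> 0" "b \<in> Basis" "b $ i \<noteq> 0" for \<delta> and b :: "real^'n^'m"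
  proof -
    have q0: "\<delta>\<^sup>2 + 4 * pi\<^sup>2 * (norm (x $ i))\<^sup>2 \<noteq> 0" for x :: "real^'n^'m" using that(1) by (simp add: add_nonneg_eq_0_iff)
    have c: "continuous_on UNIV (\<lambda>x::real^'n^'m. complex_of_real ((x \<bullet> b) ^ j * (\<delta>\<^sup>2 + 4 * pi\<^sup>2 * (norm (x $ i))\<^sup>2) powr \<tau>))"
      by (intro continuous_on_of_real continuous_on_mult continuous_on_powr continuous_intros) (use q0 in auto)
    show ?thesis unfolding dir_bounded.simps
      by (intro conjI allI c order_trans[OF *[OF that]]) simp
  qed
  then show ?case by (intro exI[of _ 1] conjI allI ballI impI) simp_all
next
  case (Suc K)
  let ?q = "\<lambda>\<delta> x::real^'n^'m. \<delta>\<^sup>2 + 4 * pi\<^sup>2 * (norm (x $ i))\<^sup>2"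
  let ?f = "\<lambda>j \<tau> \<delta> b x::real^'n^'m. complex_of_real ((x \<bullet> b) ^ j * ?q \<delta> x powr \<tau>)"
  obtain C0 where C0: "C0 \<ge> 0" "\<And>\<delta> b. \<delta> \<noteq> 0 \<Longrightarrow> b \<in> Basis \<Longrightarrow> b $ i \<noteq> 0 \<Longrightarrow> dir_bounded b K (?f j \<tau> \<delta> b)
     (\<lambda>x. C0 * (?q \<delta> x powr (\<tau> + j / 2) + ?q \<delta> x powr (\<tau> + j / 2 - K / 2)))" using Suc[of j \<tau>] by blast
  obtain C1 where C1: "C1 \<ge> 0" "\<And>\<delta> b. \<delta> \<noteq> 0 \<Longrightarrow> b \<in> Basis \<Longrightarrow> b $ i \<noteq> 0 \<Longrightarrow> dir_bounded b K (?f (j-1) \<tau> \<delta> b)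
     (\<lambda>x. C1 * (?q \<delta> x powr (\<tau> + real (j-1) / 2) + ?q \<delta> x powr (\<tau> + real (j-1) / 2 - K / 2)))" using Suc[of "j-1" \<tau>] by blast
  obtain C2 where C2: "C2 \<ge> 0" "\<And>\<delta> b. \<delta> \<noteq> 0 \<Longrightarrow> b \<in> Basis \<Longrightarrow> b $ i \<noteq> 0 \<Longrightarrow> dir_bounded b K (?f (j+1) (\<tau>-1) \<delta> b)
     (\<lambda>x. C2 * (?q \<delta> x powr (\<tau> - 1 + real (j+1) / 2) + ?q \<delta> x powr (\<tau> - 1 + real (j+1) / 2 - K / 2)))" using Suc[of "j+1" "\<tau>-1"] by blast
  define c2 where "c2 = 8 * pi\<^sup>2 * \<tau>"
  define C where "C = 2 * (C0 + j * C1 + \<bar>c2\<bar> * C2)"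
  let ?e = "\<tau> + j / 2"
  have "dir_bounded b (Suc K) (?f j \<tau> \<delta> b) (\<lambda>x. C * (?q \<delta> x powr ?e + ?q \<delta> x powr (?e - Suc K / 2)))"
    if b: "\<delta> \<noteq> 0" "b \<in> Basis" "b $ i \<noteq> 0" for \<delta> b
  proof (rule dir_bounded_SucI)
    have q: "?q \<delta> x > 0" for x using b by (intro add_pos_nonneg) auto
    have le1: "?q \<delta> x powr ?e + ?q \<delta> x powr (?e - K / 2) \<le> 2 * (?q \<delta> x powr ?e + ?q \<delta> x powr (?e - Suc K / 2))" for x
      by (rule powr_between_double(1)[OF q]) (auto simp: add_divide_distrib)
    have eq: "?e - 1/2 - K / 2 = ?e - Suc K / 2" by (simp add: add_divide_distrib)
    have le2: "?q \<delta> x powr (?e - 1/2) + ?q \<delta> x powr (?e - 1/2 - K / 2) \<le> 2 * (?q \<delta> x powr ?e + ?q \<delta> x powr (?e - Suc K / 2))" for x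
      unfolding eq by (rule powr_between_double(2)[OF q]) (auto simp: add_divide_distrib)
    show "continuous_on UNIV (?f j \<tau> \<delta> b)" by (rule dir_bounded_cont[OF C0(2)[OF b]])
    show "norm (?f j \<tau> \<delta> b x) \<le> C * (?q \<delta> x powr ?e + ?q \<delta> x powr (?e - Suc K / 2))" for x
    proof -
      have "norm (?f j \<tau> \<delta> b x) \<le> C0 * (?q \<delta> x powr ?e + ?q \<delta> x powr (?e - K / 2))" by (rule dir_bounded_bound[OF C0(2)[OF b]])
      also have "\<dots> \<le> C0 * (2 * (?q \<delta> x powr ?e + ?q \<delta> x powr (?e - Suc K / 2)))" by (rule mult_left_mono[OF le1 C0(1)])
      also have "\<dots> = (2 * C0) * (?q \<delta> x powr ?e + ?q \<delta> x powr (?e - Suc K / 2))" by (simp only: mult_ac)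
      also have "\<dots> \<le> C * (?q \<delta> x powr ?e + ?q \<delta> x powr (?e - Suc K / 2))" using C0 C1 C2 by (intro mult_right_mono) (auto simp: C_def)
      finally show ?thesis .
    qed
    obtain u where u: "b = axis i u" "u \<in> Basis" using b by (metis Basis_vec_cases axis_nth_ne_zero_iff)
    have bb: "b \<bullet> b = 1" using b by (simp add: inner_Basis)
    show "((\<lambda>t. ?f j \<tau> \<delta> b (x + t *\<^sub>R b)) has_vector_derivative (of_nat j * ?f (j-1) \<tau> \<delta> b x + complex_of_real c2 * ?f (j+1) (\<tau>-1) \<delta> b x)) (at 0)" for x
    proof -
      have "((\<lambda>t. (x \<bullet> b + t) ^ j * (\<delta>\<^sup>2 + 4 * pi\<^sup>2 * ((norm (x $ i))\<^sup>2 + 2 * t * (x \<bullet> b) + t\<^sup>2)) powr \<tau>) has_real_derivative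
         (j * ((x \<bullet> b) ^ (j-1) * ?q \<delta> x powr \<tau>) + c2 * ((x \<bullet> b) ^ (j+1) * ?q \<delta> x powr (\<tau>-1)))) (at 0)"
        by (rule derivative_eq_intros refl | use q[of x] in \<open>simp add: c2_def algebra_simps powr_diff\<close>)+
      moreover have "(x + t *\<^sub>R b) \<bullet> b = x \<bullet> b + t" for t by (simp add: inner_add_left bb)
      moreover have "(norm ((x + t *\<^sub>R b) $ i))\<^sup>2 = (norm (x $ i))\<^sup>2 + 2 * t * (x \<bullet> b) + t\<^sup>2" for t
        unfolding u(1) by (rule norm_nth_add_axis[OF u(2)])
      ultimately have "((\<lambda>t. ((x + t *\<^sub>R b) \<bullet> b) ^ j * ?q \<delta> (x + t *\<^sub>R b) powr \<tau>) has_real_derivative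
         (j * ((x \<bullet> b) ^ (j-1) * ?q \<delta> x powr \<tau>) + c2 * ((x \<bullet> b) ^ (j+1) * ?q \<delta> x powr (\<tau>-1)))) (at 0)"
        by (simp only:)
      from has_vector_derivative_of_real_real[OF this] show ?thesis
        by (simp only: of_real_add of_real_mult of_real_of_nat_eq)
    qed
    have j0: "dir_bounded b K (\<lambda>x. of_nat j * ?f (j-1) \<tau> \<delta> b x) (\<lambda>x. (j * C1) * (?q \<delta> x powr (?e - 1/2) + ?q \<delta> x powr (?e - 1/2 - K / 2)))"
    proof (cases j)
      case 0 then show ?thesis using dir_bounded_zero[of "\<lambda>_. 0"] by simp
    next
      case (Suc j')
      have "\<tau> + real (j-1) / 2 = ?e - 1/2" by (simp add: Suc field_simps)
      then show ?thesis
        by (intro dir_bounded_mono[OF dir_bounded_cmult[OF C1(2)[OF b], of "of_nat j"]])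
           (simp only: norm_of_nat mult.assoc order_refl)
    qed
    have j1: "dir_bounded b K (\<lambda>x. complex_of_real c2 * ?f (j+1) (\<tau>-1) \<delta> b x) (\<lambda>x. (\<bar>c2\<bar> * C2) * (?q \<delta> x powr (?e - 1/2) + ?q \<delta> x powr (?e - 1/2 - K / 2)))"
    proof (rule dir_bounded_mono[OF dir_bounded_cmult[OF C2(2)[OF b], of "complex_of_real c2"]])
      fix x
      have "\<tau> - 1 + real (j+1) / 2 = ?e - 1/2" by (simp add: field_simps)
      then show "cmod (complex_of_real c2) * (C2 * (?q \<delta> x powr (\<tau> - 1 + real (j+1) / 2) + ?q \<delta> x powr (\<tau> - 1 + real (j+1) / 2 - K / 2)))
         \<le> (\<bar>c2\<bar> * C2) * (?q \<delta> x powr (?e - 1/2) + ?q \<delta> x powr (?e - 1/2 - K / 2))" by (simp only: norm_of_real mult.assoc order_refl)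
    qed
    show "dir_bounded b K (\<lambda>x. of_nat j * ?f (j-1) \<tau> \<delta> b x + complex_of_real c2 * ?f (j+1) (\<tau>-1) \<delta> b x)
       (\<lambda>x. C * (?q \<delta> x powr ?e + ?q \<delta> x powr (?e - Suc K / 2)))"
    proof (rule dir_bounded_mono[OF dir_bounded_add[OF j0 j1]])
      fix x
      have "(j * C1) * (?q \<delta> x powr (?e - 1/2) + ?q \<delta> x powr (?e - 1/2 - K / 2)) + (\<bar>c2\<bar> * C2) * (?q \<delta> x powr (?e - 1/2) + ?q \<delta> x powr (?e - 1/2 - K / 2))
         = (j * C1 + \<bar>c2\<bar> * C2) * (?q \<delta> x powr (?e - 1/2) + ?q \<delta> x powr (?e - 1/2 - K / 2))" by (simp only: distrib_right)
      also have "\<dots> \<le> (j * C1 + \<bar>c2\<bar> * C2) * (2 * (?q \<delta> x powr ?e + ?q \<delta> x powr (?e - Suc K / 2)))"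
        by (rule mult_left_mono[OF le2]) (use C1 C2 in auto)
      also have "\<dots> = (2 * (j * C1 + \<bar>c2\<bar> * C2)) * (?q \<delta> x powr ?e + ?q \<delta> x powr (?e - Suc K / 2))" by (simp only: mult_ac)
      also have "\<dots> \<le> C * (?q \<delta> x powr ?e + ?q \<delta> x powr (?e - Suc K / 2))" using C0 by (intro mult_right_mono) (auto simp: C_def)
      finally show "(j * C1) * (?q \<delta> x powr (?e - 1/2) + ?q \<delta> x powr (?e - 1/2 - K / 2)) + (\<bar>c2\<bar> * C2) * (?q \<delta> x powr (?e - 1/2) + ?q \<delta> x powr (?e - 1/2 - K / 2))
         \<le> C * (?q \<delta> x powr ?e + ?q \<delta> x powr (?e - Suc K / 2))" .
    qed
  qed
  moreover have "C \<ge> 0" using C0 C1 C2 by (auto simp: C_def)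
  ultimately show ?case by (intro exI[of _ C]) auto
qed

text \<open>This is \<open>sobolev_weight\<close> at the point whose i-th block is divided by
  \<open>\<delta>\<close>, multiplied by \<open>\<delta> powr (s i)\<close>. As
  \<open>\<delta>\<close> tends to \<open>0\<close> the i-th factor tends to a homogeneous power, in
  general not smooth where \<open>y $ i\<close> vanishes.\<close>

definition scaled_weight :: "('m::finite \<Rightarrow> real) \<Rightarrow> 'm \<Rightarrow> real \<Rightarrow> real^'n^'m \<Rightarrow> real" where
  "scaled_weight s i \<delta> y = (\<delta>\<^sup>2 + 4 * pi\<^sup>2 * (norm (y $ i))\<^sup>2) powr (s i / 2) *
     (\<Prod>j\<in>UNIV - {i}. (1 + 4 * pi\<^sup>2 * (norm (y $ j))\<^sup>2) powr (s j / 2))"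

lemma one_plus_square_pos [simp]: "1 + 4 * pi\<^sup>2 * (norm (v::'a::real_normed_vector))\<^sup>2 > 0"
  by (intro add_pos_nonneg) auto

lemma one_le_one_plus_square_powr: "0 \<le> a \<Longrightarrow> 1 \<le> (1 + 4 * pi\<^sup>2 * (norm (v::'a::real_normed_vector))\<^sup>2) powr a"
  by (intro ge_one_powr_ge_zero) auto

lemma sobolev_weight_nonneg: "0 \<le> sobolev_weight s y"
  unfolding sobolev_weight_def by (intro prod_nonneg) auto

lemma continuous_sobolev_weight: "continuous_on UNIV (sobolev_weight s :: real^'n^'m \<Rightarrow> real)"
  unfolding sobolev_weight_def
  by (intro continuous_intros ballI) (use one_plus_square_pos less_irrefl in \<open>metis\<close>)

lemma sobolev_weight_remove:
  "sobolev_weight s y = (1 + 4 * pi\<^sup>2 * (norm (y $ i))\<^sup>2) powr (s i / 2) *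
     (\<Prod>j\<in>UNIV - {i}. (1 + 4 * pi\<^sup>2 * (norm (y $ j))\<^sup>2) powr (s j / 2))"
  unfolding sobolev_weight_def by (rule prod.remove) auto

lemma rest_weight_le:
  assumes "\<And>j. 0 \<le> s j"
  shows "(\<Prod>j\<in>UNIV - {i}. (1 + 4 * pi\<^sup>2 * (norm (y $ j))\<^sup>2) powr (s j / 2)) \<le> sobolev_weight s y"
  unfolding sobolev_weight_remove[where s=s and y=y and i=i]
  using mult_right_mono[OF one_le_one_plus_square_powr[where a="s i / 2" and v="y $ i"], of "\<Prod>j\<in>UNIV - {i}. (1 + 4 * pi\<^sup>2 * (norm (y $ j))\<^sup>2) powr (s j / 2)"] assms
  by (simp add: prod_nonneg)

lemma scaled_weight_le:
  assumes "\<And>j. 0 \<le> s j" "0 < \<delta>" "\<delta> \<le> 1"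
  shows "scaled_weight s i \<delta> y \<le> sobolev_weight s y"
  unfolding sobolev_weight_remove[where s=s and y=y and i=i] scaled_weight_def
  by (intro mult_right_mono powr_mono2 prod_nonneg) (use assms in \<open>auto simp: power_le_one\<close>)

lemma power2_powr_half: "0 < x \<Longrightarrow> (x\<^sup>2) powr (a / 2) = x powr (a::real)"
proof -
  assume "0 < x"
  then have "x\<^sup>2 = x powr 2" by (simp add: powr_numeral)
  then show ?thesis by (simp only: powr_powr) simp
qed

lemma sobolev_weight_growth:
  assumes "\<And>j. 0 \<le> s j"
  shows "\<exists>A\<ge>0. \<exists>N. \<forall>y::real^'n^'m. sobolev_weight s y \<le> A * (1 + norm y) ^ N"
proof -
  define N where "N j = nat \<lceil>s j\<rceil>" for j
  have "sobolev_weight s y \<le> (2 * pi) ^ (\<Sum>j\<in>UNIV. N j) * (1 + norm y) ^ (\<Sum>j\<in>UNIV. N j)" for y :: "real^'n^'m"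
  proof -
    have "(1 + 4 * pi\<^sup>2 * (norm (y $ j))\<^sup>2) powr (s j / 2) \<le> (2 * pi * (1 + norm y)) ^ N j" for j
    proof -
      have pos: "1 \<le> 2 * pi * (1 + norm y)"
      proof -
        have "1 * 1 \<le> (2 * pi) * (1 + norm y)" using pi_gt3 by (intro mult_mono) auto
        then show ?thesis by simp
      qed
      have "1 * 1 \<le> 4 * (pi * pi)" using pi_gt3 mult_mono[of 1 pi 1 pi] by simp
      then have "1 + 4 * pi\<^sup>2 * (norm (y $ j))\<^sup>2 \<le> 4 * pi\<^sup>2 * (1 + (norm (y $ j))\<^sup>2)" by (simp add: algebra_simps power2_eq_square)
      also have "\<dots> \<le> 4 * pi\<^sup>2 * (1 + norm (y $ j))\<^sup>2" by (intro mult_left_mono) (auto simp: power2_eq_square algebra_simps)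
      also have "\<dots> \<le> 4 * pi\<^sup>2 * (1 + norm y)\<^sup>2" by (intro mult_left_mono power_mono add_left_mono Finite_Cartesian_Product.norm_nth_le) auto
      also have "\<dots> = (2 * pi * (1 + norm y))\<^sup>2" by (simp add: power_mult_distrib)
      finally have "(1 + 4 * pi\<^sup>2 * (norm (y $ j))\<^sup>2) powr (s j / 2) \<le> ((2 * pi * (1 + norm y))\<^sup>2) powr (s j / 2)"
        using assms by (intro powr_mono2) auto
      also have "\<dots> = (2 * pi * (1 + norm y)) powr (s j)" by (rule power2_powr_half) (use pos in simp)
      also have "\<dots> \<le> (2 * pi * (1 + norm y)) powr (N j)" using pos assms[of j] by (intro powr_mono) (auto simp: N_def)
      also have "\<dots> = (2 * pi * (1 + norm y)) ^ N j" using pos by (intro powr_realpow) auto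
      finally show ?thesis .
    qed
    then have "sobolev_weight s y \<le> (\<Prod>j\<in>UNIV. (2 * pi * (1 + norm y)) ^ N j)"
      unfolding sobolev_weight_def by (intro prod_mono) auto
    also have "\<dots> = (2 * pi * (1 + norm y)) ^ (\<Sum>j\<in>UNIV. N j)" by (simp add: power_sum)
    finally show ?thesis by (simp only: power_mult_distrib)
  qed
  then show ?thesis by (intro exI[of _ "(2 * pi) ^ (\<Sum>j\<in>UNIV. N j)"] conjI exI[of _ "\<Sum>j\<in>UNIV. N j"]) auto
qed

text \<open>Derivatives outside block i hit powers of forms that are at least one and cost only a
  constant. Inside the block they produce the power with exponent \<open>s i / 2 - K / 2\<close>,
  which may become singular for small \<open>\<delta>\<close>; for \<open>s i = 0\<close> the weight
  does not depend on that block and the term is absent.\<close>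

lemma scaled_weight_dir_bounded:
  fixes i :: "'m::finite"
  assumes s: "\<And>j. 0 \<le> s j"
  shows "\<exists>C\<ge>0. \<forall>\<delta>\<in>{0<..1}. \<forall>b\<in>Basis. dir_bounded b K (\<lambda>y::real^'n^'m. complex_of_real (scaled_weight s i \<delta> y))
     (\<lambda>y. C * (sobolev_weight s y * (1 + (if b $ i \<noteq> 0 \<and> s i \<noteq> 0 then (\<delta>\<^sup>2 + 4 * pi\<^sup>2 * (norm (y $ i))\<^sup>2) powr (s i / 2 - K / 2) else 0))))"
proof -
  let ?q = "\<lambda>\<delta> (y::real^'n^'m) j. \<delta>\<^sup>2 + 4 * pi\<^sup>2 * (norm (y $ j))\<^sup>2"
  let ?P = "\<lambda>J (y::real^'n^'m). \<Prod>j\<in>J. (1 + 4 * pi\<^sup>2 * (norm (y $ j))\<^sup>2) powr (s j / 2)"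
  have "\<exists>C\<ge>0. \<forall>\<delta>. \<delta> \<noteq> 0 \<longrightarrow> (\<forall>b\<in>Basis. b $ j \<noteq> 0 \<longrightarrow> dir_bounded b K (\<lambda>y. complex_of_real (?q \<delta> y j powr (s j / 2)))
     (\<lambda>y. C * (?q \<delta> y j powr (s j / 2) + ?q \<delta> y j powr (s j / 2 - K / 2))))" for j
    using quadratic_powr_dir_bounded[of j K 0 "s j / 2"] by (simp only: power_0 mult_1 of_nat_0 div_0 add_0_right)
  then have "\<exists>D. \<forall>j. D j \<ge> 0 \<and> (\<forall>\<delta>. \<delta> \<noteq> 0 \<longrightarrow> (\<forall>b\<in>Basis. b $ j \<noteq> 0 \<longrightarrow> dir_bounded b K (\<lambda>y. complex_of_real (?q \<delta> y j powr (s j / 2)))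
     (\<lambda>y. D j * (?q \<delta> y j powr (s j / 2) + ?q \<delta> y j powr (s j / 2 - K / 2)))))"
    by (intro choice allI)
  then obtain D where D0: "\<forall>j. D j \<ge> 0 \<and> (\<forall>\<delta>. \<delta> \<noteq> 0 \<longrightarrow> (\<forall>b\<in>Basis. b $ j \<noteq> 0 \<longrightarrow> dir_bounded b K (\<lambda>y. complex_of_real (?q \<delta> y j powr (s j / 2)))
     (\<lambda>y. D j * (?q \<delta> y j powr (s j / 2) + ?q \<delta> y j powr (s j / 2 - K / 2)))))"
    by (elim exE)
  note D = D0[THEN spec, THEN conjunct1] D0[THEN spec, THEN conjunct2, THEN spec, THEN mp, THEN bspec, THEN mp]
  define C where "C = 1 + 2 ^ K * 2 * (\<Sum>j\<in>UNIV. D j)"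
  have Dle: "2 ^ K * 2 * D j \<le> C" for j
  proof -
    have "D j \<le> (\<Sum>j\<in>UNIV. D j)" by (rule member_le_sum) (use D in auto)
    then have "2 ^ K * 2 * D j \<le> 2 ^ K * 2 * (\<Sum>j\<in>UNIV. D j)" by (rule mult_left_mono) simp
    then show ?thesis unfolding C_def by linarith
  qed
  have Dle': "2 ^ K * D j \<le> C" for j
  proof -
    have "0 \<le> 2 ^ K * D j" using D(1) by simp
    moreover have "2 ^ K * 2 * D j = 2 * (2 ^ K * D j)" by simp
    ultimately show ?thesis using Dle[of j] by linarith
  qed
  have C1: "1 \<le> C" using D(1) by (simp add: C_def sum_nonneg)
  have q0: "?q \<delta> y j > 0" if "\<delta> > 0" for \<delta> y j using that by (intro add_pos_nonneg) auto
  have Pnn: "0 \<le> ?P J y" for J y by (intro prod_nonneg) auto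
  have cP: "continuous_on UNIV (\<lambda>y. complex_of_real (?P J y))" for J
    by (intro continuous_intros ballI) (use one_plus_square_pos less_irrefl in metis)
  have main: "dir_bounded b K (\<lambda>y. complex_of_real (scaled_weight s i \<delta> y))
     (\<lambda>y. C * (sobolev_weight s y * (1 + (if b $ i \<noteq> 0 \<and> s i \<noteq> 0 then ?q \<delta> y i powr (s i / 2 - K / 2) else 0))))"
    if \<delta>: "0 < \<delta>" "\<delta> \<le> 1" and b: "b \<in> Basis" for \<delta> and b :: "real^'n^'m"
  proof -
    obtain j u where ju: "b = axis j u" "u \<in> Basis" using b by (rule Basis_vec_cases)
    have bj: "b $ j \<noteq> 0" using ju axis_nth_ne_zero_iff by metis
    have b0: "b $ k = 0" if "k \<noteq> j" for k using ju that by (simp add: axis_def)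
    have W: "scaled_weight s i \<delta> y \<le> sobolev_weight s y" for y :: "real^'n^'m" by (rule scaled_weight_le[where s=s, OF s \<delta>])
    show ?thesis
    proof (cases "j = i")
      case True
      have cst: "dir_bounded b K (\<lambda>y. complex_of_real (?P (UNIV - {i}) y)) (?P (UNIV - {i}))"
        by (rule dir_bounded_const) (use cP True b0 Pnn in \<open>auto simp: prod_nonneg simp del: of_real_prod intro!: prod.cong\<close>)
      show ?thesis
      proof (cases "s i = 0")
        case True
        have "(\<lambda>y. complex_of_real (scaled_weight s i \<delta> y)) = (\<lambda>y. complex_of_real (?P (UNIV - {i}) y))"
          unfolding scaled_weight_def using q0[OF \<delta>(1)] True by (intro ext) (simp add: less_imp_neq[THEN not_sym])
        moreover have "?P (UNIV - {i}) y \<le> C * (sobolev_weight s y * (1 + 0))" for y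
          using rest_weight_le[where s=s and i=i and y=y, OF s] mult_right_mono[OF C1 sobolev_weight_nonneg[where s=s and y=y]] by simp
        ultimately show ?thesis using dir_bounded_mono[OF cst] True by simp
      next
        case False
        have bi: "b $ i \<noteq> 0" using bj \<open>j = i\<close> by simp
        from dir_bounded_mult[OF D(2)[of \<delta>, OF _ b bi] cst]
        have "dir_bounded b K (\<lambda>y. complex_of_real (scaled_weight s i \<delta> y))
          (\<lambda>y. 2 ^ K * (D i * (?q \<delta> y i powr (s i / 2) + ?q \<delta> y i powr (s i / 2 - K / 2)) * ?P (UNIV - {i}) y))"
          using \<delta> by (simp add: scaled_weight_def)
        then show ?thesis
        proof (rule dir_bounded_mono)
          fix y :: "real^'n^'m"
          have "?q \<delta> y i powr (s i / 2) * ?P (UNIV - {i}) y \<le> sobolev_weight s y"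
            using W[of y] by (simp add: scaled_weight_def)
          moreover have "?q \<delta> y i powr (s i / 2 - K / 2) * ?P (UNIV - {i}) y \<le> ?q \<delta> y i powr (s i / 2 - K / 2) * sobolev_weight s y"
            by (intro mult_left_mono rest_weight_le s) auto
          ultimately have "(?q \<delta> y i powr (s i / 2) + ?q \<delta> y i powr (s i / 2 - K / 2)) * ?P (UNIV - {i}) y \<le> sobolev_weight s y * (1 + ?q \<delta> y i powr (s i / 2 - K / 2))"
            by (simp add: algebra_simps)
          then have "2 ^ K * D i * ((?q \<delta> y i powr (s i / 2) + ?q \<delta> y i powr (s i / 2 - K / 2)) * ?P (UNIV - {i}) y)
             \<le> C * (sobolev_weight s y * (1 + ?q \<delta> y i powr (s i / 2 - K / 2)))"
            using Dle'[of i] order_trans[OF zero_le_one C1] Pnn[where J="UNIV - {i}" and y=y]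
            by (rule_tac mult_mono) (simp_all only: mult_nonneg_nonneg add_nonneg_nonneg powr_ge_zero)
          then show "2 ^ K * (D i * (?q \<delta> y i powr (s i / 2) + ?q \<delta> y i powr (s i / 2 - K / 2)) * ?P (UNIV - {i}) y)
             \<le> C * (sobolev_weight s y * (1 + (if b $ i \<noteq> 0 \<and> s i \<noteq> 0 then ?q \<delta> y i powr (s i / 2 - K / 2) else 0)))"
            using bi False by (simp add: mult_ac)
        qed
      qed
    next
      case False
      let ?R = "\<lambda>y. ?q \<delta> y i powr (s i / 2) * ?P (UNIV - {i} - {j}) y"
      have cR: "continuous_on UNIV (\<lambda>y. complex_of_real (?R y))"
        unfolding of_real_mult by (intro continuous_on_mult cP continuous_intros) (use q0[OF \<delta>(1)] less_irrefl in metis)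
      have cst: "dir_bounded b K (\<lambda>y. complex_of_real (?R y)) ?R"
        by (rule dir_bounded_const) (use cR False b0 Pnn in \<open>auto simp: prod_nonneg abs_mult simp del: of_real_prod of_real_mult intro!: prod.cong\<close>)
      have Weq: "scaled_weight s i \<delta> y = ?q 1 y j powr (s j / 2) * ?R y" for y :: "real^'n^'m"
        unfolding scaled_weight_def by (subst prod.remove[of "UNIV - {i}" j]) (use False in auto)
      from dir_bounded_mult[OF D(2)[of 1, OF _ b bj] cst]
      have "dir_bounded b K (\<lambda>y. complex_of_real (scaled_weight s i \<delta> y))
          (\<lambda>y. 2 ^ K * (D j * (?q 1 y j powr (s j / 2) + ?q 1 y j powr (s j / 2 - K / 2)) * ?R y))"
        unfolding Weq of_real_mult by simp
      then show ?thesis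
      proof (rule dir_bounded_mono)
        fix y :: "real^'n^'m"
        have "?q 1 y j powr (s j / 2 - K / 2) \<le> ?q 1 y j powr (s j / 2)" by (intro powr_mono) auto
        then have "(?q 1 y j powr (s j / 2) + ?q 1 y j powr (s j / 2 - K / 2)) * ?R y \<le> (2 * ?q 1 y j powr (s j / 2)) * ?R y"
          by (intro mult_right_mono) (auto intro!: mult_nonneg_nonneg prod_nonneg)
        also have "\<dots> = 2 * scaled_weight s i \<delta> y" by (simp add: Weq)
        also have "\<dots> \<le> 2 * sobolev_weight s y" using W by simp
        finally have "2 ^ K * D j * ((?q 1 y j powr (s j / 2) + ?q 1 y j powr (s j / 2 - K / 2)) * ?R y) \<le> 2 ^ K * D j * (2 * sobolev_weight s y)"
          by (rule mult_left_mono) (use D in auto)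
        also have "\<dots> = (2 ^ K * 2 * D j) * sobolev_weight s y" by simp
        also have "\<dots> \<le> C * sobolev_weight s y" by (rule mult_right_mono[OF Dle sobolev_weight_nonneg])
        finally show "2 ^ K * (D j * (?q 1 y j powr (s j / 2) + ?q 1 y j powr (s j / 2 - K / 2)) * ?R y)
            \<le> C * (sobolev_weight s y * (1 + (if b $ i \<noteq> 0 \<and> s i \<noteq> 0 then ?q \<delta> y i powr (s i / 2 - K / 2) else 0)))"
          using False b0[of i] by (simp add: mult_ac)
      qed
    qed
  qed
  show ?thesis using C1 main by (intro exI[of _ C]) auto
qed

section \<open>Kernel estimates, uniform in the width of the bump\<close>

lemma AE_inner_Basis_ne_0: "AE y in lborel. \<forall>b\<in>Basis. y \<bullet> b \<noteq> (0::real)"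
proof -
  have "AE y::'a::euclidean_space in lborel. y \<bullet> b \<noteq> 0" if "b \<in> Basis" for b
  proof -
    have "negligible {y::'a. b \<bullet> y = 0}" using negligible_hyperplane[of b 0] nonzero_Basis[OF that] by auto
    then have "{y::'a. b \<bullet> y = 0} \<in> null_sets (completion lborel)" by (simp add: negligible_iff_null_sets)
    moreover have "{y::'a. b \<bullet> y = 0} \<in> sets lborel" using closed_hyperplane[of b 0] by (auto intro: borel_closed)
    ultimately have "{y::'a. b \<bullet> y = 0} \<in> null_sets lborel" by (simp add: null_sets_completion_iff)
    from AE_not_in[OF this] show ?thesis by (auto simp: inner_commute)
  qed
  then show ?thesis by (subst AE_finite_all) auto
qed

lemma card_block_Basis: "card {b\<in>Basis :: (real^'n^'m) set. b $ i \<noteq> 0} = CARD('n)"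
proof -
  have "{b\<in>Basis :: (real^'n^'m) set. b $ i \<noteq> 0} = axis i ` Basis"
  proof (intro set_eqI iffI)
    fix b :: "real^'n^'m" assume "b \<in> {b\<in>Basis. b $ i \<noteq> 0}"
    then show "b \<in> axis i ` Basis" by (auto elim!: Basis_vec_cases simp: axis_nth_ne_zero_iff)
  next
    fix b :: "real^'n^'m" assume "b \<in> axis i ` Basis"
    then obtain u where "b = axis i u" "u \<in> Basis" by blast
    then show "b \<in> {b\<in>Basis. b $ i \<noteq> 0}" using axis_nth_ne_zero_iff[of u i i] by simp
  qed
  moreover have "inj_on (axis i :: real^'n \<Rightarrow> real^'n^'m) Basis" by (auto simp: inj_on_def axis_eq_axis)
  ultimately show ?thesis by (simp add: card_image)
qed

definition gaussian_bump :: "'m \<Rightarrow> (real^'n^'m \<Rightarrow> complex) \<Rightarrow> real \<Rightarrow> real^'n^'m \<Rightarrow> complex" where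
  "gaussian_bump i B \<delta> = (\<lambda>x. complex_of_real (exp (- pi * (norm (x $ i))\<^sup>2)) * B (scale_block i \<delta> x))"

text \<open>Up to the factor \<open>\<delta> powr (- s i)\<close>, a reflection and a dilation of
  block i, this is the Sobolev potential of a bump of width \<open>\<delta>\<close>. The forward
  transform is used so that the decay lemmas apply directly.\<close>

definition bump_kernel :: "('m::finite \<Rightarrow> real) \<Rightarrow> 'm \<Rightarrow> (real^'n^'m \<Rightarrow> complex) \<Rightarrow> real \<Rightarrow> real^'n^'m \<Rightarrow> complex" where
  "bump_kernel s i B \<delta> = fourier (\<lambda>y. complex_of_real (scaled_weight s i \<delta> y) * fourier (gaussian_bump i B \<delta>) y)"

text \<open>The transform of \<open>\<Psi>\<close>, its translates and the products of two of its
  dilates will be of this kind.\<close>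

definition smooth_bump :: "('a::euclidean_space \<Rightarrow> complex) \<Rightarrow> bool" where
  "smooth_bump B \<longleftrightarrow> (\<forall>K. \<exists>C\<ge>0. \<forall>b\<in>Basis. dir_bounded b K B (\<lambda>_. C)) \<and> (\<exists>R. \<forall>x. norm x > R \<longrightarrow> B x = 0)"

lemma gaussian_bump_uniform:
  assumes "smooth_bump B" shows "uniformly_schwartz (gaussian_bump i B ` {0<..1})"
proof -
  obtain R where "\<forall>x. norm x > R \<longrightarrow> B x = 0" using assms unfolding smooth_bump_def by blast
  moreover have "\<exists>C\<ge>0. \<forall>b\<in>Basis. dir_bounded b K B (\<lambda>_. C)" for K using assms unfolding smooth_bump_def by blast
  ultimately show ?thesis unfolding gaussian_bump_def by (intro gaussian_bump_uniformly_schwartz) auto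
qed

lemma integrable_inverse_square_prod: "integrable lborel (\<lambda>y::'a::euclidean_space. \<Prod>b\<in>Basis. 1 / (1 + \<bar>y \<bullet> b\<bar>)^2)"
  by (rule integrable_prod_Basis) (use nn_integral_inverse_square_finite in \<open>auto simp: less_top\<close>)

lemma integrable_singular_prod:
  fixes i :: "'m::finite"
  assumes "0 \<le> \<beta>" "\<beta> < 1"
  shows "integrable lborel (\<lambda>y::real^'n^'m. \<Prod>b\<in>Basis. (if b $ i \<noteq> 0 then \<bar>y \<bullet> b\<bar> powr (-\<beta>) else 1) * (1 / (1 + \<bar>y \<bullet> b\<bar>)^2))"
proof (rule integrable_prod_Basis)
  fix b :: "real^'n^'m" assume "b \<in> Basis"
  have e: "(1 + \<bar>t\<bar>) powr (-2) = 1 / (1 + \<bar>t\<bar>)^2" for t :: real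
    by (simp add: powr_minus powr_numeral divide_inverse)
  show "(\<integral>\<^sup>+t. ennreal ((if b $ i \<noteq> 0 then \<bar>t\<bar> powr (-\<beta>) else 1) * (1 / (1 + \<bar>t\<bar>)^2)) \<partial>lborel) < \<infinity>"
    using nn_integral_powr_weight_finite[of \<beta> 2] assms nn_integral_inverse_square_finite unfolding e by (cases "b $ i = 0") simp_all
qed auto

text \<open>Each of the \<open>CARD('n)\<close> coordinates of block i is at most
  \<open>norm (y $ i)\<close> in absolute value, so the negative power of the norm is at most a
  product of negative powers of the coordinates. The radial singularity thus splits into
  one-dimensional ones, integrable as soon as \<open>\<beta> < 1\<close>.\<close>

lemma block_norm_powr_le:
  fixes y :: "real^'n^'m" and \<beta> :: real
  assumes "\<forall>b\<in>Basis. y \<bullet> b \<noteq> 0" "0 \<le> \<beta>"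
  shows "norm (y $ i) powr (- (CARD('n) * \<beta>)) \<le> (\<Prod>b\<in>Basis. if b $ i \<noteq> 0 then \<bar>y \<bullet> b\<bar> powr (-\<beta>) else 1)"
proof -
  let ?J = "{b\<in>Basis :: (real^'n^'m) set. b $ i \<noteq> 0}"
  have "norm (y $ i) powr (- (CARD('n) * \<beta>)) = (norm (y $ i) powr (-\<beta>)) powr (CARD('n))" by (simp add: powr_powr mult.commute)
  also have "\<dots> = (\<Prod>b\<in>?J. norm (y $ i) powr (-\<beta>))"
  proof (cases "norm (y $ i) = 0")
    \<comment> \<open>Negative powers of \<open>0\<close> are \<open>0\<close> by convention; the
      product over the block agrees because the block is nonempty.\<close>
    case True
    have "card ?J > 0" by (simp add: card_block_Basis)
    then show ?thesis using True by (simp add: power_0_left card_block_Basis)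
  next
    case False
    then show ?thesis by (simp add: card_block_Basis powr_realpow)
  qed
  also have "\<dots> \<le> (\<Prod>b\<in>?J. \<bar>y \<bullet> b\<bar> powr (-\<beta>))"
    by (intro prod_mono conjI powr_mono2') (use assms abs_inner_Basis_le_nth in auto)
  also have "\<dots> = (\<Prod>b\<in>Basis. if b $ i \<noteq> 0 then \<bar>y \<bullet> b\<bar> powr (-\<beta>) else 1)"
    by (simp add: prod.inter_filter)
  finally show ?thesis .
qed

text \<open>Order \<open>CARD('n)\<close> is what the singularity permits in the directions of block
  i: with \<open>n = CARD('n)\<close>, that many derivatives of the weight leave
  \<open>norm (y $ i) powr (s i - n)\<close>, which is integrable near zero for
  \<open>s i > 0\<close>; for \<open>s i = 0\<close> no singular term occurs. In the other
  directions the order is arbitrary.\<close>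

lemma bump_kernel_decay_aux:
  fixes i :: "'m::finite" and B :: "real^'n^'m \<Rightarrow> complex" and s :: "'m \<Rightarrow> real"
  assumes s: "\<And>j. 0 \<le> s j" and si: "s i < CARD('n)" and B: "smooth_bump B"
  shows "\<exists>C\<ge>0. \<forall>\<delta>\<in>{0<..1}. \<forall>b\<in>Basis. (b $ i \<noteq> 0 \<longrightarrow> L = CARD('n)) \<longrightarrow>
     (\<forall>\<eta>. norm (bump_kernel s i B \<delta> \<eta>) \<le> C \<and> \<bar>\<eta> \<bullet> b\<bar> ^ L * norm (bump_kernel s i B \<delta> \<eta>) \<le> C)"
proof -
  let ?n = "real CARD('n)"
  \<comment> \<open>Chosen such that \<open>n * \<beta> = n - s i\<close>; when
    \<open>s i = 0\<close> there is no singular term, and \<open>0\<close> is a harmless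
    value.\<close>
  define \<beta> where "\<beta> = (if s i = 0 then 0 else 1 - s i / ?n)"
  have n0: "?n > 0" by simp
  have \<beta>: "0 \<le> \<beta>" "\<beta> < 1" using s[of i] si n0 by (auto simp: \<beta>_def divide_simps)
  have \<beta>e: "s i \<noteq> 0 \<Longrightarrow> s i - ?n = - (?n * \<beta>)" using n0 by (simp add: \<beta>_def field_simps)
  obtain A N where AN: "A \<ge> 0" "\<And>y::real^'n^'m. sobolev_weight s y \<le> A * (1 + norm y) ^ N"
    using sobolev_weight_growth[where s=s, OF s] by blast
  obtain C1 where C1: "C1 \<ge> 0" "\<And>\<delta> b. \<delta> \<in> {0<..1} \<Longrightarrow> b \<in> Basis \<Longrightarrow> dir_bounded b L (\<lambda>y::real^'n^'m. complex_of_real (scaled_weight s i \<delta> y))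
     (\<lambda>y. C1 * (sobolev_weight s y * (1 + (if b $ i \<noteq> 0 \<and> s i \<noteq> 0 then (\<delta>\<^sup>2 + 4 * pi\<^sup>2 * (norm (y $ i))\<^sup>2) powr (s i / 2 - L / 2) else 0))))"
    using scaled_weight_dir_bounded[where s=s and K=L, OF s] by blast
  obtain C3 where C3: "C3 \<ge> 0" "\<And>f b. f \<in> gaussian_bump i B ` {0<..1} \<Longrightarrow> b \<in> Basis \<Longrightarrow> dir_bounded b L (fourier f) (\<lambda>y. C3 / (\<Prod>b\<in>Basis. (1 + \<bar>y \<bullet> b\<bar>) ^ (N+2)))"
    using uniformly_schwartz_fourier[OF gaussian_bump_uniform[OF B]] by blast
  \<comment> \<open>The regular and the singular part of the majorant; two extra powers in each
    coordinate, from the exponent \<open>N + 2\<close> above, make both integrable.\<close>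
  define J where "J y = (\<Prod>b\<in>Basis. 1 / (1 + \<bar>y \<bullet> b\<bar>)^2) + (\<Prod>b\<in>Basis. (if b $ i \<noteq> 0 then \<bar>y \<bullet> b\<bar> powr (-\<beta>) else 1) * (1 / (1 + \<bar>y \<bullet> b\<bar>)^2))" for y :: "real^'n^'m"
  have J: "integrable lborel J" unfolding J_def
    by (intro Bochner_Integration.integrable_add integrable_inverse_square_prod integrable_singular_prod \<beta>)
  define c where "c = 2 ^ L * (C1 * A * C3)"
  define C where "C = c * (LINT y|lborel. J y)"
  have c0: "c \<ge> 0" using C1 C3 AN by (simp add: c_def)
  have J0: "J y \<ge> 0" for y unfolding J_def by (intro add_nonneg_nonneg prod_nonneg) auto
  have main: "norm (bump_kernel s i B \<delta> \<eta>) \<le> C \<and> \<bar>\<eta> \<bullet> b\<bar> ^ L * norm (bump_kernel s i B \<delta> \<eta>) \<le> C"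
    if \<delta>: "\<delta> \<in> {0<..1}" and b: "b \<in> Basis" and L: "b $ i \<noteq> 0 \<longrightarrow> L = CARD('n)" for \<delta> b \<eta>
  proof -
    let ?X = "\<lambda>y::real^'n^'m. if b $ i \<noteq> 0 \<and> s i \<noteq> 0 then (\<delta>\<^sup>2 + 4 * pi\<^sup>2 * (norm (y $ i))\<^sup>2) powr (s i / 2 - L / 2) else 0"
    let ?S = "\<lambda>y::real^'n^'m. 2 ^ L * (C1 * (sobolev_weight s y * (1 + ?X y)) * (C3 / (\<Prod>b\<in>Basis. (1 + \<bar>y \<bullet> b\<bar>) ^ (N+2))))"
    let ?u = "\<lambda>y. complex_of_real (scaled_weight s i \<delta> y) * fourier (gaussian_bump i B \<delta>) y"
    have d: "dir_bounded b L ?u ?S"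
      by (rule dir_bounded_mult[OF C1(2)[OF \<delta> b] C3(2)[OF imageI[OF \<delta>] b]])
    have X0: "0 \<le> ?X y" for y by simp
    have SJ: "?S y \<le> c * J y" if y: "\<forall>b\<in>Basis. y \<bullet> b \<noteq> 0" for y
    proof -
      let ?P = "\<Prod>b\<in>Basis. (1 + \<bar>y \<bullet> b\<bar>)"
      have P1: "?P \<ge> 1" using norm_le_prod_Basis[of y] norm_ge_zero[of y] by linarith
      have Pe: "(\<Prod>b\<in>Basis. (1 + \<bar>y \<bullet> b\<bar>) ^ (N+2)) = ?P ^ N * ?P ^ 2" unfolding prod_power_distrib[symmetric] by (rule power_add)
      have "sobolev_weight s y \<le> A * ?P ^ N"
        using AN(2)[of y] mult_left_mono[OF power_mono[OF norm_le_prod_Basis[of y], of N] AN(1)] by simp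
      then have "sobolev_weight s y * (1 + ?X y) \<le> A * ?P ^ N * (1 + ?X y)" using X0[of y] by (intro mult_right_mono) auto
      then have "sobolev_weight s y * (1 + ?X y) / (?P ^ N * ?P ^ 2) \<le> A * ?P ^ N * (1 + ?X y) / (?P ^ N * ?P ^ 2)"
        using P1 by (intro divide_right_mono) auto
      also have "\<dots> = A * ((1 + ?X y) / ?P ^ 2)" using P1 by simp
      also have "\<dots> \<le> A * J y"
      proof (rule mult_left_mono[OF _ AN(1)])
        have i2: "(\<Prod>b\<in>Basis. 1 / (1 + \<bar>y \<bullet> b\<bar>)^2) = 1 / ?P ^ 2" by (simp add: prod_dividef prod_power_distrib)
        have "?X y \<le> (\<Prod>b\<in>Basis. if b $ i \<noteq> 0 then \<bar>y \<bullet> b\<bar> powr (-\<beta>) else 1)"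
        proof (cases "b $ i \<noteq> 0 \<and> s i \<noteq> 0")
          case True
          obtain u where u: "b = axis i u" "u \<in> Basis" using True b by (metis Basis_vec_cases axis_nth_ne_zero_iff)
          have "y $ i \<bullet> u \<noteq> 0" using y b u(1) by (metis inner_axis)
          then have ny: "norm (y $ i) > 0" by auto
          have "1 * (norm (y $ i))\<^sup>2 \<le> 4 * pi\<^sup>2 * (norm (y $ i))\<^sup>2"
          proof (rule mult_right_mono)
            have "1 \<le> pi\<^sup>2" using pi_gt3 by (intro one_le_power) simp
            then show "1 \<le> 4 * pi\<^sup>2" by simp
          qed simp
          then have le: "(norm (y $ i))\<^sup>2 \<le> \<delta>\<^sup>2 + 4 * pi\<^sup>2 * (norm (y $ i))\<^sup>2" by (simp add: add_increasing)
          have "?X y = (\<delta>\<^sup>2 + 4 * pi\<^sup>2 * (norm (y $ i))\<^sup>2) powr ((s i - ?n) / 2)" using True L by (simp add: diff_divide_distrib)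
          also have "\<dots> \<le> ((norm (y $ i))\<^sup>2) powr ((s i - ?n) / 2)"
            by (rule powr_mono2'[OF _ _ le]) (use ny si in auto)
          also have "\<dots> = norm (y $ i) powr (- (?n * \<beta>))" using \<beta>e True power2_powr_half[OF ny, of "s i - ?n"] by simp
          also have "\<dots> \<le> (\<Prod>b\<in>Basis. if b $ i \<noteq> 0 then \<bar>y \<bullet> b\<bar> powr (-\<beta>) else 1)" by (rule block_norm_powr_le[OF y \<beta>(1)])
          finally show ?thesis .
        next
          case False
          then have "?X y = 0" by auto
          then show ?thesis by (simp only:) (intro prod_nonneg, auto)
        qed
        then have "?X y / ?P ^ 2 \<le> (\<Prod>b\<in>Basis. if b $ i \<noteq> 0 then \<bar>y \<bullet> b\<bar> powr (-\<beta>) else 1) / ?P ^ 2"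
          by (rule divide_right_mono) simp
        also have "\<dots> = (\<Prod>b\<in>Basis. (if b $ i \<noteq> 0 then \<bar>y \<bullet> b\<bar> powr (-\<beta>) else 1) * (1 / (1 + \<bar>y \<bullet> b\<bar>)^2))"
          unfolding prod.distrib i2 by simp
        finally show "(1 + ?X y) / ?P ^ 2 \<le> J y" unfolding J_def i2 by (simp only: add_divide_distrib add_left_mono)
      qed
      finally have *: "sobolev_weight s y * (1 + ?X y) / (?P ^ N * ?P ^ 2) \<le> A * J y" .
      have "?S y = (2 ^ L * (C1 * C3)) * (sobolev_weight s y * (1 + ?X y) / (?P ^ N * ?P ^ 2))"
        unfolding Pe by (simp only: divide_inverse mult_ac)
      also have "\<dots> \<le> (2 ^ L * (C1 * C3)) * (A * J y)" by (rule mult_left_mono[OF *]) (use C1 C3 in auto)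
      also have "\<dots> = c * J y" by (simp only: c_def mult_ac)
      finally show ?thesis .
    qed
    have q0: "\<delta>\<^sup>2 + 4 * pi\<^sup>2 * (norm (y $ i))\<^sup>2 \<noteq> 0" for y :: "real^'n^'m" using \<delta> by (simp add: add_nonneg_eq_0_iff)
    have cX: "continuous_on UNIV ?X"
    proof (cases "b $ i \<noteq> 0 \<and> s i \<noteq> 0")
      case True
      have "continuous_on UNIV (\<lambda>y::real^'n^'m. (\<delta>\<^sup>2 + 4 * pi\<^sup>2 * (norm (y $ i))\<^sup>2) powr (s i / 2 - L / 2))"
        by (intro continuous_intros ballI) (use q0 in blast)
      then show ?thesis using True by simp
    next
      case False then have "?X = (\<lambda>y. 0)" by auto
      then show ?thesis by (simp only: continuous_on_const)
    qed
    have p0: "(\<Prod>b\<in>Basis. (1 + \<bar>y \<bullet> b\<bar>) ^ (N+2)) \<noteq> 0" for y :: "real^'n^'m"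
      by (auto simp: prod_zero_iff add_nonneg_eq_0_iff)
    have "continuous_on UNIV ?S"
      by (intro continuous_on_mult continuous_on_const continuous_on_add continuous_on_divide continuous_on_prod continuous_on_power
            continuous_on_rabs continuous_on_inner continuous_on_id continuous_sobolev_weight cX ballI p0)
    then have mS: "?S \<in> borel_measurable borel" by (rule continuous_borel_complex)
    have S0: "0 \<le> ?S y" for y using dir_bounded_nonneg[OF d] .
    have S: "integrable lborel ?S"
    proof (rule Bochner_Integration.integrable_bound[OF integrable_mult_right[OF J, of c]])
      show "AE y in lborel. norm (?S y) \<le> norm (c * J y)"
        using AE_inner_Basis_ne_0
      proof eventually_elim
        case (elim y)
        show ?case unfolding real_norm_def abs_of_nonneg[OF S0] abs_of_nonneg[OF mult_nonneg_nonneg[OF c0 J0]] by (rule SJ[OF elim])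
      qed
    qed (use mS in simp)
    have SC: "(LINT y|lborel. ?S y) \<le> C"
    proof -
      have "(LINT y|lborel. ?S y) \<le> (LINT y|lborel. c * J y)"
        by (rule integral_mono_AE[OF S integrable_mult_right[OF J] eventually_mono[OF AE_inner_Basis_ne_0 SJ]])
      then show ?thesis by (simp add: C_def)
    qed
    show ?thesis unfolding bump_kernel_def
      using order_trans[OF fourier_decay[OF d S] SC] order_trans[OF norm_fourier_le[OF dir_bounded_cont[OF d] S dir_bounded_bound[OF d]] SC] by blast
  qed
  moreover have "C \<ge> 0" unfolding C_def using c0 J0 by (intro mult_nonneg_nonneg integral_nonneg_AE) auto
  ultimately show ?thesis by (intro exI[of _ C] conjI ballI allI impI) auto
qed

text \<open>Raise the bound for \<open>b\<close> to the power \<open>\<mu> b\<close> and multiply;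
  the exponents of \<open>z\<close> and of \<open>A\<close> add up to one.\<close>

lemma weighted_geometric_mean_bound:
  fixes z A :: real and X \<mu> :: "'b \<Rightarrow> real"
  assumes "finite I" "0 \<le> z" "0 \<le> A" "\<And>b. b \<in> I \<Longrightarrow> 0 \<le> X b" "\<And>b. b \<in> I \<Longrightarrow> (1 + X b) ^ K b * z \<le> A"
    and \<mu>: "\<And>b. b \<in> I \<Longrightarrow> 0 \<le> \<mu> b" "(\<Sum>b\<in>I. \<mu> b) = 1"
  shows "z * (\<Prod>b\<in>I. (1 + X b) powr (K b * \<mu> b)) \<le> A"
proof (cases "z = 0")
  case True then show ?thesis using assms by simp
next
  case False
  then have z: "z > 0" using assms by simp
  have "I \<noteq> {}" using \<mu>(2) by auto
  then obtain b0 where "b0 \<in> I" by blast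
  then have "0 < (1 + X b0) ^ K b0 * z" using z assms(4)[of b0] by (intro mult_pos_pos zero_less_power) auto
  then have A: "A > 0" using assms(5)[OF \<open>b0 \<in> I\<close>] by linarith
  have "(\<Prod>b\<in>I. ((1 + X b) ^ K b * z) powr \<mu> b) \<le> (\<Prod>b\<in>I. A powr \<mu> b)"
    by (intro prod_mono conjI powr_mono2) (use assms z in auto)
  also have "\<dots> = A powr (\<Sum>b\<in>I. \<mu> b)" using A assms(1) by (subst powr_sum) auto
  also have "\<dots> = A" using \<mu> A by simp
  also have "(\<Prod>b\<in>I. ((1 + X b) ^ K b * z) powr \<mu> b) = (\<Prod>b\<in>I. (1 + X b) powr (K b * \<mu> b) * z powr \<mu> b)"
  proof (rule prod.cong[OF refl])
    fix b assume "b \<in> I"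
    then have "1 + X b > 0" using assms(4)[of b] by simp
    then have "(1 + X b) ^ K b = (1 + X b) powr K b" by (simp add: powr_realpow)
    then show "((1 + X b) ^ K b * z) powr \<mu> b = (1 + X b) powr (K b * \<mu> b) * z powr \<mu> b"
      by (simp only: powr_mult powr_powr)
  qed
  also have "\<dots> = (\<Prod>b\<in>I. (1 + X b) powr (K b * \<mu> b)) * z powr (\<Sum>b\<in>I. \<mu> b)"
    using z assms(1) by (subst powr_sum) (auto simp: prod.distrib)
  also have "\<dots> = z * (\<Prod>b\<in>I. (1 + X b) powr (K b * \<mu> b))" using \<mu> z by simp
  finally show ?thesis .
qed

text \<open>Each bound at hand involves a single coordinate. A geometric mean with weight
  \<open>\<alpha> / n\<close> for every coordinate of block i gives the exponent
  \<open>n * (\<alpha> / n) = \<alpha>\<close> there, and the remaining weight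
  \<open>1 - \<alpha>\<close> is shared by the other coordinates, where arbitrary order is
  available. That there are other coordinates is due to \<open>CARD('m) \<ge> 2\<close>. Any
  \<open>\<alpha> < 1\<close> is possible, which leaves room above the exponent \<open>1 / r\<close>
  needed for integrability.\<close>

lemma bump_kernel_bound:
  fixes i :: "'m::finite" and B :: "real^'n^'m \<Rightarrow> complex" and s :: "'m \<Rightarrow> real"
  assumes m: "CARD('m) \<ge> 2" and s: "\<And>j. 0 \<le> s j" and si: "s i < CARD('n)" and B: "smooth_bump B" and \<alpha>: "0 < \<alpha>" "\<alpha> < (1::real)"
  shows "\<exists>C\<ge>0. \<forall>\<delta>\<in>{0<..1}. \<forall>\<eta>. norm (bump_kernel s i B \<delta> \<eta>) \<le> C * (\<Prod>b\<in>Basis. (1 + \<bar>\<eta> \<bullet> b\<bar>) powr (if b $ i \<noteq> 0 then - \<alpha> else - 2))"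
proof -
  let ?n = "CARD('n)" and ?J = "{b\<in>Basis :: (real^'n^'m) set. b $ i \<noteq> 0}" and ?J' = "{b\<in>Basis :: (real^'n^'m) set. \<not> b $ i \<noteq> 0}"
  define c where "c = real (card ?J')"
  have un: "(Basis :: (real^'n^'m) set) = ?J \<union> ?J'" "?J \<inter> ?J' = {}" by auto
  have "card (Basis :: (real^'n^'m) set) = card ?J + card ?J'" by (subst un(1), rule card_Un_disjoint) auto
  then have "CARD('m) * ?n = ?n + card ?J'" by (simp add: card_block_Basis)
  moreover have "2 * ?n \<le> CARD('m) * ?n" using m by simp
  ultimately have "card ?J' > 0" using zero_less_card_finite[where 'a='n] by linarith
  then have c: "c > 0" by (simp add: c_def)
  \<comment> \<open>Large enough for the share \<open>(1 - \<alpha>) / c\<close> of order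
    \<open>K\<close> to be at least \<open>2\<close>.\<close>
  define K where "K = nat \<lceil>2 * c / (1 - \<alpha>)\<rceil>"
  have Kc: "real K * ((1 - \<alpha>) / c) \<ge> 2"
  proof -
    have "2 * c / (1 - \<alpha>) \<le> real K" unfolding K_def by linarith
    from mult_right_mono[OF this, of "(1 - \<alpha>) / c"] show ?thesis using c \<alpha> by simp
  qed
  obtain C1 where C1: "C1 \<ge> 0" "\<And>\<delta> b \<eta>. \<delta> \<in> {0<..1} \<Longrightarrow> b \<in> Basis \<Longrightarrow>
     norm (bump_kernel s i B \<delta> \<eta>) \<le> C1 \<and> \<bar>\<eta> \<bullet> b\<bar> ^ ?n * norm (bump_kernel s i B \<delta> \<eta>) \<le> C1"
    using bump_kernel_decay_aux[where s=s and L="?n", OF s si B] by auto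
  obtain C2 where C2: "C2 \<ge> 0" "\<And>\<delta> b \<eta>. \<delta> \<in> {0<..1} \<Longrightarrow> b \<in> Basis \<Longrightarrow> \<not> b $ i \<noteq> 0 \<Longrightarrow>
     norm (bump_kernel s i B \<delta> \<eta>) \<le> C2 \<and> \<bar>\<eta> \<bullet> b\<bar> ^ K * norm (bump_kernel s i B \<delta> \<eta>) \<le> C2"
    using bump_kernel_decay_aux[where s=s and L=K, OF s si B] by auto
  define Kb where "Kb b = (if b $ i \<noteq> 0 then ?n else K)" for b :: "real^'n^'m"
  define \<mu> where "\<mu> b = (if b $ i \<noteq> 0 then \<alpha> / ?n else (1 - \<alpha>) / c)" for b :: "real^'n^'m"
  define C where "C = 2 ^ ?n * C1 + 2 ^ K * C2"
  have two: "(1 + t) ^ k * z \<le> 2 ^ k * D" if "0 \<le> t" "0 \<le> z" "z \<le> D" "t ^ k * z \<le> D" for t z D :: real and k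
  proof -
    have "(1 + t) ^ k \<le> (2 * max 1 t) ^ k" using that by (intro power_mono) auto
    then have "(1 + t) ^ k * z \<le> (2 * max 1 t) ^ k * z" using that by (intro mult_right_mono)
    also have "\<dots> = 2 ^ k * (max 1 t ^ k * z)" by (simp add: power_mult_distrib)
    also have "\<dots> \<le> 2 ^ k * D" using that by (intro mult_left_mono) (auto simp: max_def)
    finally show ?thesis .
  qed
  have "norm (bump_kernel s i B \<delta> \<eta>) \<le> C * (\<Prod>b\<in>Basis. (1 + \<bar>\<eta> \<bullet> b\<bar>) powr (if b $ i \<noteq> 0 then - \<alpha> else - 2))" if \<delta>: "\<delta> \<in> {0<..1}" for \<delta> \<eta>
  proof -
    let ?z = "norm (bump_kernel s i B \<delta> \<eta>)"
    have 1: "?z * (\<Prod>b\<in>Basis. (1 + \<bar>\<eta> \<bullet> b\<bar>) powr (Kb b * \<mu> b)) \<le> C"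
    proof (rule weighted_geometric_mean_bound)
      fix b :: "real^'n^'m" assume b: "b \<in> Basis"
      show "(1 + \<bar>\<eta> \<bullet> b\<bar>) ^ Kb b * ?z \<le> C"
      proof (cases "b $ i \<noteq> 0")
        case True
        have "(1 + \<bar>\<eta> \<bullet> b\<bar>) ^ ?n * ?z \<le> 2 ^ ?n * C1" using C1(2)[OF \<delta> b, of \<eta>] by (intro two) auto
        then show ?thesis using True C2(1) by (simp add: Kb_def C_def add_increasing2)
      next
        case False
        have "(1 + \<bar>\<eta> \<bullet> b\<bar>) ^ K * ?z \<le> 2 ^ K * C2" using C2(2)[OF \<delta> b False, of \<eta>] by (intro two) auto
        then show ?thesis using False C1(1) by (simp add: Kb_def C_def add_increasing)
      qed
      show "0 \<le> \<mu> b" using \<alpha> c by (simp add: \<mu>_def)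
    next
      have "(\<Sum>b\<in>Basis. \<mu> b) = (\<Sum>b\<in>?J. \<alpha> / ?n) + (\<Sum>b\<in>?J'. (1 - \<alpha>) / c)"
        unfolding \<mu>_def by (subst sum.If_cases) (auto simp: Int_def)
      also have "\<dots> = ?n * (\<alpha> / ?n) + c * ((1 - \<alpha>) / c)" by (simp add: card_block_Basis c_def)
      also have "\<dots> = 1" using c by simp
      finally show "(\<Sum>b\<in>Basis. \<mu> b) = 1" .
    qed (use C1 C2 in \<open>auto simp: C_def\<close>)
    have 2: "(\<Prod>b\<in>Basis. (1 + \<bar>\<eta> \<bullet> b\<bar>) powr (Kb b * \<mu> b)) * (\<Prod>b\<in>Basis. (1 + \<bar>\<eta> \<bullet> b\<bar>) powr (if b $ i \<noteq> 0 then - \<alpha> else - 2)) \<ge> 1"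
      unfolding prod.distrib[symmetric]
    proof (rule prod_ge_1)
      fix b :: "real^'n^'m" assume b: "b \<in> Basis"
      have "Kb b * \<mu> b + (if b $ i \<noteq> 0 then - \<alpha> else - 2) \<ge> 0" using Kc by (simp add: Kb_def \<mu>_def)
      then have "1 \<le> (1 + \<bar>\<eta> \<bullet> b\<bar>) powr (Kb b * \<mu> b + (if b $ i \<noteq> 0 then - \<alpha> else - 2))" by (intro ge_one_powr_ge_zero) auto
      then show "1 \<le> (1 + \<bar>\<eta> \<bullet> b\<bar>) powr (Kb b * \<mu> b) * (1 + \<bar>\<eta> \<bullet> b\<bar>) powr (if b $ i \<noteq> 0 then - \<alpha> else - 2)" by (simp only: powr_add)
    qed
    have P: "0 \<le> (\<Prod>b\<in>Basis. (1 + \<bar>\<eta> \<bullet> b\<bar>) powr (if b $ i \<noteq> 0 then - \<alpha> else - 2))" by (intro prod_nonneg) auto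
    from mult_left_mono[OF 2 norm_ge_zero[of "bump_kernel s i B \<delta> \<eta>"]] mult_right_mono[OF 1 P]
    show ?thesis by (simp add: mult.assoc)
  qed
  moreover have "C \<ge> 0" using C1 C2 by (simp add: C_def)
  ultimately show ?thesis by blast
qed

section \<open>Summation over dyadic scales\<close>

lemma sum_geometric_down:
  fixes a :: real
  assumes "finite I" "0 \<le> a" "a < 1" "\<And>L. L \<in> I \<Longrightarrow> L \<le> L0 \<and> f L \<le> a ^ (L0 - L)"
  shows "(\<Sum>L\<in>I. f L) \<le> 1 / (1 - a)"
proof -
  have "(\<Sum>L\<in>I. f L) \<le> (\<Sum>L\<in>I. a ^ (L0 - L))" using assms by (intro sum_mono) auto
  also have "\<dots> = (\<Sum>k\<in>(\<lambda>L. L0 - L) ` I. a ^ k)"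
  proof (rule sum.reindex[unfolded o_def, symmetric], rule inj_onI)
    fix x y assume "x \<in> I" "y \<in> I" "L0 - x = L0 - y"
    moreover from this have "x \<le> L0" "y \<le> L0" using assms(4) by auto
    ultimately show "x = y" by linarith
  qed
  also have "\<dots> \<le> (\<Sum>k. a ^ k)" using assms by (intro sum_le_suminf) (auto intro: summable_geometric)
  also have "\<dots> = 1 / (1 - a)" using assms by (intro suminf_geometric) auto
  finally show ?thesis .
qed

lemma sum_geometric_up:
  fixes a :: real
  assumes "finite I" "0 \<le> a" "a < 1" "\<And>L. L \<in> I \<Longrightarrow> L1 \<le> L \<and> f L \<le> a ^ (L - L1)"
  shows "(\<Sum>L\<in>I. f L) \<le> 1 / (1 - a)"
proof -
  have "(\<Sum>L\<in>I. f L) \<le> (\<Sum>L\<in>I. a ^ (L - L1))" using assms by (intro sum_mono) auto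
  also have "\<dots> = (\<Sum>k\<in>(\<lambda>L. L - L1) ` I. a ^ k)"
  proof (rule sum.reindex[unfolded o_def, symmetric], rule inj_onI)
    fix x y assume "x \<in> I" "y \<in> I" "x - L1 = y - L1"
    moreover from this have "L1 \<le> x" "L1 \<le> y" using assms(4) by auto
    ultimately show "x = y" by linarith
  qed
  also have "\<dots> \<le> (\<Sum>k. a ^ k)" using assms by (intro sum_le_suminf) (auto intro: summable_geometric)
  also have "\<dots> = 1 / (1 - a)" using assms by (intro suminf_geometric) auto
  finally show ?thesis .
qed

text \<open>At fixed t the terms are dominated by an increasing geometric sequence as long as
  \<open>2 ^ L * t \<le> 1\<close> and by a decreasing one afterwards, so the sum stays bounded
  however large the index set. This is the sense in which different scales do not interact.\<close>

lemma dyadic_sum_bounded: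
  fixes \<kappa> \<alpha> :: real
  assumes "0 < \<kappa>" "\<kappa> < \<alpha>"
  shows "\<exists>D>0. \<forall>I t. finite I \<longrightarrow> t > 0 \<longrightarrow> (\<Sum>L\<in>I. (2 ^ L * t) powr \<kappa> * (1 + 2 ^ L * t) powr (-\<alpha>)) \<le> D"
proof -
  define a where "a = 2 powr (-\<kappa>)" define b where "b = 2 powr (-(\<alpha>-\<kappa>))"
  have a: "0 < a" "a < 1" using assms powr_less_mono[of "-\<kappa>" 0 2] by (auto simp: a_def)
  have b: "0 < b" "b < 1" using assms powr_less_mono[of "-(\<alpha>-\<kappa>)" 0 2] by (auto simp: b_def)
  define D where "D = 1 / (1 - a) + 1 / (1 - b)"
  have D: "D > 0" using a b by (auto simp: D_def intro!: add_pos_pos)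
  have pw: "(2 ^ k) powr e = (2 powr e) ^ k" for k and e :: real
    by (simp add: powr_realpow[symmetric] powr_powr powr_power mult.commute)
  have "(\<Sum>L\<in>I. (2 ^ L * t) powr \<kappa> * (1 + 2 ^ L * t) powr (-\<alpha>)) \<le> D" if I: "finite I" and t: "t > 0" for I :: "nat set" and t :: real
  proof -
    let ?g = "\<lambda>L. (2 ^ L * t) powr \<kappa> * (1 + 2 ^ L * t) powr (-\<alpha>)"
    let ?A = "{L\<in>I. 2 ^ L * t \<le> 1}" and ?B = "{L\<in>I. \<not> 2 ^ L * t \<le> 1}"
    have sa: "(\<Sum>L\<in>?A. ?g L) \<le> 1 / (1 - a)"
    proof (cases "?A = {}")
      case False
      define L0 where "L0 = Max ?A"
      have L0: "L0 \<in> ?A" unfolding L0_def by (rule Max_in) (use I False in auto)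
      show ?thesis
      proof (rule sum_geometric_down[where ?L0.0=L0])
        fix L assume L: "L \<in> ?A"
        have le: "L \<le> L0" unfolding L0_def by (rule Max_ge) (use I L in auto)
        have "2 ^ L * t = 2 ^ L0 * t / 2 ^ (L0 - L)" using le by (simp add: power_diff)
        also have "\<dots> \<le> 1 / 2 ^ (L0 - L)" using L0 by (intro divide_right_mono) auto
        finally have "(2 ^ L * t) powr \<kappa> \<le> (1 / 2 ^ (L0 - L)) powr \<kappa>" using t assms by (intro powr_mono2) auto
        also have "\<dots> = a ^ (L0 - L)" by (simp add: powr_divide pw a_def powr_minus power_inverse inverse_eq_divide power_one_over)
        finally have "(2 ^ L * t) powr \<kappa> \<le> a ^ (L0 - L)" .
        moreover have "(1 + 2 ^ L * t) powr (-\<alpha>) \<le> 1"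
          using t assms powr_mono2'[of "-\<alpha>" 1 "1 + 2 ^ L * t"] by simp
        ultimately have "?g L \<le> a ^ (L0 - L) * 1" by (intro mult_mono) (use a in auto)
        then show "L \<le> L0 \<and> ?g L \<le> a ^ (L0 - L)" using le by simp
      qed (use a I in auto)
    next
      case True show ?thesis unfolding True using a by simp
    qed
    have sb: "(\<Sum>L\<in>?B. ?g L) \<le> 1 / (1 - b)"
    proof (cases "?B = {}")
      case False
      define L1 where "L1 = Min ?B"
      have L1: "L1 \<in> ?B" unfolding L1_def by (rule Min_in) (use I False in auto)
      show ?thesis
      proof (rule sum_geometric_up[where ?L1.0=L1])
        fix L assume L: "L \<in> ?B"
        have le: "L1 \<le> L" unfolding L1_def by (rule Min_le) (use I L in auto)
        have x: "2 ^ L * t > 0" using t by simp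
        have "2 ^ (L - L1) * 1 \<le> 2 ^ (L - L1) * (2 ^ L1 * t)" using L1 by (intro mult_left_mono) auto
        also have "\<dots> = 2 ^ L * t" using le by (simp add: mult.assoc[symmetric] power_add[symmetric])
        finally have lt: "2 ^ (L - L1) \<le> 2 ^ L * t" by simp
        have "?g L \<le> (2 ^ L * t) powr \<kappa> * (2 ^ L * t) powr (-\<alpha>)"
          using x assms by (intro mult_left_mono powr_mono2') auto
        also have "\<dots> = (2 ^ L * t) powr (-(\<alpha>-\<kappa>))" by (simp add: powr_add[symmetric])
        also have "\<dots> \<le> (2 ^ (L - L1)) powr (-(\<alpha>-\<kappa>))" using lt assms by (intro powr_mono2') auto
        also have "\<dots> = b ^ (L - L1)" by (simp only: pw b_def)
        finally show "L1 \<le> L \<and> ?g L \<le> b ^ (L - L1)" using le by simp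
      qed (use b I in auto)
    next
      case True show ?thesis unfolding True using b by simp
    qed
    have "(\<Sum>L\<in>I. ?g L) = (\<Sum>L\<in>?A. ?g L) + (\<Sum>L\<in>?B. ?g L)"
    proof -
      have "I = ?A \<union> ?B" by auto
      then have "(\<Sum>L\<in>I. ?g L) = (\<Sum>L\<in>?A \<union> ?B. ?g L)" by simp
      also have "\<dots> = (\<Sum>L\<in>?A. ?g L) + (\<Sum>L\<in>?B. ?g L)" by (rule sum.union_disjoint) (use I in auto)
      finally show ?thesis .
    qed
    then show ?thesis using sa sb by (simp add: D_def)
  qed
  then show ?thesis using D by blast
qed

text \<open>Jensen's inequality for the power \<open>r\<close>, with the weights
  \<open>\<psi> L\<close> normalised by their sum. The weights survive on the right with exponent
  one, and no power of the number of terms is lost.\<close>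

lemma weighted_power_sum:
  fixes \<psi> R :: "nat \<Rightarrow> real"
  assumes "1 \<le> r" "finite I" "\<And>L. L \<in> I \<Longrightarrow> 0 \<le> \<psi> L" "\<And>L. L \<in> I \<Longrightarrow> 0 < R L" "(\<Sum>L\<in>I. \<psi> L) \<le> D" "0 < D"
  shows "(\<Sum>L\<in>I. \<psi> L * R L) powr r \<le> D powr (r - 1) * (\<Sum>L\<in>I. \<psi> L * R L powr r)"
proof (cases "(\<Sum>L\<in>I. \<psi> L) = 0")
  case True
  then have "\<forall>L\<in>I. \<psi> L = 0" using assms by (simp add: sum_nonneg_eq_0_iff)
  then show ?thesis by simp
next
  case False
  define S where "S = (\<Sum>L\<in>I. \<psi> L)"
  have S: "S > 0" using False assms by (simp add: S_def less_le sum_nonneg)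
  have "I \<noteq> {}" using False by auto
  have "(\<Sum>L\<in>I. (\<psi> L / S) *\<^sub>R R L) powr r \<le> (\<Sum>L\<in>I. (\<psi> L / S) * R L powr r)"
    by (rule convex_on_sum[OF assms(2) \<open>I \<noteq> {}\<close> powr_convex[OF assms(1)]])
       (use assms S in \<open>auto simp: sum_divide_distrib[symmetric] S_def[symmetric]\<close>)
  then have *: "(\<Sum>L\<in>I. (\<psi> L / S) * R L) powr r \<le> (\<Sum>L\<in>I. (\<psi> L / S) * R L powr r)" by simp
  have e1: "(\<Sum>L\<in>I. \<psi> L * R L) = S * (\<Sum>L\<in>I. (\<psi> L / S) * R L)" using S by (simp add: sum_distrib_left)
  have e2: "(\<Sum>L\<in>I. (\<psi> L / S) * R L powr r) = (\<Sum>L\<in>I. \<psi> L * R L powr r) / S" by (simp add: sum_divide_distrib)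
  have nn: "0 \<le> (\<Sum>L\<in>I. \<psi> L * R L powr r)" using assms(3) by (intro sum_nonneg) auto
  have "(\<Sum>L\<in>I. \<psi> L * R L) powr r = S powr r * (\<Sum>L\<in>I. (\<psi> L / S) * R L) powr r" unfolding e1 by (rule powr_mult)
  also have "\<dots> \<le> S powr r * ((\<Sum>L\<in>I. \<psi> L * R L powr r) / S)" using * unfolding e2 by (intro mult_left_mono) auto
  also have "\<dots> = S powr (r - 1) * (\<Sum>L\<in>I. \<psi> L * R L powr r)" using S by (simp add: powr_diff)
  also have "\<dots> \<le> D powr (r - 1) * (\<Sum>L\<in>I. \<psi> L * R L powr r)"
    using S assms nn by (intro mult_right_mono powr_mono2) (auto simp: S_def)
  finally show ?thesis .
qed

lemma nn_integral_dyadic_scale: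
  fixes f :: "real \<Rightarrow> ennreal"
  assumes [measurable]: "f \<in> borel_measurable borel"
  shows "(\<integral>\<^sup>+t. ennreal (2 ^ L) * f (2 ^ L * t) \<partial>lborel) = (\<integral>\<^sup>+t. f t \<partial>lborel)"
proof -
  have "(\<integral>\<^sup>+t. f t \<partial>lborel) = ennreal (2 ^ L) * (\<integral>\<^sup>+t. f (2 ^ L * t) \<partial>lborel)"
    using nn_integral_real_affine[of f "2 ^ L" 0] by simp
  then show ?thesis by (simp add: nn_integral_cmult)
qed

text \<open>Majorant for the potential of the bump of width \<open>2^-L\<close>: the factor
  \<open>2 powr (L / r)\<close> makes the \<open>L^r\<close> norm in each coordinate of block i
  independent of \<open>L\<close>.\<close>

definition dyadic_profile :: "'m \<Rightarrow> real \<Rightarrow> real \<Rightarrow> nat \<Rightarrow> real^'n^'m \<Rightarrow> real" where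
  "dyadic_profile i r \<alpha> L \<xi> = (\<Prod>b\<in>Basis. if b $ i \<noteq> 0 then 2 powr (L / r) * (1 + 2 ^ L * \<bar>\<xi> \<bullet> b\<bar>) powr (-\<alpha>) else (1 + \<bar>\<xi> \<bullet> b\<bar>) powr (-2))"

text \<open>The bound is linear in the number of scales rather than of order
  \<open>card I powr r\<close>. In a single coordinate t of block i the profiles are
  \<open>\<bar>t\<bar> powr (- 1 / r)\<close> times weights with bounded sum over the scales;
  Jensen's inequality with these weights reduces the integral to a sum over \<open>L\<close> of
  integrals that, by dilation, do not depend on \<open>L\<close>.\<close>

lemma dyadic_profile_sum_bound:
  fixes i :: "'m::finite"
  assumes r: "1 < r" and \<alpha>: "1 / r < \<alpha>"
  shows "\<exists>C\<ge>0. \<forall>I. finite I \<longrightarrow> (\<integral>\<^sup>+\<xi>. ennreal ((\<Sum>L\<in>I. dyadic_profile i r \<alpha> L (\<xi>::real^'n^'m)) powr r) \<partial>lborel) \<le> ennreal (C * real (card I))"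
proof -
  obtain D where D: "D > 0" "\<And>I t. finite I \<Longrightarrow> t > 0 \<Longrightarrow> (\<Sum>L\<in>I. (2 ^ L * t) powr (1/r) * (1 + 2 ^ L * t) powr (-\<alpha>)) \<le> D"
    using dyadic_sum_bounded[of "1/r" \<alpha>] r \<alpha> by auto
  obtain b0 :: "real^'n^'m" where b0: "b0 \<in> Basis" "b0 $ i \<noteq> 0"
    using axis_in_Basis_iff[THEN iffD2, OF SOME_Basis, of i] by (metis axis_nth_ne_zero_iff SOME_Basis)
  \<comment> \<open>The integrand that remains after Jensen's inequality. In the coordinate
    \<open>b0\<close> the weight enters to the first power only, which gives the exponents
    \<open>-(1 - 1/r)\<close> and \<open>-\<alpha>\<close>: integrable at zero because
    \<open>1 / r > 0\<close>, at infinity because \<open>\<alpha> > 1 / r\<close>.\<close>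
  define f where "f L b t = (if b = b0 then 2 ^ L * (\<bar>2 ^ L * t\<bar> powr (-(1 - 1/r)) * (1 + \<bar>2 ^ L * t\<bar>) powr (-\<alpha>))
     else if b $ i \<noteq> 0 then 2 ^ L * (1 + \<bar>2 ^ L * t\<bar>) powr (-(\<alpha> * r)) else (1 + \<bar>t\<bar>) powr (-(2 * r)))" for L :: nat and b :: "real^'n^'m" and t :: real
  have fm[measurable]: "f L b \<in> borel_measurable borel" for L b unfolding f_def by measurable
  have f0: "0 \<le> f L b t" for L b t by (auto simp: f_def)
  define c where "c b = (\<integral>\<^sup>+t. ennreal (f 0 b t) \<partial>lborel)" for b
  have nn0: "(\<integral>\<^sup>+t. ennreal ((1 + \<bar>t\<bar>) powr (-\<gamma>)) \<partial>lborel) < \<infinity>" if "1 < \<gamma>" for \<gamma>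
  proof -
    have "(\<integral>\<^sup>+t. ennreal (\<bar>t\<bar> powr (-0) * (1 + \<bar>t\<bar>) powr (-\<gamma>)) \<partial>lborel) < \<infinity>"
      by (rule nn_integral_powr_weight_finite) (use that in auto)
    also have "(\<integral>\<^sup>+t. ennreal (\<bar>t\<bar> powr (-0) * (1 + \<bar>t\<bar>) powr (-\<gamma>)) \<partial>lborel) = (\<integral>\<^sup>+t. ennreal ((1 + \<bar>t\<bar>) powr (-\<gamma>)) \<partial>lborel)"
      by (rule nn_integral_cong_AE) (use AE_lborel_singleton[of "0::real"] in \<open>auto elim!: eventually_mono\<close>)
    finally show ?thesis .
  qed
  have ar: "1 < \<alpha> * r" using \<alpha> r by (simp add: field_simps)
  have cfin: "c b < \<infinity>" for b
  proof -
    have "(\<integral>\<^sup>+t. ennreal (\<bar>t\<bar> powr (-(1 - 1/r)) * (1 + \<bar>t\<bar>) powr (-\<alpha>)) \<partial>lborel) < \<infinity>"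
      by (rule nn_integral_powr_weight_finite) (use r \<alpha> in \<open>auto simp: field_simps\<close>)
    then show ?thesis using nn0[OF ar] nn0[of "2 * r"] r unfolding c_def f_def by (cases "b = b0"; cases "b $ i \<noteq> 0") auto
  qed
  have fint: "(\<integral>\<^sup>+t. ennreal (f L b t) \<partial>lborel) = c b" for L b
  proof -
    consider "b = b0" | "b \<noteq> b0" "b $ i \<noteq> 0" | "b \<noteq> b0" "b $ i = 0" by blast
    then show ?thesis
    proof cases
      case 1
      then show ?thesis using nn_integral_dyadic_scale[of "\<lambda>t. ennreal (\<bar>t\<bar> powr (-(1 - 1/r)) * (1 + \<bar>t\<bar>) powr (-\<alpha>))" L]
        unfolding c_def f_def by (simp add: ennreal_mult'')
    next
      case 2
      then show ?thesis using nn_integral_dyadic_scale[of "\<lambda>t. ennreal ((1 + \<bar>t\<bar>) powr (-(\<alpha> * r)))" L]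
        unfolding c_def f_def by (simp add: ennreal_mult'')
    qed (simp add: c_def f_def)
  qed
  define C where "C = D powr (r - 1) * enn2real (\<Prod>b\<in>Basis. c b)"
  have Cfin: "(\<Prod>b\<in>Basis. c b) < \<infinity>" using cfin by (auto simp: ennreal_prod_eq_top less_top[symmetric])
  have pint: "(\<integral>\<^sup>+\<xi>. ennreal (\<Prod>b\<in>Basis. f L b (\<xi> \<bullet> b)) \<partial>lborel) = (\<Prod>b\<in>Basis. c b)" for L
  proof -
    have "(\<integral>\<^sup>+\<xi>. ennreal (\<Prod>b\<in>Basis. f L b (\<xi> \<bullet> b)) \<partial>lborel) = (\<integral>\<^sup>+\<xi>. (\<Prod>b\<in>Basis. ennreal (f L b (\<xi> \<bullet> b))) \<partial>lborel)"
      by (simp add: prod_ennreal f0)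
    also have "\<dots> = (\<Prod>b\<in>Basis. (\<integral>\<^sup>+t. ennreal (f L b t) \<partial>lborel))" by (rule nn_integral_lborel_prod) auto
    finally show ?thesis by (simp add: fint)
  qed
  have main: "(\<Sum>L\<in>I. dyadic_profile i r \<alpha> L \<xi>) powr r \<le> D powr (r - 1) * (\<Sum>L\<in>I. \<Prod>b\<in>Basis. f L b (\<xi> \<bullet> b))"
    if I: "finite I" and \<xi>: "\<forall>b\<in>Basis. \<xi> \<bullet> b \<noteq> 0" for I \<xi>
  proof -
    define t where "t = \<bar>\<xi> \<bullet> b0\<bar>"
    have t: "t > 0" using \<xi> b0 by (simp add: t_def)
    define h where "h L b = (if b $ i \<noteq> 0 then 2 powr (L / r) * (1 + 2 ^ L * \<bar>\<xi> \<bullet> b\<bar>) powr (-\<alpha>) else (1 + \<bar>\<xi> \<bullet> b\<bar>) powr (-2))" for L :: nat and b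
    define R where "R L = (\<Prod>b\<in>Basis - {b0}. h L b)" for L
    define \<psi> where "\<psi> L = (2 ^ L * t) powr (1/r) * (1 + 2 ^ L * t) powr (-\<alpha>)" for L
    have h0: "0 \<le> h L b" for L b by (auto simp: h_def)
    have R0: "0 < R L" for L unfolding R_def h_def by (intro prod_pos) (auto simp: add_nonneg_eq_0_iff)
    have pw: "(2 powr (L / r)) = (2 ^ L) powr (1/r)" for L :: nat by (simp add: powr_realpow[symmetric] powr_powr)
    have prof: "dyadic_profile i r \<alpha> L \<xi> = t powr (-(1/r)) * (\<psi> L * R L)" for L
    proof -
      have "dyadic_profile i r \<alpha> L \<xi> = h L b0 * R L"
        unfolding dyadic_profile_def h_def[symmetric] R_def by (rule prod.remove) (use b0 in auto)
      also have "h L b0 = t powr (-(1/r)) * \<psi> L"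
        using t b0 by (simp add: h_def \<psi>_def t_def[symmetric] pw powr_mult powr_minus)
      finally show ?thesis by simp
    qed
    have fh: "f L b (\<xi> \<bullet> b) = h L b powr r" if "b \<noteq> b0" for L b
    proof (cases "b $ i \<noteq> 0")
      case True
      have "(2 powr (L / r)) powr r = 2 ^ L" using r by (simp add: powr_powr powr_realpow)
      then show ?thesis using True that by (simp add: f_def h_def powr_mult powr_powr abs_mult)
    qed (use that in \<open>simp add: f_def h_def powr_powr\<close>)
    have fb0: "f L b0 (\<xi> \<bullet> b0) = t powr (-1) * \<psi> L" for L
    proof -
      have "2 ^ L * ((2 ^ L * t) powr (-(1 - 1/r)) * (1 + 2 ^ L * t) powr (-\<alpha>)) = t powr (-1) * ((2 ^ L * t) powr 1 * (2 ^ L * t) powr (-(1 - 1/r)) * (1 + 2 ^ L * t) powr (-\<alpha>))"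
        using t by (simp add: powr_minus field_simps)
      also have "(2 ^ L * t) powr 1 * (2 ^ L * t) powr (-(1 - 1/r)) = (2 ^ L * t) powr (1/r)" by (simp only: powr_add[symmetric]) simp
      finally show ?thesis using t by (simp add: f_def \<psi>_def t_def abs_mult)
    qed
    have pf: "(\<Prod>b\<in>Basis. f L b (\<xi> \<bullet> b)) = t powr (-1) * (\<psi> L * R L powr r)" for L
    proof -
      have "(\<Prod>b\<in>Basis. f L b (\<xi> \<bullet> b)) = f L b0 (\<xi> \<bullet> b0) * (\<Prod>b\<in>Basis - {b0}. f L b (\<xi> \<bullet> b))"
        by (rule prod.remove) (use b0 in auto)
      also have "(\<Prod>b\<in>Basis - {b0}. f L b (\<xi> \<bullet> b)) = (\<Prod>b\<in>Basis - {b0}. h L b powr r)" by (intro prod.cong) (auto simp: fh)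
      also have "\<dots> = R L powr r" unfolding R_def by (rule prod_powr_distrib[symmetric])
      finally show ?thesis by (simp add: fb0)
    qed
    have "(\<Sum>L\<in>I. dyadic_profile i r \<alpha> L \<xi>) powr r = (t powr (-(1/r)) * (\<Sum>L\<in>I. \<psi> L * R L)) powr r"
      by (simp add: prof sum_distrib_left)
    also have "\<dots> = t powr (-1) * (\<Sum>L\<in>I. \<psi> L * R L) powr r" using r by (simp add: powr_mult powr_powr)
    also have "\<dots> \<le> t powr (-1) * (D powr (r - 1) * (\<Sum>L\<in>I. \<psi> L * R L powr r))"
      by (intro mult_left_mono weighted_power_sum) (use r I R0 D t in \<open>auto simp: \<psi>_def\<close>)
    also have "\<dots> = D powr (r - 1) * (\<Sum>L\<in>I. \<Prod>b\<in>Basis. f L b (\<xi> \<bullet> b))" unfolding pf sum_distrib_left[symmetric] by simp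
    finally show ?thesis .
  qed
  have "(\<integral>\<^sup>+\<xi>. ennreal ((\<Sum>L\<in>I. dyadic_profile i r \<alpha> L (\<xi>::real^'n^'m)) powr r) \<partial>lborel) \<le> ennreal (C * real (card I))" if I: "finite I" for I
  proof -
    have "(\<integral>\<^sup>+\<xi>. ennreal ((\<Sum>L\<in>I. dyadic_profile i r \<alpha> L (\<xi>::real^'n^'m)) powr r) \<partial>lborel)
       \<le> (\<integral>\<^sup>+\<xi>. ennreal (D powr (r - 1)) * (\<Sum>L\<in>I. ennreal (\<Prod>b\<in>Basis. f L b (\<xi> \<bullet> b))) \<partial>lborel)"
    proof (rule nn_integral_mono_AE)
      show "AE \<xi>::real^'n^'m in lborel. ennreal ((\<Sum>L\<in>I. dyadic_profile i r \<alpha> L \<xi>) powr r) \<le> ennreal (D powr (r - 1)) * (\<Sum>L\<in>I. ennreal (\<Prod>b\<in>Basis. f L b (\<xi> \<bullet> b)))"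
        using AE_inner_Basis_ne_0
      proof eventually_elim
        case (elim \<xi>)
        have "ennreal ((\<Sum>L\<in>I. dyadic_profile i r \<alpha> L \<xi>) powr r) \<le> ennreal (D powr (r - 1) * (\<Sum>L\<in>I. \<Prod>b\<in>Basis. f L b (\<xi> \<bullet> b)))"
          by (rule ennreal_leI[OF main[OF I elim]])
        also have "\<dots> = ennreal (D powr (r - 1)) * (\<Sum>L\<in>I. ennreal (\<Prod>b\<in>Basis. f L b (\<xi> \<bullet> b)))"
        proof -
          have "ennreal (\<Sum>L\<in>I. \<Prod>b\<in>Basis. f L b (\<xi> \<bullet> b)) = (\<Sum>L\<in>I. ennreal (\<Prod>b\<in>Basis. f L b (\<xi> \<bullet> b)))"
            by (rule sum_ennreal[symmetric]) (auto intro!: prod_nonneg f0)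
          then show ?thesis by (simp add: ennreal_mult')
        qed
        finally show ?case .
      qed
    qed
    also have "\<dots> = ennreal (D powr (r - 1)) * (\<Sum>L\<in>I. (\<integral>\<^sup>+\<xi>. ennreal (\<Prod>b\<in>Basis. f L b (\<xi> \<bullet> b)) \<partial>(lborel::(real^'n^'m) measure)))"
      by (subst nn_integral_cmult) (auto simp: nn_integral_sum)
    also have "\<dots> = ennreal (D powr (r - 1)) * (of_nat (card I) * (\<Prod>b\<in>Basis. c b))" by (simp add: pint)
    also have "(\<Prod>b\<in>Basis. c b) = ennreal (enn2real (\<Prod>b\<in>Basis. c b))" using Cfin by simp
    also have "ennreal (D powr (r - 1)) * (of_nat (card I) * ennreal (enn2real (\<Prod>b\<in>Basis. c b))) = ennreal (C * card I)"
      by (simp add: C_def ennreal_mult'' ennreal_of_nat_eq_real_of_nat mult_ac)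
    finally show ?thesis .
  qed
  moreover have "C \<ge> 0" by (simp add: C_def)
  ultimately show ?thesis by (intro exI[of _ C] conjI allI impI)
qed

section \<open>Potentials of translated Gaussian bumps\<close>

lemma scale_block_compose: "scale_block i a (scale_block i b x) = scale_block i (a * b) x"
  by (simp add: scale_block_def vec_eq_iff)

lemma scale_block_one [simp]: "scale_block i 1 x = x"
  by (simp add: scale_block_def vec_eq_iff)

lemma scale_block_inner:
  fixes x y :: "real^'n^'m"
  shows "scale_block i a x \<bullet> y = x \<bullet> scale_block i a y"
proof -
  have 1: "scale_block i a x \<bullet> y = (\<Sum>j\<in>UNIV. scale_block i a x $ j \<bullet> y $ j)" by (rule inner_vec_def)
  have 2: "x \<bullet> scale_block i a y = (\<Sum>j\<in>UNIV. x $ j \<bullet> scale_block i a y $ j)" by (rule inner_vec_def)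
  have 3: "scale_block i a x $ j \<bullet> y $ j = x $ j \<bullet> scale_block i a y $ j" for j by (cases "j = i") (simp_all add: scale_block_def)
  show ?thesis unfolding 1 2 3 by (rule refl)
qed

lemma lborel_integral_scale_block:
  fixes f :: "real^'n^'m \<Rightarrow> complex" and i :: "'m::finite"
  assumes f[measurable]: "f \<in> borel_measurable borel" and \<delta>: "0 < \<delta>"
  shows "(LINT x|lborel. f x) = of_real (\<delta> ^ CARD('n)) * (LINT x|lborel. f (scale_block i \<delta> x))"
proof -
  define c where "c j = (if j $ i \<noteq> 0 then \<delta> else 1)" for j :: "real^'n^'m"
  have T: "(\<lambda>x. 0 + (\<Sum>j\<in>Basis. (c j * (x \<bullet> j)) *\<^sub>R j)) = (scale_block i \<delta> :: real^'n^'m \<Rightarrow> real^'n^'m)"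
  proof (rule ext, rule euclidean_eqI)
    fix x b :: "real^'n^'m" assume b: "b \<in> Basis"
    show "(0 + (\<Sum>j\<in>Basis. (c j * (x \<bullet> j)) *\<^sub>R j)) \<bullet> b = scale_block i \<delta> x \<bullet> b"
      unfolding scale_block_inner_Basis[OF b] add_0_left inner_sum_left_Basis[OF b] c_def by (rule refl)
  qed
  have p: "(\<Prod>j\<in>Basis. \<bar>c j\<bar>) = \<delta> ^ CARD('n)"
  proof -
    have "(\<Prod>j\<in>Basis. \<bar>c j\<bar>) = (\<Prod>j\<in>(Basis :: (real^'n^'m) set). if j $ i \<noteq> 0 then \<delta> else 1)" using \<delta> by (intro prod.cong) (auto simp: c_def)
    also have "\<dots> = (\<Prod>j\<in>{j\<in>Basis :: (real^'n^'m) set. j $ i \<noteq> 0}. \<delta>)" by (rule prod.inter_filter[symmetric]) simp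
    finally show ?thesis by (simp add: card_block_Basis)
  qed
  have sm[measurable]: "(scale_block i \<delta> :: real^'n^'m \<Rightarrow> real^'n^'m) \<in> borel_measurable borel"
    by (intro borel_measurable_continuous_onI continuous_on_scale_block)
  have eq: "lborel = density (distr lborel borel (scale_block i \<delta> :: real^'n^'m \<Rightarrow> real^'n^'m)) (\<lambda>_. ennreal (\<delta> ^ CARD('n)))"
    using lborel_affine_euclidean[of c "0::real^'n^'m"] \<delta> unfolding T p by (auto simp: c_def)
  have "(LINT x|lborel. f x) = (LINT x|density (distr lborel borel (scale_block i \<delta> :: real^'n^'m \<Rightarrow> real^'n^'m)) (\<lambda>_. ennreal (\<delta> ^ CARD('n))). f x)"
    by (subst eq) (rule refl)
  also have "\<dots> = (LINT x|distr lborel borel (scale_block i \<delta> :: real^'n^'m \<Rightarrow> real^'n^'m). (\<delta> ^ CARD('n)) *\<^sub>R f x)"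
    by (rule integral_density) (use \<delta> in auto)
  also have "\<dots> = (LINT x|lborel. (\<delta> ^ CARD('n)) *\<^sub>R f (scale_block i \<delta> x))"
    by (rule integral_distr) auto
  also have "\<dots> = of_real (\<delta> ^ CARD('n)) * (LINT x|lborel. f (scale_block i \<delta> x))"
    by (simp add: scaleR_conv_of_real)
  finally show ?thesis .
qed

text \<open>Width \<open>\<delta>\<close> in block i around \<open>\<theta>\<close>, cut off by the
  fixed bump \<open>B\<close>, which alone localises the other blocks.\<close>

definition translated_gaussian :: "'m \<Rightarrow> (real^'n^'m \<Rightarrow> complex) \<Rightarrow> real^'n \<Rightarrow> real \<Rightarrow> real^'n^'m \<Rightarrow> complex" where
  "translated_gaussian i B \<theta> \<delta> \<xi> = complex_of_real (exp (- pi * (norm (\<xi> $ i - \<theta>) / \<delta>)\<^sup>2)) * B \<xi>"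

definition sobolev_potential :: "('m::finite \<Rightarrow> real) \<Rightarrow> (real^'n^'m \<Rightarrow> complex) \<Rightarrow> real^'n^'m \<Rightarrow> complex" where
  "sobolev_potential s F \<xi> = (LINT x|lborel. complex_of_real (sobolev_weight s x) * fourier F x * cis (2 * pi * (x \<bullet> \<xi>)))"

text \<open>Decay in the product form delivered by \<open>prod_decay\<close>; it beats the
  polynomial growth of the Sobolev weight.\<close>

definition coord_decreasing :: "('a::euclidean_space \<Rightarrow> complex) \<Rightarrow> bool" where
  "coord_decreasing h \<longleftrightarrow> continuous_on UNIV h \<and> (\<forall>q. \<exists>C\<ge>0. \<forall>x. norm (h x) \<le> C / (\<Prod>b\<in>Basis. (1 + \<bar>x \<bullet> b\<bar>) ^ q))"

lemma uniformly_schwartz_coord_decreasing: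
  fixes f :: "'a::euclidean_space \<Rightarrow> complex"
  assumes "uniformly_schwartz F" "f \<in> F" shows "coord_decreasing (fourier f)"
  unfolding coord_decreasing_def
proof (intro conjI allI)
  show "continuous_on UNIV (fourier f)" by (rule fourier_continuous[OF uniformly_schwartz_rapidly_decreasing[OF assms]])
  fix q
  obtain C where C: "C \<ge> 0" "\<forall>f\<in>F. \<forall>b\<in>Basis. dir_bounded b 0 (fourier f) (\<lambda>y. C / (\<Prod>b\<in>Basis. (1 + \<bar>y \<bullet> b\<bar>) ^ q))"
    using uniformly_schwartz_fourier[OF assms(1), of 0 q] by blast
  have "dir_bounded (SOME b. b \<in> Basis) 0 (fourier f) (\<lambda>y. C / (\<Prod>b\<in>Basis. (1 + \<bar>y \<bullet> b\<bar>) ^ q))"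
    using C(2) assms(2) SOME_Basis by blast
  then show "\<exists>C\<ge>0. \<forall>x. norm (fourier f x) \<le> C / (\<Prod>b\<in>Basis. (1 + \<bar>x \<bullet> b\<bar>) ^ q)" using C(1) by auto
qed

lemma weight_coord_decreasing_integrable:
  fixes s :: "'m::finite \<Rightarrow> real" and h :: "real^'n^'m \<Rightarrow> complex"
  assumes s: "\<And>j. 0 \<le> s j" and h: "coord_decreasing h"
  shows "integrable lborel (\<lambda>x. complex_of_real (sobolev_weight s x) * h x)"
proof -
  obtain A N where AN: "A \<ge> 0" "\<And>y::real^'n^'m. sobolev_weight s y \<le> A * (1 + norm y) ^ N"
    using sobolev_weight_growth[where s=s, OF s] by blast
  obtain C where C: "C \<ge> 0" "\<And>x. norm (h x) \<le> C / (\<Prod>b\<in>Basis. (1 + \<bar>x \<bullet> b\<bar>) ^ (N + 2))"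
    using h unfolding coord_decreasing_def by blast
  show ?thesis
  proof (rule integrable_bounded_by[OF _ integrable_mult_right[OF integrable_inverse_square_prod, of "A * C"]])
    show "continuous_on UNIV (\<lambda>x. complex_of_real (sobolev_weight s x) * h x)"
      using h unfolding coord_decreasing_def by (intro continuous_intros continuous_sobolev_weight) auto
    fix x :: "real^'n^'m"
    let ?P = "\<Prod>b\<in>Basis. (1 + \<bar>x \<bullet> b\<bar>)"
    have P1: "?P \<ge> 1" using norm_le_prod_Basis[of x] norm_ge_zero[of x] by linarith
    have Pe: "(\<Prod>b\<in>Basis. (1 + \<bar>x \<bullet> b\<bar>) ^ (N+2)) = ?P ^ N * ?P ^ 2" unfolding prod_power_distrib[symmetric] by (rule power_add)
    have i2: "(\<Prod>b\<in>Basis. 1 / (1 + \<bar>x \<bullet> b\<bar>)^2) = 1 / ?P ^ 2" by (simp add: prod_dividef prod_power_distrib)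
    have w: "sobolev_weight s x \<le> A * ?P ^ N"
      using AN(2)[of x] mult_left_mono[OF power_mono[OF norm_le_prod_Basis[of x], of N] AN(1)] by simp
    have "norm (complex_of_real (sobolev_weight s x) * h x) = sobolev_weight s x * norm (h x)"
      by (simp add: norm_mult sobolev_weight_nonneg)
    also have "\<dots> \<le> (A * ?P ^ N) * (C / (?P ^ N * ?P ^ 2))"
      by (rule mult_mono[OF w C(2)[of x, unfolded Pe]]) (use AN P1 in auto)
    also have "\<dots> = A * C * (1 / ?P ^ 2)" using P1 by (simp add: field_simps)
    finally show "norm (complex_of_real (sobolev_weight s x) * h x) \<le> A * C * (\<Prod>b\<in>Basis. 1 / (1 + \<bar>x \<bullet> b\<bar>)^2)" unfolding i2 .
  qed
qed

lemma smooth_bump_translate: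
  assumes "smooth_bump B" shows "smooth_bump (\<lambda>\<xi>. B (\<xi> + \<Theta>))"
proof -
  obtain R where R: "\<And>x. norm x > R \<Longrightarrow> B x = 0" using assms unfolding smooth_bump_def by blast
  have "B (x + \<Theta>) = 0" if "norm x > R + norm \<Theta>" for x
    using R[of "x + \<Theta>"] norm_triangle_ineq4[of "x + \<Theta>" \<Theta>] that by simp
  moreover have "\<exists>C\<ge>0. \<forall>b\<in>Basis. dir_bounded b K (\<lambda>\<xi>. B (\<xi> + \<Theta>)) (\<lambda>_. C)" for K
  proof -
    obtain C where C: "C \<ge> 0" "\<And>b. b \<in> Basis \<Longrightarrow> dir_bounded b K B (\<lambda>_. C)" using assms unfolding smooth_bump_def by blast
    have "dir_bounded b K (\<lambda>\<xi>. B (\<xi> + \<Theta>)) (\<lambda>_. C)" if "b \<in> Basis" for b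
      by (rule dir_bounded_compose[OF C(2)[OF that], where c=1]) (auto intro!: continuous_intros)
    then show ?thesis using C(1) by blast
  qed
  ultimately show ?thesis unfolding smooth_bump_def by blast
qed

lemma smooth_bump_cont: "smooth_bump B \<Longrightarrow> continuous_on UNIV B"
  unfolding smooth_bump_def using dir_bounded_cont SOME_Basis by metis

lemma gaussian_bump_cont: "smooth_bump B \<Longrightarrow> continuous_on UNIV (gaussian_bump i B \<delta>)"
  unfolding gaussian_bump_def using continuous_on_compose2[OF smooth_bump_cont continuous_on_scale_block]
  by (intro continuous_intros) auto

context
  fixes i :: "'m::finite" and B :: "real^'n^'m \<Rightarrow> complex" and \<theta> :: "real^'n" and \<delta> :: real
  assumes B: "smooth_bump B" and \<delta>: "0 < \<delta>" "\<delta> \<le> 1"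
begin

abbreviation (input) "Th \<equiv> (axis i \<theta> :: real^'n^'m)"
abbreviation (input) "Bt \<equiv> (\<lambda>\<xi>. B (\<xi> + Th))"
abbreviation (input) "Eb \<equiv> gaussian_bump i Bt \<delta>"

lemma translated_gaussian_eq: "translated_gaussian i B \<theta> \<delta> \<xi> = Eb (scale_block i (1 / \<delta>) (\<xi> - Th))"
proof -
  have "norm (scale_block i (1 / \<delta>) (\<xi> - Th) $ i) = norm (\<xi> $ i - \<theta>) / \<delta>"
    using \<delta> by (simp add: scale_block_def divide_inverse mult.commute)
  then show ?thesis using \<delta> by (simp add: translated_gaussian_def gaussian_bump_def scale_block_compose)
qed

lemma fourier_translated_gaussian:
  "fourier (translated_gaussian i B \<theta> \<delta>) x = cis (- 2 * pi * (Th \<bullet> x)) * of_real (\<delta> ^ CARD('n)) * fourier Eb (scale_block i \<delta> x)"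
proof -
  have cE: "continuous_on UNIV Eb" by (rule gaussian_bump_cont[OF smooth_bump_translate[OF B]])
  have cEs: "continuous_on UNIV (\<lambda>\<xi>. Eb (scale_block i (1 / \<delta>) \<xi>))"
    by (rule continuous_on_compose2[OF cE continuous_on_scale_block]) auto
  have m: "(\<lambda>\<xi>. Eb (scale_block i (1 / \<delta>) \<xi>) * cis (- 2 * pi * ((\<xi> + Th) \<bullet> x))) \<in> borel_measurable borel"
    by (rule continuous_borel_complex) (intro continuous_intros cEs)
  have "fourier (translated_gaussian i B \<theta> \<delta>) x = (LINT \<xi>|lborel. Eb (scale_block i (1 / \<delta>) (\<xi> - Th)) * cis (- 2 * pi * (\<xi> \<bullet> x)))"
    unfolding fourier_def translated_gaussian_eq ..
  also have "\<dots> = (LINT \<xi>|lborel. (\<lambda>\<xi>. Eb (scale_block i (1 / \<delta>) \<xi>) * cis (- 2 * pi * ((\<xi> + Th) \<bullet> x))) (\<xi> + - Th))"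
    by simp
  also have "\<dots> = (LINT \<xi>|lborel. Eb (scale_block i (1 / \<delta>) \<xi>) * cis (- 2 * pi * ((\<xi> + Th) \<bullet> x)))"
    by (rule lborel_integral_translation[OF m])
  also have "\<dots> = of_real (\<delta> ^ CARD('n)) * (LINT \<xi>|lborel. Eb (scale_block i (1 / \<delta>) (scale_block i \<delta> \<xi>)) * cis (- 2 * pi * ((scale_block i \<delta> \<xi> + Th) \<bullet> x)))"
    by (rule lborel_integral_scale_block[OF m \<delta>(1)])
  also have "(LINT \<xi>|lborel. Eb (scale_block i (1 / \<delta>) (scale_block i \<delta> \<xi>)) * cis (- 2 * pi * ((scale_block i \<delta> \<xi> + Th) \<bullet> x)))
     = (LINT \<xi>|lborel. cis (- 2 * pi * (Th \<bullet> x)) * (Eb \<xi> * cis (- 2 * pi * (\<xi> \<bullet> scale_block i \<delta> x))))"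
  proof (rule Bochner_Integration.integral_cong[OF refl])
    fix \<xi> :: "real^'n^'m"
    have "- 2 * pi * ((scale_block i \<delta> \<xi> + Th) \<bullet> x) = - 2 * pi * (Th \<bullet> x) + - 2 * pi * (\<xi> \<bullet> scale_block i \<delta> x)"
      by (simp add: inner_add_left scale_block_inner algebra_simps)
    then show "Eb (scale_block i (1 / \<delta>) (scale_block i \<delta> \<xi>)) * cis (- 2 * pi * ((scale_block i \<delta> \<xi> + Th) \<bullet> x))
       = cis (- 2 * pi * (Th \<bullet> x)) * (Eb \<xi> * cis (- 2 * pi * (\<xi> \<bullet> scale_block i \<delta> x)))"
      using \<delta> by (simp only: cis_mult[symmetric] scale_block_compose) (simp add: mult_ac)
  qed
  also have "\<dots> = cis (- 2 * pi * (Th \<bullet> x)) * fourier Eb (scale_block i \<delta> x)"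
    unfolding fourier_def by (rule integral_mult_right_zero)
  finally show ?thesis by (simp only: mult_ac)
qed

lemma gaussian_bump_coord_decreasing: "coord_decreasing (fourier Eb)"
  by (rule uniformly_schwartz_coord_decreasing[OF gaussian_bump_uniform[OF smooth_bump_translate[OF B]]]) (use \<delta> in auto)

text \<open>The constants obtained here depend on \<open>\<delta>\<close>, which is harmless: the
  statement serves for integrability at each fixed \<open>\<delta>\<close>, while uniform bounds
  come from the rescaled kernel.\<close>

lemma translated_gaussian_coord_decreasing: "coord_decreasing (fourier (translated_gaussian i B \<theta> \<delta>))"
  unfolding coord_decreasing_def
proof (intro conjI allI)
  have c: "continuous_on UNIV (fourier Eb)" using gaussian_bump_coord_decreasing unfolding coord_decreasing_def by blast
  show "continuous_on UNIV (fourier (translated_gaussian i B \<theta> \<delta>))"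
    unfolding fourier_translated_gaussian[abs_def]
    by (intro continuous_intros continuous_on_compose2[OF c continuous_on_scale_block]) auto
  fix q
  obtain C where C: "C \<ge> 0" "\<And>x. norm (fourier Eb x) \<le> C / (\<Prod>b\<in>Basis. (1 + \<bar>x \<bullet> b\<bar>) ^ q)"
    using gaussian_bump_coord_decreasing unfolding coord_decreasing_def by blast
  define c where "c = (\<Prod>b\<in>(Basis :: (real^'n^'m) set). \<delta> ^ q)"
  have c0: "c > 0" using \<delta> by (simp add: c_def)
  have "norm (fourier (translated_gaussian i B \<theta> \<delta>) x) \<le> (\<delta> ^ CARD('n) * C / c) / (\<Prod>b\<in>Basis. (1 + \<bar>x \<bullet> b\<bar>) ^ q)" for x
  proof -
    have P0: "0 < (\<Prod>b\<in>Basis. (1 + \<bar>x \<bullet> b\<bar>) ^ q)" by (intro prod_pos zero_less_power) (auto simp: add_pos_nonneg)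
    have "c * (\<Prod>b\<in>Basis. (1 + \<bar>x \<bullet> b\<bar>) ^ q) = (\<Prod>b\<in>Basis. (\<delta> * (1 + \<bar>x \<bullet> b\<bar>)) ^ q)" by (simp only: c_def prod.distrib power_mult_distrib)
    also have "\<dots> \<le> (\<Prod>b\<in>Basis. (1 + \<bar>scale_block i \<delta> x \<bullet> b\<bar>) ^ q)"
    proof (intro prod_mono conjI power_mono)
      fix b :: "real^'n^'m" assume b: "b \<in> Basis"
      have "\<delta> * \<bar>x \<bullet> b\<bar> \<le> \<bar>x \<bullet> b\<bar>" using \<delta> by (intro mult_left_le_one_le) auto
      then show "\<delta> * (1 + \<bar>x \<bullet> b\<bar>) \<le> 1 + \<bar>scale_block i \<delta> x \<bullet> b\<bar>"
        using \<delta> b by (auto simp: scale_block_inner_Basis abs_mult distrib_left)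
    qed (use \<delta> in auto)
    finally have le: "c * (\<Prod>b\<in>Basis. (1 + \<bar>x \<bullet> b\<bar>) ^ q) \<le> (\<Prod>b\<in>Basis. (1 + \<bar>scale_block i \<delta> x \<bullet> b\<bar>) ^ q)" .
    have "norm (fourier (translated_gaussian i B \<theta> \<delta>) x) = \<delta> ^ CARD('n) * norm (fourier Eb (scale_block i \<delta> x))"
      unfolding fourier_translated_gaussian using \<delta> by (simp add: norm_mult norm_power)
    also have "\<dots> \<le> \<delta> ^ CARD('n) * (C / (\<Prod>b\<in>Basis. (1 + \<bar>scale_block i \<delta> x \<bullet> b\<bar>) ^ q))"
      using \<delta> by (intro mult_left_mono C) auto
    also have "\<dots> \<le> \<delta> ^ CARD('n) * (C / (c * (\<Prod>b\<in>Basis. (1 + \<bar>x \<bullet> b\<bar>) ^ q)))"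
      using \<delta> C c0 P0 le by (intro mult_left_mono divide_left_mono mult_pos_pos order.strict_trans2[OF mult_pos_pos[OF c0 P0] le]) auto
    also have "\<dots> = (\<delta> ^ CARD('n) * C / c) / (\<Prod>b\<in>Basis. (1 + \<bar>x \<bullet> b\<bar>) ^ q)" by simp
    finally show ?thesis .
  qed
  moreover have "0 \<le> \<delta> ^ CARD('n) * C / c" using \<delta> C c0 by simp
  ultimately show "\<exists>C\<ge>0. \<forall>x. norm (fourier (translated_gaussian i B \<theta> \<delta>) x) \<le> C / (\<Prod>b\<in>Basis. (1 + \<bar>x \<bullet> b\<bar>) ^ q)" by blast
qed

lemma sobolev_weight_scale:
  fixes s :: "'m \<Rightarrow> real"
  shows "sobolev_weight s (scale_block i (1 / \<delta>) y) = \<delta> powr (- s i) * scaled_weight s i \<delta> (y :: real^'n^'m)"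
proof -
  have "1 + 4 * pi\<^sup>2 * (norm (scale_block i (1 / \<delta>) y $ i))\<^sup>2 = (\<delta>\<^sup>2 + 4 * pi\<^sup>2 * (norm (y $ i))\<^sup>2) / \<delta>\<^sup>2"
    using \<delta> by (simp add: scale_block_def power_mult_distrib field_simps)
  then have A: "(1 + 4 * pi\<^sup>2 * (norm (scale_block i (1 / \<delta>) y $ i))\<^sup>2) powr (s i / 2) = ((\<delta>\<^sup>2 + 4 * pi\<^sup>2 * (norm (y $ i))\<^sup>2) / \<delta>\<^sup>2) powr (s i / 2)"
    by (rule arg_cong)
  have D: "(X / \<delta>\<^sup>2) powr (s i / 2) = \<delta> powr (- s i) * X powr (s i / 2)" for X :: real
  proof -
    have "(X / \<delta>\<^sup>2) powr (s i / 2) = X powr (s i / 2) / (\<delta>\<^sup>2) powr (s i / 2)" by (simp add: powr_divide)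
    then show ?thesis unfolding power2_powr_half[OF \<delta>(1)] powr_minus by (simp add: field_simps)
  qed
  have 1: "(1 + 4 * pi\<^sup>2 * (norm (scale_block i (1 / \<delta>) y $ i))\<^sup>2) powr (s i / 2) = \<delta> powr (- s i) * (\<delta>\<^sup>2 + 4 * pi\<^sup>2 * (norm (y $ i))\<^sup>2) powr (s i / 2)"
    by (rule trans[OF A D])
  have "(norm (scale_block i (1 / \<delta>) y $ j))\<^sup>2 = (norm (y $ j))\<^sup>2" if "j \<in> UNIV - {i}" for j
    using that by (simp add: scale_block_def)
  then have 2: "(\<Prod>j\<in>UNIV - {i}. (1 + 4 * pi\<^sup>2 * (norm (scale_block i (1 / \<delta>) y $ j))\<^sup>2) powr (s j / 2)) = (\<Prod>j\<in>UNIV - {i}. (1 + 4 * pi\<^sup>2 * (norm (y $ j))\<^sup>2) powr (s j / 2))"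
    by (intro prod.cong refl) simp
  show ?thesis
    unfolding sobolev_weight_remove[where s=s and y="scale_block i (1 / \<delta>) y" and i=i] 1 2 scaled_weight_def by (rule mult.assoc)
qed

text \<open>The substitution that divides block i by \<open>\<delta>\<close> has a Jacobian
  cancelling the factor \<open>\<delta> ^ CARD('n)\<close> of the transform, so
  \<open>\<delta> powr (- s i)\<close> from the weight is the whole loss. The sign in the argument
  turns the inverse transform into a forward one.\<close>

lemma sobolev_potential_translated_gaussian:
  fixes s :: "'m \<Rightarrow> real"
  assumes s: "\<And>j. 0 \<le> s j"
  shows "sobolev_potential s (translated_gaussian i B \<theta> \<delta>) \<xi> = of_real (\<delta> powr (- s i)) * bump_kernel s i Bt \<delta> (- scale_block i (1 / \<delta>) (\<xi> - Th))"
proof -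
  have c: "continuous_on UNIV (fourier Eb)" using gaussian_bump_coord_decreasing unfolding coord_decreasing_def by blast
  let ?f = "\<lambda>x. complex_of_real (sobolev_weight s x) * (cis (- 2 * pi * (Th \<bullet> x)) * of_real (\<delta> ^ CARD('n)) * fourier Eb (scale_block i \<delta> x)) * cis (2 * pi * (x \<bullet> \<xi>))"
  have m: "?f \<in> borel_measurable borel"
    by (rule continuous_borel_complex) (intro continuous_intros continuous_sobolev_weight continuous_on_compose2[OF c continuous_on_scale_block] subset_UNIV)
  have "sobolev_potential s (translated_gaussian i B \<theta> \<delta>) \<xi> = (LINT x|lborel. ?f x)"
    unfolding sobolev_potential_def fourier_translated_gaussian ..
  also have "\<dots> = of_real ((1 / \<delta>) ^ CARD('n)) * (LINT y|lborel. ?f (scale_block i (1 / \<delta>) y))"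
    by (rule lborel_integral_scale_block[OF m]) (use \<delta> in simp)
  also have "(LINT y|lborel. ?f (scale_block i (1 / \<delta>) y)) = (LINT y|lborel. (of_real (\<delta> ^ CARD('n)) * of_real (\<delta> powr (- s i))) *
     (complex_of_real (scaled_weight s i \<delta> y) * fourier Eb y * cis (- 2 * pi * (y \<bullet> (- scale_block i (1 / \<delta>) (\<xi> - Th))))))"
  proof (rule Bochner_Integration.integral_cong[OF refl])
    fix y :: "real^'n^'m"
    have e0: "y \<bullet> (- scale_block i (1 / \<delta>) (\<xi> - Th)) = Th \<bullet> scale_block i (1 / \<delta>) y - scale_block i (1 / \<delta>) y \<bullet> \<xi>"
      unfolding inner_minus_right scale_block_inner[symmetric] inner_diff_right inner_commute[of "scale_block i (1 / \<delta>) y" Th] by simp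
    have e1: "- 2 * pi * (y \<bullet> (- scale_block i (1 / \<delta>) (\<xi> - Th))) = - 2 * pi * (Th \<bullet> scale_block i (1 / \<delta>) y) + 2 * pi * (scale_block i (1 / \<delta>) y \<bullet> \<xi>)"
      unfolding e0 by (simp add: algebra_simps)
    have e2: "scale_block i \<delta> (scale_block i (1 / \<delta>) y) = y" using \<delta> by (simp add: scale_block_compose)
    show "?f (scale_block i (1 / \<delta>) y) = (of_real (\<delta> ^ CARD('n)) * of_real (\<delta> powr (- s i))) *
     (complex_of_real (scaled_weight s i \<delta> y) * fourier Eb y * cis (- 2 * pi * (y \<bullet> (- scale_block i (1 / \<delta>) (\<xi> - Th)))))"
      unfolding e1 e2 cis_mult[symmetric] sobolev_weight_scale of_real_mult by (simp only: mult_ac)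
  qed
  also have "\<dots> = (of_real (\<delta> ^ CARD('n)) * of_real (\<delta> powr (- s i))) * bump_kernel s i Bt \<delta> (- scale_block i (1 / \<delta>) (\<xi> - Th))"
    unfolding bump_kernel_def fourier_def[of "\<lambda>y. complex_of_real (scaled_weight s i \<delta> y) * fourier Eb y"] by (rule integral_mult_right_zero)
  also have "of_real ((1 / \<delta>) ^ CARD('n)) * \<dots> = of_real (\<delta> powr (- s i)) * bump_kernel s i Bt \<delta> (- scale_block i (1 / \<delta>) (\<xi> - Th))"
    using \<delta> by (simp add: power_one_over field_simps)
  finally show ?thesis .
qed

lemma translated_gaussian_continuous: "continuous_on UNIV (translated_gaussian i B \<theta> \<delta>)"
  unfolding translated_gaussian_def using \<delta> by (intro continuous_intros smooth_bump_cont B) auto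

lemma translated_gaussian_integrable: "integrable lborel (translated_gaussian i B \<theta> \<delta>)"
proof -
  obtain R where R: "\<And>x. norm x > R \<Longrightarrow> B x = 0" using B unfolding smooth_bump_def by blast
  have "translated_gaussian i B \<theta> \<delta> x = indicator (cball 0 R) x *\<^sub>R translated_gaussian i B \<theta> \<delta> x" for x
    using R[of x] by (auto simp: indicator_def translated_gaussian_def)
  then have "translated_gaussian i B \<theta> \<delta> = (\<lambda>x. indicator (cball 0 R) x *\<^sub>R translated_gaussian i B \<theta> \<delta> x)" by (rule ext)
  moreover have "integrable lborel (\<lambda>x. indicator (cball 0 R) x *\<^sub>R translated_gaussian i B \<theta> \<delta> x)"
    by (rule borel_integrable_compact) (auto intro: continuous_on_subset[OF translated_gaussian_continuous])
  ultimately show ?thesis by simp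
qed

end

section \<open>Sobolev potentials\<close>

text \<open>Conditions under which the potential is an absolutely convergent integral and represents
  the distribution in \<open>sobolev_norm\<close>; they pass to finite linear combinations.\<close>

definition sobolev_regular :: "('m::finite \<Rightarrow> real) \<Rightarrow> (real^'n^'m \<Rightarrow> complex) \<Rightarrow> bool" where
  "sobolev_regular s F \<longleftrightarrow> continuous_on UNIV F \<and> integrable lborel F \<and>
     integrable lborel (\<lambda>x. complex_of_real (sobolev_weight s x) * fourier F x)"

lemma integrable_mult_cis:
  fixes h :: "'a::euclidean_space \<Rightarrow> complex"
  assumes "integrable lborel h"
  shows "integrable lborel (\<lambda>x. h x * cis (c * (x \<bullet> \<xi>)))"
  by (rule Bochner_Integration.integrable_bound[OF assms])
     (use borel_measurable_integrable[OF assms] in \<open>auto simp: norm_mult cis_conv_exp\<close>)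

lemma fourier_sum:
  fixes F :: "'b \<Rightarrow> 'a::euclidean_space \<Rightarrow> complex"
  assumes "\<And>j. j \<in> I \<Longrightarrow> integrable lborel (F j)"
  shows "fourier (\<lambda>x. \<Sum>j\<in>I. c j * F j x) \<xi> = (\<Sum>j\<in>I. c j * fourier (F j) \<xi>)"
proof -
  have "fourier (\<lambda>x. \<Sum>j\<in>I. c j * F j x) \<xi> = (LINT x|lborel. (\<Sum>j\<in>I. c j * (F j x * cis (- 2 * pi * (x \<bullet> \<xi>)))))"
    unfolding fourier_def by (simp add: sum_distrib_right mult.assoc)
  also have "\<dots> = (\<Sum>j\<in>I. (LINT x|lborel. c j * (F j x * cis (- 2 * pi * (x \<bullet> \<xi>)))))"
    by (rule Bochner_Integration.integral_sum) (intro integrable_mult_right integrable_mult_cis assms)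
  also have "\<dots> = (\<Sum>j\<in>I. c j * fourier (F j) \<xi>)" unfolding fourier_def by simp
  finally show ?thesis .
qed

lemma sobolev_regular_sum:
  fixes F :: "'b \<Rightarrow> real^'n^'m \<Rightarrow> complex"
  assumes "finite I" "\<And>j. j \<in> I \<Longrightarrow> sobolev_regular s (F j)"
  shows "sobolev_regular s (\<lambda>x. \<Sum>j\<in>I. c j * F j x)"
    "sobolev_potential s (\<lambda>x. \<Sum>j\<in>I. c j * F j x) \<xi> = (\<Sum>j\<in>I. c j * sobolev_potential s (F j) \<xi>)"
proof -
  have F: "continuous_on UNIV (F j)" "integrable lborel (F j)" "integrable lborel (\<lambda>x. complex_of_real (sobolev_weight s x) * fourier (F j) x)"
    if "j \<in> I" for j using assms(2)[OF that] unfolding sobolev_regular_def by auto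
  have e: "complex_of_real (sobolev_weight s x) * fourier (\<lambda>x. \<Sum>j\<in>I. c j * F j x) x = (\<Sum>j\<in>I. c j * (complex_of_real (sobolev_weight s x) * fourier (F j) x))" for x
    by (simp add: fourier_sum[OF F(2)] sum_distrib_left mult.left_commute)
  show "sobolev_regular s (\<lambda>x. \<Sum>j\<in>I. c j * F j x)"
    unfolding sobolev_regular_def e
    by (intro conjI continuous_intros Bochner_Integration.integrable_sum integrable_mult_right F)
  have "sobolev_potential s (\<lambda>x. \<Sum>j\<in>I. c j * F j x) \<xi> = (LINT x|lborel. (\<Sum>j\<in>I. c j * (complex_of_real (sobolev_weight s x) * fourier (F j) x * cis (2 * pi * (x \<bullet> \<xi>)))))"
    unfolding sobolev_potential_def e by (simp add: sum_distrib_right mult.assoc)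
  also have "\<dots> = (\<Sum>j\<in>I. (LINT x|lborel. c j * (complex_of_real (sobolev_weight s x) * fourier (F j) x * cis (2 * pi * (x \<bullet> \<xi>)))))"
    by (rule Bochner_Integration.integral_sum) (intro integrable_mult_right integrable_mult_cis F)
  also have "\<dots> = (\<Sum>j\<in>I. c j * sobolev_potential s (F j) \<xi>)" unfolding sobolev_potential_def by simp
  finally show "sobolev_potential s (\<lambda>x. \<Sum>j\<in>I. c j * F j x) \<xi> = (\<Sum>j\<in>I. c j * sobolev_potential s (F j) \<xi>)" .
qed

lemma sobolev_potential_measurable:
  assumes "sobolev_regular s F"
  shows "sobolev_potential s F \<in> borel_measurable borel"
proof -
  let ?h = "\<lambda>x. complex_of_real (sobolev_weight s x) * fourier F x"
  have [measurable]: "?h \<in> borel_measurable borel"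
    using assms borel_measurable_integrable unfolding sobolev_regular_def by auto
  have "(\<lambda>(\<xi>, x). ?h x * cis (2 * pi * (x \<bullet> \<xi>))) \<in> borel_measurable (borel \<Otimes>\<^sub>M lborel)"
    unfolding cis_conv_exp by measurable
  then show ?thesis unfolding sobolev_potential_def[abs_def]
    by (intro lborel.borel_measurable_lebesgue_integral) (simp add: split_beta')
qed

text \<open>Only Fubini is needed here: the potential is defined by an absolutely convergent integral on
  the Fourier side, so no inversion theorem enters.\<close>

lemma sobolev_potential_represents:
  fixes s :: "'m::finite \<Rightarrow> real" and F :: "real^'n^'m \<Rightarrow> complex"
  assumes s: "\<And>j. 0 \<le> s j" and F: "sobolev_regular s F"
  shows "represents (sobolev_potential s F)
     (distr_inv_fourier (distr_mult (sobolev_weight s) (distr_fourier (distr_of F))))"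
  unfolding represents_def
proof (intro conjI allI impI)
  show mg: "sobolev_potential s F \<in> borel_measurable borel" by (rule sobolev_potential_measurable[OF F])
  fix \<phi> :: "real^'n^'m \<Rightarrow> complex" assume \<phi>: "schwartz \<phi>"
  let ?h = "\<lambda>x. complex_of_real (sobolev_weight s x) * fourier F x"
  let ?G = "\<lambda>x. complex_of_real (sobolev_weight s x) * inv_fourier \<phi> x"
  have iF: "integrable lborel F" and ih: "integrable lborel ?h" using F unfolding sobolev_regular_def by auto
  have mF[measurable]: "F \<in> borel_measurable borel" and mh[measurable]: "?h \<in> borel_measurable borel"
    using borel_measurable_integrable[OF iF] borel_measurable_integrable[OF ih] by auto
  have r\<phi>: "rapidly_decreasing \<phi>" by (rule schwartz_rapidly_decreasing[OF \<phi>])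
  have i\<phi>: "integrable lborel \<phi>" by (rule rapidly_decreasing_integrable[OF r\<phi>])
  have m\<phi>[measurable]: "\<phi> \<in> borel_measurable borel" using borel_measurable_integrable[OF i\<phi>] by simp
  have cd: "coord_decreasing (inv_fourier \<phi>)"
  proof -
    have cd0: "coord_decreasing (fourier \<phi>)" by (rule uniformly_schwartz_coord_decreasing[OF schwartz_uniformly_schwartz[OF \<phi>]]) simp
    have "continuous_on UNIV (\<lambda>x. fourier \<phi> (- x))"
      by (rule continuous_on_compose2[of UNIV "fourier \<phi>" UNIV "\<lambda>x. - x"])
         (use cd0 in \<open>auto simp: coord_decreasing_def intro!: continuous_intros\<close>)
    moreover have "\<exists>C\<ge>0. \<forall>x. norm (fourier \<phi> (- x)) \<le> C / (\<Prod>b\<in>Basis. (1 + \<bar>x \<bullet> b\<bar>) ^ q)" for q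
    proof -
      obtain C where C: "C \<ge> 0" "\<And>x. norm (fourier \<phi> x) \<le> C / (\<Prod>b\<in>Basis. (1 + \<bar>x \<bullet> b\<bar>) ^ q)"
        using cd0 unfolding coord_decreasing_def by blast
      have "norm (fourier \<phi> (- x)) \<le> C / (\<Prod>b\<in>Basis. (1 + \<bar>x \<bullet> b\<bar>) ^ q)" for x using C(2)[of "-x"] by simp
      then show ?thesis using C(1) by blast
    qed
    ultimately show ?thesis unfolding coord_decreasing_def inv_fourier_def by blast
  qed
  have iG: "integrable lborel ?G" by (rule weight_coord_decreasing_integrable[OF s cd])
  have mG[measurable]: "?G \<in> borel_measurable borel" using borel_measurable_integrable[OF iG] by simp
  have gb: "norm (sobolev_potential s F \<xi>) \<le> (LINT x|lborel. norm (?h x))" for \<xi>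
    unfolding sobolev_potential_def
    by (rule Bochner_Integration.integral_norm_bound_integral[OF integrable_mult_cis[OF ih] integrable_norm[OF ih]]) (simp add: norm_mult)
  show "integrable lborel (\<lambda>x. sobolev_potential s F x * \<phi> x)"
  proof (rule Bochner_Integration.integrable_bound[OF integrable_mult_right[OF integrable_norm[OF i\<phi>], of "LINT x|lborel. norm (?h x)"]])
    show "AE x in lborel. norm (sobolev_potential s F x * \<phi> x) \<le> norm ((LINT x|lborel. norm (?h x)) * norm (\<phi> x))"
      using gb by (auto simp: norm_mult intro!: AE_I2 mult_right_mono order_trans[OF gb])
  qed (use mg in measurable)
  let ?e = "\<lambda>x \<xi>::real^'n^'m. cis (- 2 * pi * (x \<bullet> \<xi>))"
  have A: "distr_inv_fourier (distr_mult (sobolev_weight s) (distr_fourier (distr_of F))) \<phi> = (LINT \<xi>|lborel. LINT x|lborel. F \<xi> * (?G x * ?e x \<xi>))"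
    unfolding distr_inv_fourier_def distr_mult_def distr_fourier_def distr_of_def fourier_def[of ?G] by simp
  have B: "(LINT \<xi>|lborel. LINT x|lborel. F \<xi> * (?G x * ?e x \<xi>)) = (LINT x|lborel. LINT \<xi>|lborel. F \<xi> * (?G x * ?e x \<xi>))"
  proof (rule fubini_lborel[OF _ integrable_norm[OF iG] integrable_norm[OF iF]])
    show "(\<lambda>(x, \<xi>). F \<xi> * (?G x * ?e x \<xi>)) \<in> borel_measurable (borel \<Otimes>\<^sub>M borel)" unfolding cis_conv_exp by measurable
    show "norm (F \<xi> * (?G x * ?e x \<xi>)) \<le> norm (?G x) * norm (F \<xi>)" for x \<xi> by (simp only: norm_mult norm_cis) simp
  qed
  have C: "(LINT \<xi>|lborel. F \<xi> * (?G x * ?e x \<xi>)) = (LINT \<xi>|lborel. ?h x * (\<phi> \<xi> * cis (2 * pi * (x \<bullet> \<xi>))))" for x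
  proof -
    have "(LINT \<xi>|lborel. F \<xi> * (?G x * ?e x \<xi>)) = (LINT \<xi>|lborel. ?G x * (F \<xi> * cis (- 2 * pi * (\<xi> \<bullet> x))))"
      by (intro Bochner_Integration.integral_cong refl) (simp only: inner_commute mult_ac)
    also have "\<dots> = ?G x * fourier F x" unfolding fourier_def[of F] by (rule integral_mult_right_zero)
    also have "\<dots> = ?h x * inv_fourier \<phi> x" by (simp only: mult_ac)
    also have "\<dots> = (LINT \<xi>|lborel. ?h x * (\<phi> \<xi> * cis (- 2 * pi * (\<xi> \<bullet> (- x)))))"
      unfolding inv_fourier_def fourier_def[of \<phi>] by (rule integral_mult_right_zero[symmetric])
    also have "\<dots> = (LINT \<xi>|lborel. ?h x * (\<phi> \<xi> * cis (2 * pi * (x \<bullet> \<xi>))))"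
      by (intro Bochner_Integration.integral_cong refl) (simp add: inner_commute)
    finally show ?thesis .
  qed
  have D: "(LINT x|lborel. LINT \<xi>|lborel. ?h x * (\<phi> \<xi> * cis (2 * pi * (x \<bullet> \<xi>)))) = (LINT \<xi>|lborel. LINT x|lborel. ?h x * (\<phi> \<xi> * cis (2 * pi * (x \<bullet> \<xi>))))"
  proof (rule fubini_lborel[OF _ integrable_norm[OF i\<phi>] integrable_norm[OF ih]])
    show "(\<lambda>(\<xi>, x). ?h x * (\<phi> \<xi> * cis (2 * pi * (x \<bullet> \<xi>)))) \<in> borel_measurable (borel \<Otimes>\<^sub>M borel)" unfolding cis_conv_exp by measurable
    show "norm (?h x * (\<phi> \<xi> * cis (2 * pi * (x \<bullet> \<xi>)))) \<le> norm (\<phi> \<xi>) * norm (?h x)" for \<xi> x by (simp only: norm_mult norm_cis) simp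
  qed
  have E: "(LINT x|lborel. ?h x * (\<phi> \<xi> * cis (2 * pi * (x \<bullet> \<xi>)))) = sobolev_potential s F \<xi> * \<phi> \<xi>" for \<xi>
  proof -
    have "(LINT x|lborel. ?h x * (\<phi> \<xi> * cis (2 * pi * (x \<bullet> \<xi>)))) = (LINT x|lborel. \<phi> \<xi> * (?h x * cis (2 * pi * (x \<bullet> \<xi>))))"
      by (intro Bochner_Integration.integral_cong refl) (simp only: mult_ac)
    also have "\<dots> = \<phi> \<xi> * sobolev_potential s F \<xi>" unfolding sobolev_potential_def by (rule integral_mult_right_zero)
    finally show ?thesis by (simp only: mult.commute)
  qed
  show "distr_inv_fourier (distr_mult (sobolev_weight s) (distr_fourier (distr_of F))) \<phi> = distr_of (sobolev_potential s F) \<phi>"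
    unfolding A B C D E by (simp only: distr_of_def)
qed

lemma translated_gaussian_regular:
  fixes s :: "'m::finite \<Rightarrow> real" and B :: "real^'n^'m \<Rightarrow> complex"
  assumes "\<And>j. 0 \<le> s j" "smooth_bump B" "0 < \<delta>" "\<delta> \<le> 1"
  shows "sobolev_regular s (translated_gaussian i B \<theta> \<delta>)"
  unfolding sobolev_regular_def
  by (intro conjI translated_gaussian_continuous translated_gaussian_integrable weight_coord_decreasing_integrable translated_gaussian_coord_decreasing assms)

text \<open>The condition \<open>s i \<le> n / r\<close> distributes the loss
  \<open>2 powr (L * s i)\<close> over the n coordinates of the block as
  \<open>2 powr (L / r)\<close> each, which is the normalisation of the dyadic profile. The factor
  \<open>1 *\<close> puts the sum in the form of \<open>sobolev_regular_sum\<close>.\<close>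

lemma gaussian_sum_potential_bound:
  fixes s :: "'m::finite \<Rightarrow> real" and B :: "real^'n^'m \<Rightarrow> complex"
  assumes m: "CARD('m) \<ge> 2" and s: "\<And>j. 0 \<le> s j" and r: "1 < r" and si: "s i \<le> CARD('n) / r" and B: "smooth_bump B"
  shows "\<exists>C\<ge>0. \<forall>I. finite I \<longrightarrow>
     (\<integral>\<^sup>+\<xi>. ennreal (norm (sobolev_potential s (\<lambda>\<xi>. \<Sum>L\<in>I. 1 * translated_gaussian i B \<theta> ((1/2) ^ L) \<xi>) \<xi>) powr r) \<partial>lborel) \<le> ennreal (C * real (card I))"
proof -
  let ?Th = "axis i \<theta> :: real^'n^'m"
  \<comment> \<open>Halfway between \<open>1 / r\<close>, which the summation over scales requires
    as a lower bound, and \<open>1\<close>, the limit of the kernel estimate.\<close>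
  define \<alpha> where "\<alpha> = (1 + 1 / r) / 2"
  have \<alpha>: "0 < \<alpha>" "\<alpha> < 1" "1 / r < \<alpha>" using r by (auto simp: \<alpha>_def field_simps)
  have "CARD('n) / r < CARD('n)" using r by (simp add: field_simps)
  then have sn: "s i < CARD('n)" using si by simp
  obtain C0 where C0: "C0 \<ge> 0" "\<And>\<delta> \<eta>. \<delta> \<in> {0<..1} \<Longrightarrow> norm (bump_kernel s i (\<lambda>\<xi>. B (\<xi> + ?Th)) \<delta> \<eta>) \<le> C0 * (\<Prod>b\<in>Basis. (1 + \<bar>\<eta> \<bullet> b\<bar>) powr (if b $ i \<noteq> 0 then - \<alpha> else - 2))"
    using bump_kernel_bound[where s=s, OF m s sn smooth_bump_translate[OF B] \<alpha>(1,2)] by blast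
  obtain C1 where C1: "C1 \<ge> 0" "\<And>I. finite I \<Longrightarrow> (\<integral>\<^sup>+\<xi>. ennreal ((\<Sum>L\<in>I. dyadic_profile i r \<alpha> L (\<xi>::real^'n^'m)) powr r) \<partial>lborel) \<le> ennreal (C1 * real (card I))"
    using dyadic_profile_sum_bound[OF r \<alpha>(3)] by blast
  have single: "norm (sobolev_potential s (translated_gaussian i B \<theta> ((1/2) ^ L)) \<xi>) \<le> C0 * dyadic_profile i r \<alpha> L (\<xi> + - ?Th)" for L \<xi>
  proof -
    define \<delta> where "\<delta> = (1/2::real) ^ L"
    have \<delta>: "0 < \<delta>" "\<delta> \<le> 1" by (auto simp: \<delta>_def power_le_one)
    have id: "1 / \<delta> = 2 ^ L" by (simp add: \<delta>_def power_one_over)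
    let ?\<eta> = "- scale_block i (1 / \<delta>) (\<xi> - ?Th)"
    let ?J = "{b\<in>Basis :: (real^'n^'m) set. b $ i \<noteq> 0}"
    have eb: "\<bar>?\<eta> \<bullet> b\<bar> = (if b $ i \<noteq> 0 then 2 ^ L * \<bar>(\<xi> + - ?Th) \<bullet> b\<bar> else \<bar>(\<xi> + - ?Th) \<bullet> b\<bar>)" if "b \<in> Basis" for b
      using that by (simp add: scale_block_inner_Basis id abs_mult)
    have "\<delta> powr (- s i) = 2 powr (L * s i)"
    proof -
      have "\<delta> = 2 powr (- real L)" by (simp add: \<delta>_def powr_minus powr_realpow power_one_over inverse_eq_divide)
      then show ?thesis by (simp add: powr_powr)
    qed
    also have "\<dots> \<le> 2 powr (CARD('n) * (L / r))"
      using mult_left_mono[OF si, of "real L"] by (intro powr_mono) (auto simp: mult_ac)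
    also have "\<dots> = (\<Prod>b\<in>?J. 2 powr (L / r))" by (simp add: card_block_Basis powr_realpow[symmetric] powr_powr mult.commute)
    also have "\<dots> = (\<Prod>b\<in>(Basis :: (real^'n^'m) set). if b $ i \<noteq> 0 then 2 powr (L / r) else 1)" by (rule prod.inter_filter) simp
    finally have d: "\<delta> powr (- s i) \<le> (\<Prod>b\<in>(Basis :: (real^'n^'m) set). if b $ i \<noteq> 0 then 2 powr (L / r) else 1)" .
    have "norm (sobolev_potential s (translated_gaussian i B \<theta> \<delta>) \<xi>) = \<delta> powr (- s i) * norm (bump_kernel s i (\<lambda>\<xi>. B (\<xi> + ?Th)) \<delta> ?\<eta>)"
      unfolding sobolev_potential_translated_gaussian[where s=s, OF B \<delta> s] by (simp add: norm_mult)
    also have "\<dots> \<le> (\<Prod>b\<in>(Basis :: (real^'n^'m) set). if b $ i \<noteq> 0 then 2 powr (L / r) else 1) * (C0 * (\<Prod>b\<in>Basis. (1 + \<bar>?\<eta> \<bullet> b\<bar>) powr (if b $ i \<noteq> 0 then - \<alpha> else - 2)))"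
      by (intro mult_mono d C0 prod_nonneg) (use \<delta> in auto)
    also have "\<dots> = C0 * (\<Prod>b\<in>Basis. (if b $ i \<noteq> 0 then 2 powr (L / r) else 1) * (1 + \<bar>?\<eta> \<bullet> b\<bar>) powr (if b $ i \<noteq> 0 then - \<alpha> else - 2))"
      by (simp only: prod.distrib mult_ac)
    also have "(\<Prod>b\<in>Basis. (if b $ i \<noteq> 0 then 2 powr (L / r) else 1) * (1 + \<bar>?\<eta> \<bullet> b\<bar>) powr (if b $ i \<noteq> 0 then - \<alpha> else - 2)) = dyadic_profile i r \<alpha> L (\<xi> + - ?Th)"
      unfolding dyadic_profile_def by (rule prod.cong[OF refl]) (simp only: eb split: if_split, simp)
    finally show ?thesis unfolding \<delta>_def .
  qed
  have "(\<integral>\<^sup>+\<xi>. ennreal (norm (sobolev_potential s (\<lambda>\<xi>. \<Sum>L\<in>I. 1 * translated_gaussian i B \<theta> ((1/2) ^ L) \<xi>) \<xi>) powr r) \<partial>lborel) \<le> ennreal ((C0 powr r * C1) * real (card I))" if I: "finite I" for I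
  proof -
    let ?p = "\<lambda>\<xi>. \<Sum>L\<in>I. dyadic_profile i r \<alpha> L (\<xi>::real^'n^'m)"
    have m: "?p \<in> borel_measurable borel" unfolding dyadic_profile_def by measurable
    have pt: "ennreal (norm (sobolev_potential s (\<lambda>\<xi>. \<Sum>L\<in>I. 1 * translated_gaussian i B \<theta> ((1/2) ^ L) \<xi>) \<xi>) powr r) \<le> ennreal (C0 powr r) * ennreal (?p (\<xi> + - ?Th) powr r)" for \<xi>
    proof -
      have reg: "sobolev_regular s (translated_gaussian i B \<theta> ((1/2) ^ L))" for L
        by (rule translated_gaussian_regular[where s=s, OF s B]) (auto simp: power_le_one)
      have "sobolev_potential s (\<lambda>\<xi>. \<Sum>L\<in>I. 1 * translated_gaussian i B \<theta> ((1/2) ^ L) \<xi>) \<xi> = (\<Sum>L\<in>I. 1 * sobolev_potential s (translated_gaussian i B \<theta> ((1/2) ^ L)) \<xi>)"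
        by (rule sobolev_regular_sum(2)[OF I reg])
      then have "norm (sobolev_potential s (\<lambda>\<xi>. \<Sum>L\<in>I. 1 * translated_gaussian i B \<theta> ((1/2) ^ L) \<xi>) \<xi>) \<le> (\<Sum>L\<in>I. C0 * dyadic_profile i r \<alpha> L (\<xi> + - ?Th))"
        using sum_norm_le[of I "\<lambda>L. 1 * sobolev_potential s (translated_gaussian i B \<theta> ((1/2) ^ L)) \<xi>" "\<lambda>L. C0 * dyadic_profile i r \<alpha> L (\<xi> + - ?Th)"] single by simp
      also have "\<dots> = C0 * ?p (\<xi> + - ?Th)" by (rule sum_distrib_left[symmetric])
      finally have "norm (sobolev_potential s (\<lambda>\<xi>. \<Sum>L\<in>I. 1 * translated_gaussian i B \<theta> ((1/2) ^ L) \<xi>) \<xi>) powr r \<le> (C0 * ?p (\<xi> + - ?Th)) powr r"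
        using r by (intro powr_mono2) auto
      also have "\<dots> = C0 powr r * ?p (\<xi> + - ?Th) powr r" by (rule powr_mult)
      finally show ?thesis by (subst ennreal_mult'[symmetric]) (auto intro: ennreal_leI)
    qed
    have "(\<integral>\<^sup>+\<xi>. ennreal (norm (sobolev_potential s (\<lambda>\<xi>. \<Sum>L\<in>I. 1 * translated_gaussian i B \<theta> ((1/2) ^ L) \<xi>) \<xi>) powr r) \<partial>lborel)
       \<le> (\<integral>\<^sup>+\<xi>. ennreal (C0 powr r) * ennreal (?p (\<xi> + - ?Th) powr r) \<partial>lborel)" by (rule nn_integral_mono) (rule pt)
    also have "\<dots> = ennreal (C0 powr r) * (\<integral>\<^sup>+\<xi>. ennreal (?p (\<xi> + - ?Th) powr r) \<partial>lborel)"
      by (rule nn_integral_cmult) (use m in measurable)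
    also have "(\<integral>\<^sup>+\<xi>. ennreal (?p (\<xi> + - ?Th) powr r) \<partial>lborel) = (\<integral>\<^sup>+\<xi>. ennreal (?p \<xi> powr r) \<partial>lborel)"
      by (rule nn_integral_lborel_translation[of "\<lambda>\<xi>. ennreal (?p \<xi> powr r)"]) (use m in measurable)
    also have "ennreal (C0 powr r) * \<dots> \<le> ennreal (C0 powr r) * ennreal (C1 * real (card I))"
      by (rule mult_left_mono[OF C1(2)[OF I]]) simp
    also have "\<dots> = ennreal ((C0 powr r * C1) * real (card I))" using C1(1) by (simp add: ennreal_mult'[symmetric] mult.assoc)
    finally show ?thesis .
  qed
  moreover have "0 \<le> C0 powr r * C1" using C1 by simp
  ultimately show ?thesis by (intro exI[of _ "C0 powr r * C1"] conjI allI impI)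
qed

section \<open>Affine substitutions and iterated differences\<close>

lemma lborel_integral_affine:
  fixes f :: "'a::euclidean_space \<Rightarrow> 'b::{banach,second_countable_topology}"
  assumes f[measurable]: "f \<in> borel_measurable borel" and c: "c \<noteq> 0"
  shows "(LINT x|lborel. f x) = (\<bar>c\<bar> ^ DIM('a)) *\<^sub>R (LINT x|lborel. f (t + c *\<^sub>R x))"
proof -
  have "(LINT x|lborel. f x) = (LINT x|density (distr lborel borel (\<lambda>x. t + c *\<^sub>R x)) (\<lambda>_. ennreal (\<bar>c\<bar> ^ DIM('a))). f x)"
    using lborel_affine[OF c, of t] by simp
  also have "\<dots> = (LINT x|distr lborel borel (\<lambda>x. t + c *\<^sub>R x). (\<bar>c\<bar> ^ DIM('a)) *\<^sub>R f x)"
    by (rule integral_density) auto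
  also have "\<dots> = (LINT x|lborel. (\<bar>c\<bar> ^ DIM('a)) *\<^sub>R f (t + c *\<^sub>R x))"
    by (rule integral_distr) auto
  finally show ?thesis by simp
qed

lemma lborel_integrable_affine:
  fixes f :: "'a::euclidean_space \<Rightarrow> 'b::{banach,second_countable_topology}"
  assumes f: "integrable lborel f" and c: "c \<noteq> 0"
  shows "integrable lborel (\<lambda>x. f (t + c *\<^sub>R x))"
proof -
  have m[measurable]: "f \<in> borel_measurable borel" using borel_measurable_integrable[OF f] by simp
  have "integrable (density (distr lborel borel (\<lambda>x. t + c *\<^sub>R x)) (\<lambda>_. ennreal (\<bar>c\<bar> ^ DIM('a)))) f"
    using lborel_affine[OF c, of t] f by simp
  then have "integrable (distr lborel borel (\<lambda>x. t + c *\<^sub>R x)) (\<lambda>x. (\<bar>c\<bar> ^ DIM('a)) *\<^sub>R f x)"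
    by (subst (asm) integrable_density) auto
  then have "integrable lborel (\<lambda>x. (\<bar>c\<bar> ^ DIM('a)) *\<^sub>R f (t + c *\<^sub>R x))"
    by (subst (asm) integrable_distr_eq) auto
  from integrable_scaleR_right[OF this, of "inverse (\<bar>c\<bar> ^ DIM('a))"] show ?thesis using c by simp
qed

definition forward_diff :: "'a::real_vector \<Rightarrow> ('a \<Rightarrow> complex) \<Rightarrow> 'a \<Rightarrow> complex" where
  "forward_diff h f x = f x - f (x + h)"

lemma forward_diff_bound:
  fixes f :: "'a::euclidean_space \<Rightarrow> complex"
  assumes d: "\<And>x. ((\<lambda>t. f (x + t *\<^sub>R v)) has_vector_derivative f' x) (at 0)"
    and b: "\<And>x. norm (f' x) \<le> S x" and t: "0 \<le> t" "t \<le> 1" and A: "\<And>x \<tau>. 0 \<le> \<tau> \<Longrightarrow> \<tau> \<le> 1 \<Longrightarrow> S (x + \<tau> *\<^sub>R v) \<le> A * S x"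
  shows "norm (forward_diff (t *\<^sub>R v) f x) \<le> t * A * S x"
proof -
  have D: "((\<lambda>t. f (x + t *\<^sub>R v)) has_derivative (\<lambda>h. h *\<^sub>R f' (x + s *\<^sub>R v))) (at s within {0..t})" for s
  proof -
    have "((\<lambda>t. f (x + s *\<^sub>R v + t *\<^sub>R v)) \<circ> (\<lambda>u. u - s) has_vector_derivative (1 *\<^sub>R f' (x + s *\<^sub>R v))) (at s within {0..t})"
      by (rule vector_diff_chain_within)
         (use has_vector_derivative_at_within[OF d[of "x + s *\<^sub>R v"]] in \<open>auto intro!: derivative_eq_intros\<close>)
    then show ?thesis by (simp add: o_def algebra_simps has_vector_derivative_def)
  qed
  have "norm ((\<lambda>t. f (x + t *\<^sub>R v)) 0 - (\<lambda>t. f (x + t *\<^sub>R v)) t) \<le> (A * S x) * norm (0 - t)"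
  proof (rule differentiable_bound[OF convex_real_interval(5) D])
    fix s assume s: "s \<in> {0..t}"
    show "onorm (\<lambda>h. h *\<^sub>R f' (x + s *\<^sub>R v)) \<le> A * S x"
    proof (rule onorm_le)
      fix h :: real
      have "norm (f' (x + s *\<^sub>R v)) \<le> A * S x" using order_trans[OF b A[of s x]] s t by auto
      from mult_left_mono[OF this, of "\<bar>h\<bar>"] show "norm (h *\<^sub>R f' (x + s *\<^sub>R v)) \<le> A * S x * norm h" by (simp add: mult.commute)
    qed
  qed (use t in auto)
  then show ?thesis using t by (simp add: forward_diff_def mult_ac)
qed

lemma dir_bounded_forward_diff:
  fixes f :: "'a::euclidean_space \<Rightarrow> complex"
  assumes "dir_bounded v (Suc K) f S" and t: "0 \<le> t" "t \<le> 1" and A: "\<And>x \<tau>. 0 \<le> \<tau> \<Longrightarrow> \<tau> \<le> 1 \<Longrightarrow> S (x + \<tau> *\<^sub>R v) \<le> A * S x"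
  shows "dir_bounded v K (forward_diff (t *\<^sub>R v) f) (\<lambda>x. t * A * S x)"
  using assms(1)
proof (induction K arbitrary: f)
  case 0
  then obtain f' where f: "\<And>x. ((\<lambda>t. f (x + t *\<^sub>R v)) has_vector_derivative f' x) (at 0)" "dir_bounded v 0 f' S" by auto
  have c: "continuous_on UNIV f" by (rule dir_bounded_cont[OF 0])
  have "continuous_on UNIV (forward_diff (t *\<^sub>R v) f)"
    unfolding forward_diff_def[abs_def] by (intro continuous_on_diff c continuous_on_compose2[OF c]) (auto intro!: continuous_intros)
  then show ?case using forward_diff_bound[OF f(1) dir_bounded_bound[OF f(2)] t A] by simp
next
  case (Suc K)
  then obtain f' where f: "\<And>x. ((\<lambda>t. f (x + t *\<^sub>R v)) has_vector_derivative f' x) (at 0)" "dir_bounded v (Suc K) f' S" by auto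
  have c: "continuous_on UNIV f" by (rule dir_bounded_cont[OF Suc.prems])
  show ?case
  proof (rule dir_bounded_SucI[OF _ forward_diff_bound[OF f(1) dir_bounded_bound[OF f(2)] t A] _ Suc.IH[OF f(2)]])
    show "continuous_on UNIV (forward_diff (t *\<^sub>R v) f)"
      unfolding forward_diff_def[abs_def] by (intro continuous_on_diff c continuous_on_compose2[OF c]) (auto intro!: continuous_intros)
    fix x
    have "((\<lambda>s. f (x + s *\<^sub>R v) - f (x + t *\<^sub>R v + s *\<^sub>R v)) has_vector_derivative f' x - f' (x + t *\<^sub>R v)) (at 0)"
      by (intro has_vector_derivative_diff f)
    then show "((\<lambda>s. forward_diff (t *\<^sub>R v) f (x + s *\<^sub>R v)) has_vector_derivative forward_diff (t *\<^sub>R v) f' x) (at 0)"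
      by (simp add: forward_diff_def add_ac)
  qed
qed

text \<open>Each difference trades one directional derivative for a factor \<open>t\<close>, so
  \<open>K\<close> of them gain \<open>t ^ K\<close>; \<open>A\<close> measures how much the
  majorant can grow along the segment from x to \<open>x + v\<close>.\<close>

lemma iterated_forward_diff_bound:
  fixes f :: "'a::euclidean_space \<Rightarrow> complex"
  assumes "dir_bounded v K f S" and t: "0 \<le> t" "t \<le> 1" and "\<And>x \<tau>. 0 \<le> \<tau> \<Longrightarrow> \<tau> \<le> 1 \<Longrightarrow> S (x + \<tau> *\<^sub>R v) \<le> A * S x" and A0: "0 \<le> A"
  shows "norm ((forward_diff (t *\<^sub>R v) ^^ K) f x) \<le> (t * A) ^ K * S x"
  using assms(1,4)
proof (induction K arbitrary: f S)
  case 0 then show ?case by simp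
next
  case (Suc K)
  have "dir_bounded v K (forward_diff (t *\<^sub>R v) f) (\<lambda>x. t * A * S x)"
    by (rule dir_bounded_forward_diff[OF Suc.prems(1) t Suc.prems(2)])
  from Suc.IH[OF this] have "norm ((forward_diff (t *\<^sub>R v) ^^ K) (forward_diff (t *\<^sub>R v) f) x) \<le> (t * A) ^ K * (t * A * S x)"
    using Suc.prems(2) t A0 mult_left_mono[of "S (_ + _ *\<^sub>R v)" "A * S _" "t * A"] by (simp add: mult_ac)
  then show ?case by (simp add: funpow_swap1 mult_ac)
qed

section \<open>Hardy norms of modulated Gaussian envelopes\<close>

text \<open>The k-fold average over the pair x, \<open>x + h\<close>. Its transform is that of the
  Gaussian times \<open>((1 + cis (2 * pi * (h \<bullet> \<xi>))) / 2) ^ k\<close>, a factor equal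
  to \<open>1\<close> at frequency zero, so averaging does not change the limit of wide
  envelopes.\<close>

primrec averaged_gaussian :: "'a::euclidean_space \<Rightarrow> real \<Rightarrow> nat \<Rightarrow> 'a \<Rightarrow> real" where
  "averaged_gaussian h \<delta> 0 x = exp (- pi * (\<delta> * norm x)\<^sup>2)"
| "averaged_gaussian h \<delta> (Suc k) x = (averaged_gaussian h \<delta> k x + averaged_gaussian h \<delta> k (x + h)) / 2"

lemma averaged_gaussian_nonneg: "0 \<le> averaged_gaussian h \<delta> k x"
  by (induction k arbitrary: x) (auto intro!: add_nonneg_nonneg divide_nonneg_nonneg)

lemma averaged_gaussian_continuous: "continuous_on UNIV (averaged_gaussian h \<delta> k)"
proof (induction k)
  case (Suc k)
  have "continuous_on UNIV (\<lambda>x. averaged_gaussian h \<delta> k (x + h))"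
    by (rule continuous_on_compose2[OF Suc]) (auto intro!: continuous_intros)
  then show ?case by (auto intro!: continuous_intros Suc)
qed (auto intro!: continuous_intros)

lemma weight_shift:
  fixes x h :: "'a::real_normed_vector"
  assumes "0 \<le> \<delta>" "\<delta> * norm h \<le> 1" "0 \<le> C"
  shows "C / (1 + \<delta> * norm (x + h)) ^ N \<le> 2 ^ N * (C / (1 + \<delta> * norm x) ^ N)"
proof -
  have "norm x \<le> norm (x + h) + norm h" using norm_triangle_ineq4[of "x + h" h] by simp
  from mult_left_mono[OF this assms(1)] have "1 + \<delta> * norm x \<le> 2 * (1 + \<delta> * norm (x + h))"
    using assms mult_nonneg_nonneg[OF assms(1) norm_ge_zero[of "x + h"]] unfolding distrib_left by linarith
  then have "(1 + \<delta> * norm x) ^ N \<le> (2 * (1 + \<delta> * norm (x + h))) ^ N" using assms by (intro power_mono) auto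
  then have le: "(1 + \<delta> * norm x) ^ N \<le> 2 ^ N * (1 + \<delta> * norm (x + h)) ^ N" by (simp only: power_mult_distrib)
  have p: "0 < (1 + \<delta> * norm x) ^ N" "0 < (1 + \<delta> * norm (x + h)) ^ N" using assms by (auto intro!: zero_less_power add_pos_nonneg)
  have "1 / (1 + \<delta> * norm (x + h)) ^ N \<le> 2 ^ N / (1 + \<delta> * norm x) ^ N"
    using le p by (simp add: divide_simps mult.commute)
  from mult_left_mono[OF this assms(3)] show ?thesis by (simp add: mult_ac)
qed

lemma averaged_gaussian_bound:
  assumes "norm h \<le> 1"
  shows "\<exists>C\<ge>0. \<forall>\<delta>\<in>{0<..1}. \<forall>x. averaged_gaussian h \<delta> k x \<le> C / (1 + \<delta> * norm x) ^ N"
proof (induction k)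
  case 0
  have "averaged_gaussian h \<delta> 0 x \<le> (2 + real N) ^ N / (1 + \<delta> * norm x) ^ N" if "\<delta> \<in> {0<..1}" for \<delta> x
  proof -
    have "0 \<le> \<delta> * norm x" using that by simp
    from power_le_exp_square[OF this, of N] this show ?thesis by (simp add: pos_le_divide_eq add_pos_nonneg mult.commute)
  qed
  then show ?case by (intro exI[of _ "(2 + real N) ^ N"]) auto
next
  case (Suc k)
  then obtain C where C: "C \<ge> 0" "\<And>\<delta> x. \<delta> \<in> {0<..1} \<Longrightarrow> averaged_gaussian h \<delta> k x \<le> C / (1 + \<delta> * norm x) ^ N" by blast
  have "averaged_gaussian h \<delta> (Suc k) x \<le> (2 ^ N * C) / (1 + \<delta> * norm x) ^ N" if \<delta>: "\<delta> \<in> {0<..1}" for \<delta> x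
  proof -
    have "\<delta> * norm h \<le> 1 * 1" using \<delta> assms by (intro mult_mono) auto
    then have 1: "C / (1 + \<delta> * norm (x + h)) ^ N \<le> 2 ^ N * (C / (1 + \<delta> * norm x) ^ N)" using \<delta> C by (intro weight_shift) auto
    have "0 \<le> C / (1 + \<delta> * norm x) ^ N" using C \<delta> by auto
    then have 2: "C / (1 + \<delta> * norm x) ^ N \<le> 2 ^ N * (C / (1 + \<delta> * norm x) ^ N)" using mult_right_mono[of 1 "2 ^ N" "C / (1 + \<delta> * norm x) ^ N"] by simp
    have "averaged_gaussian h \<delta> (Suc k) x \<le> (2 ^ N * (C / (1 + \<delta> * norm x) ^ N) + 2 ^ N * (C / (1 + \<delta> * norm x) ^ N)) / 2"
      unfolding averaged_gaussian.simps
      by (intro divide_right_mono add_mono order_trans[OF C(2)[OF \<delta>] 1] order_trans[OF C(2)[OF \<delta>] 2]) simp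
    then show ?thesis by (simp only: times_divide_eq_right mult_2[symmetric]) simp
  qed
  then show ?case using C(1) by (intro exI[of _ "2 ^ N * C"]) auto
qed

text \<open>A modulation that changes sign under the shift \<open>h\<close> turns the averages of the envelope into
  iterated differences of the mollifier, which supplies the cancellation needed for \<open>p \<le> 1\<close>.\<close>

lemma convolve_averaged_gaussian:
  fixes f P :: "'a::euclidean_space \<Rightarrow> complex"
  assumes f: "continuous_on UNIV f" "\<And>x. norm (f x) \<le> D" and P: "continuous_on UNIV P" "\<And>x. norm (P x) \<le> 1" "\<And>x. P (x + h) = - P x"
    and h: "norm h \<le> 1" and \<delta>: "\<delta> \<in> {0<..1}"
  shows "convolve f (\<lambda>y. P y * of_real (averaged_gaussian h \<delta> k y)) x
       = of_real ((1/2) ^ k) * convolve ((forward_diff h ^^ k) f) (\<lambda>y. P y * of_real (averaged_gaussian h \<delta> 0 y)) x"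
  using f
proof (induction k arbitrary: f D)
  case 0 then show ?case by simp
next
  case (Suc k)
  let ?g = "\<lambda>y. P y * complex_of_real (averaged_gaussian h \<delta> k y)"
  have cg: "continuous_on UNIV ?g" by (intro continuous_intros P averaged_gaussian_continuous)
  obtain C where C: "C \<ge> 0" "\<And>x. averaged_gaussian h \<delta> k x \<le> C / (1 + \<delta> * norm x) ^ (2 * DIM('a))"
    using averaged_gaussian_bound[OF h, of k "2 * DIM('a)"] \<delta> by blast
  have iw: "integrable lborel (\<lambda>x::'a. C / (1 + \<delta> * norm x) ^ (2 * DIM('a)))"
    using lborel_integrable_affine[OF integrable_norm_weight[where 'a='a and N="2 * DIM('a)" and C=C, OF order_refl], of \<delta> 0] \<delta> by simp
  have ig: "integrable lborel ?g"
  proof (rule integrable_bounded_by[OF cg iw])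
    fix y
    have "norm (?g y) \<le> 1 * averaged_gaussian h \<delta> k y" unfolding norm_mult
      using P(2)[of y] averaged_gaussian_nonneg[of h \<delta> k y] by (intro mult_mono) auto
    then show "norm (?g y) \<le> C / (1 + \<delta> * norm y) ^ (2 * DIM('a))" using C(2)[of y] by simp
  qed
  have cf: "continuous_on UNIV (\<lambda>y. f (c - y))" for c
    by (rule continuous_on_compose2[OF Suc.prems(1)]) (auto intro!: continuous_intros)
  have i1: "integrable lborel (\<lambda>y. f (c - y) * ?g y)" for c
  proof (rule integrable_bounded_by[OF _ integrable_mult_right[OF integrable_norm[OF ig], of D]])
    show "norm (f (c - y) * ?g y) \<le> D * norm (?g y)" for y unfolding norm_mult by (intro mult_right_mono Suc.prems) auto
  qed (intro continuous_intros cf cg)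
  let ?F = "\<lambda>y. f (x + h - y) * ?g y"
  have mF: "?F \<in> borel_measurable borel" using borel_measurable_integrable[OF i1] by simp
  \<comment> \<open>In the half with the shifted envelope, \<open>P (y + h) = - P y\<close> restores
    the modulation at the shifted point at the cost of a sign; translating back moves the shift to
    \<open>f\<close>.\<close>
  have "convolve f (\<lambda>y. P y * of_real (averaged_gaussian h \<delta> (Suc k) y)) x
      = (LINT y|lborel. (1/2) * (f (x - y) * ?g y) - (1/2) * ?F (y + h))"
    unfolding convolve_def
  proof (rule Bochner_Integration.integral_cong[OF refl])
    fix y
    have "x + h - (y + h) = x - y" by simp
    moreover have "P (h + y) = - P y" using P(3)[of y] by (simp add: add.commute)
    ultimately show "f (x - y) * (P y * of_real (averaged_gaussian h \<delta> (Suc k) y)) = (1/2) * (f (x - y) * ?g y) - (1/2) * ?F (y + h)"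
      by (simp add: P(3) field_simps)
  qed
  also have "\<dots> = (LINT y|lborel. (1/2) * (f (x - y) * ?g y)) - (LINT y|lborel. (1/2) * ?F (y + h))"
    by (rule Bochner_Integration.integral_diff) (intro integrable_mult_right i1 lborel_integrable_translation[of ?F h])+
  also have "(LINT y|lborel. (1/2) * ?F (y + h)) = (LINT y|lborel. (1/2) * ?F y)"
    by (rule lborel_integral_translation[of "\<lambda>y. (1/2) * ?F y"]) (use mF in measurable)
  also have "(LINT y|lborel. (1/2) * (f (x - y) * ?g y)) - (LINT y|lborel. (1/2) * ?F y) = (LINT y|lborel. (1/2) * (f (x - y) * ?g y) - (1/2) * ?F y)"
    by (rule Bochner_Integration.integral_diff[symmetric]) (intro integrable_mult_right i1)+
  also have "\<dots> = (LINT y|lborel. (1/2) * (forward_diff h f (x - y) * ?g y))"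
  proof (rule Bochner_Integration.integral_cong[OF refl])
    fix y
    have "x - y + h = x + h - y" by simp
    then show "(1/2) * (f (x - y) * ?g y) - (1/2) * ?F y = (1/2) * (forward_diff h f (x - y) * ?g y)"
      by (simp add: forward_diff_def algebra_simps)
  qed
  also have "\<dots> = (1/2) * convolve (forward_diff h f) ?g x" unfolding convolve_def by (rule integral_mult_right_zero)
  also have "convolve (forward_diff h f) ?g x = of_real ((1/2) ^ k) * convolve ((forward_diff h ^^ k) (forward_diff h f)) (\<lambda>y. P y * of_real (averaged_gaussian h \<delta> 0 y)) x"
  proof (rule Suc.IH)
    show "continuous_on UNIV (forward_diff h f)" unfolding forward_diff_def[abs_def]
      by (intro continuous_on_diff Suc.prems continuous_on_compose2[OF Suc.prems(1)]) (auto intro!: continuous_intros)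
    show "norm (forward_diff h f x) \<le> 2 * D" for x
      unfolding forward_diff_def using norm_triangle_ineq4[of "f x" "f (x + h)"] Suc.prems(2)[of x] Suc.prems(2)[of "x + h"] by simp
  qed
  finally show ?case by (simp add: funpow_swap1)
qed

text \<open>When \<open>F\<close> fails to be integrable its integral is \<open>0\<close> by
  convention and the bound still holds, so the applications need not check measurability of
  \<open>F\<close>.\<close>

lemma norm_lborel_integral_le:
  fixes F :: "'a::euclidean_space \<Rightarrow> complex"
  assumes "integrable lborel G" "\<And>y. norm (F y) \<le> G y"
  shows "norm (LINT y|lborel. F y) \<le> (LINT y|lborel. G y)"
proof (cases "integrable lborel F")
  case True
  then show ?thesis by (rule Bochner_Integration.integral_norm_bound_integral[OF _ assms])
next
  case False
  have "0 \<le> G y" for y using assms(2)[of y] norm_ge_zero order_trans by blast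
  then show ?thesis using False by (simp add: not_integrable_integral_eq)
qed

lemma iterated_forward_diff_dilate:
  "(forward_diff h ^^ k) (\<lambda>x. c * f (a *\<^sub>R x)) = (\<lambda>x. c * (forward_diff (a *\<^sub>R h) ^^ k) f (a *\<^sub>R x))"
proof (induction k)
  case (Suc k)
  show ?case unfolding funpow.simps o_def Suc
    by (simp add: forward_diff_def[abs_def] fun_eq_iff scaleR_add_right right_diff_distrib)
qed simp

lemma dyadic_dilate_eq:
  "dyadic_dilate \<phi> j = (\<lambda>x::'a::euclidean_space. of_real ((2 powi j) ^ DIM('a)) * \<phi> ((2 powi j) *\<^sub>R x))"
proof
  fix x :: 'a
  have "(2::complex) powi (j * int DIM('a)) = of_real ((2 powi j) ^ DIM('a))"
    by (simp add: power_int_mult)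
  then show "dyadic_dilate \<phi> j x = of_real ((2 powi j) ^ DIM('a)) * \<phi> ((2 powi j) *\<^sub>R x)"
    by (simp add: dyadic_dilate_def)
qed

text \<open>A Peetre-type inequality, from \<open>norm x \<le> norm y + norm (x - y)\<close>: the
  weight at x passes to y at the price of a weight in \<open>x - y\<close>, possibly with the larger
  parameter \<open>d\<close>.\<close>

lemma weight_product:
  fixes x y :: "'a::real_normed_vector"
  assumes "0 \<le> c" "c \<le> d"
  shows "(1 + c * norm x) ^ N \<le> (1 + c * norm y) ^ N * (1 + d * norm (x - y)) ^ N"
proof -
  have "norm x \<le> norm y + norm (x - y)" using norm_triangle_ineq[of y "x - y"] by simp
  from mult_left_mono[OF this assms(1)] have "c * norm x \<le> c * norm y + c * norm (x - y)" by (simp add: distrib_left)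
  also have "\<dots> \<le> c * norm y + d * norm (x - y)" using assms by (intro add_left_mono mult_right_mono) auto
  finally have "1 + c * norm x \<le> 1 + (c * norm y + d * norm (x - y))" by simp
  also have "\<dots> \<le> (1 + c * norm y) * (1 + d * norm (x - y))"
    using mult_nonneg_nonneg[of "c * norm y" "d * norm (x - y)"] assms by (simp add: algebra_simps)
  finally have "(1 + c * norm x) ^ N \<le> ((1 + c * norm y) * (1 + d * norm (x - y))) ^ N" using assms by (intro power_mono) auto
  then show ?thesis by (simp only: power_mult_distrib)
qed

text \<open>The mollifier at scale \<open>a = 2 powi j\<close> is compared with the envelope of
  width \<open>1 / \<delta>\<close>. If \<open>a \<ge> \<delta>\<close> it is no wider than the
  envelope and plain size estimates suffice. If \<open>a < \<delta>\<close> it is wider; then the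
  oscillation of \<open>P\<close> must be exploited, and the \<open>N\<close> averages provide
  \<open>N\<close> differences of the mollifier. Averaging as often as the desired order of decay
  makes the bound uniform in \<open>j\<close>.\<close>

lemma hardy_maximal_bound:
  fixes \<phi> :: "'a::euclidean_space \<Rightarrow> complex"
  assumes \<phi>: "schwartz \<phi>" and e: "e \<in> Basis"
  shows "\<exists>C\<ge>0. \<forall>\<delta>\<in>{0<..1}. \<forall>P. continuous_on UNIV P \<longrightarrow> (\<forall>x. norm (P x) \<le> 1) \<longrightarrow> (\<forall>x. P (x + (1/2) *\<^sub>R e) = - P x) \<longrightarrow>
     (\<forall>j x. norm (convolve (dyadic_dilate \<phi> j) (\<lambda>y. P y * of_real (averaged_gaussian ((1/2) *\<^sub>R e) \<delta> N y)) x) \<le> C / (1 + \<delta> * norm x) ^ N)"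
proof -
  let ?n = "DIM('a)" and ?h = "(1/2) *\<^sub>R e"
  have ne: "norm e = 1" using e by simp
  have nh: "norm ?h \<le> 1" using ne by simp
  have r\<phi>: "rapidly_decreasing \<phi>" by (rule schwartz_rapidly_decreasing[OF \<phi>])
  have c\<phi>: "continuous_on UNIV \<phi>" by (rule rapidly_decreasing_cont[OF r\<phi>])
  obtain C1 where C1: "C1 \<ge> 0" "\<And>\<delta> x. \<delta> \<in> {0<..1} \<Longrightarrow> averaged_gaussian ?h \<delta> N x \<le> C1 / (1 + \<delta> * norm x) ^ N"
    using averaged_gaussian_bound[OF nh, of N N] by blast
  obtain C4 where C4: "C4 \<ge> 0" "\<And>\<delta> x. \<delta> \<in> {0<..1} \<Longrightarrow> averaged_gaussian ?h \<delta> 0 x \<le> C4 / (1 + \<delta> * norm x) ^ (N + 2 * ?n)"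
    using averaged_gaussian_bound[OF nh, of 0 "N + 2 * ?n"] by blast
  obtain C3 where C3: "C3 \<ge> 0" "dir_bounded e N \<phi> (\<lambda>x. C3 / (1 + norm x) ^ N)"
    using schwartz_dir_bounded[OF \<phi> e] by blast
  obtain D where D: "\<And>x. norm (\<phi> x) \<le> D" using rapidly_decreasing_bound[OF r\<phi>, of 0] by auto
  define G where "G w = (1 + norm w) ^ N * norm (\<phi> w)" for w
  have rG: "rapidly_decreasing (\<lambda>w. of_real ((1 + norm w) ^ N) * \<phi> w)"
  proof (rule rapidly_decreasing_mult_growth[OF r\<phi>, where A=1 and k=N])
    show "norm (complex_of_real ((1 + norm x) ^ N)) \<le> 1 * (1 + norm x) ^ N" for x :: 'a unfolding norm_of_real by simp
  qed (intro continuous_intros)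
  have "G = (\<lambda>w. norm (of_real ((1 + norm w) ^ N) * \<phi> w))" by (rule ext) (simp only: G_def norm_mult norm_of_real, simp)
  then have iG: "integrable lborel G" using integrable_norm[OF rapidly_decreasing_integrable[OF rG]] by simp
  have mG: "G \<in> borel_measurable borel" using borel_measurable_integrable[OF iG] by simp
  define C2 where "C2 = (LINT w|lborel. G w)"
  have C2: "C2 \<ge> 0" unfolding C2_def by (rule integral_nonneg_AE) (auto simp: G_def)
  let ?w = "\<lambda>z::'a. 1 / (1 + norm z) ^ (2 * ?n)"
  have iw: "integrable lborel ?w" by (rule integrable_norm_weight) simp
  have mw: "?w \<in> borel_measurable borel" using borel_measurable_integrable[OF iw] by simp
  define C5 where "C5 = (LINT z|lborel. ?w z)"
  have C5: "C5 \<ge> 0" unfolding C5_def by (rule integral_nonneg_AE) auto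
  define B1 where "B1 = C1 * C2" define B2 where "B2 = (2 ^ N) ^ N * C3 * C4 * C5"
  have main: "norm (convolve (dyadic_dilate \<phi> j) (\<lambda>y. P y * of_real (averaged_gaussian ?h \<delta> N y)) x) \<le> (B1 + B2) / (1 + \<delta> * norm x) ^ N"
    if \<delta>: "\<delta> \<in> {0<..1}" and P: "continuous_on UNIV P" "\<And>x. norm (P x) \<le> 1" "\<And>x. P (x + ?h) = - P x" for \<delta> P j x
  proof -
    define a :: real where "a = 2 powi j"
    have a: "a > 0" by (simp add: a_def)
    let ?f = "\<lambda>x. complex_of_real (a ^ ?n) * \<phi> (a *\<^sub>R x)"
    have dd: "dyadic_dilate \<phi> j = ?f" unfolding dyadic_dilate_eq a_def ..
    have X: "0 < (1 + \<delta> * norm x) ^ N" using \<delta> by (intro zero_less_power add_pos_nonneg) auto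
    have B: "B1 \<ge> 0" "B2 \<ge> 0" using C1 C2 C3 C4 C5 by (auto simp: B1_def B2_def)
    show ?thesis
    proof (cases "\<delta> \<le> a")
      case True
      have i: "integrable lborel (\<lambda>y. (C1 / (1 + \<delta> * norm x) ^ N * a ^ ?n) * G (a *\<^sub>R x + (- a) *\<^sub>R y))"
        using lborel_integrable_affine[OF iG, of "- a" "a *\<^sub>R x"] a by (intro integrable_mult_right) simp
      have "norm (convolve ?f (\<lambda>y. P y * of_real (averaged_gaussian ?h \<delta> N y)) x) \<le> (LINT y|lborel. (C1 / (1 + \<delta> * norm x) ^ N * a ^ ?n) * G (a *\<^sub>R x + (- a) *\<^sub>R y))"
        unfolding convolve_def
      proof (rule norm_lborel_integral_le[OF i])
        fix y
        have eq: "a *\<^sub>R x + (- a) *\<^sub>R y = a *\<^sub>R (x - y)" by (simp add: scaleR_diff_right)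
        have Y: "0 < (1 + \<delta> * norm y) ^ N" using \<delta> by (intro zero_less_power add_pos_nonneg) auto
        have na: "a * norm (x - y) = norm (a *\<^sub>R (x - y))" using a by simp
        have "(1 + \<delta> * norm x) ^ N \<le> (1 + \<delta> * norm y) ^ N * (1 + norm (a *\<^sub>R (x - y))) ^ N"
          unfolding na[symmetric] by (rule weight_product) (use \<delta> True in auto)
        then have w: "1 / (1 + \<delta> * norm y) ^ N \<le> (1 + norm (a *\<^sub>R (x - y))) ^ N / (1 + \<delta> * norm x) ^ N"
          using X Y by (simp add: divide_simps mult.commute)
        have "averaged_gaussian ?h \<delta> N y \<le> C1 * (1 / (1 + \<delta> * norm y) ^ N)" using C1(2)[OF \<delta>, of y] by simp
        also have "\<dots> \<le> C1 * ((1 + norm (a *\<^sub>R (x - y))) ^ N / (1 + \<delta> * norm x) ^ N)" by (rule mult_left_mono[OF w C1(1)])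
        finally have g: "averaged_gaussian ?h \<delta> N y \<le> C1 * ((1 + norm (a *\<^sub>R (x - y))) ^ N / (1 + \<delta> * norm x) ^ N)" .
        have "norm (?f (x - y) * (P y * of_real (averaged_gaussian ?h \<delta> N y))) = (a ^ ?n * norm (\<phi> (a *\<^sub>R (x - y)))) * (norm (P y) * averaged_gaussian ?h \<delta> N y)"
          using a averaged_gaussian_nonneg[of ?h \<delta> N y] by (simp add: norm_mult norm_power)
        also have "\<dots> \<le> (a ^ ?n * norm (\<phi> (a *\<^sub>R (x - y)))) * (1 * (C1 * ((1 + norm (a *\<^sub>R (x - y))) ^ N / (1 + \<delta> * norm x) ^ N)))"
          by (intro mult_left_mono mult_mono P g averaged_gaussian_nonneg) (use a in auto)
        also have "\<dots> = (C1 / (1 + \<delta> * norm x) ^ N * a ^ ?n) * G (a *\<^sub>R (x - y))"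
          by (simp add: G_def norm_mult norm_power)
        finally show "norm (?f (x - y) * (P y * of_real (averaged_gaussian ?h \<delta> N y))) \<le> (C1 / (1 + \<delta> * norm x) ^ N * a ^ ?n) * G (a *\<^sub>R x + (- a) *\<^sub>R y)"
          unfolding eq .
      qed
      also have "\<dots> = (C1 / (1 + \<delta> * norm x) ^ N * a ^ ?n) * (LINT y|lborel. G (a *\<^sub>R x + (- a) *\<^sub>R y))" by (rule integral_mult_right_zero)
      also have "\<dots> = C1 / (1 + \<delta> * norm x) ^ N * C2"
        using lborel_integral_affine[OF mG, of "- a" "a *\<^sub>R x"] a by (simp add: C2_def)
      also have "\<dots> \<le> (B1 + B2) / (1 + \<delta> * norm x) ^ N" using B X by (simp add: B1_def divide_right_mono)
      finally show ?thesis unfolding dd .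
    next
      case False
      then have a1: "a < \<delta>" "a \<le> 1" using \<delta> by auto
      have cf: "continuous_on UNIV ?f"
        by (intro continuous_intros continuous_on_compose2[OF c\<phi>]) auto
      have bf: "norm (?f x) \<le> a ^ ?n * D" for x using D a by (simp add: norm_mult norm_power)
      have eqc: "convolve ?f (\<lambda>y. P y * of_real (averaged_gaussian ?h \<delta> N y)) x
         = of_real ((1/2) ^ N) * convolve ((forward_diff ?h ^^ N) ?f) (\<lambda>y. P y * of_real (averaged_gaussian ?h \<delta> 0 y)) x"
        by (rule convolve_averaged_gaussian[OF cf bf P nh \<delta>])
      \<comment> \<open>A difference with step \<open>(1/2) *\<^sub>R e\<close> of the dilated
        mollifier is one with step \<open>(a/2) *\<^sub>R e\<close> of the mollifier itself, hence a
        gain of \<open>a\<close> each time.\<close>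
      have fd: "(forward_diff ?h ^^ N) ?f = (\<lambda>x. complex_of_real (a ^ ?n) * (forward_diff ((a/2) *\<^sub>R e) ^^ N) \<phi> (a *\<^sub>R x))"
        unfolding iterated_forward_diff_dilate by simp
      have fb: "norm ((forward_diff ((a/2) *\<^sub>R e) ^^ N) \<phi> w) \<le> a ^ N * ((2 ^ N) ^ N * (C3 / (1 + norm w) ^ N))" for w
      proof -
        have "norm ((forward_diff ((a/2) *\<^sub>R e) ^^ N) \<phi> w) \<le> (a / 2 * 2 ^ N) ^ N * (C3 / (1 + norm w) ^ N)"
        proof (rule iterated_forward_diff_bound[OF C3(2)])
          fix x \<tau> assume "0 \<le> \<tau>" "\<tau> \<le> (1::real)"
          then show "C3 / (1 + norm (x + \<tau> *\<^sub>R e)) ^ N \<le> 2 ^ N * (C3 / (1 + norm x) ^ N)"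
            using weight_shift[of 1 "\<tau> *\<^sub>R e" C3 x N] C3(1) ne by simp
        qed (use a a1 in auto)
        also have "\<dots> \<le> (a * 2 ^ N) ^ N * (C3 / (1 + norm w) ^ N)"
          using a C3(1) by (intro mult_right_mono power_mono) auto
        finally show ?thesis by (simp add: power_mult_distrib mult.assoc)
      qed
      have XA: "0 < (1 + a * norm x) ^ N" using a by (intro zero_less_power add_pos_nonneg) auto
      define c where "c = a ^ ?n * (a ^ N * ((2 ^ N) ^ N * C3)) * C4 / (1 + a * norm x) ^ N"
      have i: "integrable lborel (\<lambda>z. c * ?w (0 + \<delta> *\<^sub>R z))"
        using lborel_integrable_affine[OF iw, of \<delta> 0] \<delta> by (intro integrable_mult_right) simp
      have "norm (convolve ((forward_diff ?h ^^ N) ?f) (\<lambda>y. P y * of_real (averaged_gaussian ?h \<delta> 0 y)) x) \<le> (LINT z|lborel. c * ?w (0 + \<delta> *\<^sub>R z))"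
        unfolding convolve_def fd
      proof (rule norm_lborel_integral_le[OF i])
        fix z
        let ?Z = "1 + \<delta> * norm z" and ?W = "1 + norm (a *\<^sub>R (x - z))"
        have Z: "0 < ?Z" using \<delta> by (intro add_pos_nonneg) auto
        have W: "0 < ?W" by (intro add_pos_nonneg) auto
        have na: "a * norm (x - z) = norm (a *\<^sub>R (x - z))" using a by simp
        have "(1 + a * norm x) ^ N \<le> (1 + a * norm z) ^ N * ?W ^ N"
          unfolding na[symmetric] by (rule weight_product) (use a in auto)
        also have "\<dots> \<le> ?Z ^ N * ?W ^ N"
          using a a1 \<delta> by (intro mult_right_mono power_mono add_left_mono mult_right_mono) auto
        finally have w: "1 / ?W ^ N \<le> ?Z ^ N / (1 + a * norm x) ^ N"
          using XA W by (simp add: divide_simps mult.commute)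
        have g: "averaged_gaussian ?h \<delta> 0 z \<le> C4 / (?Z ^ N * ?Z ^ (2 * ?n))" using C4(2)[OF \<delta>, of z] by (simp only: power_add)
        have "norm (complex_of_real (a ^ ?n) * (forward_diff ((a/2) *\<^sub>R e) ^^ N) \<phi> (a *\<^sub>R (x - z)) * (P z * of_real (averaged_gaussian ?h \<delta> 0 z)))
           = (a ^ ?n * norm ((forward_diff ((a/2) *\<^sub>R e) ^^ N) \<phi> (a *\<^sub>R (x - z)))) * (norm (P z) * averaged_gaussian ?h \<delta> 0 z)"
          using a averaged_gaussian_nonneg[of ?h \<delta> 0 z] by (simp only: norm_mult norm_of_real abs_of_nonneg[of "a ^ ?n"] zero_le_power less_imp_le abs_of_nonneg[of "averaged_gaussian ?h \<delta> 0 z"])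
        also have "\<dots> \<le> (a ^ ?n * (a ^ N * ((2 ^ N) ^ N * (C3 / ?W ^ N)))) * (1 * (C4 / (?Z ^ N * ?Z ^ (2 * ?n))))"
          using a C3(1) W by (intro mult_mono mult_left_mono fb P g averaged_gaussian_nonneg mult_nonneg_nonneg norm_ge_zero) auto
        also have "\<dots> = (a ^ ?n * (a ^ N * ((2 ^ N) ^ N * C3)) * C4 / (?Z ^ N * ?Z ^ (2 * ?n))) * (1 / ?W ^ N)" by simp
        also have "\<dots> \<le> (a ^ ?n * (a ^ N * ((2 ^ N) ^ N * C3)) * C4 / (?Z ^ N * ?Z ^ (2 * ?n))) * (?Z ^ N / (1 + a * norm x) ^ N)"
          using a C3(1) C4(1) Z by (intro mult_left_mono w) auto
        also have "\<dots> = c * ?w (0 + \<delta> *\<^sub>R z)" using Z \<delta> by (simp add: c_def)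
        finally show "norm (complex_of_real (a ^ ?n) * (forward_diff ((a/2) *\<^sub>R e) ^^ N) \<phi> (a *\<^sub>R (x - z)) * (P z * of_real (averaged_gaussian ?h \<delta> 0 z))) \<le> c * ?w (0 + \<delta> *\<^sub>R z)" .
      qed
      also have "\<dots> = c * (LINT z|lborel. ?w (0 + \<delta> *\<^sub>R z))" by (rule integral_mult_right_zero)
      also have "(LINT z|lborel. ?w (0 + \<delta> *\<^sub>R z)) = C5 / \<delta> ^ ?n"
        using lborel_integral_affine[OF mw, of \<delta> 0] \<delta> unfolding C5_def by (simp add: field_simps)
      also have "c * (C5 / \<delta> ^ ?n) \<le> B2 / (1 + \<delta> * norm x) ^ N"
      proof -
        \<comment> \<open>The gain \<open>a ^ N\<close> of the differences pays for replacing the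
          slowly growing weight \<open>1 + a * norm x\<close> by
          \<open>1 + \<delta> * norm x\<close>.\<close>
        have "(a / \<delta>) * (1 + \<delta> * norm x) \<le> 1 + a * norm x" using a a1 \<delta> by (simp add: field_simps)
        then have "((a / \<delta>) * (1 + \<delta> * norm x)) ^ N \<le> (1 + a * norm x) ^ N" using a \<delta> by (intro power_mono) auto
        then have le: "(a / \<delta>) ^ N * (1 + \<delta> * norm x) ^ N \<le> (1 + a * norm x) ^ N" by (simp only: power_mult_distrib)
        have ad: "0 < (a / \<delta>) ^ N" using a \<delta> by simp
        have "1 / (1 + a * norm x) ^ N \<le> 1 / ((a / \<delta>) ^ N * (1 + \<delta> * norm x) ^ N)"
          using le ad X XA by (intro divide_left_mono mult_pos_pos) auto
        then have "a ^ N * (1 / (1 + a * norm x) ^ N) \<le> a ^ N * (1 / ((a / \<delta>) ^ N * (1 + \<delta> * norm x) ^ N))" using a by (intro mult_left_mono) auto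
        also have "\<dots> = \<delta> ^ N / (1 + \<delta> * norm x) ^ N" using a \<delta> by (simp add: power_divide)
        also have "\<dots> \<le> 1 / (1 + \<delta> * norm x) ^ N" using \<delta> X by (intro divide_right_mono) (auto simp: power_le_one)
        finally have 1: "a ^ N * (1 / (1 + a * norm x) ^ N) \<le> 1 / (1 + \<delta> * norm x) ^ N" .
        have 2: "a ^ ?n / \<delta> ^ ?n \<le> 1" using a a1 \<delta> by (simp add: power_mono)
        have "c * (C5 / \<delta> ^ ?n) = B2 * ((a ^ N * (1 / (1 + a * norm x) ^ N)) * (a ^ ?n / \<delta> ^ ?n))" by (simp add: c_def B2_def)
        also have "\<dots> \<le> B2 * (1 / (1 + \<delta> * norm x) ^ N * 1)"
          by (intro mult_left_mono mult_mono 1 2) (use B X XA a \<delta> in auto)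
        finally show ?thesis by simp
      qed
      finally have F: "norm (convolve ((forward_diff ?h ^^ N) ?f) (\<lambda>y. P y * of_real (averaged_gaussian ?h \<delta> 0 y)) x) \<le> B2 / (1 + \<delta> * norm x) ^ N" .
      have "norm (convolve ?f (\<lambda>y. P y * of_real (averaged_gaussian ?h \<delta> N y)) x) = (1/2) ^ N * norm (convolve ((forward_diff ?h ^^ N) ?f) (\<lambda>y. P y * of_real (averaged_gaussian ?h \<delta> 0 y)) x)"
        unfolding eqc norm_mult by (simp add: norm_power norm_divide)
      also have "\<dots> \<le> 1 * norm (convolve ((forward_diff ?h ^^ N) ?f) (\<lambda>y. P y * of_real (averaged_gaussian ?h \<delta> 0 y)) x)"
        by (intro mult_right_mono) (auto simp: power_le_one)
      also have "\<dots> \<le> B2 / (1 + \<delta> * norm x) ^ N" using F by simp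
      also have "\<dots> \<le> (B1 + B2) / (1 + \<delta> * norm x) ^ N" using B X by (intro divide_right_mono) auto
      finally show ?thesis unfolding dd .
    qed
  qed
  have "B1 + B2 \<ge> 0" using C1 C2 C3 C4 C5 by (auto simp: B1_def B2_def)
  then show ?thesis using main by (intro exI[of _ "B1 + B2"] conjI ballI allI impI) auto
qed

section \<open>Fourier transforms of Gaussians and concentration at a point\<close>

lemma lborel_integral_prod_Basis:
  fixes f :: "'a::euclidean_space \<Rightarrow> real \<Rightarrow> complex"
  assumes "\<And>b. b \<in> Basis \<Longrightarrow> integrable lborel (f b)"
  shows "(LINT x|lborel. (\<Prod>b\<in>Basis. f b (x \<bullet> b))) = (\<Prod>b\<in>Basis. (LINT t|lborel. f b t))"
proof -
  interpret product_sigma_finite "\<lambda>_::'a. interval_measure (\<lambda>x. x)"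
    unfolding product_sigma_finite_def lborel_eq_real[symmetric] by (intro allI lborel.sigma_finite_measure_axioms)
  have m[measurable]: "f b \<in> borel_measurable borel" if "b \<in> Basis" for b
    using borel_measurable_integrable[OF assms[OF that]] by simp
  have "(LINT x|lborel. (\<Prod>b\<in>Basis. f b (x \<bullet> b))) = (LINT g|(\<Pi>\<^sub>M b\<in>Basis. interval_measure (\<lambda>x. x)). (\<Prod>b\<in>Basis. f b ((\<Sum>b\<in>Basis. g b *\<^sub>R b) \<bullet> b)))"
    unfolding lborel_def by (rule integral_distr) (auto intro!: borel_measurable_prod measurable_compose[OF _ m])
  also have "\<dots> = (LINT g|(\<Pi>\<^sub>M b\<in>Basis. interval_measure (\<lambda>x. x)). (\<Prod>b\<in>Basis. f b (g b)))"
    by (intro Bochner_Integration.integral_cong refl prod.cong) simp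
  also have "\<dots> = (\<Prod>b\<in>Basis. (LINT t|interval_measure (\<lambda>x. x). f b t))"
    by (rule product_integral_prod) (use assms in \<open>auto simp: lborel_eq_real\<close>)
  finally show ?thesis by (simp add: lborel_eq_real)
qed

text \<open>The characteristic function of the standard normal distribution, rescaled by
  \<open>sqrt (2 * pi)\<close>.\<close>

lemma gaussian_fourier_real:
  "(LINT t|lborel. complex_of_real (exp (- pi * t\<^sup>2)) * cis (2 * pi * (s * t))) = of_real (exp (- pi * s\<^sup>2))"
proof -
  let ?c = "sqrt (2 * pi)"
  have c: "?c > 0" by simp
  have c2: "?c * ?c = 2 * pi" by simp
  define u where "u = ?c * s"
  have "complex_of_real (exp (- (u\<^sup>2) / 2)) = char std_normal_distribution u" by (simp add: char_std_normal_distribution)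
  also have "\<dots> = (LINT x|lborel. std_normal_density x *\<^sub>R iexp (u * x))"
    unfolding char_def by (rule integral_density) (auto simp: normal_density_nonneg)
  also have "\<dots> = ?c *\<^sub>R (LINT t|lborel. std_normal_density (0 + ?c * t) *\<^sub>R iexp (u * (0 + ?c * t)))"
    using lborel_integral_real_affine[of ?c "\<lambda>x. std_normal_density x *\<^sub>R iexp (u * x)" 0] c by simp
  also have "(LINT t|lborel. std_normal_density (0 + ?c * t) *\<^sub>R iexp (u * (0 + ?c * t)))
      = (LINT t|lborel. of_real (1 / ?c) * (complex_of_real (exp (- pi * t\<^sup>2)) * cis (2 * pi * (s * t))))"
  proof (rule Bochner_Integration.integral_cong[OF refl])
    fix t
    have "std_normal_density (0 + ?c * t) = 1 / ?c * exp (- pi * t\<^sup>2)"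
      by (simp add: std_normal_density_def power_mult_distrib)
    moreover have "u * (0 + ?c * t) = 2 * pi * (s * t)" using c2 by (simp add: u_def mult_ac)
    ultimately show "std_normal_density (0 + ?c * t) *\<^sub>R iexp (u * (0 + ?c * t)) = of_real (1 / ?c) * (complex_of_real (exp (- pi * t\<^sup>2)) * cis (2 * pi * (s * t)))"
      by (simp only: scaleR_conv_of_real of_real_mult cis_conv_exp mult.assoc)
  qed
  also have "\<dots> = of_real (1 / ?c) * (LINT t|lborel. complex_of_real (exp (- pi * t\<^sup>2)) * cis (2 * pi * (s * t)))"
    by (rule integral_mult_right_zero)
  also have "?c *\<^sub>R (of_real (1 / ?c) * (LINT t|lborel. complex_of_real (exp (- pi * t\<^sup>2)) * cis (2 * pi * (s * t)))) = (LINT t|lborel. complex_of_real (exp (- pi * t\<^sup>2)) * cis (2 * pi * (s * t)))"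
    using c by (simp add: scaleR_conv_of_real)
  finally have "(LINT t|lborel. complex_of_real (exp (- pi * t\<^sup>2)) * cis (2 * pi * (s * t))) = of_real (exp (- (u\<^sup>2) / 2))" ..
  moreover have "- (u\<^sup>2) / 2 = - pi * s\<^sup>2" by (simp add: u_def power_mult_distrib)
  ultimately show ?thesis by simp
qed

lemma gaussian_integrable:
  "integrable lborel (\<lambda>x::'a::euclidean_space. exp (- pi * (norm x)\<^sup>2))"
proof (rule Bochner_Integration.integrable_bound[OF integrable_norm_weight[where 'a='a and N="2 * DIM('a)" and C="(2 + real (2 * DIM('a))) ^ (2 * DIM('a))", OF order_refl]])
  show "AE x::'a in lborel. norm (exp (- pi * (norm x)\<^sup>2)) \<le> norm ((2 + real (2 * DIM('a))) ^ (2 * DIM('a)) / (1 + norm x) ^ (2 * DIM('a)))"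
  proof (rule AE_I2)
    fix x :: 'a
    have "exp (- pi * (norm x)\<^sup>2) \<le> (2 + real (2 * DIM('a))) ^ (2 * DIM('a)) / (1 + norm x) ^ (2 * DIM('a))"
      using power_le_exp_square[of "norm x" "2 * DIM('a)"] by (simp add: pos_le_divide_eq add_pos_nonneg mult.commute)
    then show "norm (exp (- pi * (norm x)\<^sup>2)) \<le> norm ((2 + real (2 * DIM('a))) ^ (2 * DIM('a)) / (1 + norm x) ^ (2 * DIM('a)))"
      by (rule order_trans[rotated, OF order_trans[OF _ abs_ge_self[THEN order_trans]]]) auto
  qed
qed (simp add: borel_measurable_continuous_onI continuous_intros)

lemma gaussian_fourier:
  fixes X :: "'a::euclidean_space"
  shows "(LINT x|lborel. complex_of_real (exp (- pi * (norm x)\<^sup>2)) * cis (2 * pi * (X \<bullet> x))) = of_real (exp (- pi * (norm X)\<^sup>2))"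
proof -
  let ?f = "\<lambda>b t. complex_of_real (exp (- pi * t\<^sup>2)) * cis (2 * pi * ((X \<bullet> b) * t))"
  have nb: "(norm x)\<^sup>2 = (\<Sum>b\<in>Basis. (x \<bullet> b)\<^sup>2)" for x :: 'a
    unfolding power2_norm_eq_inner by (subst euclidean_inner) (simp add: power2_eq_square)
  have ex: "exp (- pi * (norm x)\<^sup>2) = (\<Prod>b\<in>Basis. exp (- pi * (x \<bullet> b)\<^sup>2))" for x :: 'a
    unfolding nb sum_distrib_left by (rule exp_sum) simp
  have cs: "cis (\<Sum>b\<in>A. g b) = (\<Prod>b\<in>A. cis (g b))" if "finite A" for A and g :: "'a \<Rightarrow> real"
    using that by (induction A rule: finite_induct) (auto simp: cis_mult[symmetric])
  have "complex_of_real (exp (- pi * (norm x)\<^sup>2)) * cis (2 * pi * (X \<bullet> x)) = (\<Prod>b\<in>Basis. ?f b (x \<bullet> b))" for x :: 'a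
  proof -
    have "2 * pi * (X \<bullet> x) = (\<Sum>b\<in>Basis. 2 * pi * ((X \<bullet> b) * (x \<bullet> b)))"
      by (subst euclidean_inner) (simp add: sum_distrib_left)
    then show ?thesis unfolding ex prod.distrib of_real_prod by (simp only: cs[OF finite_Basis])
  qed
  then have "(LINT x|lborel. complex_of_real (exp (- pi * (norm x)\<^sup>2)) * cis (2 * pi * (X \<bullet> x))) = (LINT x|lborel. (\<Prod>b\<in>Basis. ?f b (x \<bullet> b)))"
    by (simp only:)
  also have "\<dots> = (\<Prod>b\<in>Basis. (LINT t|lborel. ?f b t))"
  proof (rule lborel_integral_prod_Basis)
    fix b :: 'a
    have i: "integrable lborel (\<lambda>t::real. exp (- pi * t\<^sup>2))" using gaussian_integrable[where 'a=real] by simp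
    show "integrable lborel (?f b)"
      by (rule Bochner_Integration.integrable_bound[OF i]) (auto simp: norm_mult cis_conv_exp)
  qed
  also have "\<dots> = (\<Prod>b\<in>Basis. of_real (exp (- pi * (X \<bullet> b)\<^sup>2)))" by (simp only: gaussian_fourier_real)
  also have "\<dots> = of_real (exp (- pi * (norm X)\<^sup>2))" unfolding ex of_real_prod ..
  finally show ?thesis .
qed

text \<open>A Gaussian concentrates at a point of continuity of the bounded function
  \<open>S\<close>. The error is a Gaussian mean of the deviation of \<open>S\<close> from
  \<open>S \<tau>\<close>, and is free of \<open>X\<close> because the exponential has modulus one.
  Uniformity in \<open>X\<close> is essential: the result is used on a region whose diameter grows
  with \<open>R\<close>.\<close>

lemma gaussian_approximate_identity:
  fixes S :: "'a::euclidean_space \<Rightarrow> complex"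
  assumes m[measurable]: "S \<in> borel_measurable borel" and b: "\<And>x. norm (S x) \<le> A" and c: "isCont S \<tau>"
  shows "\<exists>E. E \<longlonglongrightarrow> 0 \<and> (\<forall>R\<ge>1. \<forall>X. norm ((LINT \<xi>|lborel. S \<xi> * of_real (real R ^ DIM('a) * exp (- pi * (real R * norm (\<xi> - \<tau>))\<^sup>2)) * cis (2 * pi * (X \<bullet> \<xi>)))
      - S \<tau> * cis (2 * pi * (X \<bullet> \<tau>)) * of_real (exp (- pi * (norm X / R)\<^sup>2))) \<le> E R)"
proof -
  let ?g = "\<lambda>x::'a. exp (- pi * (norm x)\<^sup>2)"
  define E where "E R = (LINT \<eta>|lborel. norm (S (\<tau> + (1 / real R) *\<^sub>R \<eta>) - S \<tau>) * ?g \<eta>)" for R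
  have gi: "integrable lborel ?g" by (rule gaussian_integrable)
  have gm[measurable]: "?g \<in> borel_measurable borel" using borel_measurable_integrable[OF gi] by simp
  have bd: "norm (S x - S \<tau>) \<le> 2 * A" for x using norm_triangle_ineq4[of "S x" "S \<tau>"] b[of x] b[of \<tau>] by linarith
  have Sm[measurable]: "(\<lambda>\<eta>. S (\<tau> + r *\<^sub>R \<eta>)) \<in> borel_measurable borel" for r :: real
    by (rule measurable_compose[OF _ m]) measurable
  have "E \<longlonglongrightarrow> (LINT \<eta>::'a|lborel. 0 :: real)" unfolding E_def
  proof (rule integral_dominated_convergence[where f="\<lambda>_. 0" and s="\<lambda>R \<eta>. norm (S (\<tau> + (1 / real R) *\<^sub>R \<eta>) - S \<tau>) * ?g \<eta>" and w="\<lambda>\<eta>::'a. 2 * A * ?g \<eta>"])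
    show "AE \<eta> in lborel. (\<lambda>R. norm (S (\<tau> + (1 / real R) *\<^sub>R \<eta>) - S \<tau>) * ?g \<eta>) \<longlonglongrightarrow> 0"
    proof (rule AE_I2)
      fix \<eta> :: 'a
      have "(\<lambda>R. \<tau> + (1 / real R) *\<^sub>R \<eta>) \<longlonglongrightarrow> \<tau> + 0 *\<^sub>R \<eta>" by (intro tendsto_intros lim_1_over_n)
      then have "(\<lambda>R. S (\<tau> + (1 / real R) *\<^sub>R \<eta>)) \<longlonglongrightarrow> S \<tau>" using isCont_tendsto_compose[OF c] by simp
      then have "(\<lambda>R. norm (S (\<tau> + (1 / real R) *\<^sub>R \<eta>) - S \<tau>) * ?g \<eta>) \<longlonglongrightarrow> norm (S \<tau> - S \<tau>) * ?g \<eta>" by (intro tendsto_intros)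
      then show "(\<lambda>R. norm (S (\<tau> + (1 / real R) *\<^sub>R \<eta>) - S \<tau>) * ?g \<eta>) \<longlonglongrightarrow> 0" by simp
    qed
    show "AE \<eta> in lborel. norm (norm (S (\<tau> + (1 / real R) *\<^sub>R \<eta>) - S \<tau>) * ?g \<eta>) \<le> 2 * A * ?g \<eta>" for R
      by (rule AE_I2) (use bd in \<open>auto simp: abs_mult intro!: mult_right_mono\<close>)
  qed (use gi in \<open>auto intro!: integrable_mult_right\<close>)
  then have E0: "E \<longlonglongrightarrow> 0" by simp
  have "norm ((LINT \<xi>|lborel. S \<xi> * of_real (real R ^ DIM('a) * exp (- pi * (real R * norm (\<xi> - \<tau>))\<^sup>2)) * cis (2 * pi * (X \<bullet> \<xi>)))
      - S \<tau> * cis (2 * pi * (X \<bullet> \<tau>)) * of_real (exp (- pi * (norm X / R)\<^sup>2))) \<le> E R" if R: "R \<ge> 1" for R X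
  proof -
    let ?F = "\<lambda>\<xi>. S \<xi> * of_real (real R ^ DIM('a) * exp (- pi * (real R * norm (\<xi> - \<tau>))\<^sup>2)) * cis (2 * pi * (X \<bullet> \<xi>))"
    let ?c = "\<lambda>\<eta>. cis (2 * pi * (X \<bullet> (\<tau> + (1 / real R) *\<^sub>R \<eta>)))"
    have mF: "?F \<in> borel_measurable borel" unfolding cis_conv_exp by measurable
    have "(LINT \<xi>|lborel. ?F \<xi>) = (\<bar>1 / real R\<bar> ^ DIM('a)) *\<^sub>R (LINT \<eta>|lborel. ?F (\<tau> + (1 / real R) *\<^sub>R \<eta>))"
      by (rule lborel_integral_affine[OF mF]) (use R in simp)
    also have "\<dots> = (LINT \<eta>|lborel. (\<bar>1 / real R\<bar> ^ DIM('a)) *\<^sub>R ?F (\<tau> + (1 / real R) *\<^sub>R \<eta>))" by (rule integral_scaleR_right[symmetric])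
    also have "\<dots> = (LINT \<eta>|lborel. S (\<tau> + (1 / real R) *\<^sub>R \<eta>) * of_real (?g \<eta>) * ?c \<eta>)"
    proof (rule Bochner_Integration.integral_cong[OF refl])
      fix \<eta> :: 'a
      have n: "real R * norm (\<tau> + (1 / real R) *\<^sub>R \<eta> - \<tau>) = norm \<eta>" using R by simp
      show "(\<bar>1 / real R\<bar> ^ DIM('a)) *\<^sub>R ?F (\<tau> + (1 / real R) *\<^sub>R \<eta>) = S (\<tau> + (1 / real R) *\<^sub>R \<eta>) * of_real (?g \<eta>) * ?c \<eta>"
        unfolding n using R by (simp add: scaleR_conv_of_real power_one_over field_simps)
    qed
    finally have e1: "(LINT \<xi>|lborel. ?F \<xi>) = (LINT \<eta>|lborel. S (\<tau> + (1 / real R) *\<^sub>R \<eta>) * of_real (?g \<eta>) * ?c \<eta>)" .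
    have cc: "?c \<eta> = cis (2 * pi * (X \<bullet> \<tau>)) * cis (2 * pi * (((1 / real R) *\<^sub>R X) \<bullet> \<eta>))" for \<eta>
      by (simp add: cis_mult inner_add_right distrib_left)
    have e2: "(LINT \<eta>|lborel. S \<tau> * of_real (?g \<eta>) * ?c \<eta>) = S \<tau> * cis (2 * pi * (X \<bullet> \<tau>)) * of_real (exp (- pi * (norm X / R)\<^sup>2))"
    proof -
      have "(LINT \<eta>|lborel. S \<tau> * of_real (?g \<eta>) * ?c \<eta>) = (LINT \<eta>|lborel. (S \<tau> * cis (2 * pi * (X \<bullet> \<tau>))) * (of_real (?g \<eta>) * cis (2 * pi * (((1 / real R) *\<^sub>R X) \<bullet> \<eta>))))"
        unfolding cc by (simp only: mult_ac)
      also have "\<dots> = (S \<tau> * cis (2 * pi * (X \<bullet> \<tau>))) * of_real (exp (- pi * (norm ((1 / real R) *\<^sub>R X))\<^sup>2))"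
        by (simp only: integral_mult_right_zero gaussian_fourier)
      finally show ?thesis by simp
    qed
    have cm[measurable]: "?c \<in> borel_measurable borel" unfolding cis_conv_exp by measurable
    have i1: "integrable lborel (\<lambda>\<eta>. S (\<tau> + (1 / real R) *\<^sub>R \<eta>) * of_real (?g \<eta>) * ?c \<eta>)"
      by (rule Bochner_Integration.integrable_bound[OF integrable_mult_right[OF gi, of A]])
         (use b in \<open>auto simp: norm_mult abs_mult intro!: AE_I2 mult_right_mono order_trans[OF b abs_ge_self]\<close>)
    have i2: "integrable lborel (\<lambda>\<eta>. S \<tau> * of_real (?g \<eta>) * ?c \<eta>)"
      by (rule Bochner_Integration.integrable_bound[OF integrable_mult_right[OF gi, of A]])
         (use b in \<open>auto simp: norm_mult abs_mult intro!: AE_I2 mult_right_mono order_trans[OF b abs_ge_self]\<close>)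
    have i3: "integrable lborel (\<lambda>\<eta>. norm (S (\<tau> + (1 / real R) *\<^sub>R \<eta>) - S \<tau>) * ?g \<eta>)"
      by (rule Bochner_Integration.integrable_bound[OF integrable_mult_right[OF gi, of "2 * A"]])
         (auto simp: norm_mult intro!: AE_I2 order_trans[OF mult_right_mono[OF bd] abs_ge_self])
    have "norm ((LINT \<xi>|lborel. ?F \<xi>) - S \<tau> * cis (2 * pi * (X \<bullet> \<tau>)) * of_real (exp (- pi * (norm X / R)\<^sup>2)))
      = norm (LINT \<eta>|lborel. S (\<tau> + (1 / real R) *\<^sub>R \<eta>) * of_real (?g \<eta>) * ?c \<eta> - S \<tau> * of_real (?g \<eta>) * ?c \<eta>)"
      unfolding e1 e2[symmetric] Bochner_Integration.integral_diff[OF i1 i2] ..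
    also have "\<dots> \<le> E R" unfolding E_def
    proof (rule Bochner_Integration.integral_norm_bound_integral[OF Bochner_Integration.integrable_diff[OF i1 i2] i3])
      fix \<eta> :: 'a
      have "S (\<tau> + (1 / real R) *\<^sub>R \<eta>) * of_real (?g \<eta>) * ?c \<eta> - S \<tau> * of_real (?g \<eta>) * ?c \<eta> = (S (\<tau> + (1 / real R) *\<^sub>R \<eta>) - S \<tau>) * of_real (?g \<eta>) * ?c \<eta>"
        by (simp only: left_diff_distrib)
      then show "norm (S (\<tau> + (1 / real R) *\<^sub>R \<eta>) * of_real (?g \<eta>) * ?c \<eta> - S \<tau> * of_real (?g \<eta>) * ?c \<eta>) \<le> norm (S (\<tau> + (1 / real R) *\<^sub>R \<eta>) - S \<tau>) * ?g \<eta>"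
        by (simp only: norm_mult norm_cis norm_of_real abs_exp_cancel mult_1_right order_refl)
    qed
    finally show ?thesis .
  qed
  then show ?thesis using E0 by blast
qed

text \<open>A shift of the envelope by \<open>h\<close> multiplies the transform by a phase
  depending on \<open>\<xi> - \<theta>\<close>, so each average contributes half of one plus that
  phase.\<close>

lemma fourier_modulated_averaged_gaussian:
  fixes \<theta> h :: "'a::euclidean_space"
  assumes h: "norm h \<le> 1" and R: "R \<ge> 1"
  shows "fourier (\<lambda>x. cis (2 * pi * (\<theta> \<bullet> x)) * of_real (averaged_gaussian h (1 / real R) k x)) \<xi>
    = of_real (real R ^ DIM('a) * exp (- pi * (real R * norm (\<xi> - \<theta>))\<^sup>2)) * ((1 + cis (2 * pi * (h \<bullet> (\<xi> - \<theta>)))) / 2) ^ k"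
proof (induction k)
  case 0
  let ?F = "\<lambda>x. complex_of_real (exp (- pi * (1 / real R * norm x)\<^sup>2)) * cis (2 * pi * ((\<theta> - \<xi>) \<bullet> x))"
  have mF: "?F \<in> borel_measurable borel" unfolding cis_conv_exp by measurable
  have "fourier (\<lambda>x. cis (2 * pi * (\<theta> \<bullet> x)) * of_real (averaged_gaussian h (1 / real R) 0 x)) \<xi> = (LINT x|lborel. ?F x)"
    unfolding fourier_def
  proof (rule Bochner_Integration.integral_cong[OF refl])
    fix x
    have "2 * pi * ((\<theta> - \<xi>) \<bullet> x) = 2 * pi * (\<theta> \<bullet> x) + - 2 * pi * (x \<bullet> \<xi>)" by (simp add: inner_diff_left inner_commute algebra_simps)
    then show "cis (2 * pi * (\<theta> \<bullet> x)) * of_real (averaged_gaussian h (1 / real R) 0 x) * cis (- 2 * pi * (x \<bullet> \<xi>)) = ?F x"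
      by (simp only: cis_mult[symmetric] averaged_gaussian.simps mult_ac)
  qed
  also have "\<dots> = (\<bar>real R\<bar> ^ DIM('a)) *\<^sub>R (LINT x|lborel. ?F (0 + real R *\<^sub>R x))"
    by (rule lborel_integral_affine[OF mF]) (use R in simp)
  also have "(LINT x|lborel. ?F (0 + real R *\<^sub>R x)) = (LINT x|lborel. complex_of_real (exp (- pi * (norm x)\<^sup>2)) * cis (2 * pi * ((real R *\<^sub>R (\<theta> - \<xi>)) \<bullet> x)))"
    by (rule Bochner_Integration.integral_cong[OF refl]) (use R in simp)
  also have "\<dots> = of_real (exp (- pi * (norm (real R *\<^sub>R (\<theta> - \<xi>)))\<^sup>2))" by (rule gaussian_fourier)
  finally show ?case by (simp add: scaleR_conv_of_real norm_minus_commute)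
next
  case (Suc k)
  let ?d = "1 / real R"
  let ?u = "\<lambda>x. cis (2 * pi * (\<theta> \<bullet> x)) * complex_of_real (averaged_gaussian h ?d k x)"
  have d: "?d \<in> {0<..1}" using R by auto
  obtain C where C: "C \<ge> 0" "\<And>x. averaged_gaussian h ?d k x \<le> C / (1 + ?d * norm x) ^ (2 * DIM('a))"
    using averaged_gaussian_bound[OF h, of k "2 * DIM('a)"] d by blast
  have iw: "integrable lborel (\<lambda>x::'a. C / (1 + ?d * norm x) ^ (2 * DIM('a)))"
    using lborel_integrable_affine[OF integrable_norm_weight[where 'a='a and N="2 * DIM('a)" and C=C, OF order_refl], of ?d 0] R by simp
  have cu: "continuous_on UNIV ?u" by (intro continuous_intros averaged_gaussian_continuous)
  have iu: "integrable lborel ?u"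
    by (rule integrable_bounded_by[OF cu iw]) (use C(2) averaged_gaussian_nonneg[of h ?d k] in \<open>simp add: norm_mult\<close>)
  let ?v = "\<lambda>x. ?u x * cis (- 2 * pi * (x \<bullet> \<xi>))"
  have iv: "integrable lborel ?v" by (rule integrable_bounded_by[OF _ integrable_norm[OF iu]]) (auto intro!: continuous_intros cu simp: norm_mult)
  have mv: "?v \<in> borel_measurable borel" using borel_measurable_integrable[OF iv] by simp
  let ?p = "cis (2 * pi * (h \<bullet> (\<xi> - \<theta>)))"
  have "fourier (\<lambda>x. cis (2 * pi * (\<theta> \<bullet> x)) * of_real (averaged_gaussian h ?d (Suc k) x)) \<xi> = (LINT x|lborel. (1/2) * ?v x + (?p / 2) * ?v (x + h))"
    unfolding fourier_def
  proof (rule Bochner_Integration.integral_cong[OF refl])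
    fix x
    have "?p * (cis (2 * pi * (\<theta> \<bullet> (x + h))) * cis (- 2 * pi * ((x + h) \<bullet> \<xi>))) = cis (2 * pi * (\<theta> \<bullet> x)) * cis (- 2 * pi * (x \<bullet> \<xi>))"
      unfolding cis_mult by (rule arg_cong[where f=cis]) (simp add: inner_add_left inner_add_right inner_diff_right inner_commute algebra_simps)
    then have 1: "?p * ?v (x + h) = cis (2 * pi * (\<theta> \<bullet> x)) * cis (- 2 * pi * (x \<bullet> \<xi>)) * of_real (averaged_gaussian h ?d k (x + h))"
      by (simp only: mult_ac)
    define A where "A = cis (2 * pi * (\<theta> \<bullet> x)) * cis (- 2 * pi * (x \<bullet> \<xi>))"
    have 2: "?p * ?v (x + h) = A * of_real (averaged_gaussian h ?d k (x + h))" using 1 unfolding A_def .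
    have 3: "?v x = A * of_real (averaged_gaussian h ?d k x)" unfolding A_def by (simp only: mult_ac)
    have "cis (2 * pi * (\<theta> \<bullet> x)) * of_real (averaged_gaussian h ?d (Suc k) x) * cis (- 2 * pi * (x \<bullet> \<xi>)) = A * of_real (averaged_gaussian h ?d (Suc k) x)"
      unfolding A_def by (simp only: mult_ac)
    also have "\<dots> = (1/2) * (A * of_real (averaged_gaussian h ?d k x)) + (1/2) * (A * of_real (averaged_gaussian h ?d k (x + h)))"
      by (simp add: field_simps)
    also have "\<dots> = (1/2) * ?v x + (?p / 2) * ?v (x + h)" unfolding 2[symmetric] 3[symmetric] by simp
    finally show "cis (2 * pi * (\<theta> \<bullet> x)) * of_real (averaged_gaussian h ?d (Suc k) x) * cis (- 2 * pi * (x \<bullet> \<xi>)) = (1/2) * ?v x + (?p / 2) * ?v (x + h)" .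
  qed
  also have "\<dots> = (LINT x|lborel. (1/2) * ?v x) + (LINT x|lborel. (?p / 2) * ?v (x + h))"
    by (intro Bochner_Integration.integral_add integrable_mult_right iv lborel_integrable_translation[of ?v h])
  also have "\<dots> = (1/2) * (LINT x|lborel. ?v x) + (?p / 2) * (LINT x|lborel. ?v (x + h))" by (simp only: integral_mult_right_zero)
  also have "(LINT x|lborel. ?v (x + h)) = (LINT x|lborel. ?v x)" by (rule lborel_integral_translation[OF mv])
  also have "(LINT x|lborel. ?v x) = fourier ?u \<xi>" unfolding fourier_def ..
  also have "(1/2) * fourier ?u \<xi> + (?p / 2) * fourier ?u \<xi> = fourier ?u \<xi> * ((1 + ?p) / 2)" by (simp add: field_simps)
  finally show ?case unfolding Suc by simp
qed

section \<open>Construction of the multiplier\<close>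

text \<open>Here the dilation factor may exceed one, unlike in \<open>dir_bounded_compose\<close>,
  so the majorant grows with the order.\<close>

lemma dir_bounded_dilate:
  "dir_bounded v K f S \<Longrightarrow> dir_bounded v K (\<lambda>x. f (c *\<^sub>R x)) (\<lambda>x. (max 1 \<bar>c\<bar>) ^ K * S (c *\<^sub>R x))"
proof (induction K arbitrary: f)
  case 0
  then show ?case by (auto intro!: continuous_on_compose2[of UNIV f] continuous_intros)
next
  case (Suc K)
  let ?m = "max 1 \<bar>c\<bar>"
  obtain f' where f: "\<And>x. ((\<lambda>t. f (x + t *\<^sub>R v)) has_vector_derivative f' x) (at 0)" "dir_bounded v K f' S"
    using Suc.prems by auto
  have S0: "0 \<le> S x" for x by (rule dir_bounded_nonneg[OF f(2)])
  show ?case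
  proof (rule dir_bounded_SucI)
    show "continuous_on UNIV (\<lambda>x. f (c *\<^sub>R x))"
      using Suc.prems by (auto intro!: continuous_on_compose2[of UNIV f] continuous_intros)
    fix x
    have "norm (f (c *\<^sub>R x)) \<le> 1 * S (c *\<^sub>R x)" using Suc.prems by simp
    also have "\<dots> \<le> ?m ^ Suc K * S (c *\<^sub>R x)" by (rule mult_right_mono[OF one_le_power S0]) simp
    finally show "norm (f (c *\<^sub>R x)) \<le> ?m ^ Suc K * S (c *\<^sub>R x)" .
    have "((\<lambda>t. f (c *\<^sub>R x + t *\<^sub>R v)) has_vector_derivative f' (c *\<^sub>R x)) (at (c * 0))" using f(1) by simp
    then have "((\<lambda>t. f (c *\<^sub>R x + (c * t) *\<^sub>R v)) has_vector_derivative c *\<^sub>R f' (c *\<^sub>R x)) (at 0)"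
      using vector_diff_chain_at[of "\<lambda>t. c * t" c 0 "\<lambda>t. f (c *\<^sub>R x + t *\<^sub>R v)" "f' (c *\<^sub>R x)"]
      by (auto simp: o_def has_real_derivative_iff_has_vector_derivative[symmetric] intro!: derivative_eq_intros)
    then show "((\<lambda>t. f (c *\<^sub>R (x + t *\<^sub>R v))) has_vector_derivative of_real c * f' (c *\<^sub>R x)) (at 0)"
      by (simp add: scaleR_add_right scaleR_conv_of_real)
  next
    have "dir_bounded v K (\<lambda>x. of_real c * f' (c *\<^sub>R x)) (\<lambda>x. norm (of_real c :: complex) * (?m ^ K * S (c *\<^sub>R x)))"
      by (rule dir_bounded_cmult[OF Suc.IH[OF f(2)]])
    moreover have "norm (of_real c :: complex) * (?m ^ K * S (c *\<^sub>R x)) \<le> ?m ^ Suc K * S (c *\<^sub>R x)" for x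
    proof -
      have "norm (of_real c :: complex) * (?m ^ K * S (c *\<^sub>R x)) \<le> ?m * (?m ^ K * S (c *\<^sub>R x))"
        by (rule mult_right_mono) (auto intro!: mult_nonneg_nonneg S0)
      then show ?thesis by (simp add: mult_ac)
    qed
    ultimately show "dir_bounded v K (\<lambda>x. of_real c * f' (c *\<^sub>R x)) (\<lambda>x. ?m ^ Suc K * S (c *\<^sub>R x))"
      by (rule dir_bounded_mono)
  qed
qed

section \<open>The transform of the admissible bump\<close>

context
  fixes \<Psi> :: "'a::euclidean_space \<Rightarrow> complex"
  assumes adm: "admissible_bump \<Psi>"
begin

lemma admissible_bump_rapid: "rapidly_decreasing \<Psi>"
  using adm schwartz_rapidly_decreasing unfolding admissible_bump_def by blast

text \<open>The set where the transform does not vanish is open and contained in the closed annulus;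
  moving a little along the ray shows that the bounds are strict. Strictness decides the borderline
  scales \<open>j = 1\<close> and \<open>j = -1\<close> on the unit sphere.\<close>

lemma admissible_bump_support:
  assumes "fourier \<Psi> \<xi> \<noteq> 0" shows "1 / 2 < norm \<xi>" "norm \<xi> < 2"
proof -
  let ?U = "{\<xi>. fourier \<Psi> \<xi> \<noteq> 0}"
  have "open ?U" by (intro open_Collect_neq fourier_continuous admissible_bump_rapid continuous_intros)
  then obtain d where d: "d > 0" "ball \<xi> d \<subseteq> ?U" using assms unfolding open_contains_ball by auto
  have sub: "1 / 2 \<le> norm x \<and> norm x \<le> 2" if "x \<in> ?U" for x
    using adm closure_subset[of ?U] that unfolding admissible_bump_def by auto
  have n: "norm \<xi> \<ge> 1 / 2" using sub assms by simp
  define t where "t = min d 1 / (4 * norm \<xi>)"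
  have n0: "norm \<xi> > 0" using n by linarith
  have "t > 0" using d n0 by (simp add: t_def)
  moreover have "t \<le> 1 / (4 * (1 / 2))" unfolding t_def by (rule frac_le) (use n d in auto)
  moreover have "t * norm \<xi> = min d 1 / 4" using n0 by (simp add: t_def)
  ultimately have t: "t > 0" "t \<le> 1 / 2" "t * norm \<xi> < d" using d by auto
  have b: "(1 + u) *\<^sub>R \<xi> \<in> ?U" if "\<bar>u\<bar> = t" for u
  proof -
    have "dist \<xi> ((1 + u) *\<^sub>R \<xi>) = \<bar>u\<bar> * norm \<xi>" by (simp add: dist_norm scaleR_add_left)
    then show ?thesis using d(2) t that by (auto simp: subset_iff)
  qed
  have "norm ((1 + t) *\<^sub>R \<xi>) \<le> 2" "norm ((1 + - t) *\<^sub>R \<xi>) \<ge> 1 / 2" using sub[OF b[of t]] sub[OF b[of "- t"]] t by simp_all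
  then have "(1 + t) * norm \<xi> \<le> 2" "(1 - t) * norm \<xi> \<ge> 1 / 2" using t by auto
  moreover have "t * norm \<xi> > 0" using t n0 by simp
  ultimately show "1 / 2 < norm \<xi>" "norm \<xi> < 2" by (auto simp: algebra_simps)
qed

text \<open>At unit vectors all terms of the partition of unity except \<open>j = 0\<close> vanish.
  Hence the profile of a shell has a point where it is exactly \<open>1\<close> and does not distort
  the prescribed values.\<close>

lemma admissible_bump_sphere:
  assumes "norm \<xi> = 1" shows "fourier \<Psi> \<xi> = 1"
proof -
  let ?f = "\<lambda>j::int. fourier \<Psi> ((1 / 2 powi j) *\<^sub>R \<xi>)"
  have "?f j = 0" if "j \<noteq> 0" for j
  proof (rule ccontr)
    assume "?f j \<noteq> 0"
    then have a: "1 / 2 < (1::real) / 2 powi j" "1 / 2 powi j < (2::real)"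
      using admissible_bump_support[of "(1 / 2 powi j) *\<^sub>R \<xi>"] assms by auto
    show False
    proof (cases "j \<ge> 1")
      case True
      then have "(2::real) powi 1 \<le> 2 powi j" by (intro power_int_increasing) auto
      then show False using a by (simp add: field_simps)
    next
      case False
      then have "(2::real) powi j \<le> 2 powi (-1)" using that by (intro power_int_increasing) auto
      then show False using a by (simp add: field_simps)
    qed
  qed
  then have "(?f has_sum 1) UNIV \<longleftrightarrow> (?f has_sum 1) {0}" by (intro has_sum_cong_neutral) auto
  moreover have "\<xi> \<noteq> 0" using assms by auto
  then have "(?f has_sum 1) UNIV" using adm unfolding admissible_bump_def by blast
  ultimately have "(?f has_sum 1) {0}" by blast
  moreover have "(?f has_sum (\<Sum>j\<in>{0}. ?f j)) {0}" by (rule has_sum_finite) simp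
  ultimately have "1 = (\<Sum>j\<in>{0}. ?f j)" by (rule has_sum_unique)
  then show ?thesis by simp
qed

lemma admissible_bump_smooth: "smooth_bump (fourier \<Psi>)"
  unfolding smooth_bump_def
proof (intro conjI allI)
  fix K
  have "schwartz \<Psi>" using adm unfolding admissible_bump_def by blast
  then obtain C where C: "C \<ge> 0" "\<And>b. b \<in> Basis \<Longrightarrow> dir_bounded b K (fourier \<Psi>) (\<lambda>y. C / (\<Prod>b\<in>Basis. (1 + \<bar>y \<bullet> b\<bar>) ^ 0))"
    using uniformly_schwartz_fourier[OF schwartz_uniformly_schwartz, of \<Psi> K 0] by auto
  then show "\<exists>C\<ge>0. \<forall>b\<in>Basis. dir_bounded b K (fourier \<Psi>) (\<lambda>_. C)" by (intro exI[of _ C]) simp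
next
  show "\<exists>R. \<forall>x. norm x > R \<longrightarrow> fourier \<Psi> x = 0" using admissible_bump_support(2) by (intro exI[of _ 2]) force
qed

text \<open>The Sobolev norm at a dyadic scale sees a shell through such a product, \<open>c\<close>
  being the ratio of the two scales.\<close>

lemma admissible_bump_product_smooth: "smooth_bump (\<lambda>\<xi>. fourier \<Psi> (c *\<^sub>R \<xi>) * fourier \<Psi> \<xi>)"
  unfolding smooth_bump_def
proof (intro conjI allI)
  fix K
  obtain C where C: "C \<ge> 0" "\<And>b. b \<in> Basis \<Longrightarrow> dir_bounded b K (fourier \<Psi>) (\<lambda>_. C)"
    using admissible_bump_smooth unfolding smooth_bump_def by blast
  have "dir_bounded b K (\<lambda>\<xi>. fourier \<Psi> (c *\<^sub>R \<xi>) * fourier \<Psi> \<xi>) (\<lambda>_. 2 ^ K * ((max 1 \<bar>c\<bar>) ^ K * C * C))" if "b \<in> Basis" for b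
    by (rule dir_bounded_mult[OF dir_bounded_dilate[OF C(2)[OF that]] C(2)[OF that]])
  then show "\<exists>D\<ge>0. \<forall>b\<in>Basis. dir_bounded b K (\<lambda>\<xi>. fourier \<Psi> (c *\<^sub>R \<xi>) * fourier \<Psi> \<xi>) (\<lambda>_. D)"
    using C(1) by (intro exI[of _ "2 ^ K * ((max 1 \<bar>c\<bar>) ^ K * C * C)"]) auto
next
  show "\<exists>R. \<forall>x. norm x > R \<longrightarrow> fourier \<Psi> (c *\<^sub>R x) * fourier \<Psi> x = 0"
    using admissible_bump_support(2) by (intro exI[of _ 2]) force
qed

end

section \<open>Functions with prescribed values and small potential\<close>

lemma sum_powr_le:
  fixes x :: "nat \<Rightarrow> real"
  assumes "\<And>p. p < M \<Longrightarrow> 0 \<le> x p" "0 < r"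
  shows "(\<Sum>p<M. x p) powr r \<le> real M powr r * (\<Sum>p<M. x p powr r)"
proof (cases "M = 0")
  case False
  define m where "m = Max (x ` {..<M})"
  have "m \<in> x ` {..<M}" unfolding m_def by (rule Max_in) (use False in auto)
  then obtain q where q: "q < M" "m = x q" by auto
  have "x p \<le> m" if "p < M" for p unfolding m_def by (rule Max_ge) (use that in auto)
  then have "(\<Sum>p<M. x p) \<le> (\<Sum>p<M. x q)" using q(2) by (intro sum_mono) auto
  also have "\<dots> = real M * x q" by simp
  finally have "(\<Sum>p<M. x p) powr r \<le> (real M * x q) powr r"
    by (intro powr_mono2) (use assms in \<open>auto intro: sum_nonneg\<close>)
  also have "\<dots> = real M powr r * x q powr r" using assms(1)[OF q(1)] by (simp add: powr_mult)
  also have "\<dots> \<le> real M powr r * (\<Sum>p<M. x p powr r)"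
    by (intro mult_left_mono member_le_sum) (use q in auto)
  finally show ?thesis .
qed simp

context
  fixes s :: "'m::finite \<Rightarrow> real" and i :: 'm and r :: real and n :: "'n::finite itself"
  assumes m: "CARD('m) \<ge> 2" and s: "\<And>j. 0 \<le> s j" and r: "1 < r" and si: "s i \<le> CARD('n) / r"
begin

text \<open>Each sum over \<open>N\<close> scales has an r-th power integral \<open>O(N)\<close> and
  carries the factor \<open>1 / N\<close>, which leaves \<open>O(N powr (1 - r))\<close>. The crude
  power of \<open>M\<close> in \<open>sum_powr_le\<close> does no harm, as \<open>M\<close> is fixed
  while \<open>N\<close> grows. The bound depends on the set of scales only through its cardinality,
  so arbitrarily fine scales may be chosen later.\<close>

lemma averaged_potential_small:
  fixes B :: "real^'n^'m \<Rightarrow> complex" and v :: "nat \<Rightarrow> complex" and \<theta> :: "nat \<Rightarrow> real^'n" and M :: nat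
  assumes B: "smooth_bump B" and v: "\<And>p. norm (v p) \<le> 1"
  defines "F \<equiv> \<lambda>N I \<xi>. (\<Sum>p<M. v p / of_nat N * (\<Sum>L\<in>I. 1 * translated_gaussian i B (\<theta> p) ((1/2) ^ L) \<xi>))"
  shows "\<forall>\<^sub>F N in sequentially. \<forall>I. finite I \<and> card I = N \<longrightarrow> sobolev_regular s (F N I) \<and>
     (\<integral>\<^sup>+\<xi>. ennreal (norm (sobolev_potential s (F N I) \<xi>) powr r) \<partial>lborel) \<le> 1"
proof -
  let ?G = "\<lambda>I p \<xi>. \<Sum>L\<in>I. 1 * translated_gaussian i B (\<theta> p) ((1/2) ^ L) \<xi>"
  have "\<forall>p. \<exists>C\<ge>0. \<forall>I. finite I \<longrightarrow>
     (\<integral>\<^sup>+\<xi>. ennreal (norm (sobolev_potential s (?G I p) \<xi>) powr r) \<partial>lborel) \<le> ennreal (C * real (card I))"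
    using gaussian_sum_potential_bound[OF m, where s=s, OF s r si B] by (intro allI)
  then obtain C where C: "\<And>p. C p \<ge> 0" and Cb: "\<And>p I. finite I \<Longrightarrow>
     (\<integral>\<^sup>+\<xi>. ennreal (norm (sobolev_potential s (?G I p) \<xi>) powr r) \<partial>lborel) \<le> ennreal (C p * real (card I))"
    by (elim choice[THEN exE]) auto
  define K where "K = real M powr r * (\<Sum>p<M. C p)"
  have "(\<lambda>N. K * real N powr (1 - r)) \<longlonglongrightarrow> K * 0"
    by (intro tendsto_intros tendsto_neg_powr filterlim_real_sequentially) (use r in auto)
  then have "\<forall>\<^sub>F N in sequentially. K * real N powr (1 - r) < 1" by (intro order_tendstoD(2)[where y="K * 0"]) auto
  moreover have "\<forall>\<^sub>F N in sequentially. N \<ge> (1::nat)" by (rule eventually_ge_at_top)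
  ultimately show ?thesis
  proof eventually_elim
    case (elim N)
    show ?case
    proof (intro allI impI)
      fix I :: "nat set" assume I: "finite I \<and> card I = N"
      have reg: "sobolev_regular s (?G I p)" for p
        by (rule sobolev_regular_sum(1)) (use I in \<open>auto intro!: translated_gaussian_regular s B simp: power_le_one\<close>)
      note regF = sobolev_regular_sum[of "{..<M}" s "\<lambda>p. ?G I p" "\<lambda>p. v p / of_nat N", OF finite_lessThan reg]
      define \<Phi> where "\<Phi> p = sobolev_potential s (?G I p)" for p
      have m\<Phi>: "(\<lambda>\<xi>. ennreal (norm (\<Phi> p \<xi>) powr r)) \<in> borel_measurable lborel" for p
        using sobolev_potential_measurable[OF reg, of p] unfolding \<Phi>_def[symmetric] by simp
      have \<Phi>b: "(\<integral>\<^sup>+\<xi>. ennreal (norm (\<Phi> p \<xi>) powr r) \<partial>lborel) \<le> ennreal (C p * real N)" for p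
        using Cb[of I p] I unfolding \<Phi>_def by blast
      have potF: "sobolev_potential s (F N I) \<xi> = (\<Sum>p<M. v p / of_nat N * \<Phi> p \<xi>)" for \<xi>
        unfolding F_def \<Phi>_def by (rule regF(2))
      have regN: "sobolev_regular s (F N I)" unfolding F_def by (rule regF(1))
      let ?k = "real M powr r * (1 / real N) powr r"
      have pw: "ennreal (norm (sobolev_potential s (F N I) \<xi>) powr r) \<le> (\<Sum>p<M. ennreal ?k * ennreal (norm (\<Phi> p \<xi>) powr r))" for \<xi>
      proof -
        have "norm (sobolev_potential s (F N I) \<xi>) \<le> (\<Sum>p<M. (1 / real N) * norm (\<Phi> p \<xi>))"
          unfolding potF
          by (intro sum_norm_le) (use v elim in \<open>auto simp: norm_mult norm_divide intro!: divide_right_mono mult_left_le_one_le\<close>)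
        then have "norm (sobolev_potential s (F N I) \<xi>) powr r \<le> (\<Sum>p<M. (1 / real N) * norm (\<Phi> p \<xi>)) powr r"
          by (intro powr_mono2) (use r in auto)
        also have "\<dots> \<le> real M powr r * (\<Sum>p<M. ((1 / real N) * norm (\<Phi> p \<xi>)) powr r)"
          by (rule sum_powr_le) (use r in auto)
        also have "\<dots> = (\<Sum>p<M. ?k * norm (\<Phi> p \<xi>) powr r)"
          unfolding sum_distrib_left by (rule sum.cong[OF refl], subst powr_mult) (auto simp only: mult.assoc divide_nonneg_nonneg of_nat_0_le_iff zero_le_one norm_ge_zero)
        finally have "ennreal (norm (sobolev_potential s (F N I) \<xi>) powr r) \<le> ennreal (\<Sum>p<M. ?k * norm (\<Phi> p \<xi>) powr r)" by (rule ennreal_leI)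
        also have "\<dots> = (\<Sum>p<M. ennreal (?k * norm (\<Phi> p \<xi>) powr r))" by (rule sum_ennreal[symmetric]) simp
        also have "\<dots> = (\<Sum>p<M. ennreal ?k * ennreal (norm (\<Phi> p \<xi>) powr r))" by (intro sum.cong refl ennreal_mult) auto
        finally show ?thesis .
      qed
      have "(\<integral>\<^sup>+\<xi>. ennreal (norm (sobolev_potential s (F N I) \<xi>) powr r) \<partial>lborel) \<le> (\<integral>\<^sup>+\<xi>. (\<Sum>p<M. ennreal ?k * ennreal (norm (\<Phi> p \<xi>) powr r)) \<partial>lborel)"
        by (intro nn_integral_mono pw)
      also have "\<dots> = (\<Sum>p<M. ennreal ?k * (\<integral>\<^sup>+\<xi>. ennreal (norm (\<Phi> p \<xi>) powr r) \<partial>lborel))"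
        unfolding nn_integral_cmult[OF m\<Phi>, symmetric] by (rule nn_integral_sum) (use m\<Phi> in measurable)
      also have "\<dots> \<le> (\<Sum>p<M. ennreal ?k * ennreal (C p * real N))"
        by (intro sum_mono mult_left_mono \<Phi>b) simp
      also have "\<dots> = (\<Sum>p<M. ennreal (?k * (C p * real N)))" using C by (intro sum.cong refl ennreal_mult[symmetric]) auto
      also have "\<dots> = ennreal (\<Sum>p<M. ?k * (C p * real N))" using C by (intro sum_ennreal) auto
      also have "(\<Sum>p<M. ?k * (C p * real N)) = K * ((1 / real N) powr r * real N)"
        unfolding K_def sum_distrib_left sum_distrib_right by (intro sum.cong refl) (simp only: mult_ac)
      also have "(1 / real N) powr r * real N = real N powr (1 - r)"
        using elim by (simp add: powr_divide powr_diff)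
      also have "ennreal (K * real N powr (1 - r)) \<le> ennreal 1" by (rule ennreal_leI) (use elim in simp)
      finally show "sobolev_regular s (F N I) \<and> (\<integral>\<^sup>+\<xi>. ennreal (norm (sobolev_potential s (F N I) \<xi>) powr r) \<partial>lborel) \<le> 1"
        using regN unfolding ennreal_1 by (intro conjI)
    qed
  qed
qed

end

context
  fixes s :: "'m::finite \<Rightarrow> real" and i :: 'm and r :: real and n :: "'n::finite itself"
  assumes m: "CARD('m) \<ge> 2" and s: "\<And>j. 0 \<le> s j" and r: "1 < r" and si: "s i \<le> CARD('n) / r"
begin

lemma points_separated:
  fixes \<theta> :: "nat \<Rightarrow> 'b::real_normed_vector"
  assumes "inj_on \<theta> {..<M}"
  shows "\<exists>\<eta>>0. \<forall>p<M. \<forall>q<M. p \<noteq> q \<longrightarrow> norm (\<theta> p - \<theta> q) \<ge> 2 * \<eta>"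
proof -
  let ?D = "(\<lambda>(p, q). norm (\<theta> p - \<theta> q)) ` {(p, q). p < M \<and> q < M \<and> p \<noteq> q}"
  have "{(p, q). p < M \<and> q < M \<and> p \<noteq> q} \<subseteq> {..<M} \<times> {..<M}" by auto
  then have f: "finite ?D" by (intro finite_imageI) (rule finite_subset, auto)
  define \<eta> where "\<eta> = Min (insert 1 ?D) / 2"
  have "Min (insert 1 ?D) > 0"
    using f assms by (subst Min_gr_iff) (auto dest: inj_onD)
  moreover have "Min (insert 1 ?D) \<le> norm (\<theta> p - \<theta> q)" if "p < M" "q < M" "p \<noteq> q" for p q
    by (rule Min_le) (use f that in auto)
  ultimately show ?thesis by (intro exI[of _ \<eta>]) (auto simp: \<eta>_def)
qed

text \<open>A dilation by \<open>2 powi k\<close> shifts the scale index by \<open>k\<close> and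
  moves the centre. The bounds on \<open>k\<close> and \<open>L\<close> keep
  \<open>int L + k\<close> nonnegative, so that \<open>nat\<close> does not truncate.\<close>

lemma translated_gaussian_dilate:
  assumes "k \<ge> -1" "L \<ge> 1"
  shows "complex_of_real (exp (- pi * (2 ^ L * norm ((2 powi k) *\<^sub>R (\<xi> $ i) - \<theta>))\<^sup>2)) * B \<xi>
    = translated_gaussian i B ((2 powi (- k)) *\<^sub>R \<theta>) ((1/2) ^ nat (int L + k)) \<xi>"
proof -
  have e: "(2 powi k) *\<^sub>R (\<xi> $ i) - \<theta> = (2 powi k) *\<^sub>R (\<xi> $ i - (2 powi (- k)) *\<^sub>R \<theta>)"
    by (simp add: scaleR_diff_right power_int_add[symmetric])
  have "(2::real) ^ nat (int L + k) = 2 powi (int L + k)"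
    using assms power_int_of_nat[of "2::real" "nat (int L + k)"] by simp
  then have p: "2 ^ L * (2 powi k) = 1 / (1/2 :: real) ^ nat (int L + k)"
    by (simp add: power_int_add power_one_over)
  have "2 ^ L * norm ((2 powi k) *\<^sub>R (\<xi> $ i) - \<theta>) = (2 ^ L * (2 powi k)) * norm (\<xi> $ i - (2 powi (- k)) *\<^sub>R \<theta>)"
    unfolding e by simp
  also have "\<dots> = norm (\<xi> $ i - (2 powi (- k)) *\<^sub>R \<theta>) / (1/2) ^ nat (int L + k)" unfolding p by simp
  finally show ?thesis unfolding translated_gaussian_def by simp
qed

text \<open>Averages over \<open>N\<close> fine scales equal \<open>1\<close> at their own centre
  and are negligible at distance \<open>\<eta>\<close>, so a combination takes nearly the prescribed
  values at all centres. The three values of \<open>k\<close> are the dyadic scales at which one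
  shell is visible to \<open>multiplier_sobolev\<close>, with \<open>B k\<close> as the
  corresponding product of bumps; one function \<open>a\<close> has to be good for all
  three.\<close>

lemma capacity_function:
  fixes B :: "int \<Rightarrow> real^'n^'m \<Rightarrow> complex" and v :: "nat \<Rightarrow> complex" and \<theta> :: "nat \<Rightarrow> real^'n" and M :: nat
  assumes B: "\<And>k. smooth_bump (B k)" and v: "\<And>p. norm (v p) \<le> 1" and inj: "inj_on \<theta> {..<M}" and \<epsilon>: "\<epsilon> > 0"
  shows "\<exists>a. continuous_on UNIV a \<and> (\<forall>z. norm (a z) \<le> 2) \<and> (\<forall>p<M. norm (a (\<theta> p) - v p) \<le> \<epsilon>) \<and>
    (\<forall>k\<in>{-1, 0, 1::int}. sobolev_regular s (\<lambda>\<xi>. a ((2 powi k) *\<^sub>R (\<xi> $ i)) * B k \<xi>) \<and>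
       (\<integral>\<^sup>+\<xi>. ennreal (norm (sobolev_potential s (\<lambda>\<xi>. a ((2 powi k) *\<^sub>R (\<xi> $ i)) * B k \<xi>) \<xi>) powr r) \<partial>lborel) \<le> 1)"
proof -
  obtain \<eta> where \<eta>: "\<eta> > 0" "\<And>p q. p < M \<Longrightarrow> q < M \<Longrightarrow> p \<noteq> q \<Longrightarrow> norm (\<theta> p - \<theta> q) \<ge> 2 * \<eta>"
    using points_separated[OF inj] by blast
  let ?F = "\<lambda>k N I \<xi>. \<Sum>p<M. v p / of_nat N * (\<Sum>L\<in>I. 1 * translated_gaussian i (B k) ((2 powi (- k)) *\<^sub>R \<theta> p) ((1/2) ^ L) \<xi>)"
  have small: "\<forall>\<^sub>F N in sequentially. \<forall>I. finite I \<and> card I = N \<longrightarrow> sobolev_regular s (?F k N I) \<and>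
     (\<integral>\<^sup>+\<xi>. ennreal (norm (sobolev_potential s (?F k N I) \<xi>) powr r) \<partial>lborel) \<le> 1" for k
    by (rule averaged_potential_small[OF m, where s=s, OF s r si B v])
  \<comment> \<open>\<open>1 / (N * \<eta>\<^sup>2)\<close> bounds each average at distance
    \<open>\<eta>\<close> from its centre, so \<open>M\<close> times it bounds all cross terms:
    below \<open>\<epsilon>\<close> it gives the accuracy, below \<open>1\<close> the bound
    \<open>2\<close>.\<close>
  have "(\<lambda>N. real M * (1 / (real N * \<eta>\<^sup>2))) \<longlonglongrightarrow> real M * 0"
    using tendsto_mult[OF lim_1_over_n[where 'a=real] tendsto_const[of "1 / \<eta>\<^sup>2"]] by (intro tendsto_intros) simp
  then have "\<forall>\<^sub>F N in sequentially. real M * (1 / (real N * \<eta>\<^sup>2)) < min \<epsilon> 1" using \<epsilon> by (intro order_tendstoD(2)) auto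
  then have "\<forall>\<^sub>F N in sequentially. (\<forall>k\<in>{-1,0,1::int}. \<forall>I. finite I \<and> card I = N \<longrightarrow> sobolev_regular s (?F k N I) \<and>
     (\<integral>\<^sup>+\<xi>. ennreal (norm (sobolev_potential s (?F k N I) \<xi>) powr r) \<partial>lborel) \<le> 1) \<and> real M * (1 / (real N * \<eta>\<^sup>2)) < min \<epsilon> 1 \<and> 1 \<le> N"
  proof (intro eventually_conj eventually_ge_at_top)
    show "\<forall>\<^sub>F N in sequentially. \<forall>k\<in>{-1,0,1::int}. \<forall>I. finite I \<and> card I = N \<longrightarrow> sobolev_regular s (?F k N I) \<and>
     (\<integral>\<^sup>+\<xi>. ennreal (norm (sobolev_potential s (?F k N I) \<xi>) powr r) \<partial>lborel) \<le> 1"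
      by (rule eventually_ball_finite) (intro finite.intros, intro ballI small)
  qed
  then have "\<exists>N. (\<forall>k\<in>{-1,0,1::int}. \<forall>I. finite I \<and> card I = N \<longrightarrow> sobolev_regular s (?F k N I) \<and>
     (\<integral>\<^sup>+\<xi>. ennreal (norm (sobolev_potential s (?F k N I) \<xi>) powr r) \<partial>lborel) \<le> 1) \<and> real M * (1 / (real N * \<eta>\<^sup>2)) < min \<epsilon> 1 \<and> 1 \<le> N"
    by (rule eventually_happens'[OF sequentially_bot])
  then obtain N where N0: "\<forall>k\<in>{-1,0,1::int}. \<forall>I. finite I \<and> card I = N \<longrightarrow> sobolev_regular s (?F k N I) \<and>
     (\<integral>\<^sup>+\<xi>. ennreal (norm (sobolev_potential s (?F k N I) \<xi>) powr r) \<partial>lborel) \<le> 1" and N23: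
    "real M * (1 / (real N * \<eta>\<^sup>2)) < min \<epsilon> 1" "1 \<le> N" by (elim exE conjE)
  have N: "k \<in> {-1,0,1::int} \<Longrightarrow> finite I \<Longrightarrow> card I = N \<Longrightarrow> sobolev_regular s (?F k N I) \<and>
     (\<integral>\<^sup>+\<xi>. ennreal (norm (sobolev_potential s (?F k N I) \<xi>) powr r) \<partial>lborel) \<le> 1" for k I
    by (rule N0[rule_format], assumption, intro conjI)
  \<comment> \<open>\<open>N\<close> consecutive scales, all larger than \<open>N\<close>: the
    Gaussians are narrow enough, and the index stays nonnegative after a shift by
    \<open>-1\<close>.\<close>
  let ?I = "{N+1..N+N}"
  have cI: "card ?I = N" by simp
  define g where "g p z = (\<Sum>L\<in>?I. exp (- pi * (2 ^ L * norm (z - \<theta> p))\<^sup>2)) / real N" for p z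
  define a where "a z = (\<Sum>p<M. v p * of_real (g p z))" for z
  let ?\<kappa> = "1 / (real N * \<eta>\<^sup>2)"
  have g0: "0 \<le> g p z" for p z unfolding g_def by (intro divide_nonneg_nonneg sum_nonneg) auto
  have g1: "g p z \<le> 1" for p z
  proof -
    have "(\<Sum>L\<in>?I. exp (- pi * (2 ^ L * norm (z - \<theta> p))\<^sup>2)) \<le> (\<Sum>L\<in>?I. 1)" by (intro sum_mono) simp
    then show ?thesis unfolding g_def using N23(2) cI by simp
  qed
  have g\<kappa>: "g p z \<le> ?\<kappa>" if d: "norm (z - \<theta> p) \<ge> \<eta>" for p z
  proof -
    have "exp (- pi * (2 ^ L * norm (z - \<theta> p))\<^sup>2) \<le> ?\<kappa>" if L: "L \<in> ?I" for L
    proof -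
      have "real N \<le> real L" using L by simp
      also have "real L \<le> 2 ^ L" using of_nat_less_two_power[of L] by (simp add: less_imp_le)
      also have "\<dots> \<le> (2 ^ L)\<^sup>2" by (simp add: self_le_power)
      finally have a: "real N * \<eta>\<^sup>2 \<le> (2 ^ L)\<^sup>2 * (norm (z - \<theta> p))\<^sup>2"
        by (intro mult_mono power_mono d) (use \<eta>(1) in auto)
      have "real N * \<eta>\<^sup>2 \<le> pi * (2 ^ L * norm (z - \<theta> p))\<^sup>2"
        unfolding power_mult_distrib using mult_mono[OF _ a, of 1 pi] pi_ge_two by simp
      then have "exp (- pi * (2 ^ L * norm (z - \<theta> p))\<^sup>2) \<le> exp (- (real N * \<eta>\<^sup>2))" by simp
      also have "\<dots> \<le> ?\<kappa>"
      proof -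
        have "real N * \<eta>\<^sup>2 \<le> exp (real N * \<eta>\<^sup>2)" using exp_ge_add_one_self[of "real N * \<eta>\<^sup>2"] by linarith
        moreover have "real N * \<eta>\<^sup>2 > 0" using N23(2) \<eta>(1) by simp
        ultimately show ?thesis unfolding exp_minus inverse_eq_divide by (intro frac_le) auto
      qed
      finally show ?thesis .
    qed
    then have "(\<Sum>L\<in>?I. exp (- pi * (2 ^ L * norm (z - \<theta> p))\<^sup>2)) \<le> real (card ?I) * ?\<kappa>" by (intro sum_bounded_above)
    then show ?thesis unfolding g_def cI using N23(2) by (simp add: pos_divide_le_eq mult.commute)
  qed
  have sg: "(\<Sum>p\<in>A. g p z) \<le> real M * ?\<kappa>" if A: "A \<subseteq> {..<M}" "\<And>p. p \<in> A \<Longrightarrow> norm (z - \<theta> p) \<ge> \<eta>" for A z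
  proof -
    have "(\<Sum>p\<in>A. g p z) \<le> real (card A) * ?\<kappa>" by (intro sum_bounded_above g\<kappa> A)
    also have "\<dots> \<le> real M * ?\<kappa>"
      using card_mono[OF _ A(1)] \<eta>(1) by (intro mult_right_mono) auto
    finally show ?thesis .
  qed
  have far: "norm (z - \<theta> p) \<ge> \<eta>" if "p < M" "q < M" "p \<noteq> q" "norm (z - \<theta> q) < \<eta>" for p q z
    using \<eta>(2)[OF that(1-3)] that(4) norm_triangle_ineq4[of "z - \<theta> q" "z - \<theta> p"] by (simp add: norm_minus_commute)
  have bd: "norm (a z) \<le> 2" for z
  proof -
    have "norm (a z) \<le> (\<Sum>p<M. g p z)" unfolding a_def
      by (intro sum_norm_le) (use v g0 in \<open>auto simp: norm_mult intro!: mult_left_le_one_le\<close>)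
    also have "\<dots> \<le> 2"
    proof (cases "\<exists>q<M. norm (z - \<theta> q) < \<eta>")
      case True
      then obtain q where q: "q < M" "norm (z - \<theta> q) < \<eta>" by blast
      have "(\<Sum>p<M. g p z) = g q z + (\<Sum>p\<in>{..<M}-{q}. g p z)" using q by (subst sum.remove[of _ q]) auto
      also have "\<dots> \<le> 1 + real M * ?\<kappa>" by (intro add_mono g1 sg) (use far q in auto)
      finally show ?thesis using N23(1) by linarith
    next
      case False
      then have "\<eta> \<le> norm (z - \<theta> p)" if "p < M" for p using that by (meson not_less)
      then have "(\<Sum>p<M. g p z) \<le> real M * ?\<kappa>" by (intro sg) auto
      then show ?thesis using N23(1) by linarith
    qed
    finally show ?thesis .
  qed
  have val: "norm (a (\<theta> q) - v q) \<le> \<epsilon>" if q: "q < M" for q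
  proof -
    have g1: "g q (\<theta> q) = 1" unfolding g_def using N23(2) cI by simp
    have "a (\<theta> q) = v q * of_real (g q (\<theta> q)) + (\<Sum>p\<in>{..<M}-{q}. v p * of_real (g p (\<theta> q)))"
      unfolding a_def using q by (subst sum.remove[of _ q]) auto
    then have "norm (a (\<theta> q) - v q) = norm (\<Sum>p\<in>{..<M}-{q}. v p * of_real (g p (\<theta> q)))" unfolding g1 by simp
    also have "\<dots> \<le> (\<Sum>p\<in>{..<M}-{q}. g p (\<theta> q))"
      by (intro sum_norm_le) (use v g0 in \<open>auto simp: norm_mult intro!: mult_left_le_one_le\<close>)
    also have "\<dots> \<le> real M * ?\<kappa>" by (intro sg) (use far q \<eta>(1) in auto)
    finally show ?thesis using N23(1) by linarith
  qed
  \<comment> \<open>Dilating the argument turns the scales \<open>?I\<close> into shifted ones,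
    equal in number, so the estimate for \<open>N\<close> arbitrary scales applies.\<close>
  have F: "(\<lambda>\<xi>. a ((2 powi k) *\<^sub>R (\<xi> $ i)) * B k \<xi>) = ?F k N ((\<lambda>L. nat (int L + k)) ` ?I)" if k: "k \<in> {-1,0,1}" for k
  proof
    fix \<xi> :: "real^'n^'m"
    have inj: "inj_on (\<lambda>L. nat (int L + k)) ?I" by (rule inj_onI) (use k in auto)
    have "v p * of_real (g p ((2 powi k) *\<^sub>R (\<xi> $ i))) * B k \<xi>
      = v p / of_nat N * (\<Sum>L\<in>(\<lambda>L. nat (int L + k)) ` ?I. 1 * translated_gaussian i (B k) ((2 powi (- k)) *\<^sub>R \<theta> p) ((1/2) ^ L) \<xi>)" for p
    proof -
      have "(\<Sum>L\<in>(\<lambda>L. nat (int L + k)) ` ?I. 1 * translated_gaussian i (B k) ((2 powi (- k)) *\<^sub>R \<theta> p) ((1/2) ^ L) \<xi>)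
        = (\<Sum>L\<in>?I. complex_of_real (exp (- pi * (2 ^ L * norm ((2 powi k) *\<^sub>R (\<xi> $ i) - \<theta> p))\<^sup>2)) * B k \<xi>)"
        unfolding sum.reindex[OF inj] o_def mult_1_left
        by (intro sum.cong refl translated_gaussian_dilate[symmetric]) (use k in auto)
      also have "\<dots> = of_real (\<Sum>L\<in>?I. exp (- pi * (2 ^ L * norm ((2 powi k) *\<^sub>R (\<xi> $ i) - \<theta> p))\<^sup>2)) * B k \<xi>"
        unfolding of_real_sum sum_distrib_right ..
      finally show ?thesis unfolding g_def by (simp add: of_real_divide)
    qed
    then show "a ((2 powi k) *\<^sub>R (\<xi> $ i)) * B k \<xi> = ?F k N ((\<lambda>L. nat (int L + k)) ` ?I) \<xi>"
      unfolding a_def sum_distrib_right by (intro sum.cong refl)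
  qed
  have "continuous_on UNIV a" unfolding a_def[abs_def] g_def by (intro continuous_intros) (use N23(2) in auto)
  moreover have "sobolev_regular s (\<lambda>\<xi>. a ((2 powi k) *\<^sub>R (\<xi> $ i)) * B k \<xi>) \<and>
       (\<integral>\<^sup>+\<xi>. ennreal (norm (sobolev_potential s (\<lambda>\<xi>. a ((2 powi k) *\<^sub>R (\<xi> $ i)) * B k \<xi>) \<xi>) powr r) \<partial>lborel) \<le> 1"
    if k: "k \<in> {-1,0,1}" for k
    unfolding F[OF k]
  proof (rule N[OF k])
    show "card ((\<lambda>L. nat (int L + k)) ` ?I) = N" by (subst card_image) (use k in \<open>auto intro!: inj_onI\<close>)
  qed simp
  ultimately show ?thesis using bd val by (intro exI[of _ a]) blast
qed

end

section \<open>Assembling the lacunary shells\<close>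

lemma sobolev_norm_le_1:
  fixes s :: "'m::finite \<Rightarrow> real" and F :: "real^'n^'m \<Rightarrow> complex"
  assumes s: "\<And>j. 0 \<le> s j" and r: "1 < r" and F: "sobolev_regular s F"
    and b: "(\<integral>\<^sup>+\<xi>. ennreal (norm (sobolev_potential s F \<xi>) powr r) \<partial>lborel) \<le> 1"
  shows "sobolev_norm r s F \<le> 1"
proof -
  let ?I = "\<integral>\<^sup>+\<xi>. ennreal (norm (sobolev_potential s F \<xi>) powr r) \<partial>lborel"
  have "sobolev_norm r s F \<le> Lnorm (ennreal r) (\<lambda>x. ennreal (norm (sobolev_potential s F x)))"
    unfolding sobolev_norm_def distr_Lnorm_def
    by (rule Inf_lower) (use sobolev_potential_represents[where s=s, OF s F] in blast)
  also have "\<dots> = ennreal_rpow ?I (1 / r)"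
    unfolding Lnorm_def using r by (simp add: ennreal_rpow_def)
  also have "\<dots> = ennreal (enn2real ?I powr (1 / r))"
    using b by (auto simp: ennreal_rpow_def top_unique)
  also have "\<dots> \<le> ennreal 1"
  proof (rule ennreal_leI)
    have "enn2real ?I \<le> 1" using b by (simp add: enn2real_leI)
    then show "enn2real ?I powr (1 / r) \<le> 1" using powr_mono2[of "1 / r" "enn2real ?I" 1] r by simp
  qed
  finally show ?thesis by simp
qed

text \<open>Two points of the open annulus on one ray differ by a factor strictly between
  \<open>1/4\<close> and \<open>4\<close>; among powers of two this leaves three.\<close>

lemma powi_two_scales:
  assumes "1 / 2 < x" "x < 2" "1 / 2 < 2 powi k * x" "2 powi k * x < (2::real)"
  shows "k \<in> {-1, 0, 1}"
proof -
  have a: "2 powi k < (4::real)"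
  proof (rule ccontr)
    assume "\<not> 2 powi k < (4::real)"
    then have "4 * (1 / 2) \<le> 2 powi k * x" using assms by (intro mult_mono) auto
    then show False using assms by simp
  qed
  have b: "1 / 4 < (2::real) powi k"
  proof (rule ccontr)
    assume "\<not> 1 / 4 < (2::real) powi k"
    then have "2 powi k * x \<le> 1 / 4 * 2" using assms by (intro mult_mono) auto
    then show False using assms by simp
  qed
  have "k < 2"
  proof (rule ccontr)
    assume "\<not> k < 2"
    then have "(2::real) powi 2 \<le> 2 powi k" by (intro power_int_increasing) auto
    then show False using a by simp
  qed
  moreover have "k > -2"
  proof (rule ccontr)
    assume "\<not> k > -2"
    then have "(2::real) powi k \<le> 2 powi (-2)" by (intro power_int_increasing) auto
    then show False using b by (simp add: power_int_minus)
  qed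
  ultimately show ?thesis by auto
qed

text \<open>Consecutive shells are five dyadic steps apart, while a shell is visible at three
  consecutive dyadic scales only, so no scale sees two shells.\<close>

lemma lacunary_scale: "(1 / 32 :: real) ^ \<nu> * 2 powi j = 2 powi (j - 5 * int \<nu>)"
proof -
  have "(32::real) ^ \<nu> = (2 ^ 5) ^ \<nu>" by simp
  also have "\<dots> = 2 powi (5 * int \<nu>)" unfolding power_mult[symmetric] using power_int_of_nat[of "2::real" "5 * \<nu>"] by simp
  finally show ?thesis by (simp add: power_int_diff power_one_over)
qed

text \<open>The multiplier is a sum of disjoint shells, the \<open>\<nu>\<close>-th being a function
  of block i, rescaled by \<open>32^\<nu>\<close>, times the profile given by \<open>\<Psi>\<close>.
  At each dyadic scale at most one shell is visible, so the norms do not add up. On a shell the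
  error has two sources: the accuracy \<open>(1/2) ^ \<nu>\<close> of the prescribed values, and the
  Lipschitz variation of the profile away from \<open>\<eta>\<close>, where it equals
  \<open>1\<close>.\<close>

lemma multiplier_construction:
  fixes \<Psi> :: "real^'n^'m \<Rightarrow> complex" and s :: "'m::finite \<Rightarrow> real" and i :: 'm and e :: "real^'n"
    and v :: "nat \<Rightarrow> nat \<Rightarrow> complex" and M :: "nat \<Rightarrow> nat" and \<eta> :: "real^'n^'m"
  assumes m: "CARD('m) \<ge> 2" and s: "\<And>j. 0 \<le> s j" and r: "1 < r" and si: "s i \<le> CARD('n) / r"
    and adm: "admissible_bump \<Psi>" and e: "e \<noteq> 0" and v: "\<And>\<nu> p. norm (v \<nu> p) \<le> 1" and \<eta>: "norm \<eta> = 1"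
  shows "\<exists>\<sigma>. \<sigma> \<in> borel_measurable borel \<and> (\<exists>A. \<forall>\<xi>. norm (\<sigma> \<xi>) \<le> A) \<and> multiplier_sobolev r s \<Psi> \<sigma> < \<infinity> \<and>
    (\<exists>L\<ge>0. \<forall>\<nu> p \<xi>. p < M \<nu> \<longrightarrow> \<xi> $ i = (2 * real p + 1) *\<^sub>R e \<longrightarrow> norm ((1/32) ^ \<nu> *\<^sub>R \<xi> - \<eta>) \<le> 1 / 4 \<longrightarrow>
      isCont \<sigma> \<xi> \<and> norm (\<sigma> \<xi> - v \<nu> p) \<le> L * ((1/2) ^ \<nu> + norm ((1/32) ^ \<nu> *\<^sub>R \<xi> - \<eta>)))"
proof -
  note supp = admissible_bump_support[OF adm]
  let ?P = "fourier \<Psi>"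
  obtain A where A: "A \<ge> 0" "\<And>\<xi> \<eta>. norm (?P \<xi> - ?P \<eta>) \<le> A * norm (\<xi> - \<eta>)"
    using fourier_lipschitz[OF admissible_bump_rapid[OF adm]] by blast
  have cP: "continuous_on UNIV ?P" by (rule fourier_continuous[OF admissible_bump_rapid[OF adm]])
  obtain D where D: "D \<ge> 0" "\<And>\<xi>. norm (?P \<xi>) \<le> D"
  proof -
    obtain C where C: "C \<ge> 0" "\<And>b. b \<in> Basis \<Longrightarrow> dir_bounded b 0 ?P (\<lambda>_. C)"
      using admissible_bump_smooth[OF adm] unfolding smooth_bump_def by blast
    show ?thesis by (rule that[OF C(1)]) (rule dir_bounded_bound[OF C(2)[OF SOME_Basis]])
  qed
  define B where "B k \<xi> = ?P ((2 powi k) *\<^sub>R \<xi>) * ?P \<xi>" for k \<xi>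
  have B: "smooth_bump (B k)" for k unfolding B_def[abs_def] by (rule admissible_bump_product_smooth[OF adm])
  \<comment> \<open>The prescribed frequencies are odd multiples of \<open>e\<close>, on the same
    grid for every shell; after rescaling they crowd near the origin, still at distinct
    points.\<close>
  define \<theta> where "\<theta> \<nu> p = ((1/32) ^ \<nu> * (2 * real p + 1)) *\<^sub>R e" for \<nu> p :: nat
  have inj: "inj_on (\<theta> \<nu>) {..<M \<nu>}" for \<nu> by (rule inj_onI) (use e in \<open>auto simp: \<theta>_def\<close>)
  have "\<forall>\<nu>. \<exists>a. continuous_on UNIV a \<and> (\<forall>z. norm (a z) \<le> 2) \<and> (\<forall>p<M \<nu>. norm (a (\<theta> \<nu> p) - v \<nu> p) \<le> (1/2) ^ \<nu>) \<and>
    (\<forall>k\<in>{-1, 0, 1::int}. sobolev_regular s (\<lambda>\<xi>. a ((2 powi k) *\<^sub>R (\<xi> $ i)) * B k \<xi>) \<and>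
       (\<integral>\<^sup>+\<xi>. ennreal (norm (sobolev_potential s (\<lambda>\<xi>. a ((2 powi k) *\<^sub>R (\<xi> $ i)) * B k \<xi>) \<xi>) powr r) \<partial>lborel) \<le> 1)"
    by (intro allI capacity_function[OF m, where s=s, OF s r si B v inj]) simp
  then obtain a where a: "\<forall>\<nu>. continuous_on UNIV (a \<nu>) \<and> (\<forall>z. norm (a \<nu> z) \<le> 2) \<and> (\<forall>p<M \<nu>. norm (a \<nu> (\<theta> \<nu> p) - v \<nu> p) \<le> (1/2) ^ \<nu>) \<and>
    (\<forall>k\<in>{-1, 0, 1::int}. sobolev_regular s (\<lambda>\<xi>. a \<nu> ((2 powi k) *\<^sub>R (\<xi> $ i)) * B k \<xi>) \<and>
       (\<integral>\<^sup>+\<xi>. ennreal (norm (sobolev_potential s (\<lambda>\<xi>. a \<nu> ((2 powi k) *\<^sub>R (\<xi> $ i)) * B k \<xi>) \<xi>) powr r) \<partial>lborel) \<le> 1)"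
    by (elim choice[THEN exE])
  define T where "T \<nu> \<xi> = a \<nu> ((1/32) ^ \<nu> *\<^sub>R (\<xi> $ i)) * ?P ((1/32) ^ \<nu> *\<^sub>R \<xi>)" for \<nu> \<xi>
  define \<sigma> where "\<sigma> \<xi> = (\<Sum>\<nu>. T \<nu> \<xi>)" for \<xi>
  have cT: "continuous_on UNIV (T \<nu>)" for \<nu>
    unfolding T_def[abs_def]
    by (intro continuous_on_mult continuous_on_compose2[OF a[rule_format, THEN conjunct1]] continuous_on_compose2[OF cP] continuous_intros) auto
  have Ts: "1 / 2 < norm ((1/32) ^ \<nu> *\<^sub>R \<xi>)" "norm ((1/32) ^ \<nu> *\<^sub>R \<xi>) < 2" if "T \<nu> \<xi> \<noteq> 0" for \<nu> \<xi>
  proof -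
    have "?P ((1/32) ^ \<nu> *\<^sub>R \<xi>) \<noteq> 0" using that unfolding T_def by simp
    then show "1 / 2 < norm ((1/32) ^ \<nu> *\<^sub>R \<xi>)" "norm ((1/32) ^ \<nu> *\<^sub>R \<xi>) < 2" by (rule supp)+
  qed
  have T0: "T \<mu> \<xi> = 0" if "\<mu> \<noteq> \<nu>" "1 / 2 < norm ((1/32) ^ \<nu> *\<^sub>R \<xi>)" "norm ((1/32) ^ \<nu> *\<^sub>R \<xi>) < 2" for \<mu> \<nu> \<xi>
  proof (rule ccontr)
    assume "T \<mu> \<xi> \<noteq> 0"
    note s2 = Ts[OF this]
    have e1: "norm ((1/32) ^ \<nu> *\<^sub>R \<xi>) = 2 powi (- (5 * int \<nu>)) * norm \<xi>" for \<nu> :: nat using lacunary_scale[of \<nu> 0] by simp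
    have e2: "2 powi (- (5 * int \<mu>)) = 2 powi (5 * int \<nu> - 5 * int \<mu>) * (2 :: real) powi (- (5 * int \<nu>))" by (simp add: power_int_add[symmetric])
    have e3: "norm ((1/32) ^ \<mu> *\<^sub>R \<xi>) = 2 powi (5 * int \<nu> - 5 * int \<mu>) * norm ((1/32) ^ \<nu> *\<^sub>R \<xi>)"
      by (simp only: e1 e2 mult.assoc)
    have "5 * int \<nu> - 5 * int \<mu> \<in> {-1, 0, 1}" by (rule powi_two_scales[OF that(2,3) s2[unfolded e3]])
    then show False using that(1) by (auto; presburger)
  qed
  have \<sigma>T: "\<sigma> \<xi> = T \<nu> \<xi>" if "\<And>\<mu>. \<mu> \<noteq> \<nu> \<Longrightarrow> T \<mu> \<xi> = 0" for \<nu> \<xi>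
    unfolding \<sigma>_def using suminf_finite[of "{\<nu>}" "\<lambda>\<nu>. T \<nu> \<xi>"] that by simp
  have dich: "\<sigma> \<xi> = 0 \<and> (\<forall>\<nu>. T \<nu> \<xi> = 0) \<or> (\<exists>\<nu>. \<sigma> \<xi> = T \<nu> \<xi> \<and> (\<forall>\<mu>. \<mu> \<noteq> \<nu> \<longrightarrow> T \<mu> \<xi> = 0))" for \<xi>
  proof (cases "\<exists>\<nu>. T \<nu> \<xi> \<noteq> 0")
    case True
    then obtain \<nu> where n: "T \<nu> \<xi> \<noteq> 0" by blast
    have "T \<mu> \<xi> = 0" if "\<mu> \<noteq> \<nu>" for \<mu> by (rule T0[OF that Ts[OF n]])
    then show ?thesis using \<sigma>T[of \<nu> \<xi>] by blast
  next
    case False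
    then show ?thesis by (auto simp: \<sigma>_def)
  qed
  \<comment> \<open>Pointwise the series has at most one nonzero term, so the measurable partial
    sums converge to it.\<close>
  have meas: "\<sigma> \<in> borel_measurable borel"
  proof (rule borel_measurable_LIMSEQ_metric)
    show "(\<lambda>\<xi>. \<Sum>\<nu><N. T \<nu> \<xi>) \<in> borel_measurable borel" for N
      by (intro borel_measurable_continuous_onI continuous_intros continuous_on_sum cT)
    fix \<xi> :: "real^'n^'m"
    have "\<exists>\<nu>. \<forall>\<mu>. \<mu> \<noteq> \<nu> \<longrightarrow> T \<mu> \<xi> = 0" using dich[of \<xi>] by blast
    then obtain \<nu> where "\<And>\<mu>. \<mu> \<notin> {\<nu>} \<Longrightarrow> T \<mu> \<xi> = 0" by auto
    then have "summable (\<lambda>\<nu>. T \<nu> \<xi>)" by (intro summable_finite[of "{\<nu>}"]) auto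
    then show "(\<lambda>N. \<Sum>\<nu><N. T \<nu> \<xi>) \<longlonglongrightarrow> \<sigma> \<xi>" unfolding \<sigma>_def by (rule summable_LIMSEQ)
  qed
  have bd: "norm (\<sigma> \<xi>) \<le> 2 * D" for \<xi>
  proof -
    have "norm (T \<nu> \<xi>) \<le> 2 * D" for \<nu> unfolding T_def norm_mult by (intro mult_mono D) (use a D in auto)
    then show ?thesis using dich[of \<xi>] D(1) by auto
  qed
  have Tj: "T \<nu> ((2 powi j) *\<^sub>R \<xi>) = a \<nu> ((2 powi (j - 5 * int \<nu>)) *\<^sub>R (\<xi> $ i)) * ?P ((2 powi (j - 5 * int \<nu>)) *\<^sub>R \<xi>)" for \<nu> j \<xi>
    unfolding T_def by (simp add: lacunary_scale[symmetric])
  have near: "j - 5 * int \<nu> \<in> {-1, 0, 1}" if "T \<nu> ((2 powi j) *\<^sub>R \<xi>) \<noteq> 0" "?P \<xi> \<noteq> 0" for \<nu> j \<xi>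
  proof -
    have "?P ((2 powi (j - 5 * int \<nu>)) *\<^sub>R \<xi>) \<noteq> 0" using that(1) unfolding Tj by auto
    note z = supp[OF this]
    have n: "norm ((2 powi (j - 5 * int \<nu>)) *\<^sub>R \<xi>) = 2 powi (j - 5 * int \<nu>) * norm \<xi>" by simp
    show ?thesis by (rule powi_two_scales[OF supp[OF that(2)] z[unfolded n]])
  qed
  \<comment> \<open>Either \<open>j - 5 * \<nu>\<close> lies in \<open>{-1, 0, 1}\<close> for some
    \<open>\<nu>\<close>, and the single visible shell is bounded by the choice of
    \<open>a \<nu>\<close>, or the product with the bump vanishes identically.\<close>
  have sob: "sobolev_norm r s (\<lambda>\<xi>. \<sigma> ((2 powi j) *\<^sub>R \<xi>) * ?P \<xi>) \<le> 1" for j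
  proof (cases "\<exists>\<nu>. j - 5 * int \<nu> \<in> {-1, 0, 1}")
    case True
    then obtain \<nu> where \<nu>: "j - 5 * int \<nu> \<in> {-1, 0, 1}" by blast
    have "\<sigma> ((2 powi j) *\<^sub>R \<xi>) * ?P \<xi> = a \<nu> ((2 powi (j - 5 * int \<nu>)) *\<^sub>R (\<xi> $ i)) * B (j - 5 * int \<nu>) \<xi>" for \<xi>
    proof (cases "?P \<xi> = 0")
      case False
      have "T \<mu> ((2 powi j) *\<^sub>R \<xi>) = 0" if "\<mu> \<noteq> \<nu>" for \<mu>
      proof (rule ccontr)
        assume "T \<mu> ((2 powi j) *\<^sub>R \<xi>) \<noteq> 0"
        then have "j - 5 * int \<mu> \<in> {-1, 0, 1}" by (rule near[OF _ False])
        then show False using \<nu> that by (auto; presburger)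
      qed
      then have "\<sigma> ((2 powi j) *\<^sub>R \<xi>) = T \<nu> ((2 powi j) *\<^sub>R \<xi>)" by (rule \<sigma>T)
      then show ?thesis by (simp only: Tj B_def mult.assoc)
    qed (simp add: B_def)
    then have e: "(\<lambda>\<xi>. \<sigma> ((2 powi j) *\<^sub>R \<xi>) * ?P \<xi>) = (\<lambda>\<xi>. a \<nu> ((2 powi (j - 5 * int \<nu>)) *\<^sub>R (\<xi> $ i)) * B (j - 5 * int \<nu>) \<xi>)" by (rule ext)
    note an = a[rule_format, of \<nu>, THEN conjunct2, THEN conjunct2, THEN conjunct2, rule_format, OF \<nu>]
    show ?thesis unfolding e by (rule sobolev_norm_le_1[where s=s, OF s r an[THEN conjunct1] an[THEN conjunct2]])
  next
    case False
    have "\<sigma> ((2 powi j) *\<^sub>R \<xi>) * ?P \<xi> = 0" for \<xi>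
    proof (cases "?P \<xi> = 0")
      case P: False
      have "T \<mu> ((2 powi j) *\<^sub>R \<xi>) = 0" for \<mu> using near[OF _ P] False by blast
      then show ?thesis by (simp add: \<sigma>_def)
    qed simp
    then have e: "(\<lambda>\<xi>. \<sigma> ((2 powi j) *\<^sub>R \<xi>) * ?P \<xi>) = (\<lambda>\<xi>. 0)" by (rule ext)
    have z: "sobolev_regular s (\<lambda>\<xi>::real^'n^'m. 0)" "sobolev_potential s (\<lambda>\<xi>::real^'n^'m. 0) \<xi> = 0" for \<xi>
      unfolding sobolev_regular_def sobolev_potential_def fourier_def by simp_all
    show ?thesis unfolding e by (rule sobolev_norm_le_1[where s=s, OF s r z(1)]) (simp add: z(2))
  qed
  have "multiplier_sobolev r s \<Psi> \<sigma> \<le> 1" unfolding multiplier_sobolev_def by (rule SUP_least) (rule sob)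
  then have mult: "multiplier_sobolev r s \<Psi> \<sigma> < \<infinity>" by (rule order_le_less_trans) simp
  have val: "isCont \<sigma> \<xi> \<and> norm (\<sigma> \<xi> - v \<nu> p) \<le> (D + A) * ((1/2) ^ \<nu> + norm ((1/32) ^ \<nu> *\<^sub>R \<xi> - \<eta>))"
    if p: "p < M \<nu>" and xi: "\<xi> $ i = (2 * real p + 1) *\<^sub>R e" and d: "norm ((1/32) ^ \<nu> *\<^sub>R \<xi> - \<eta>) \<le> 1 / 4" for \<nu> p \<xi>
  proof
    let ?U = "{\<xi>::real^'n^'m. 1 / 2 < norm ((1/32) ^ \<nu> *\<^sub>R \<xi>)} \<inter> {\<xi>. norm ((1/32) ^ \<nu> *\<^sub>R \<xi>) < 2}"
    have U: "\<sigma> \<zeta> = T \<nu> \<zeta>" if "\<zeta> \<in> ?U" for \<zeta> by (rule \<sigma>T, rule T0) (use that in auto)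
    let ?z = "(1/32) ^ \<nu> *\<^sub>R \<xi>"
    have "norm ?z \<le> norm \<eta> + norm (?z - \<eta>)" "norm \<eta> \<le> norm ?z + norm (?z - \<eta>)"
      using norm_triangle_ineq[of \<eta> "?z - \<eta>"] norm_triangle_ineq4[of ?z "?z - \<eta>"] by (simp_all del: norm_scaleR)
    then have xU: "\<xi> \<in> ?U" using d \<eta> by (simp del: norm_scaleR)
    have "open ?U" by (intro open_Int open_Collect_less continuous_intros)
    moreover have "continuous_on ?U \<sigma>"
      using continuous_on_subset[OF cT, of ?U \<nu>] U by (subst continuous_on_cong[OF refl U]) auto
    ultimately show "isCont \<sigma> \<xi>" using xU continuous_on_eq_continuous_at by blast
    have "(1/32) ^ \<nu> *\<^sub>R (\<xi> $ i) = \<theta> \<nu> p" unfolding xi \<theta>_def by simp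
    then have "\<sigma> \<xi> - v \<nu> p = (a \<nu> (\<theta> \<nu> p) - v \<nu> p) * ?P ?z + v \<nu> p * (?P ?z - ?P \<eta>)"
      unfolding U[OF xU] T_def admissible_bump_sphere[OF adm \<eta>] by (simp add: algebra_simps)
    then have "norm (\<sigma> \<xi> - v \<nu> p) \<le> norm (a \<nu> (\<theta> \<nu> p) - v \<nu> p) * norm (?P ?z) + norm (v \<nu> p) * norm (?P ?z - ?P \<eta>)"
      by (metis norm_mult norm_triangle_ineq)
    also have "\<dots> \<le> (1/2) ^ \<nu> * D + 1 * (A * norm (?z - \<eta>))"
      by (intro add_mono mult_mono D A v) (use a p A in auto)
    also have "\<dots> \<le> (D + A) * ((1/2) ^ \<nu> + norm (?z - \<eta>))"
      using A(1) D(1) by (simp add: algebra_simps)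
    finally show "norm (\<sigma> \<xi> - v \<nu> p) \<le> (D + A) * ((1/2) ^ \<nu> + norm (?z - \<eta>))" .
  qed
  show ?thesis
  proof (rule exI[of _ \<sigma>], intro conjI)
    show "\<exists>A. \<forall>\<xi>. norm (\<sigma> \<xi>) \<le> A" using bd by blast
    show "\<exists>L\<ge>0. \<forall>\<nu> p \<xi>. p < M \<nu> \<longrightarrow> \<xi> $ i = (2 * real p + 1) *\<^sub>R e \<longrightarrow> norm ((1/32) ^ \<nu> *\<^sub>R \<xi> - \<eta>) \<le> 1 / 4 \<longrightarrow>
      isCont \<sigma> \<xi> \<and> norm (\<sigma> \<xi> - v \<nu> p) \<le> L * ((1/2) ^ \<nu> + norm ((1/32) ^ \<nu> *\<^sub>R \<xi> - \<eta>))"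
      by (rule exI[of _ "D + A"], intro conjI allI impI val) (use A D in auto)
  qed (rule meas mult)+
qed

section \<open>Transference to trigonometric polynomials\<close>

text \<open>A class of functions, stable under differentiation, that contains all test functions. As
  \<open>schwartz\<close> quantifies over iterated partial derivatives, stability of a class is
  easier to establish than formulas for them.\<close>

inductive gaussian_span :: "('a::euclidean_space \<Rightarrow> complex) \<Rightarrow> bool" where
  base: "0 < \<alpha> \<Longrightarrow> gaussian_span (\<lambda>x. cis (\<theta> \<bullet> x) * of_real (exp (- pi * (\<alpha> * norm (x + a))\<^sup>2)))"
| add: "gaussian_span f \<Longrightarrow> gaussian_span g \<Longrightarrow> gaussian_span (\<lambda>x. f x + g x)"
| scale: "gaussian_span f \<Longrightarrow> gaussian_span (\<lambda>x. c * f x)"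
| coord: "gaussian_span f \<Longrightarrow> gaussian_span (\<lambda>x. of_real (x \<bullet> b) * f x)"

lemma gaussian_span_decay:
  assumes "gaussian_span f" shows "\<exists>C. \<forall>x. (1 + norm x) ^ N * norm (f x) \<le> C"
  using assms
proof (induction arbitrary: N rule: gaussian_span.induct)
  case (base \<alpha> \<theta> a)
  let ?K = "(1 + norm a) * (1 + 1 / \<alpha>)"
  have "(1 + norm x) ^ N * norm (cis (\<theta> \<bullet> x) * of_real (exp (- pi * (\<alpha> * norm (x + a))\<^sup>2))) \<le> ?K ^ N * (2 + real N) ^ N" for x
  proof -
    let ?t = "\<alpha> * norm (x + a)"
    have "norm x \<le> norm (x + a) + norm a" using norm_triangle_ineq4[of "x + a" a] by simp
    also have "norm (x + a) = ?t * (1 / \<alpha>)" using base by simp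
    finally have "1 + norm x \<le> (1 + norm a) + ?t * (1 / \<alpha>)" by simp
    also have "\<dots> \<le> ?K * (1 + ?t)"
    proof -
      have "?K * (1 + ?t) = (1 + norm a) * (1 + ?t) + (1 / \<alpha>) * (1 + norm a) + ?t * (1 / \<alpha>) + norm a * (?t * (1 / \<alpha>))" by (simp add: algebra_simps)
      moreover have "1 + norm a \<le> (1 + norm a) * (1 + ?t)"
        using mult_left_mono[of 1 "1 + ?t" "1 + norm a"] base by simp
      moreover have "0 \<le> (1 / \<alpha>) * (1 + norm a)" "0 \<le> norm a * (?t * (1 / \<alpha>))" using base by simp_all
      ultimately show ?thesis by linarith
    qed
    finally have "(1 + norm x) ^ N \<le> (?K * (1 + ?t)) ^ N" by (intro power_mono) auto
    then have "(1 + norm x) ^ N * exp (- pi * ?t\<^sup>2) \<le> ?K ^ N * ((1 + ?t) ^ N * exp (- pi * ?t\<^sup>2))"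
      unfolding power_mult_distrib mult.assoc[symmetric] by (intro mult_right_mono) auto
    also have "\<dots> \<le> ?K ^ N * (2 + real N) ^ N"
      by (intro mult_left_mono power_le_exp_square zero_le_power mult_nonneg_nonneg) (use base in auto)
    finally show ?thesis by (simp only: norm_mult norm_cis norm_of_real abs_exp_cancel mult_1_left)
  qed
  then show ?case by blast
next
  case (add f g)
  obtain C D where "\<And>x. (1 + norm x) ^ N * norm (f x) \<le> C" "\<And>x. (1 + norm x) ^ N * norm (g x) \<le> D"
    using add.IH[of N] by blast
  moreover have "(1 + norm x) ^ N * norm (f x + g x) \<le> (1 + norm x) ^ N * norm (f x) + (1 + norm x) ^ N * norm (g x)" for x
    unfolding distrib_left[symmetric] by (intro mult_left_mono norm_triangle_ineq) auto
  ultimately have "(1 + norm x) ^ N * norm (f x + g x) \<le> C + D" for x by (meson add_mono order_trans)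
  then show ?case by blast
next
  case (scale f c)
  obtain C where C: "\<And>x. (1 + norm x) ^ N * norm (f x) \<le> C" using scale.IH[of N] by blast
  have "(1 + norm x) ^ N * norm (c * f x) \<le> norm c * C" for x
    using mult_left_mono[OF C[of x], of "norm c"] by (simp add: norm_mult mult_ac)
  then show ?case by blast
next
  case (coord f b)
  obtain C where C: "\<And>x. (1 + norm x) ^ Suc N * norm (f x) \<le> C" using coord.IH[of "Suc N"] by blast
  have "(1 + norm x) ^ N * norm (of_real (x \<bullet> b) * f x) \<le> norm b * C" for x
  proof -
    have "\<bar>x \<bullet> b\<bar> \<le> (1 + norm x) * norm b" using Cauchy_Schwarz_ineq2[of x b] by (simp add: distrib_right add_increasing)
    then have "\<bar>x \<bullet> b\<bar> * ((1 + norm x) ^ N * norm (f x)) \<le> ((1 + norm x) * norm b) * ((1 + norm x) ^ N * norm (f x))"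
      by (rule mult_right_mono) auto
    also have "\<dots> = norm b * ((1 + norm x) ^ Suc N * norm (f x))" by (simp add: mult_ac)
    also have "\<dots> \<le> norm b * C" by (intro mult_left_mono C) auto
    finally show ?thesis by (simp add: norm_mult mult_ac)
  qed
  then show ?case by blast
qed

text \<open>A modulated Gaussian differentiates to itself times an affine function; the rule
  \<open>coord\<close> exists for this.\<close>

lemma gaussian_span_derivative:
  assumes "gaussian_span f"
  shows "\<exists>f'. (\<forall>x. (f has_derivative f' x) (at x)) \<and> (\<forall>b. gaussian_span (\<lambda>x. f' x b))"
  using assms
proof (induction rule: gaussian_span.induct)
  case (base \<alpha> \<theta> a)
  let ?f = "\<lambda>x. cis (\<theta> \<bullet> x) * complex_of_real (exp (- pi * (\<alpha> * norm (x + a))\<^sup>2))"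
  let ?d = "\<lambda>x v. (\<i> * of_real (\<theta> \<bullet> v) + of_real (- 2 * pi * \<alpha>\<^sup>2 * ((x + a) \<bullet> v))) * ?f x"
  have fe: "?f = (\<lambda>x. exp (\<i> * of_real (\<theta> \<bullet> x) + of_real (- pi * \<alpha>\<^sup>2 * ((x + a) \<bullet> (x + a)))))"
    by (rule ext) (simp add: exp_add[symmetric] cis_conv_exp exp_of_real[symmetric] power_mult_distrib power2_norm_eq_inner mult.assoc)
  have "(?f has_derivative ?d x) (at x)" for x
  proof -
    let ?u = "\<lambda>x. \<i> * of_real (\<theta> \<bullet> x) + complex_of_real (- pi * \<alpha>\<^sup>2 * ((x + a) \<bullet> (x + a)))"
    have "(?u has_derivative (\<lambda>v. \<i> * of_real (\<theta> \<bullet> v) + of_real (- 2 * pi * \<alpha>\<^sup>2 * ((x + a) \<bullet> v)))) (at x)"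
      by (rule has_derivative_eq_rhs, (rule derivative_intros)+) (auto simp: fun_eq_iff inner_commute algebra_simps)
    from has_derivative_compose[OF this DERIV_exp[unfolded has_field_derivative_def]]
    have "((\<lambda>x. exp (?u x)) has_derivative (\<lambda>v. exp (?u x) * (\<i> * of_real (\<theta> \<bullet> v) + of_real (- 2 * pi * \<alpha>\<^sup>2 * ((x + a) \<bullet> v))))) (at x)" .
    then show ?thesis unfolding fe[symmetric] fun_cong[OF fe, of x, symmetric] by (simp only: mult.commute)
  qed
  moreover have "gaussian_span (\<lambda>x. ?d x b)" for b
  proof -
    note f = gaussian_span.base[OF base, of \<theta> a]
    have "gaussian_span (\<lambda>x. (\<i> * of_real (\<theta> \<bullet> b) + of_real (- 2 * pi * \<alpha>\<^sup>2 * (a \<bullet> b))) * ?f x + of_real (- 2 * pi * \<alpha>\<^sup>2) * (of_real (x \<bullet> b) * ?f x))"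
      by (intro gaussian_span.add gaussian_span.scale gaussian_span.coord f)
    then show ?thesis by (rule back_subst[where P=gaussian_span]) (simp add: fun_eq_iff inner_add_left algebra_simps)
  qed
  ultimately show ?case by (intro exI[of _ ?d]) blast
next
  case (add f g)
  obtain f' g' where f: "\<forall>x. (f has_derivative f' x) (at x)" "\<forall>b. gaussian_span (\<lambda>x. f' x b)"
    and g: "\<forall>x. (g has_derivative g' x) (at x)" "\<forall>b. gaussian_span (\<lambda>x. g' x b)" using add.IH by blast
  show ?case
    by (rule exI[of _ "\<lambda>x v. f' x v + g' x v"]) (use f g in \<open>auto intro!: has_derivative_add gaussian_span.add\<close>)
next
  case (scale f c)
  obtain f' where f: "\<forall>x. (f has_derivative f' x) (at x)" "\<forall>b. gaussian_span (\<lambda>x. f' x b)" using scale.IH by blast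
  show ?case
    by (rule exI[of _ "\<lambda>x v. c * f' x v"]) (use f in \<open>auto intro!: has_derivative_mult_right gaussian_span.scale\<close>)
next
  case (coord f b)
  obtain f' where f: "\<forall>x. (f has_derivative f' x) (at x)" "\<forall>b. gaussian_span (\<lambda>x. f' x b)" using coord.IH by blast
  have "((\<lambda>x. of_real (x \<bullet> b) * f x) has_derivative (\<lambda>v. of_real (x \<bullet> b) * f' x v + of_real (v \<bullet> b) * f x)) (at x)" for x
    by (intro has_derivative_mult f(1)[rule_format] derivative_intros)
  moreover have "gaussian_span (\<lambda>x. of_real (x \<bullet> b) * f' x v + of_real (v \<bullet> b) * f x)" for v
    by (intro gaussian_span.add gaussian_span.scale gaussian_span.coord f(2)[rule_format] coord.hyps)
  ultimately show ?case by (intro exI[of _ "\<lambda>x v. of_real (x \<bullet> b) * f' x v + of_real (v \<bullet> b) * f x"]) blast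
qed

lemma gaussian_span_schwartz:
  assumes "gaussian_span f" shows "schwartz f"
proof -
  have it: "gaussian_span (iter_partial bs f)" for bs
  proof (induction bs)
    case (Cons b bs)
    obtain f' where f': "\<forall>x. (iter_partial bs f has_derivative f' x) (at x)" "\<forall>b. gaussian_span (\<lambda>x. f' x b)"
      using gaussian_span_derivative[OF Cons] by blast
    have "frechet_derivative (iter_partial bs f) (at x) = f' x" for x
      using frechet_derivative_at[OF f'(1)[rule_format]] by simp
    then show ?case using f'(2) by simp
  qed (use assms in simp)
  show ?thesis unfolding schwartz_def
  proof (intro allI impI conjI)
    fix bs and x :: 'a
    show "iter_partial bs f differentiable at x" using gaussian_span_derivative[OF it[of bs]] unfolding differentiable_def by blast
  next
    fix bs and N :: nat
    obtain C where C: "\<And>x. (1 + norm x) ^ N * norm (iter_partial bs f x) \<le> C" using gaussian_span_decay[OF it[of bs], of N] by blast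
    have "norm (norm x ^ N *\<^sub>R iter_partial bs f x) \<le> C" for x
    proof -
      have "norm (norm x ^ N *\<^sub>R iter_partial bs f x) \<le> (1 + norm x) ^ N * norm (iter_partial bs f x)"
        by (auto intro!: mult_right_mono power_mono)
      then show ?thesis using C[of x] by linarith
    qed
    then show "bounded (range (\<lambda>x. norm x ^ N *\<^sub>R iter_partial bs f x))" by (intro boundedI[of _ C]) auto
  qed
qed

lemma gaussian_span_modulated:
  assumes "0 < \<delta>"
  shows "gaussian_span (\<lambda>x. cis (\<theta> \<bullet> x) * of_real (averaged_gaussian h \<delta> k (x + a)))"
proof (induction k arbitrary: a)
  case 0
  then show ?case using gaussian_span.base[OF assms, of \<theta> a] by simp
next
  case (Suc k)
  have "gaussian_span (\<lambda>x. (1/2) * (cis (\<theta> \<bullet> x) * of_real (averaged_gaussian h \<delta> k (x + a))) + (1/2) * (cis (\<theta> \<bullet> x) * of_real (averaged_gaussian h \<delta> k (x + (a + h)))))"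
    by (intro gaussian_span.add gaussian_span.scale Suc)
  then show ?case by (rule back_subst[where P=gaussian_span]) (simp add: fun_eq_iff field_simps)
qed

text \<open>All frequencies lie on the line spanned by \<open>e\<close>, so that the limit problem
  concerns trigonometric polynomials in the one variable \<open>e \<bullet> x\<close>.\<close>

definition gaussian_trig_poly :: "'k set \<Rightarrow> ('k \<Rightarrow> complex) \<Rightarrow> ('k \<Rightarrow> real) \<Rightarrow> 'a::euclidean_space \<Rightarrow> 'a \<Rightarrow> real \<Rightarrow> nat \<Rightarrow> 'a \<Rightarrow> complex" where
  "gaussian_trig_poly A c d e h \<delta> K x = (\<Sum>a\<in>A. c a * cis (2 * pi * (d a * (e \<bullet> x)))) * of_real (averaged_gaussian h \<delta> K x)"

lemma gaussian_trig_poly_sum: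
  "gaussian_trig_poly A c d e h \<delta> K = (\<lambda>x. \<Sum>a\<in>A. c a * (cis (2 * pi * ((d a *\<^sub>R e) \<bullet> x)) * of_real (averaged_gaussian h \<delta> K x)))"
  by (rule ext) (simp add: gaussian_trig_poly_def sum_distrib_right mult.assoc)

lemma gaussian_trig_poly_schwartz:
  fixes e h :: "'a::euclidean_space"
  assumes "0 < \<delta>" "finite A" shows "schwartz (gaussian_trig_poly A c d e h \<delta> K)"
proof (rule gaussian_span_schwartz)
  have g: "gaussian_span (\<lambda>x. cis (2 * pi * (\<theta> \<bullet> x)) * of_real (averaged_gaussian h \<delta> K x))" for \<theta> :: 'a
    using gaussian_span_modulated[OF assms(1), of "(2 * pi) *\<^sub>R \<theta>" h K 0] by simp
  show "gaussian_span (gaussian_trig_poly A c d e h \<delta> K)" unfolding gaussian_trig_poly_sum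
    using assms(2)
  proof (induction A rule: finite_induct)
    case empty
    show ?case using gaussian_span.scale[OF g[of 0], of 0] by simp
  next
    case (insert a A)
    show ?case unfolding sum.insert[OF insert.hyps]
      by (intro gaussian_span.add gaussian_span.scale g insert.IH)
  qed
qed

lemma gaussian_trig_poly_fourier:
  fixes h e :: "'a::euclidean_space"
  assumes h: "norm h \<le> 1" and R: "R \<ge> 1"
  shows "fourier (gaussian_trig_poly A c d e h (1 / real R) K) \<xi> =
    (\<Sum>a\<in>A. c a * (of_real (real R ^ DIM('a) * exp (- pi * (real R * norm (\<xi> - d a *\<^sub>R e))\<^sup>2)) * ((1 + cis (2 * pi * (h \<bullet> (\<xi> - d a *\<^sub>R e)))) / 2) ^ K))"
proof -
  have d: "1 / real R \<in> {0<..1}" using R by auto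
  have i: "integrable lborel (\<lambda>x. cis (2 * pi * (\<theta> \<bullet> x)) * complex_of_real (averaged_gaussian h (1 / real R) K x))" for \<theta> :: 'a
  proof -
    have "gaussian_span (\<lambda>x. cis (2 * pi * (\<theta> \<bullet> x)) * of_real (averaged_gaussian h (1 / real R) K x))"
      using gaussian_span_modulated[of "1 / real R" "(2 * pi) *\<^sub>R \<theta>" h K 0] d by simp
    then show ?thesis by (intro rapidly_decreasing_integrable schwartz_rapidly_decreasing gaussian_span_schwartz)
  qed
  show ?thesis unfolding gaussian_trig_poly_sum fourier_sum[OF i] fourier_modulated_averaged_gaussian[OF h R] ..
qed

text \<open>The product of the transforms is expanded over all choices \<open>g\<close> of one
  frequency for each function. Every term is a Gaussian concentrating at the point
  \<open>\<tau> g\<close>, where the multiplier is continuous, so in the limit the operator acts by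
  evaluation at these points. The common Gaussian factor is the product of the
  \<open>CARD('m)\<close> envelopes before averaging.\<close>

lemma gaussian_transference:
  fixes \<sigma> :: "real^'n^'m \<Rightarrow> complex" and A :: "'m::finite \<Rightarrow> 'k set" and c :: "'m \<Rightarrow> 'k \<Rightarrow> complex" and d :: "'m \<Rightarrow> 'k \<Rightarrow> real"
    and h e :: "real^'n" and K :: "'m \<Rightarrow> nat"
  defines "\<tau> \<equiv> \<lambda>g::'m \<Rightarrow> 'k. (\<chi> j. d j (g j) *\<^sub>R e) :: real^'n^'m"
  assumes m: "\<sigma> \<in> borel_measurable borel" and S: "\<And>\<xi>. norm (\<sigma> \<xi>) \<le> S" and fin: "\<And>j. finite (A j)" and h: "norm h \<le> 1"
    and cont: "\<And>g. g \<in> PiE UNIV A \<Longrightarrow> isCont \<sigma> (\<tau> g)"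
  shows "\<exists>E. E \<longlonglongrightarrow> 0 \<and> (\<forall>R\<ge>1. \<forall>x.
    norm (multiplier_op \<sigma> (\<lambda>j. gaussian_trig_poly (A j) (c j) (d j) e h (1 / real R) (K j)) x
      - of_real (exp (- pi * real CARD('m) * (norm x / R)\<^sup>2)) * (\<Sum>g\<in>PiE UNIV A. (\<Prod>j\<in>UNIV. c j (g j)) * \<sigma> (\<tau> g) * cis (2 * pi * (\<Sum>j\<in>UNIV. d j (g j) * (e \<bullet> x))))) \<le> E R)"
proof -
  let ?G = "PiE UNIV A"
  have fG: "finite ?G" by (rule finite_PiE) (use fin in auto)
  \<comment> \<open>The factors coming from the averages of the envelopes. Merged into the
    multiplier, they are bounded by one and equal to \<open>1\<close> at \<open>\<tau> g\<close>, so
    the limit does not notice them.\<close>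
  define Y where "Y g \<xi> = (\<Prod>j\<in>UNIV. ((1 + cis (2 * pi * (h \<bullet> (\<xi> $ j - d j (g j) *\<^sub>R e)))) / 2) ^ K j)" for g and \<xi> :: "real^'n^'m"
  define Z where "Z g \<xi> = \<sigma> \<xi> * Y g \<xi>" for g \<xi>
  define C where "C g = (\<Prod>j\<in>UNIV. c j (g j))" for g
  have Y1: "norm (Y g \<xi>) \<le> 1" for g \<xi>
  proof -
    have "norm ((1 + cis t) / 2) \<le> 1" for t using norm_triangle_ineq[of 1 "cis t"] by (simp add: norm_divide)
    then show ?thesis unfolding Y_def prod_norm[symmetric] norm_power by (intro prod_le_1) (auto intro!: power_le_one)
  qed
  have cY: "continuous_on UNIV (Y g)" for g unfolding Y_def cis_conv_exp by (intro continuous_intros) auto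
  have mZ: "Z g \<in> borel_measurable borel" for g
    unfolding Z_def[abs_def] by (intro borel_measurable_times m borel_measurable_continuous_onI cY)
  have bZ: "norm (Z g \<xi>) \<le> S" for g \<xi>
  proof -
    have "norm (Z g \<xi>) \<le> norm (\<sigma> \<xi>) * 1" unfolding Z_def norm_mult by (intro mult_left_mono Y1) simp
    then show ?thesis using S[of \<xi>] by simp
  qed
  have cZ: "isCont (Z g) (\<tau> g)" if "g \<in> ?G" for g
    unfolding Z_def[abs_def] using cY[of g] by (intro isCont_mult cont that) (auto simp: continuous_on_eq_continuous_at)
  have Zt: "Z g (\<tau> g) = \<sigma> (\<tau> g)" for g by (simp add: Z_def Y_def \<tau>_def)
  let ?g = "\<lambda>R g \<xi>. real R ^ DIM(real^'n^'m) * exp (- pi * (real R * norm (\<xi> - \<tau> g))\<^sup>2)"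
  have "\<forall>g. \<exists>E. g \<in> ?G \<longrightarrow> E \<longlonglongrightarrow> 0 \<and> (\<forall>R\<ge>1. \<forall>X. norm ((LINT \<xi>|lborel. Z g \<xi> * of_real (?g R g \<xi>) * cis (2 * pi * (X \<bullet> \<xi>)))
      - Z g (\<tau> g) * cis (2 * pi * (X \<bullet> \<tau> g)) * of_real (exp (- pi * (norm X / R)\<^sup>2))) \<le> E R)"
    using gaussian_approximate_identity[OF mZ bZ cZ] by blast
  then obtain E where E: "\<forall>g. g \<in> ?G \<longrightarrow> E g \<longlonglongrightarrow> 0 \<and> (\<forall>R\<ge>1. \<forall>X. norm ((LINT \<xi>|lborel. Z g \<xi> * of_real (?g R g \<xi>) * cis (2 * pi * (X \<bullet> \<xi>)))
      - Z g (\<tau> g) * cis (2 * pi * (X \<bullet> \<tau> g)) * of_real (exp (- pi * (norm X / R)\<^sup>2))) \<le> E g R)"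
    by (elim choice[THEN exE])
  have nsq: "(norm \<zeta>)\<^sup>2 = (\<Sum>j\<in>UNIV. (norm (\<zeta> $ j))\<^sup>2)" for \<zeta> :: "real^'n^'m"
    by (simp add: power2_norm_eq_inner inner_vec_def)
  have prodG: "(\<Prod>j\<in>UNIV. real R ^ CARD('n) * exp (- pi * (real R * norm (\<xi> $ j - d j (g j) *\<^sub>R e))\<^sup>2)) = ?g R g \<xi>" for R g and \<xi> :: "real^'n^'m"
  proof -
    have "- pi * (real R * norm (\<xi> - \<tau> g))\<^sup>2 = (\<Sum>j\<in>UNIV. - pi * (real R * norm (\<xi> $ j - d j (g j) *\<^sub>R e))\<^sup>2)"
      unfolding power_mult_distrib nsq by (simp add: \<tau>_def sum_distrib_left)
    then have "exp (- pi * (real R * norm (\<xi> - \<tau> g))\<^sup>2) = (\<Prod>j\<in>UNIV. exp (- pi * (real R * norm (\<xi> $ j - d j (g j) *\<^sub>R e))\<^sup>2))"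
      by (simp only: exp_sum finite)
    moreover have "DIM(real^'n^'m) = CARD('n) * CARD('m)" by (simp add: mult.commute)
    ultimately show ?thesis by (simp only: prod.distrib prod_constant power_mult)
  qed
  have main: "norm (multiplier_op \<sigma> (\<lambda>j. gaussian_trig_poly (A j) (c j) (d j) e h (1 / real R) (K j)) x
      - of_real (exp (- pi * real CARD('m) * (norm x / R)\<^sup>2)) * (\<Sum>g\<in>?G. C g * \<sigma> (\<tau> g) * cis (2 * pi * (\<Sum>j\<in>UNIV. d j (g j) * (e \<bullet> x))))) \<le> (\<Sum>g\<in>?G. norm (C g) * E g R)"
    if R: "R \<ge> 1" for R x
  proof -
    \<comment> \<open>Repeating x in every block turns the phase into an inner product with
      \<open>\<xi>\<close>; the squared norm becomes \<open>CARD('m)\<close> times as large.\<close>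
    define X where "X = (\<chi> j::'m. x)"
    have X1: "x \<bullet> (\<Sum>j\<in>UNIV. \<xi> $ j) = X \<bullet> \<xi>" for \<xi> :: "real^'n^'m" unfolding inner_vec_def[of X \<xi>] by (simp add: X_def inner_sum_right)
    have X2: "X \<bullet> \<tau> g = (\<Sum>j\<in>UNIV. d j (g j) * (e \<bullet> x))" for g unfolding inner_vec_def[of X] by (simp add: X_def \<tau>_def inner_commute)
    have X3: "- pi * (norm X / R)\<^sup>2 = - pi * real CARD('m) * (norm x / R)\<^sup>2" by (simp add: power_divide nsq X_def)
    let ?I = "\<lambda>g \<xi>. Z g \<xi> * of_real (?g R g \<xi>) * cis (2 * pi * (X \<bullet> \<xi>))"
    have int: "integrable lborel (?I g)" for g
    proof -
      have "integrable lborel (\<lambda>\<xi>::real^'n^'m. exp (- pi * (norm (- (real R *\<^sub>R \<tau> g) + real R *\<^sub>R \<xi>))\<^sup>2))"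
        by (rule lborel_integrable_affine[OF gaussian_integrable]) (use R in simp)
      moreover have "norm (- (real R *\<^sub>R \<tau> g) + real R *\<^sub>R \<xi>) = real R * norm (\<xi> - \<tau> g)" for \<xi>
      proof -
        have "- (real R *\<^sub>R \<tau> g) + real R *\<^sub>R \<xi> = real R *\<^sub>R (\<xi> - \<tau> g)" by (simp add: scaleR_diff_right)
        then show ?thesis by simp
      qed
      ultimately have "integrable lborel (\<lambda>\<xi>. S * ?g R g \<xi>)" by (simp only: integrable_mult_right)
      then show ?thesis
      proof (rule Bochner_Integration.integrable_bound)
        show "?I g \<in> borel_measurable lborel" using mZ[of g] unfolding cis_conv_exp by measurable
        have "0 \<le> S" using norm_ge_zero S order_trans by blast
        then show "AE \<xi> in lborel. norm (?I g \<xi>) \<le> norm (S * ?g R g \<xi>)"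
          by (intro AE_I2) (use bZ in \<open>auto simp: norm_mult norm_power intro!: mult_mono\<close>)
      qed
    qed
    have "multiplier_op \<sigma> (\<lambda>j. gaussian_trig_poly (A j) (c j) (d j) e h (1 / real R) (K j)) x = (LINT \<xi>|lborel. (\<Sum>g\<in>?G. C g * ?I g \<xi>))"
      unfolding multiplier_op_def
    proof (rule Bochner_Integration.integral_cong[OF refl])
      fix \<xi> :: "real^'n^'m"
      have "(\<Prod>j\<in>UNIV. fourier (gaussian_trig_poly (A j) (c j) (d j) e h (1 / real R) (K j)) (\<xi> $ j))
        = (\<Sum>g\<in>?G. \<Prod>j\<in>UNIV. c j (g j) * (of_real (real R ^ CARD('n) * exp (- pi * (real R * norm (\<xi> $ j - d j (g j) *\<^sub>R e))\<^sup>2)) * ((1 + cis (2 * pi * (h \<bullet> (\<xi> $ j - d j (g j) *\<^sub>R e)))) / 2) ^ K j))"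
        unfolding gaussian_trig_poly_fourier[OF h R] DIM_cart DIM_real mult_1_right by (rule prod_sum_PiE) (use fin in auto)
      also have "\<dots> = (\<Sum>g\<in>?G. C g * (of_real (?g R g \<xi>) * Y g \<xi>))"
        by (rule sum.cong[OF refl]) (simp only: prodG[symmetric] C_def Y_def of_real_prod prod.distrib of_real_mult)
      finally have pe: "(\<Prod>j\<in>UNIV. fourier (gaussian_trig_poly (A j) (c j) (d j) e h (1 / real R) (K j)) (\<xi> $ j)) = \<dots>" .
      show "\<sigma> \<xi> * (\<Prod>j\<in>UNIV. fourier (gaussian_trig_poly (A j) (c j) (d j) e h (1 / real R) (K j)) (\<xi> $ j)) * cis (2 * pi * (x \<bullet> (\<Sum>j\<in>UNIV. \<xi> $ j))) = (\<Sum>g\<in>?G. C g * ?I g \<xi>)"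
        unfolding pe X1 sum_distrib_left sum_distrib_right by (rule sum.cong[OF refl]) (simp only: Z_def mult_ac)
    qed
    also have "\<dots> = (\<Sum>g\<in>?G. C g * (LINT \<xi>|lborel. ?I g \<xi>))"
      by (subst Bochner_Integration.integral_sum[OF integrable_mult_right[OF int]]) (simp only: integral_mult_right_zero)
    finally have e1: "multiplier_op \<sigma> (\<lambda>j. gaussian_trig_poly (A j) (c j) (d j) e h (1 / real R) (K j)) x = (\<Sum>g\<in>?G. C g * (LINT \<xi>|lborel. ?I g \<xi>))" .
    have "norm ((\<Sum>g\<in>?G. C g * (LINT \<xi>|lborel. ?I g \<xi>)) - of_real (exp (- pi * real CARD('m) * (norm x / R)\<^sup>2)) * (\<Sum>g\<in>?G. C g * \<sigma> (\<tau> g) * cis (2 * pi * (\<Sum>j\<in>UNIV. d j (g j) * (e \<bullet> x)))))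
      = norm (\<Sum>g\<in>?G. C g * ((LINT \<xi>|lborel. ?I g \<xi>) - Z g (\<tau> g) * cis (2 * pi * (X \<bullet> \<tau> g)) * of_real (exp (- pi * (norm X / R)\<^sup>2))))"
      unfolding Zt X2 X3 sum_distrib_left sum_subtractf[symmetric]
      by (rule arg_cong[where f=norm], rule sum.cong[OF refl]) (simp only: right_diff_distrib mult_ac)
    also have "\<dots> \<le> (\<Sum>g\<in>?G. norm (C g) * E g R)"
      by (rule sum_norm_le, unfold norm_mult, rule mult_left_mono) (use E R in auto)
    finally show ?thesis unfolding e1 .
  qed
  have "(\<lambda>R. \<Sum>g\<in>?G. norm (C g) * E g R) \<longlonglongrightarrow> (\<Sum>g\<in>?G. norm (C g) * 0)"
    by (intro tendsto_sum tendsto_mult tendsto_const) (use E in blast)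
  then have "(\<lambda>R. \<Sum>g\<in>?G. norm (C g) * E g R) \<longlonglongrightarrow> 0" by simp
  then show ?thesis using main unfolding C_def by blast
qed

section \<open>Rudin-Shapiro polynomials and Dirichlet kernels\<close>

lemma sum_lessThan_add: "(\<Sum>p<N + K. f p) = (\<Sum>p<N. f p) + (\<Sum>p<K. f (N + p))" for f :: "nat \<Rightarrow> 'a::comm_monoid_add"
  by (induction K) (auto simp: add.assoc)

text \<open>The recursion passes from \<open>P\<close>, \<open>Q\<close> to
  \<open>P + z^N Q\<close>, \<open>P - z^N Q\<close> with \<open>N = 2^\<mu>\<close>; on the unit
  circle the parallelogram law doubles the sum of squares.\<close>

lemma rudin_shapiro_pair:
  "\<exists>\<epsilon> \<delta> :: nat \<Rightarrow> real. (\<forall>p. \<epsilon> p \<in> {1, -1} \<and> \<delta> p \<in> {1, -1}) \<and>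
    (\<forall>z::complex. norm z = 1 \<longrightarrow> (norm (\<Sum>p<2 ^ \<mu>. of_real (\<epsilon> p) * z ^ p))\<^sup>2 + (norm (\<Sum>p<2 ^ \<mu>. of_real (\<delta> p) * z ^ p))\<^sup>2 = 2 * 2 ^ \<mu>)"
proof (induction \<mu>)
  case 0
  show ?case by (intro exI[of _ "\<lambda>_. 1"]) auto
next
  case (Suc \<mu>)
  then obtain \<epsilon> \<delta> :: "nat \<Rightarrow> real" where s: "\<forall>p. \<epsilon> p \<in> {1, -1} \<and> \<delta> p \<in> {1, -1}"
    and b: "\<forall>z::complex. norm z = 1 \<longrightarrow> (norm (\<Sum>p<2 ^ \<mu>. of_real (\<epsilon> p) * z ^ p))\<^sup>2 + (norm (\<Sum>p<2 ^ \<mu>. of_real (\<delta> p) * z ^ p))\<^sup>2 = 2 * 2 ^ \<mu>"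
    by blast
  let ?N = "2 ^ \<mu> :: nat"
  define ap am where "ap p = (if p < ?N then \<epsilon> p else \<delta> (p - ?N))" and "am p = (if p < ?N then \<epsilon> p else - \<delta> (p - ?N))" for p
  have par: "(norm (a + c))\<^sup>2 + (norm (a - c))\<^sup>2 = 2 * ((norm a)\<^sup>2 + (norm c)\<^sup>2)" for a c :: complex
    by (simp add: power2_norm_eq_inner inner_add_left inner_add_right inner_diff_left inner_diff_right)
  have "(norm (\<Sum>p<2 ^ Suc \<mu>. of_real (ap p) * z ^ p))\<^sup>2 + (norm (\<Sum>p<2 ^ Suc \<mu>. of_real (am p) * z ^ p))\<^sup>2 = 2 * 2 ^ Suc \<mu>"
    if z: "norm z = 1" for z :: complex
  proof -
    let ?P = "\<Sum>p<?N. of_real (\<epsilon> p) * z ^ p" and ?Q = "z ^ ?N * (\<Sum>p<?N. of_real (\<delta> p) * z ^ p)"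
    have N: "2 ^ Suc \<mu> = ?N + ?N" by simp
    have "(\<Sum>p<2 ^ Suc \<mu>. of_real (ap p) * z ^ p) = ?P + ?Q"
      unfolding N sum_lessThan_add sum_distrib_left by (auto simp: ap_def power_add mult_ac)
    moreover have "(\<Sum>p<2 ^ Suc \<mu>. of_real (am p) * z ^ p) = ?P - ?Q"
      unfolding N sum_lessThan_add sum_distrib_left by (auto simp: am_def power_add mult_ac sum_negf)
    moreover have "norm ?Q = norm (\<Sum>p<?N. of_real (\<delta> p) * z ^ p)" using z by (simp add: norm_mult norm_power)
    ultimately show ?thesis using b z by (simp add: par)
  qed
  moreover have "\<forall>p. ap p \<in> {1, -1} \<and> am p \<in> {1, -1}" using s by (auto simp: ap_def am_def)
  ultimately show ?case by blast
qed

lemma rudin_shapiro: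
  "\<exists>\<epsilon> :: nat \<Rightarrow> real. (\<forall>p. \<epsilon> p \<in> {1, -1}) \<and> (\<forall>z::complex. norm z = 1 \<longrightarrow> norm (\<Sum>p<2 ^ \<mu>. of_real (\<epsilon> p) * z ^ p) \<le> sqrt (2 * 2 ^ \<mu>))"
proof -
  obtain \<epsilon> \<delta> :: "nat \<Rightarrow> real" where s: "\<forall>p. \<epsilon> p \<in> {1, -1} \<and> \<delta> p \<in> {1, -1}"
    and b: "\<forall>z::complex. norm z = 1 \<longrightarrow> (norm (\<Sum>p<2 ^ \<mu>. of_real (\<epsilon> p) * z ^ p))\<^sup>2 + (norm (\<Sum>p<2 ^ \<mu>. of_real (\<delta> p) * z ^ p))\<^sup>2 = 2 * 2 ^ \<mu>"
    using rudin_shapiro_pair by blast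
  have "norm (\<Sum>p<2 ^ \<mu>. of_real (\<epsilon> p) * z ^ p) \<le> sqrt (2 * 2 ^ \<mu>)" if "norm z = 1" for z :: complex
  proof (rule real_le_rsqrt)
    show "(norm (\<Sum>p<2 ^ \<mu>. of_real (\<epsilon> p) * z ^ p))\<^sup>2 \<le> 2 * 2 ^ \<mu>"
      using b[rule_format, OF that] zero_le_power2[of "norm (\<Sum>p<2 ^ \<mu>. of_real (\<delta> p) * z ^ p)"] by linarith
  qed
  then show ?thesis using s by blast
qed

section \<open>Dirichlet kernels and the partition of unity by their squares\<close>

definition dirichlet :: "nat \<Rightarrow> real \<Rightarrow> complex" where
  "dirichlet M t = (\<Sum>p<M. cis (2 * pi * (real p * t)))"

lemma dirichlet_norm_square:
  "complex_of_real ((norm (dirichlet M t))\<^sup>2) = (\<Sum>p<M. \<Sum>q<M. cis (2 * pi * ((real p - real q) * t)))"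
proof -
  have "complex_of_real ((norm (dirichlet M t))\<^sup>2) = dirichlet M t * cnj (dirichlet M t)" by (rule complex_norm_square)
  also have "\<dots> = (\<Sum>p<M. \<Sum>q<M. cis (2 * pi * (real p * t)) * cis (- (2 * pi * (real q * t))))"
    by (simp add: dirichlet_def sum_product cis_cnj)
  finally show ?thesis by (simp add: cis_mult algebra_simps)
qed

lemma sum_roots_of_unity:
  assumes "p < M" "q < M"
  shows "(\<Sum>j<M. cis (2 * pi * ((real p - real q) * (- real j / real M)))) = (if p = q then of_nat M else 0)"
proof (cases "p = q")
  case False
  have M0: "real M \<noteq> 0" using assms by simp
  define z where "z = cis (- 2 * pi * (real p - real q) / real M)"
  have zj: "cis (2 * pi * ((real p - real q) * (- real j / real M))) = z ^ j" for j
    unfolding z_def Complex.DeMoivre by (simp add: mult_ac)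
  have zM: "z ^ M = 1"
  proof -
    have "real M * (- 2 * pi * (real p - real q) / real M) = 2 * pi * of_int (int q - int p)"
      using M0 by (simp add: field_simps)
    then show ?thesis unfolding z_def Complex.DeMoivre by (simp only: cis_multiple_2pi Ints_of_int)
  qed
  have "z \<noteq> 1"
  proof
    assume "z = 1"
    then obtain n :: int where "- 2 * pi * (real p - real q) / real M = of_int (2 * n) * pi"
      unfolding z_def cis_conv_exp exp_eq_1 by auto
    then have "pi * (real q - real p) = pi * (of_int n * real M)" using M0 by (simp add: field_simps)
    then have "real q - real p = of_int n * real M" by (simp only: mult_left_cancel[OF pi_neq_zero])
    then have "int q - int p = n * int M" by (metis of_int_diff of_int_eq_iff of_int_mult of_int_of_nat_eq)
    then have "int M dvd int q - int p" by simp
    then have "int q - int p = 0" using dvd_imp_le_int[of "int q - int p" "int M"] assms by linarith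
    then show False using False by simp
  qed
  then show ?thesis unfolding zj using False zM by (simp add: sum_gp_strict)
qed simp

text \<open>Orthogonality of the M-th roots of unity leaves only the diagonal of the double sum for
  the squared modulus. So the \<open>M\<close> translates of the normalised squared kernel form a
  partition of unity at every real t, not merely on a grid.\<close>

lemma dirichlet_parseval:
  assumes "M \<ge> 1" shows "(\<Sum>j<M. (norm (dirichlet M (t - real j / real M)) / real M)\<^sup>2) = 1"
proof -
  have "complex_of_real (\<Sum>j<M. (norm (dirichlet M (t - real j / real M)))\<^sup>2)
    = (\<Sum>j<M. \<Sum>p<M. \<Sum>q<M. cis (2 * pi * ((real p - real q) * t)) * cis (2 * pi * ((real p - real q) * (- real j / real M))))"
    unfolding of_real_sum dirichlet_norm_square cis_mult by (simp add: algebra_simps)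
  also have "\<dots> = (\<Sum>p<M. \<Sum>j<M. \<Sum>q<M. cis (2 * pi * ((real p - real q) * t)) * cis (2 * pi * ((real p - real q) * (- real j / real M))))"
    by (rule sum.swap)
  also have "\<dots> = (\<Sum>p<M. \<Sum>q<M. \<Sum>j<M. cis (2 * pi * ((real p - real q) * t)) * cis (2 * pi * ((real p - real q) * (- real j / real M))))"
    by (rule sum.cong[OF refl], rule sum.swap)
  also have "\<dots> = (\<Sum>p<M. \<Sum>q<M. cis (2 * pi * ((real p - real q) * t)) * (if p = q then of_nat M else 0))"
    unfolding sum_distrib_left[symmetric] by (intro sum.cong refl arg_cong2[where f="(*)"] sum_roots_of_unity) auto
  also have "\<dots> = (\<Sum>p<M. \<Sum>q<M. if p = q then of_nat M else 0)" by (intro sum.cong refl) simp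
  also have "\<dots> = complex_of_real (real M * real M)" by simp
  finally have "(\<Sum>j<M. (norm (dirichlet M (t - real j / real M)))\<^sup>2) = real M * real M" by (simp only: of_real_eq_iff)
  then show ?thesis using assms unfolding power_divide sum_divide_distrib[symmetric] by (simp add: power2_eq_square)
qed

lemma dirichlet_periodic: "dirichlet M (t + of_int k) = dirichlet M t"
proof -
  have "cis (2 * pi * (real p * (t + of_int k))) = cis (2 * pi * (real p * t))" for p
  proof -
    have "2 * pi * (real p * (t + of_int k)) = 2 * pi * (real p * t) + 2 * pi * of_int (int p * k)" by (simp add: algebra_simps)
    then show ?thesis by (simp only: cis_mult[symmetric] cis_multiple_2pi Ints_of_int mult_1_right)
  qed
  then show ?thesis unfolding dirichlet_def by simp
qed

text \<open>Each of the \<open>M\<close> summands is within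
  \<open>2 * pi * M * \<bar>t\<bar> \<le> 8 / 100\<close> of \<open>1\<close>; the constant uses
  only \<open>pi < 4\<close>.\<close>

lemma dirichlet_near_zero:
  assumes "M \<ge> 1" "\<bar>t\<bar> \<le> 1 / (100 * real M)"
  shows "norm (dirichlet M t) / real M \<ge> 92 / 100"
proof -
  have "norm (of_nat M - dirichlet M t) = norm (\<Sum>p<M. cis 0 - cis (2 * pi * (real p * t)))" unfolding dirichlet_def sum_subtractf by simp
  also have "\<dots> \<le> (\<Sum>p<M. 8 / 100)"
  proof (rule sum_norm_le)
    fix p assume p: "p \<in> {..<M}"
    have "norm (cis 0 - cis (2 * pi * (real p * t))) \<le> \<bar>0 - 2 * pi * (real p * t)\<bar>" by (rule norm_cis_diff_le)
    also have "\<dots> = 2 * pi * (real p * \<bar>t\<bar>)" by (simp add: abs_mult)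
    also have "\<dots> \<le> 2 * 4 * (real M * (1 / (100 * real M)))"
      by (intro mult_mono) (use assms p pi_less_4 in auto)
    finally show "norm (cis 0 - cis (2 * pi * (real p * t))) \<le> 8 / 100" using assms by simp
  qed
  finally have "norm (of_nat M - dirichlet M t) \<le> real M * (8 / 100)" by simp
  then have "real M - norm (dirichlet M t) \<le> real M * (8 / 100)"
    using norm_triangle_ineq2[of "of_nat M" "dirichlet M t"] by simp
  then show ?thesis using assms(1) by (simp add: field_simps)
qed

text \<open>By the Parseval identity only one of the kernels can be large, so it cannot be cancelled by the others.\<close>

lemma dirichlet_cube_sum_lower_bound:
  assumes M: "M \<ge> 1" and t: "\<bar>real M * t - real k\<bar> \<le> 1 / 100" and \<phi>: "\<And>j. norm (\<phi> j) = 1"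
  shows "1 / 2 \<le> norm (\<Sum>j<M. \<phi> j * of_real ((norm (dirichlet M (t - real j / real M)) / real M)\<^sup>2) * (dirichlet M (t - real j / real M) / of_nat M))"
proof -
  define u where "u j = norm (dirichlet M (t - real j / real M)) / real M" for j
  define T where "T j = \<phi> j * of_real ((u j)\<^sup>2) * (dirichlet M (t - real j / real M) / of_nat M)" for j
  \<comment> \<open>\<open>t\<close> is within \<open>1 / (100 * M)\<close> of \<open>k / M\<close>,
    and by periodicity the kernel centred there is the one with index
    \<open>k mod M\<close>.\<close>
  define j0 where "j0 = k mod M"
  have j0: "j0 < M" using M by (simp add: j0_def)
  have "real k = real (M * (k div M) + j0)" unfolding j0_def by simp
  then have "t - real j0 / real M = (t - real k / real M) + of_int (int (k div M))" using M by (simp add: field_simps)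
  then have "dirichlet M (t - real j0 / real M) = dirichlet M (t - real k / real M)" by (simp only: dirichlet_periodic)
  moreover have "\<bar>t - real k / real M\<bar> \<le> 1 / (100 * real M)"
  proof -
    have "t - real k / real M = (real M * t - real k) / real M" using M by (simp add: field_simps)
    then show ?thesis using t M by (simp add: abs_divide field_simps)
  qed
  ultimately have u0: "u j0 \<ge> 92 / 100" using dirichlet_near_zero[OF M] unfolding u_def by simp
  have nT: "norm (T j) = (u j)\<^sup>2 * u j" for j unfolding T_def norm_mult norm_divide norm_of_real \<phi> by (simp add: u_def)
  have P: "(\<Sum>j<M. (u j)\<^sup>2) = 1" unfolding u_def by (rule dirichlet_parseval[OF M])
  have "(\<Sum>j<M. (u j)\<^sup>2) = (u j0)\<^sup>2 + (\<Sum>j\<in>{..<M}-{j0}. (u j)\<^sup>2)" by (rule sum.remove) (use j0 in auto)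
  then have pars: "(u j0)\<^sup>2 + (\<Sum>j\<in>{..<M}-{j0}. (u j)\<^sup>2) = 1" unfolding P by (rule sym)
  have u1: "u j \<le> 1" if "j < M" for j
  proof -
    have "(u j)\<^sup>2 \<le> (\<Sum>j<M. (u j)\<^sup>2)" by (rule member_le_sum) (use that in auto)
    also have "\<dots> = 1" unfolding u_def by (rule dirichlet_parseval[OF M])
    finally have "(u j)\<^sup>2 \<le> 1\<^sup>2" by simp
    then show ?thesis by (rule power2_le_imp_le) simp
  qed
  have "norm (\<Sum>j\<in>{..<M}-{j0}. T j) \<le> (\<Sum>j\<in>{..<M}-{j0}. (u j)\<^sup>2)"
  proof (rule sum_norm_le)
    fix j assume "j \<in> {..<M} - {j0}"
    then have "(u j)\<^sup>2 * u j \<le> (u j)\<^sup>2 * 1" by (intro mult_left_mono u1) auto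
    then show "norm (T j) \<le> (u j)\<^sup>2" unfolding nT by simp
  qed
  moreover have sT: "(\<Sum>j<M. T j) = T j0 + (\<Sum>j\<in>{..<M}-{j0}. T j)" by (rule sum.remove) (use j0 in auto)
  moreover have "norm (T j0) \<le> norm (T j0 + (\<Sum>j\<in>{..<M}-{j0}. T j)) + norm (\<Sum>j\<in>{..<M}-{j0}. T j)"
    using norm_triangle_ineq4[of "T j0 + (\<Sum>j\<in>{..<M}-{j0}. T j)" "\<Sum>j\<in>{..<M}-{j0}. T j"] by simp
  ultimately have l: "norm (T j0) - (1 - (u j0)\<^sup>2) \<le> norm (\<Sum>j<M. T j)" using pars unfolding sT by linarith
  \<comment> \<open>With \<open>u \<ge> 92 / 100\<close> for the large kernel, the sum is at least
    \<open>u^3 - (1 - u^2)\<close>, about \<open>0.78 - 0.15\<close>.\<close>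
  have "(92/100)\<^sup>2 \<le> (u j0)\<^sup>2" by (rule power_mono[OF u0]) simp
  then have a: "8464/10000 \<le> (u j0)\<^sup>2" by (simp add: power2_eq_square)
  have "8464/10000 * (92/100) \<le> norm (T j0)" unfolding nT by (rule mult_mono[OF a u0]) auto
  then have "1 / 2 \<le> norm (\<Sum>j<M. T j)" using a l by linarith
  then show ?thesis unfolding T_def u_def .
qed

text \<open>The value the multiplier should have at the p-th frequency on shell \<open>b\<close>:
  the sign cancels that of the Rudin-Shapiro coefficient, and the exponential translates the
  resulting Dirichlet kernel to \<open>b / M\<close>.\<close>

definition test_phase :: "nat \<Rightarrow> (nat \<Rightarrow> real) \<Rightarrow> nat \<Rightarrow> nat \<Rightarrow> complex" where
  "test_phase M \<epsilon> b p = of_real (\<epsilon> p) * cis (- 2 * pi * (real p * real b / real M))"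

section \<open>Test polynomials: a flat polynomial, a shell selector and single exponentials\<close>

context
  fixes i1 i2 :: "'m::finite" and M :: nat and \<epsilon> :: "nat \<Rightarrow> real"
  assumes ii: "i1 \<noteq> i2" and M: "M \<ge> 1" and sgn: "\<And>p. \<epsilon> p \<in> {1, -1}"
    and flat: "\<forall>z::complex. norm z = 1 \<longrightarrow> norm (\<Sum>p<M. of_real (\<epsilon> p) * z ^ p) \<le> sqrt (2 * real M)"
begin

text \<open>All functions share one index type, as the transference statement requires; components
  that do not vary are \<open>0\<close>. For \<open>i2\<close> the first component names the shell
  and the other two run through the double sum of a squared Dirichlet kernel.\<close>

definition test_index :: "'m \<Rightarrow> (nat \<times> nat \<times> nat) set" where
  "test_index j = (if j = i1 then {..<M} \<times> {0} \<times> {0} else if j = i2 then {..<M} \<times> {..<M} \<times> {..<M} else {(0, 0, 0)})"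

text \<open>The normalisation \<open>1 / (2 * sqrt M)\<close> brings the flat polynomial below
  \<open>1\<close>. The exponentials at \<open>i2\<close> centre the squared kernel of shell
  \<open>a\<close> at \<open>a / M\<close>.\<close>

definition test_coeff :: "'m \<Rightarrow> nat \<times> nat \<times> nat \<Rightarrow> complex" where
  "test_coeff j = (\<lambda>(a, p, q). if j = i1 then of_real (\<epsilon> a / (2 * sqrt (real M)))
     else if j = i2 then cis (2 * pi * ((real p - real q) * (- real a / real M))) / (of_nat M)\<^sup>2 else 1)"

text \<open>Frequencies are odd, so that a shift by half a period changes the sign; as they are
  spaced by \<open>2\<close>, kernels appear with argument \<open>2 * t\<close>. The term
  \<open>32 ^ prod_encode (M, a)\<close> gives every pair \<open>(M, a)\<close> its own shell, so
  that one multiplier serves every \<open>M\<close>.\<close>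

definition test_freq :: "'m \<Rightarrow> nat \<times> nat \<times> nat \<Rightarrow> real" where
  "test_freq j = (\<lambda>(a, p, q). if j = i1 then 2 * real a + 1
     else if j = i2 then 32 ^ prod_encode (M, a) + 1 + 2 * (real p - real q) else 1)"

definition test_poly :: "'m \<Rightarrow> real \<Rightarrow> complex" where
  "test_poly j t = (\<Sum>a\<in>test_index j. test_coeff j a * cis (2 * pi * (test_freq j a * t)))"

lemma test_index_finite: "finite (test_index j)" unfolding test_index_def by auto

lemma sum_test_index:
  "(\<Sum>a\<in>test_index i1. f a) = (\<Sum>a<M. f (a, 0, 0))"
  "(\<Sum>a\<in>test_index i2. f a) = (\<Sum>a<M. \<Sum>p<M. \<Sum>q<M. f (a, p, q))"
  "j \<noteq> i1 \<Longrightarrow> j \<noteq> i2 \<Longrightarrow> (\<Sum>a\<in>test_index j. f a) = f (0, 0, 0)" for f :: "nat \<times> nat \<times> nat \<Rightarrow> 'b::comm_monoid_add"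
proof -
  have "(\<Sum>a\<in>test_index i1. f a) = (\<Sum>(a, y)\<in>{..<M} \<times> ({0} \<times> {0}). f (a, y))" by (simp add: test_index_def)
  also have "\<dots> = (\<Sum>a<M. \<Sum>y\<in>{0} \<times> {0}. f (a, y))" by (rule sum.cartesian_product[symmetric])
  finally show "(\<Sum>a\<in>test_index i1. f a) = (\<Sum>a<M. f (a, 0, 0))" by simp
  have "(\<Sum>a\<in>test_index i2. f a) = (\<Sum>(a, y)\<in>{..<M} \<times> ({..<M} \<times> {..<M}). f (a, y))" using ii by (simp add: test_index_def)
  also have "\<dots> = (\<Sum>a<M. \<Sum>y\<in>{..<M} \<times> {..<M}. f (a, y))" by (rule sum.cartesian_product[symmetric])
  also have "\<dots> = (\<Sum>a<M. \<Sum>p<M. \<Sum>q<M. f (a, p, q))" by (intro sum.cong refl) (simp add: sum.cartesian_product split_def)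
  finally show "(\<Sum>a\<in>test_index i2. f a) = (\<Sum>a<M. \<Sum>p<M. \<Sum>q<M. f (a, p, q))" .
qed (simp add: test_index_def)

text \<open>For a fixed shell the double sum is the expanded square of a Dirichlet kernel; the
  unimodular factor in front carries it to the shell.\<close>

lemma test_kernel:
  "(\<Sum>p<M. \<Sum>q<M. test_coeff i2 (a, p, q) * cis (2 * pi * (test_freq i2 (a, p, q) * t)))
    = cis (2 * pi * ((32 ^ prod_encode (M, a) + 1) * t)) * of_real ((norm (dirichlet M (2 * t - real a / real M)) / real M)\<^sup>2)"
proof -
  have "test_coeff i2 (a, p, q) * cis (2 * pi * (test_freq i2 (a, p, q) * t))
    = cis (2 * pi * ((32 ^ prod_encode (M, a) + 1) * t)) / (of_nat M)\<^sup>2 * cis (2 * pi * ((real p - real q) * (2 * t - real a / real M)))" for p q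
  proof -
    have "2 * pi * ((real p - real q) * (- real a / real M)) + 2 * pi * ((32 ^ prod_encode (M, a) + 1 + 2 * (real p - real q)) * t)
      = 2 * pi * ((32 ^ prod_encode (M, a) + 1) * t) + 2 * pi * ((real p - real q) * (2 * t - real a / real M))"
      by (simp add: algebra_simps)
    then show ?thesis using ii unfolding test_coeff_def test_freq_def by (simp add: cis_mult)
  qed
  then have "(\<Sum>p<M. \<Sum>q<M. test_coeff i2 (a, p, q) * cis (2 * pi * (test_freq i2 (a, p, q) * t)))
    = cis (2 * pi * ((32 ^ prod_encode (M, a) + 1) * t)) / (of_nat M)\<^sup>2 * of_real ((norm (dirichlet M (2 * t - real a / real M)))\<^sup>2)"
    unfolding dirichlet_norm_square sum_distrib_left by (simp only:)
  then show ?thesis by (simp add: power_divide)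
qed

text \<open>Flatness of the Rudin-Shapiro polynomial for \<open>i1\<close>, the partition of unity
  for \<open>i2\<close>, a single exponential otherwise.\<close>

lemma test_poly_bound: "norm (test_poly j t) \<le> 1"
proof -
  consider "j = i1" | "j = i2" | "j \<noteq> i1" "j \<noteq> i2" by blast
  then show ?thesis
  proof cases
    case 1
    have "test_poly j t = (\<Sum>a<M. (cis (2 * pi * t) / of_real (2 * sqrt (real M))) * (of_real (\<epsilon> a) * cis (2 * pi * (2 * t)) ^ a))"
      unfolding test_poly_def 1 sum_test_index
    proof (rule sum.cong[OF refl])
      fix a
      have "cis (2 * pi * (test_freq i1 (a, 0, 0) * t)) = cis (2 * pi * t) * cis (2 * pi * (2 * t)) ^ a"
        unfolding Complex.DeMoivre cis_mult by (rule arg_cong[where f=cis]) (simp add: test_freq_def algebra_simps)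
      then show "test_coeff i1 (a, 0, 0) * cis (2 * pi * (test_freq i1 (a, 0, 0) * t)) = (cis (2 * pi * t) / of_real (2 * sqrt (real M))) * (of_real (\<epsilon> a) * cis (2 * pi * (2 * t)) ^ a)"
        by (simp add: test_coeff_def)
    qed
    also have "norm \<dots> = 1 / (2 * sqrt (real M)) * norm (\<Sum>a<M. of_real (\<epsilon> a) * cis (2 * pi * (2 * t)) ^ a)"
      unfolding sum_distrib_left[symmetric] norm_mult norm_divide norm_of_real by simp
    also have "\<dots> \<le> 1 / (2 * sqrt (real M)) * sqrt (2 * real M)" by (intro mult_left_mono flat[rule_format]) auto
    also have "\<dots> = sqrt 2 / 2" using M by (simp add: real_sqrt_mult)
    also have "\<dots> \<le> 1" using sqrt2_less_2 by simp
    finally show ?thesis .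
  next
    case 2
    have "norm (test_poly j t) \<le> (\<Sum>a<M. (norm (dirichlet M (2 * t - real a / real M)) / real M)\<^sup>2)"
      unfolding test_poly_def 2 sum_test_index test_kernel
      by (intro sum_norm_le) (simp add: norm_mult norm_power norm_divide)
    then show ?thesis using dirichlet_parseval[OF M] by simp
  next
    case 3
    then show ?thesis unfolding test_poly_def sum_test_index(3)[OF 3] by (simp add: test_coeff_def norm_mult)
  qed
qed

lemma test_poly_antiperiodic: "test_poly j (t + 1 / 2) = - test_poly j t"
proof -
  have "\<exists>k::int. test_freq j a = of_int (2 * k + 1)" if "a \<in> test_index j" for a
  proof -
    obtain b p q where a: "a = (b, p, q)" by (cases a) auto
    have "b \<le> b * 1" by simp
    \<comment> \<open>The exponent of \<open>32\<close> has to be positive for the frequency to be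
      odd; this follows from \<open>M \<ge> 1\<close>.\<close>
    have "M \<le> prod_encode (M, b)" by (rule le_prod_encode_1)
    then obtain l where l: "prod_encode (M, b) = Suc l" using M by (metis Suc_le_D One_nat_def order_trans)
    show ?thesis
    proof (cases "j = i1")
      case True
      then show ?thesis by (intro exI[of _ "int b"]) (simp add: test_freq_def a)
    next
      case F: False
      show ?thesis
      proof (cases "j = i2")
        case True
        then show ?thesis using F by (intro exI[of _ "16 * 32 ^ l + int p - int q"]) (simp add: test_freq_def a l)
      next
        case False
        then show ?thesis using F by (intro exI[of _ 0]) (simp add: test_freq_def a)
      qed
    qed
  qed
  then have "cis (2 * pi * (test_freq j a * (t + 1 / 2))) = - cis (2 * pi * (test_freq j a * t))" if a: "a \<in> test_index j" for a
  proof -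
    obtain k :: int where k: "test_freq j a = of_int (2 * k + 1)" using \<open>\<And>a. a \<in> test_index j \<Longrightarrow> _\<close> a by blast
    have "2 * pi * (test_freq j a * (t + 1 / 2)) = 2 * pi * (test_freq j a * t) + (2 * pi * of_int k + pi)"
      unfolding k by (simp add: algebra_simps)
    then show ?thesis by (simp only: cis_mult[symmetric] cis_multiple_2pi Ints_of_int cis_pi mult_1_left mult_minus1_right)
  qed
  then show ?thesis unfolding test_poly_def sum_negf[symmetric] by (intro sum.cong refl) simp
qed

text \<open>This total mass is the factor by which a deviation of the multiplier from its prescribed
  values is amplified. Against a main term of order \<open>sqrt M\<close> it explains why that
  deviation must be small compared with \<open>1 / M\<close>.\<close>

lemma test_coeff_sum: "(\<Sum>g\<in>PiE UNIV test_index. norm (\<Prod>j\<in>UNIV. test_coeff j (g j))) = sqrt (real M) / 2 * real M"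
proof -
  have "(\<Sum>g\<in>PiE UNIV test_index. norm (\<Prod>j\<in>UNIV. test_coeff j (g j))) = (\<Prod>j\<in>UNIV. \<Sum>a\<in>test_index j. norm (test_coeff j a))"
    unfolding prod_norm[symmetric] by (rule prod_sum_PiE[symmetric]) (auto simp: test_index_finite)
  also have "\<dots> = (\<Sum>a\<in>test_index i1. norm (test_coeff i1 a)) * ((\<Sum>a\<in>test_index i2. norm (test_coeff i2 a)) * (\<Prod>j\<in>UNIV - {i1} - {i2}. \<Sum>a\<in>test_index j. norm (test_coeff j a)))"
    using ii by (subst prod.remove[of UNIV i1], simp, simp, subst prod.remove[of "UNIV - {i1}" i2]) auto
  also have "(\<Prod>j\<in>UNIV - {i1} - {i2}. \<Sum>a\<in>test_index j. norm (test_coeff j a)) = 1"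
  proof (rule prod.neutral, rule ballI)
    fix j assume "j \<in> UNIV - {i1} - {i2}"
    then have j: "j \<noteq> i1" "j \<noteq> i2" by auto
    show "(\<Sum>a\<in>test_index j. norm (test_coeff j a)) = 1" unfolding sum_test_index(3)[OF j] by (simp add: test_coeff_def j)
  qed
  also have "(\<Sum>a\<in>test_index i1. norm (test_coeff i1 a)) = sqrt (real M) / 2"
  proof -
    have N: "norm (test_coeff i1 (a, 0, 0)) = 1 / (2 * sqrt (real M))" for a
      using sgn[of a] unfolding test_coeff_def by (auto simp: norm_divide norm_mult)
    show ?thesis unfolding sum_test_index N using M by (simp add: field_simps)
  qed
  also have "(\<Sum>a\<in>test_index i2. norm (test_coeff i2 a)) = real M"
  proof -
    have "norm (test_coeff i2 (a, p, q)) = 1 / (real M)\<^sup>2" for a p q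
      using ii unfolding test_coeff_def by (simp add: norm_divide norm_power)
    then show ?thesis unfolding sum_test_index using M by (simp add: power2_eq_square)
  qed
  finally show ?thesis by simp
qed

text \<open>The prescribed value couples the shell chosen by \<open>i2\<close> with the frequency
  chosen by \<open>i1\<close>. Summing over the shell \<open>b\<close> with an indicator for it
  decouples the two; for each \<open>b\<close> the sum over \<open>g\<close> factorises into a
  shifted Dirichlet kernel, its squared modulus and unimodular factors, up to normalisation.\<close>

lemma test_main_lower_bound:
  assumes t: "\<bar>real M * (2 * t) - real k\<bar> \<le> 1 / 100"
  shows "sqrt (real M) / 4 \<le> norm (\<Sum>g\<in>PiE UNIV test_index. (\<Prod>j\<in>UNIV. test_coeff j (g j)) * test_phase M \<epsilon> (fst (g i2)) (fst (g i1)) * cis (2 * pi * (\<Sum>j\<in>UNIV. test_freq j (g j) * t)))"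
proof -
  define F where "F b j a = test_coeff j a * cis (2 * pi * (test_freq j a * t)) *
      (if j = i1 then test_phase M \<epsilon> b (fst a) else if j = i2 then (if fst a = b then 1 else 0) else 1)" for b j a
  let ?G = "PiE UNIV test_index"
  have cs: "cis (2 * pi * (\<Sum>j\<in>A. f j)) = (\<Prod>j\<in>A. cis (2 * pi * f j))" if "finite A" for A and f :: "'m \<Rightarrow> real"
    using that by (induction A rule: finite_induct) (auto simp: cis_mult[symmetric] distrib_left)
  have split2: "(\<Prod>j\<in>UNIV. h j) = h i1 * (h i2 * (\<Prod>j\<in>UNIV - {i1} - {i2}. h j))" for h :: "'m \<Rightarrow> complex"
    using ii by (subst prod.remove[of UNIV i1], simp, simp, subst prod.remove[of "UNIV - {i1}" i2]) auto
  have trm: "(\<Prod>j\<in>UNIV. test_coeff j (g j)) * test_phase M \<epsilon> (fst (g i2)) (fst (g i1)) * cis (2 * pi * (\<Sum>j\<in>UNIV. test_freq j (g j) * t))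
     = (\<Sum>b<M. \<Prod>j\<in>UNIV. F b j (g j))" if g: "g \<in> ?G" for g
  proof -
    let ?p = "\<lambda>b. \<Prod>j\<in>UNIV. if j = i1 then test_phase M \<epsilon> b (fst (g j)) else if j = i2 then (if fst (g j) = b then 1 else 0) else 1"
    have p: "?p b = (if fst (g i2) = b then test_phase M \<epsilon> b (fst (g i1)) else 0)" for b
      unfolding split2 using ii by (subst prod.neutral) auto
    have "g i2 \<in> test_index i2" using g by auto
    then have b: "fst (g i2) < M" using ii by (auto simp: test_index_def)
    have "(\<Sum>b<M. \<Prod>j\<in>UNIV. F b j (g j)) = (\<Sum>b<M. ((\<Prod>j\<in>UNIV. test_coeff j (g j)) * (\<Prod>j\<in>UNIV. cis (2 * pi * (test_freq j (g j) * t)))) * ?p b)"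
      unfolding F_def prod.distrib ..
    also have "\<dots> = ((\<Prod>j\<in>UNIV. test_coeff j (g j)) * (\<Prod>j\<in>UNIV. cis (2 * pi * (test_freq j (g j) * t)))) * (\<Sum>b<M. ?p b)"
      by (rule sum_distrib_left[symmetric])
    also have "(\<Sum>b<M. ?p b) = test_phase M \<epsilon> (fst (g i2)) (fst (g i1))" unfolding p using b by simp
    finally show ?thesis unfolding cs[OF finite] by (simp only: mult_ac)
  qed
  define W where "W = (\<Prod>j\<in>UNIV - {i1} - {i2}. cis (2 * pi * t))"
  define D where "D b = dirichlet M (2 * t - real b / real M)" for b
  have nW: "norm W = 1" unfolding W_def prod_norm[symmetric] by simp
  have F1: "(\<Sum>a\<in>test_index i1. F b i1 a) = cis (2 * pi * t) / of_real (2 * sqrt (real M)) * D b" for b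
    unfolding sum_test_index D_def dirichlet_def sum_distrib_left
  proof (rule sum.cong[OF refl])
    fix a
    have e: "cis (2 * pi * ((2 * real a + 1) * t)) * cis (- 2 * pi * (real a * real b / real M)) = cis (2 * pi * t) * cis (2 * pi * (real a * (2 * t - real b / real M)))"
      unfolding cis_mult by (rule arg_cong[where f=cis]) (simp add: algebra_simps)
    \<comment> \<open>The sign of the coefficient meets the sign prescribed for the multiplier; this
      is what creates the peak.\<close>
    have s: "complex_of_real (\<epsilon> a) * of_real (\<epsilon> a) = 1" using sgn[of a] by auto
    have "F b i1 (a, 0, 0) = (complex_of_real (\<epsilon> a) * of_real (\<epsilon> a)) / of_real (2 * sqrt (real M)) * (cis (2 * pi * ((2 * real a + 1) * t)) * cis (- 2 * pi * (real a * real b / real M)))"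
      unfolding F_def test_coeff_def test_freq_def test_phase_def by simp
    then show "F b i1 (a, 0, 0) = cis (2 * pi * t) / of_real (2 * sqrt (real M)) * cis (2 * pi * (real a * (2 * t - real b / real M)))"
      unfolding s e by simp
  qed
  have F2: "(\<Sum>a\<in>test_index i2. F b i2 a) = cis (2 * pi * ((32 ^ prod_encode (M, b) + 1) * t)) * of_real ((norm (D b) / real M)\<^sup>2)" if b: "b < M" for b
  proof -
    have "(\<Sum>a\<in>test_index i2. F b i2 a) = (\<Sum>a<M. if a = b then \<Sum>p<M. \<Sum>q<M. test_coeff i2 (a, p, q) * cis (2 * pi * (test_freq i2 (a, p, q) * t)) else 0)"
      unfolding sum_test_index using ii by (intro sum.cong refl) (auto simp: F_def)
    also have "\<dots> = (\<Sum>p<M. \<Sum>q<M. test_coeff i2 (b, p, q) * cis (2 * pi * (test_freq i2 (b, p, q) * t)))" using b by simp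
    finally show ?thesis unfolding test_kernel D_def .
  qed
  have F3: "(\<Prod>j\<in>UNIV - {i1} - {i2}. \<Sum>a\<in>test_index j. F b j a) = W" for b
    unfolding W_def
  proof (rule prod.cong[OF refl])
    fix j assume "j \<in> UNIV - {i1} - {i2}"
    then have j: "j \<noteq> i1" "j \<noteq> i2" by auto
    show "(\<Sum>a\<in>test_index j. F b j a) = cis (2 * pi * t)" unfolding sum_test_index(3)[OF j] by (simp add: F_def test_coeff_def test_freq_def j)
  qed
  have "(\<Sum>g\<in>?G. (\<Prod>j\<in>UNIV. test_coeff j (g j)) * test_phase M \<epsilon> (fst (g i2)) (fst (g i1)) * cis (2 * pi * (\<Sum>j\<in>UNIV. test_freq j (g j) * t)))
    = (\<Sum>g\<in>?G. \<Sum>b<M. \<Prod>j\<in>UNIV. F b j (g j))" by (rule sum.cong[OF refl]) (rule trm)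
  also have "\<dots> = (\<Sum>b<M. \<Sum>g\<in>?G. \<Prod>j\<in>UNIV. F b j (g j))" by (rule sum.swap)
  also have "\<dots> = (\<Sum>b<M. \<Prod>j\<in>UNIV. \<Sum>a\<in>test_index j. F b j a)"
    by (intro sum.cong refl prod_sum_PiE[symmetric]) (auto simp: test_index_finite)
  also have "\<dots> = (\<Sum>b<M. (W * cis (2 * pi * t) * of_real (sqrt (real M) / 2)) * (cis (2 * pi * ((32 ^ prod_encode (M, b) + 1) * t)) * of_real ((norm (D b) / real M)\<^sup>2) * (D b / of_nat M)))"
  proof (rule sum.cong[OF refl])
    fix b assume "b \<in> {..<M}"
    then have b: "b < M" by simp
    have sq: "complex_of_real (sqrt (real M) / 2) / of_nat M = 1 / of_real (2 * sqrt (real M))"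
    proof -
      have "sqrt (real M) / 2 / real M = 1 / (2 * sqrt (real M))" using M by (simp add: field_simps)
      then have "complex_of_real (sqrt (real M) / 2 / real M) = of_real (1 / (2 * sqrt (real M)))" by (rule arg_cong)
      then show ?thesis by simp
    qed
    have "(\<Prod>j\<in>UNIV. \<Sum>a\<in>test_index j. F b j a) = (1 / of_real (2 * sqrt (real M))) * (W * cis (2 * pi * t) * (cis (2 * pi * ((32 ^ prod_encode (M, b) + 1) * t)) * of_real ((norm (D b) / real M)\<^sup>2) * D b))"
      unfolding split2[of "\<lambda>j. \<Sum>a\<in>test_index j. F b j a"] F1 F2[OF b] F3 by (simp only: divide_inverse mult_ac mult_1_left)
    also have "\<dots> = (W * cis (2 * pi * t) * of_real (sqrt (real M) / 2)) * (cis (2 * pi * ((32 ^ prod_encode (M, b) + 1) * t)) * of_real ((norm (D b) / real M)\<^sup>2) * (D b / of_nat M))"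
      unfolding sq[symmetric] by (simp only: divide_inverse mult_ac)
    finally show "(\<Prod>j\<in>UNIV. \<Sum>a\<in>test_index j. F b j a) = \<dots>" .
  qed
  also have "\<dots> = (W * cis (2 * pi * t) * of_real (sqrt (real M) / 2)) * (\<Sum>b<M. cis (2 * pi * ((32 ^ prod_encode (M, b) + 1) * t)) * of_real ((norm (D b) / real M)\<^sup>2) * (D b / of_nat M))"
    by (rule sum_distrib_left[symmetric])
  finally have e: "(\<Sum>g\<in>?G. (\<Prod>j\<in>UNIV. test_coeff j (g j)) * test_phase M \<epsilon> (fst (g i2)) (fst (g i1)) * cis (2 * pi * (\<Sum>j\<in>UNIV. test_freq j (g j) * t))) = \<dots>" .
  have "1 / 2 \<le> norm (\<Sum>b<M. cis (2 * pi * ((32 ^ prod_encode (M, b) + 1) * t)) * of_real ((norm (D b) / real M)\<^sup>2) * (D b / of_nat M))"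
    unfolding D_def by (rule dirichlet_cube_sum_lower_bound[OF M t]) simp
  then have "sqrt (real M) / 2 * (1 / 2) \<le> sqrt (real M) / 2 * norm (\<Sum>b<M. cis (2 * pi * ((32 ^ prod_encode (M, b) + 1) * t)) * of_real ((norm (D b) / real M)\<^sup>2) * (D b / of_nat M))"
    by (rule mult_left_mono) simp
  then show ?thesis unfolding e norm_mult nW by simp
qed

text \<open>Division by \<open>32^\<nu>\<close> sends the large part of the frequency of
  \<open>i2\<close> to \<open>1\<close>; what remains in any component is at most
  \<open>3 * M\<close> before the division, and \<open>\<nu> \<ge> M\<close> by the choice of the
  pairing.\<close>

lemma test_freq_distance:
  fixes e :: "real^'n"
  assumes e: "norm e = 1" and g: "g \<in> PiE UNIV test_index"
  shows "norm ((1/32) ^ prod_encode (M, fst (g i2)) *\<^sub>R (\<chi> j. test_freq j (g j) *\<^sub>R e) - axis i2 e) \<le> real CARD('m) * (3 * real M * (1/32) ^ M)"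
proof -
  let ?\<nu> = "prod_encode (M, fst (g i2))"
  let ?z = "(1/32) ^ ?\<nu> *\<^sub>R (\<chi> j. test_freq j (g j) *\<^sub>R e) - axis i2 e :: real^'n^'m"
  have "norm (?z $ j) \<le> 3 * real M * (1/32) ^ M" for j
  proof -
    obtain a p q where gj: "g j = (a, p, q)" by (cases "g j") auto
    have "g j \<in> test_index j" using g by auto
    then have apq: "a < M" "p < M" "q < M" if "j = i1 \<or> j = i2" using that ii M by (auto simp: test_index_def gj split: if_splits)
    have "\<bar>(1/32) ^ ?\<nu> * test_freq j (g j) - (if j = i2 then 1 else 0)\<bar> \<le> (1/32) ^ ?\<nu> * (3 * real M)"
    proof -
      have "\<bar>x * y\<bar> \<le> x * (3 * real M)" if "\<bar>y\<bar> \<le> 3 * real M" "0 \<le> x" for x y :: real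
        using that by (simp add: abs_mult mult_left_mono)
      note b = this[of _ "(1/32) ^ ?\<nu>"]
      consider "j = i1" | "j = i2" | "j \<noteq> i1" "j \<noteq> i2" by blast
      then show ?thesis
      proof cases
        case 1
        then have "g i1 = (a, p, q)" using gj by simp
        then show ?thesis using 1 b[of "2 * real a + 1"] apq M ii by (simp add: test_freq_def)
      next
        case 2
        have g2: "g i2 = (a, p, q)" using 2 gj by simp
        have "(1/32) ^ k * (32 ^ k + 1 + 2 * (real p - real q)) - 1 = (1/32) ^ k * (1 + 2 * (real p - real q))" for k :: nat
          by (simp add: power_one_over field_simps)
        then have "(1/32) ^ ?\<nu> * test_freq j (g j) - 1 = (1/32) ^ ?\<nu> * (1 + 2 * (real p - real q))"
          using 2 ii by (simp add: test_freq_def g2)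
        then show ?thesis using 2 b[of "1 + 2 * (real p - real q)"] apq M by simp
      next
        case 3
        then show ?thesis using b[of 1] M by (simp add: gj test_freq_def)
      qed
    qed
    also have "\<dots> \<le> (1/32) ^ M * (3 * real M)"
      by (intro mult_right_mono power_decreasing le_prod_encode_1) auto
    finally have "\<bar>(1/32) ^ ?\<nu> * test_freq j (g j) - (if j = i2 then 1 else 0)\<bar> \<le> 3 * real M * (1/32) ^ M" by (simp only: mult.commute)
    moreover have "?z $ j = ((1/32) ^ ?\<nu> * test_freq j (g j) - (if j = i2 then 1 else 0)) *\<^sub>R e"
      by (simp add: axis_def scaleR_diff_left)
    ultimately show ?thesis using e by simp
  qed
  then have "(\<Sum>j\<in>UNIV. norm (?z $ j)) \<le> real CARD('m) * (3 * real M * (1/32) ^ M)" by (intro sum_bounded_above)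
  moreover have "norm ?z \<le> (\<Sum>j\<in>UNIV. norm (?z $ j))" unfolding norm_vec_def by (rule L2_set_le_sum) simp
  ultimately show ?thesis by linarith
qed

end

section \<open>Unboundedness of the operator\<close>

lemma ennreal_rpow_mono: "x \<le> y \<Longrightarrow> 0 \<le> a \<Longrightarrow> ennreal_rpow x a \<le> ennreal_rpow y a"
  unfolding ennreal_rpow_def
  by (auto simp: top_unique less_top intro!: ennreal_leI powr_mono2 enn2real_mono)

lemma ennreal_rpow_ennreal: "0 \<le> x \<Longrightarrow> ennreal_rpow (ennreal x) a = ennreal (x powr a)"
  unfolding ennreal_rpow_def by simp

lemma Lnorm_lower_bound:
  fixes g :: "'a::euclidean_space \<Rightarrow> ennreal"
  assumes p: "0 < p" and E: "E \<in> sets borel" and c: "0 \<le> c" and v: "0 \<le> v" "ennreal v \<le> emeasure lborel E"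
    and g: "\<And>x. x \<in> E \<Longrightarrow> ennreal c \<le> g x"
  shows "ennreal (c * v powr (1 / p)) \<le> Lnorm (ennreal p) g"
proof -
  have "ennreal (c powr p * v) = ennreal (c powr p) * ennreal v" by (rule ennreal_mult) (use v in auto)
  also have "\<dots> \<le> ennreal (c powr p) * emeasure lborel E" by (rule mult_left_mono) (use v in auto)
  also have "\<dots> = (\<integral>\<^sup>+x. ennreal (c powr p) * indicator E x \<partial>lborel)" by (rule nn_integral_cmult_indicator[symmetric]) (use E in simp)
  also have "\<dots> \<le> (\<integral>\<^sup>+x. ennreal_rpow (g x) p \<partial>lborel)"
  proof (rule nn_integral_mono)
    fix x
    show "ennreal (c powr p) * indicator E x \<le> ennreal_rpow (g x) p"
      using ennreal_rpow_mono[OF g, of x p] ennreal_rpow_ennreal[OF c, of p] p by (auto simp: indicator_def)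
  qed
  finally have "ennreal_rpow (ennreal (c powr p * v)) (1 / p) \<le> ennreal_rpow (\<integral>\<^sup>+x. ennreal_rpow (g x) p \<partial>lborel) (1 / p)"
    by (rule ennreal_rpow_mono) (use p in simp)
  moreover have "(c powr p * v) powr (1 / p) = c * v powr (1 / p)" using p c v by (simp add: powr_mult powr_powr)
  ultimately show ?thesis unfolding Lnorm_def using p c v by (simp add: ennreal_rpow_ennreal)
qed

lemma convolve_measurable:
  fixes f g :: "'a::euclidean_space \<Rightarrow> complex"
  assumes "continuous_on UNIV f" "continuous_on UNIV g"
  shows "convolve f g \<in> borel_measurable borel"
proof -
  have "(\<lambda>(x, y). f (x - y) * g y) \<in> borel_measurable borel"
    unfolding split_def
    by (intro borel_measurable_continuous_onI continuous_intros continuous_on_compose2[OF assms(1)] continuous_on_compose2[OF assms(2)]) auto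
  then have "(\<lambda>(x, y). f (x - y) * g y) \<in> borel_measurable (borel \<Otimes>\<^sub>M lborel)" by (simp add: borel_prod[symmetric] cong: measurable_cong_sets)
  then show ?thesis unfolding convolve_def[abs_def] by (rule lborel.borel_measurable_lebesgue_integral)
qed

text \<open>The maximal function decays like the N-th inverse power of
  \<open>1 + norm x / R\<close>, uniformly in \<open>P\<close> and \<open>R\<close>; with
  \<open>N * q \<ge> 2 * DIM('a)\<close> its q-th power is integrable, and the dilation contributes
  \<open>R powr (DIM('a) / q)\<close>. The exponent is written \<open>enn2real (1 / q)\<close> to
  cover \<open>q = \<infinity>\<close>, where it is \<open>0\<close>.\<close>

lemma hardy_norm_averaged_gaussian_bound:
  fixes \<phi> :: "'a::euclidean_space \<Rightarrow> complex" and q :: ennreal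
  assumes \<phi>: "schwartz \<phi>" and e: "e \<in> Basis" and q: "0 < q"
  shows "\<exists>N. \<exists>C\<ge>0. \<forall>R\<ge>(1::nat). \<forall>P. continuous_on UNIV P \<longrightarrow> (\<forall>x. norm (P x) \<le> 1) \<longrightarrow> (\<forall>x. P (x + (1/2) *\<^sub>R e) = - P x) \<longrightarrow>
     hardy_norm \<phi> q (\<lambda>y. P y * of_real (averaged_gaussian ((1/2) *\<^sub>R e) (1 / real R) N y)) \<le> ennreal (C * real R powr (real DIM('a) * enn2real (1 / q)))"
proof (cases "q = \<infinity>")
  case True
  obtain C where C: "C \<ge> 0" "\<forall>\<delta>\<in>{0<..1}. \<forall>P. continuous_on UNIV P \<longrightarrow> (\<forall>x. norm (P x) \<le> 1) \<longrightarrow> (\<forall>x. P (x + (1/2) *\<^sub>R e) = - P x) \<longrightarrow>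
     (\<forall>j x. norm (convolve (dyadic_dilate \<phi> j) (\<lambda>y. P y * of_real (averaged_gaussian ((1/2) *\<^sub>R e) \<delta> 0 y)) x) \<le> C / (1 + \<delta> * norm x) ^ 0)"
    using hardy_maximal_bound[OF \<phi> e, of 0] by blast
  show ?thesis
  proof (rule exI[of _ 0], rule exI[of _ C], intro conjI allI impI)
    fix R :: nat and P :: "'a \<Rightarrow> complex"
    assume R: "1 \<le> R" and P: "continuous_on UNIV P" "\<forall>x. norm (P x) \<le> 1" "\<forall>x. P (x + (1/2) *\<^sub>R e) = - P x"
    let ?f = "\<lambda>y. P y * complex_of_real (averaged_gaussian ((1/2) *\<^sub>R e) (1 / real R) 0 y)"
    have cf: "continuous_on UNIV ?f" by (intro continuous_intros averaged_gaussian_continuous P(1))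
    have c\<phi>: "continuous_on UNIV (dyadic_dilate \<phi> j)" for j
      unfolding dyadic_dilate_def
      by (intro continuous_intros continuous_on_compose2[OF rapidly_decreasing_cont[OF schwartz_rapidly_decreasing[OF \<phi>]]]) auto
    have d: "1 / real R \<in> {0<..1}" using R by auto
    have b: "norm (convolve (dyadic_dilate \<phi> j) ?f x) \<le> C" for j x
      using C(2)[rule_format, OF d P(1) P(2)[rule_format] P(3)[rule_format], of j x] by simp
    have "(\<lambda>x. SUP j::int. ennreal (norm (convolve (dyadic_dilate \<phi> j) ?f x))) \<in> borel_measurable lborel"
      using convolve_measurable[OF c\<phi> cf] by (intro borel_measurable_SUP) auto
    note meas = this
    have "hardy_norm \<phi> q ?f = esssup lborel (\<lambda>x. SUP j::int. ennreal (norm (convolve (dyadic_dilate \<phi> j) ?f x)))"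
      unfolding hardy_norm_def Lnorm_def by (rule if_P[OF True])
    also have "\<dots> \<le> ennreal C" by (rule esssup_I[OF meas AE_I2]) (intro SUP_least ennreal_leI b)
    finally have "hardy_norm \<phi> q ?f \<le> ennreal C" .
    then show "hardy_norm \<phi> q ?f \<le> ennreal (C * real R powr (real DIM('a) * enn2real (1 / q)))"
      using R True by simp
  qed (rule C(1))
next
  case False
  define Q where "Q = enn2real q"
  have qQ: "q = ennreal Q" using False by (simp add: Q_def less_top)
  have Q: "Q > 0" using q unfolding qQ by simp
  let ?D = "DIM('a)"
  define N where "N = nat \<lceil>real (2 * ?D) / Q\<rceil>"
  have "real (2 * ?D) / Q \<le> real N" unfolding N_def by (rule of_nat_ceiling)
  then have NQ: "real (2 * ?D) \<le> real N * Q" using Q by (simp add: field_simps)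
  obtain C where C: "C \<ge> 0" "\<forall>\<delta>\<in>{0<..1}. \<forall>P. continuous_on UNIV P \<longrightarrow> (\<forall>x. norm (P x) \<le> 1) \<longrightarrow> (\<forall>x. P (x + (1/2) *\<^sub>R e) = - P x) \<longrightarrow>
     (\<forall>j x. norm (convolve (dyadic_dilate \<phi> j) (\<lambda>y. P y * of_real (averaged_gaussian ((1/2) *\<^sub>R e) \<delta> N y)) x) \<le> C / (1 + \<delta> * norm x) ^ N)"
    using hardy_maximal_bound[OF \<phi> e, of N] by blast
  let ?w = "\<lambda>x::'a. C powr Q / (1 + norm x) ^ (2 * ?D)"
  define I where "I = (LINT x|lborel. ?w x)"
  have wi: "integrable lborel ?w" by (rule integrable_norm_weight) simp
  have I0: "I \<ge> 0" unfolding I_def by (intro integral_nonneg_AE AE_I2) simp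
  have inv: "enn2real (1 / q) = 1 / Q"
    unfolding qQ using Q by (subst ennreal_1[symmetric], subst divide_ennreal) auto
  show ?thesis
  proof (rule exI[of _ N], rule exI[of _ "I powr (1 / Q)"], intro conjI allI impI)
    fix R :: nat and P :: "'a \<Rightarrow> complex"
    assume R: "1 \<le> R" and P: "continuous_on UNIV P" "\<forall>x. norm (P x) \<le> 1" "\<forall>x. P (x + (1/2) *\<^sub>R e) = - P x"
    let ?f = "\<lambda>y. P y * complex_of_real (averaged_gaussian ((1/2) *\<^sub>R e) (1 / real R) N y)"
    let ?d = "1 / real R"
    have d: "?d \<in> {0<..1}" using R by auto
    have b: "ennreal_rpow (SUP j::int. ennreal (norm (convolve (dyadic_dilate \<phi> j) ?f x))) Q \<le> ennreal (?w (0 + ?d *\<^sub>R x))" for x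
    proof -
      have B0: "0 \<le> C / (1 + ?d * norm x) ^ N" using C(1) R by simp
      have "(SUP j::int. ennreal (norm (convolve (dyadic_dilate \<phi> j) ?f x))) \<le> ennreal (C / (1 + ?d * norm x) ^ N)"
        by (intro SUP_least ennreal_leI) (rule C(2)[rule_format, OF d P(1) P(2)[rule_format] P(3)[rule_format]])
      then have "ennreal_rpow (SUP j::int. ennreal (norm (convolve (dyadic_dilate \<phi> j) ?f x))) Q \<le> ennreal ((C / (1 + ?d * norm x) ^ N) powr Q)"
        using ennreal_rpow_mono[of _ "ennreal (C / (1 + ?d * norm x) ^ N)" Q] Q ennreal_rpow_ennreal[OF B0] by simp
      also have "\<dots> \<le> ennreal (?w (0 + ?d *\<^sub>R x))"
      proof (rule ennreal_leI)
        let ?y = "1 + ?d * norm x"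
        have y: "?y \<ge> 1" using R by simp
        have y0: "?y > 0" using y by linarith
        have "(C / ?y ^ N) powr Q = C powr Q / (?y ^ N) powr Q" by (rule powr_divide)
        also have "(?y ^ N) powr Q = ?y powr (real N * Q)" using powr_realpow[OF y0, of N] powr_powr[of ?y "real N" Q] by simp
        also have "C powr Q / ?y powr (real N * Q) \<le> C powr Q / ?y powr real (2 * ?D)"
          by (rule divide_left_mono[OF powr_mono[OF NQ y]]) (use y0 in auto)
        also have "?y powr real (2 * ?D) = ?y ^ (2 * ?D)" by (rule powr_realpow[OF y0])
        finally show "(C / ?y ^ N) powr Q \<le> ?w (0 + ?d *\<^sub>R x)" by simp
      qed
      finally show ?thesis .
    qed
    have int: "integrable lborel (\<lambda>x. ?w (0 + ?d *\<^sub>R x))" by (rule lborel_integrable_affine[OF wi]) (use R in simp)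
    have val: "(LINT x|lborel. ?w (0 + ?d *\<^sub>R x)) = real R ^ ?D * I"
    proof -
      have m: "?w \<in> borel_measurable borel" using borel_measurable_integrable[OF wi] by simp
      have "I = (\<bar>?d\<bar> ^ ?D) *\<^sub>R (LINT x|lborel. ?w (0 + ?d *\<^sub>R x))" unfolding I_def by (rule lborel_integral_affine[OF m]) (use R in simp)
      then show ?thesis using R by (simp add: power_one_over field_simps)
    qed
    have "hardy_norm \<phi> q ?f = ennreal_rpow (\<integral>\<^sup>+x. ennreal_rpow (SUP j::int. ennreal (norm (convolve (dyadic_dilate \<phi> j) ?f x))) Q \<partial>lborel) (1 / Q)"
      unfolding hardy_norm_def Lnorm_def Q_def using False by simp
    also have "\<dots> \<le> ennreal_rpow (\<integral>\<^sup>+x. ennreal (?w (0 + ?d *\<^sub>R x)) \<partial>lborel) (1 / Q)"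
      by (intro ennreal_rpow_mono nn_integral_mono b) (use Q in simp)
    also have "(\<integral>\<^sup>+x. ennreal (?w (0 + ?d *\<^sub>R x)) \<partial>lborel) = ennreal (real R ^ ?D * I)"
      unfolding val[symmetric] by (rule nn_integral_eq_integral[OF int]) simp
    also have "ennreal_rpow (ennreal (real R ^ ?D * I)) (1 / Q) = ennreal ((real R ^ ?D * I) powr (1 / Q))" by (rule ennreal_rpow_ennreal) (use I0 in simp)
    also have "(real R ^ ?D * I) powr (1 / Q) = I powr (1 / Q) * real R powr (real ?D * (1 / Q))"
    proof -
      have r: "real R > 0" using R by simp
      have "(real R ^ ?D * I) powr (1 / Q) = (real R ^ ?D) powr (1 / Q) * I powr (1 / Q)" using I0 by (simp add: powr_mult)
      also have "(real R ^ ?D) powr (1 / Q) = real R powr (real ?D * (1 / Q))" using powr_realpow[OF r, of ?D] powr_powr[of "real R" "real ?D" "1 / Q"] by simp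
      finally show ?thesis by simp
    qed
    finally show "hardy_norm \<phi> q ?f \<le> ennreal (I powr (1 / Q) * real R powr (real ?D * enn2real (1 / q)))" unfolding inv .
  qed simp
qed

text \<open>Along \<open>e\<close> the set consists of \<open>2 * M * R\<close> intervals of length
  \<open>1 / (200 * M)\<close> to the right of the points \<open>k / (2 * M)\<close>, in total
  \<open>R / 100\<close>; in the other coordinates it is the whole interval up to \<open>R\<close>.
  These are points where one of the kernels peaks, at distances comparable with the width of the
  envelope.\<close>

lemma periodic_slab:
  fixes e :: "'a::euclidean_space"
  assumes e: "e \<in> Basis" and M: "M \<ge> 1"
  shows "\<exists>E\<in>sets borel. ennreal (real R ^ DIM('a) / 100) \<le> emeasure lborel E \<and>
    (\<forall>x\<in>E. norm x \<le> real DIM('a) * real R \<and> (\<exists>k::nat. \<bar>real M * (2 * (e \<bullet> x)) - real k\<bar> \<le> 1 / 100))"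
proof -
  let ?J = "\<lambda>k::nat. {real k / (2 * real M)..real k / (2 * real M) + 1 / (200 * real M)}"
  define A where "A = (\<Union>k<2 * M * R. ?J k)"
  have Am: "A \<in> sets borel" unfolding A_def by auto
  have M0: "real M > 0" using M by simp
  have disj: "disjoint_family_on ?J {..<2 * M * R}"
    unfolding disjoint_family_on_def
  proof (intro ballI impI)
    fix k l :: nat assume kl: "k \<noteq> l"
    have "?J k \<inter> ?J l = {}" if "k < l" for k l :: nat
    proof -
      have "real k + 1 \<le> real l" using that by simp
      then have "(real k + 1) / (2 * real M) \<le> real l / (2 * real M)" using M0 by (intro divide_right_mono) auto
      moreover have "1 / (200 * real M) < 1 / (2 * real M)" using M0 by (intro divide_strict_left_mono) auto
      ultimately have "real k / (2 * real M) + 1 / (200 * real M) < real l / (2 * real M)" by (simp add: add_divide_distrib)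
      then show ?thesis by auto
    qed
    then show "?J k \<inter> ?J l = {}" using kl by (metis Int_commute linorder_neq_iff)
  qed
  have "(\<Sum>k<2 * M * R. emeasure lborel (?J k)) = emeasure lborel A"
    unfolding A_def by (rule sum_emeasure) (use disj in auto)
  moreover have "emeasure lborel (?J k) = ennreal (1 / (200 * real M))" for k using M0 by simp
  ultimately have "emeasure lborel A = (\<Sum>k<2 * M * R. ennreal (1 / (200 * real M)))" by simp
  also have "\<dots> = ennreal (\<Sum>k<2 * M * R. 1 / (200 * real M))" by (rule sum_ennreal) simp
  also have "(\<Sum>k<2 * M * R. 1 / (200 * real M)) = real R / 100" using M0 by simp
  finally have eA: "emeasure lborel A = ennreal (real R / 100)" .
  define S where "S b = (if b = e then A else {0..real R})" for b :: 'a
  have Sm: "S b \<in> sets borel" for b using Am by (simp add: S_def)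
  define E where "E = {x. \<forall>b\<in>Basis. x \<bullet> b \<in> S b}"
  have ind: "indicator E x = (\<Prod>b\<in>Basis. indicator (S b) (x \<bullet> b) :: ennreal)" for x
    by (auto simp: E_def indicator_def prod_zero_iff)
  have Em: "E \<in> sets borel"
  proof -
    have "E = (\<Inter>b\<in>Basis. (\<lambda>x. x \<bullet> b) -` S b)" by (auto simp: E_def)
    moreover have "(\<lambda>x. x \<bullet> b) -` S b \<in> sets borel" for b :: 'a
      using measurable_sets[of "\<lambda>x. x \<bullet> b" borel borel "S b"] Sm by simp
    ultimately show ?thesis by (auto intro!: sets.finite_INT)
  qed
  have "emeasure lborel E = (\<integral>\<^sup>+x. indicator E x \<partial>lborel)" using Em by simp
  also have "\<dots> = (\<integral>\<^sup>+x. (\<Prod>b\<in>Basis. indicator (S b) (x \<bullet> b)) \<partial>lborel)" unfolding ind ..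
  also have "\<dots> = (\<Prod>b\<in>Basis. (\<integral>\<^sup>+t. indicator (S b) t \<partial>lborel))" by (rule nn_integral_lborel_prod) (use Sm in auto)
  also have "\<dots> = (\<Prod>b\<in>Basis. emeasure lborel (S b))" using Sm by simp
  also have "\<dots> = emeasure lborel (S e) * (\<Prod>b\<in>Basis - {e}. emeasure lborel (S b))" by (rule prod.remove) (use e in auto)
  also have "(\<Prod>b\<in>Basis - {e}. emeasure lborel (S b)) = (\<Prod>b\<in>Basis - {e}. ennreal (real R))" by (rule prod.cong) (auto simp: S_def)
  also have "\<dots> = ennreal (real R ^ (DIM('a) - 1))" using e by (simp add: ennreal_power)
  also have "emeasure lborel (S e) = ennreal (real R / 100)" by (simp add: S_def eA)
  also have "ennreal (real R / 100) * ennreal (real R ^ (DIM('a) - 1)) = ennreal (real R / 100 * real R ^ (DIM('a) - 1))" by (rule ennreal_mult[symmetric]) auto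
  also have "real R / 100 * real R ^ (DIM('a) - 1) = real R ^ DIM('a) / 100"
    using power_Suc[of "real R" "DIM('a) - 1"] DIM_positive[where 'a='a] by simp
  finally have eE: "emeasure lborel E = ennreal (real R ^ DIM('a) / 100)" .
  have pt: "norm x \<le> real DIM('a) * real R \<and> (\<exists>k::nat. \<bar>real M * (2 * (e \<bullet> x)) - real k\<bar> \<le> 1 / 100)" if x: "x \<in> E" for x
  proof
    have "x \<bullet> e \<in> A" using x e unfolding E_def S_def by auto
    then obtain k where k: "k < 2 * M * R" "real k / (2 * real M) \<le> x \<bullet> e" "x \<bullet> e \<le> real k / (2 * real M) + 1 / (200 * real M)" unfolding A_def by auto
    have a: "real k \<le> real M * (2 * (e \<bullet> x))" "real M * (2 * (e \<bullet> x)) \<le> real k + 1 / 100"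
      using k(2,3) M0 by (simp_all add: inner_commute field_simps)
    then show "\<exists>k::nat. \<bar>real M * (2 * (e \<bullet> x)) - real k\<bar> \<le> 1 / 100" by (intro exI[of _ k]) simp
    have "real k + 1 \<le> 2 * real M * real R" using k(1) by (metis Suc_leI of_nat_Suc of_nat_le_iff of_nat_mult of_nat_numeral add.commute)
    then have "real M * (2 * (e \<bullet> x)) \<le> real M * (2 * real R)" using a(2) by linarith
    then have up: "x \<bullet> e \<le> real R" using M0 by (simp add: inner_commute)
    have lo: "0 \<le> x \<bullet> e" using k(2) by (rule order_trans[rotated]) simp
    have "\<bar>x \<bullet> b\<bar> \<le> real R" if "b \<in> Basis" for b
      using x that up lo unfolding E_def S_def by (cases "b = e") auto
    then have "(\<Sum>b\<in>Basis. \<bar>x \<bullet> b\<bar>) \<le> real DIM('a) * real R" by (intro sum_bounded_above)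
    then show "norm x \<le> real DIM('a) * real R" using norm_le_l1[of x] by linarith
  qed
  show ?thesis by (rule bexI[OF _ Em]) (use eE pt in auto)
qed

lemma eventually_lacunary_error_small:
  fixes L m :: real
  assumes "L \<ge> 0" "m \<ge> 0"
  shows "\<forall>\<^sub>F M in sequentially. m * (3 * real M * (1/32) ^ M) \<le> 1 / 4 \<and>
    L * ((1/2) ^ M + m * (3 * real M * (1/32) ^ M)) * real M \<le> 1 / 4"
proof -
  let ?y = "\<lambda>M. real M * (1/2) ^ M"
  have y: "?y \<longlonglongrightarrow> 0" using powser_times_n_limit_0[of "1/2 :: real"] by simp
  have "(\<lambda>M. 3 * m * ?y M) \<longlonglongrightarrow> 3 * m * 0" by (intro tendsto_intros y)
  then have "\<forall>\<^sub>F M in sequentially. 3 * m * ?y M < 1 / 4" by (intro order_tendstoD(2)) auto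
  moreover have "(\<lambda>M. L * (?y M + 3 * m * (?y M * ?y M))) \<longlonglongrightarrow> L * (0 + 3 * m * (0 * 0))" by (intro tendsto_intros y)
  then have "\<forall>\<^sub>F M in sequentially. L * (?y M + 3 * m * (?y M * ?y M)) < 1 / 4" by (intro order_tendstoD(2)) auto
  ultimately show ?thesis
  proof eventually_elim
    case (elim M)
    \<comment> \<open>The inequality \<open>32^-M \<le> 4^-M\<close> reduces both conditions to the
      null sequence \<open>M * 2^-M\<close>.\<close>
    have p: "(1/32 :: real) ^ M \<le> (1/2) ^ M * (1/2) ^ M"
      unfolding power_mult_distrib[symmetric] by (intro power_mono) auto
    also have "\<dots> \<le> (1/2) ^ M * 1" by (intro mult_left_mono power_le_one) auto
    finally have p1: "(1/32 :: real) ^ M \<le> (1/2) ^ M" by simp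
    have "m * (3 * real M * (1/32) ^ M) \<le> m * (3 * real M * (1/2) ^ M)"
      using assms by (intro mult_left_mono p1) auto
    moreover have q: "m * (3 * real M * (1/32) ^ M) \<le> m * (3 * real M * ((1/2) ^ M * (1/2) ^ M))"
      using assms by (intro mult_left_mono p) auto
    have "L * ((1/2) ^ M + m * (3 * real M * (1/32) ^ M)) * real M \<le> L * ((1/2) ^ M + m * (3 * real M * ((1/2) ^ M * (1/2) ^ M))) * real M"
      by (intro mult_right_mono mult_left_mono add_left_mono q) (use assms in auto)
    ultimately show ?case using elim by (simp add: algebra_simps)
  qed
qed

theorem proposition1p2:
  fixes \<Psi> :: "real ^ 'n ^ 'm \<Rightarrow> complex"
    and \<phi> :: "real ^ 'n \<Rightarrow> complex"
    and r p :: real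
    and P :: "'m::finite \<Rightarrow> ennreal"
    and s :: "'m \<Rightarrow> real"
    and i\<^sub>1 :: 'm
  assumes "CARD('m) \<ge> 2"
    and "admissible_bump \<Psi>"
    and "schwartz \<phi>" and "fourier \<phi> 0 = 1"
    and "1 < r"
    and "\<And>i. 0 < P i" and "0 < p"
    and "(\<Sum>i\<in>UNIV. 1 / P i) = 1 / ennreal p"
    and "\<And>i. 0 \<le> s i"
    and "\<And>i. s i\<^sub>1 \<le> s i"
    and "s i\<^sub>1 \<le> real CARD('n) / r"
  shows "\<exists>\<sigma> :: real ^ 'n ^ 'm \<Rightarrow> complex.
           \<sigma> \<in> borel_measurable borel \<and> bounded (range \<sigma>) \<and>
           multiplier_sobolev r s \<Psi> \<sigma> < \<infinity> \<and>
           \<not> multiplier_bounded \<phi> P (ennreal p) \<sigma>"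
proof -
  define e :: "real^'n" where "e = axis (SOME k. True) 1"
  have eB: "e \<in> Basis" unfolding e_def by (simp add: axis_in_Basis_iff)
  then have e1: "norm e = 1" and ee: "e \<bullet> e = 1" and e0: "e \<noteq> 0" by (auto simp: inner_Basis)
  have "\<exists>i2. i\<^sub>1 \<noteq> i2"
  proof (rule ccontr)
    assume "\<not> (\<exists>i2. i\<^sub>1 \<noteq> i2)"
    then have "(UNIV :: 'm set) = {i\<^sub>1}" by auto
    then have "CARD('m) = card {i\<^sub>1}" by (rule arg_cong)
    then show False using assms(1) by simp
  qed
  then obtain i2 where ii: "i\<^sub>1 \<noteq> i2" by blast
  define \<eta> :: "real^'n^'m" where "\<eta> = axis i2 e"
  have \<eta>: "norm \<eta> = 1" unfolding \<eta>_def by (simp add: norm_eq_sqrt_inner inner_axis_axis ee)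
  \<comment> \<open>Flat signs are available for powers of two; other \<open>M\<close> get the
    constant sign \<open>1\<close>, since the shells are indexed by all pairs and each of them must
    be given values.\<close>
  have "\<forall>M. \<exists>\<epsilon>::nat \<Rightarrow> real. (\<forall>p. \<epsilon> p \<in> {1, -1}) \<and> ((\<exists>\<mu>. M = 2 ^ \<mu>) \<longrightarrow> (\<forall>z::complex. norm z = 1 \<longrightarrow> norm (\<Sum>p<M. of_real (\<epsilon> p) * z ^ p) \<le> sqrt (2 * real M)))"
  proof
    fix M :: nat
    show "\<exists>\<epsilon>::nat \<Rightarrow> real. (\<forall>p. \<epsilon> p \<in> {1, -1}) \<and> ((\<exists>\<mu>. M = 2 ^ \<mu>) \<longrightarrow> (\<forall>z::complex. norm z = 1 \<longrightarrow> norm (\<Sum>p<M. of_real (\<epsilon> p) * z ^ p) \<le> sqrt (2 * real M)))"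
    proof (cases "\<exists>\<mu>. M = 2 ^ \<mu>")
      case True
      then obtain \<mu> where M: "M = 2 ^ \<mu>" by blast
      have rM: "real M = 2 ^ \<mu>" unfolding M by simp
      show ?thesis unfolding rM using rudin_shapiro[of \<mu>] M by blast
    next
      case False
      then show ?thesis by (intro exI[of _ "\<lambda>_. 1"]) simp
    qed
  qed
  then obtain \<epsilon> :: "nat \<Rightarrow> nat \<Rightarrow> real" where \<epsilon>: "\<forall>M. (\<forall>p. \<epsilon> M p \<in> {1, -1}) \<and> ((\<exists>\<mu>. M = 2 ^ \<mu>) \<longrightarrow> (\<forall>z::complex. norm z = 1 \<longrightarrow> norm (\<Sum>p<M. of_real (\<epsilon> M p) * z ^ p) \<le> sqrt (2 * real M)))"
    by (elim choice[THEN exE])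
  have sgn: "\<epsilon> M p \<in> {1, -1}" for M p using \<epsilon> by blast
  \<comment> \<open>Shell \<open>\<nu>\<close> belongs to the pair \<open>(M, b)\<close> encoded by
    \<open>\<nu>\<close>; its first \<open>M\<close> frequencies are the ones prescribed
    below.\<close>
  define v where "v \<nu> p = test_phase (fst (prod_decode \<nu>)) (\<epsilon> (fst (prod_decode \<nu>))) (snd (prod_decode \<nu>)) p" for \<nu> p
  have v1: "norm (v \<nu> p) \<le> 1" for \<nu> p
    using sgn[of "fst (prod_decode \<nu>)" p] unfolding v_def test_phase_def norm_mult norm_cis norm_of_real by auto
  \<comment> \<open>The multiplier is fixed here, before any bound for the operator and before
    \<open>M\<close>; all \<open>M\<close> are already built into it.\<close>
  obtain \<sigma> S L where \<sigma>m: "\<sigma> \<in> borel_measurable borel" and S: "\<And>\<xi>. norm (\<sigma> \<xi>) \<le> S" and \<sigma>s: "multiplier_sobolev r s \<Psi> \<sigma> < \<infinity>" and L0: "L \<ge> 0"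
    and L: "\<forall>\<nu> p \<xi>. p < fst (prod_decode \<nu>) \<longrightarrow> \<xi> $ i\<^sub>1 = (2 * real p + 1) *\<^sub>R e \<longrightarrow> norm ((1/32) ^ \<nu> *\<^sub>R \<xi> - \<eta>) \<le> 1 / 4 \<longrightarrow>
      isCont \<sigma> \<xi> \<and> norm (\<sigma> \<xi> - v \<nu> p) \<le> L * ((1/2) ^ \<nu> + norm ((1/32) ^ \<nu> *\<^sub>R \<xi> - \<eta>))"
    using multiplier_construction[OF assms(1), where s=s and i=i\<^sub>1 and v=v and M="\<lambda>\<nu>. fst (prod_decode \<nu>)", OF assms(9) assms(5) assms(11) assms(2) e0 v1 \<eta>]
    by (elim exE conjE) (rule that, assumption, erule spec)
  have "\<not> multiplier_bounded \<phi> P (ennreal p) \<sigma>"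
  proof
    assume "multiplier_bounded \<phi> P (ennreal p) \<sigma>"
    then obtain C0 where C0: "\<forall>f. (\<forall>i. schwartz (f i) \<and> hardy_norm \<phi> (P i) (f i) < \<infinity>) \<longrightarrow>
        Lnorm (ennreal p) (\<lambda>x. ennreal (norm (multiplier_op \<sigma> f x))) \<le> ennreal C0 * (\<Prod>i\<in>UNIV. hardy_norm \<phi> (P i) (f i))"
      unfolding multiplier_bounded_def by blast
    \<comment> \<open>\<open>ennreal\<close> of a negative number is \<open>0\<close>, so the bound
      may be taken nonnegative.\<close>
    define C where "C = max 0 C0"
    have C: "C \<ge> 0" "ennreal C0 = ennreal C" by (auto simp: C_def max_def ennreal_neg)
    let ?h = "(1/2) *\<^sub>R e"
    have "\<forall>i. \<exists>N. \<exists>D\<ge>0. \<forall>R\<ge>(1::nat). \<forall>Q. continuous_on UNIV Q \<longrightarrow> (\<forall>x. norm (Q x) \<le> 1) \<longrightarrow> (\<forall>x. Q (x + ?h) = - Q x) \<longrightarrow>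
       hardy_norm \<phi> (P i) (\<lambda>y. Q y * of_real (averaged_gaussian ?h (1 / real R) N y)) \<le> ennreal (D * real R powr (real DIM(real^'n) * enn2real (1 / P i)))"
      by (intro allI hardy_norm_averaged_gaussian_bound assms(3) eB assms(6))
    then obtain K D where D: "\<forall>i. D i \<ge> 0 \<and> (\<forall>R\<ge>(1::nat). \<forall>Q. continuous_on UNIV Q \<longrightarrow> (\<forall>x. norm (Q x) \<le> 1) \<longrightarrow> (\<forall>x. Q (x + ?h) = - Q x) \<longrightarrow>
       hardy_norm \<phi> (P i) (\<lambda>y. Q y * of_real (averaged_gaussian ?h (1 / real R) (K i) y)) \<le> ennreal (D i * real R powr (real DIM(real^'n) * enn2real (1 / P i))))"
      by (elim choice[THEN exE])
    let ?n = "real CARD('n)" and ?m = "real CARD('m)"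
    \<comment> \<open>The value of the common envelope at distance \<open>n * R\<close>, beyond
      which the set used for the lower bound does not reach.\<close>
    define c0 where "c0 = exp (- pi * ?m * ?n\<^sup>2)"
    have c0: "c0 > 0" by (simp add: c0_def)
    \<comment> \<open>The upper bound that the final inequality forces on \<open>sqrt M\<close>:
      \<open>16\<close> comes from the pointwise lower bound, \<open>100 powr (1 / p)\<close> from
      the proportion \<open>1 / 100\<close> of the set.\<close>
    define B where "B = 16 * (C * (\<Prod>i\<in>UNIV. D i)) * 100 powr (1 / p) / c0"
    have "\<forall>\<^sub>F M in sequentially. ?m * (3 * real M * (1/32) ^ M) \<le> 1 / 4 \<and>
      L * ((1/2) ^ M + ?m * (3 * real M * (1/32) ^ M)) * real M \<le> 1 / 4"
      by (rule eventually_lacunary_error_small[OF L0]) simp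
    then obtain M0 where M0: "\<And>M. M \<ge> M0 \<Longrightarrow> ?m * (3 * real M * (1/32) ^ M) \<le> 1 / 4 \<and>
      L * ((1/2) ^ M + ?m * (3 * real M * (1/32) ^ M)) * real M \<le> 1 / 4"
      unfolding eventually_sequentially by blast
    \<comment> \<open>A power of two beyond both thresholds, by \<open>k < 2 ^ k\<close>.\<close>
    define M :: nat where "M = 2 ^ (max M0 (nat \<lceil>B\<^sup>2\<rceil>))"
    have Mge: "max M0 (nat \<lceil>B\<^sup>2\<rceil>) < M" unfolding M_def by (rule less_exp)
    have M1: "M \<ge> 1" using Mge by simp
    have "B\<^sup>2 \<le> real (nat \<lceil>B\<^sup>2\<rceil>)" by (rule of_nat_ceiling)
    then have "B\<^sup>2 < real M" using Mge by linarith
    then have MB: "B < sqrt (real M)" by (rule real_less_rsqrt)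
    have Md: "?m * (3 * real M * (1/32) ^ M) \<le> 1 / 4" and Ms: "L * ((1/2) ^ M + ?m * (3 * real M * (1/32) ^ M)) * real M \<le> 1 / 4"
      using M0[of M] Mge by auto
    have flat: "\<forall>z::complex. norm z = 1 \<longrightarrow> norm (\<Sum>p<M. of_real (\<epsilon> M p) * z ^ p) \<le> sqrt (2 * real M)"
      using \<epsilon> unfolding M_def by blast
    note ctx = ii M1 sgn[of M] flat
    let ?A = "test_index i\<^sub>1 i2 M" and ?c = "test_coeff i\<^sub>1 i2 M (\<epsilon> M)" and ?d = "test_freq i\<^sub>1 i2 M"
    define \<tau> where "\<tau> g = (\<chi> j. ?d j (g j) *\<^sub>R e)" for g
    define \<kappa> where "\<kappa> = L * ((1/2) ^ M + ?m * (3 * real M * (1/32) ^ M))"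
    \<comment> \<open>The shell index is at least \<open>M\<close>, so the error
      \<open>\<kappa>\<close> is uniform over all frequencies that occur.\<close>
    have near: "isCont \<sigma> (\<tau> g) \<and> norm (\<sigma> (\<tau> g) - test_phase M (\<epsilon> M) (fst (g i2)) (fst (g i\<^sub>1))) \<le> \<kappa>" if g: "g \<in> PiE UNIV ?A" for g
    proof -
      let ?\<nu> = "prod_encode (M, fst (g i2))"
      have "g i\<^sub>1 \<in> ?A i\<^sub>1" using g by auto
      then have a: "fst (g i\<^sub>1) < M" unfolding test_index_def[OF ctx] by auto
      have "\<tau> g $ i\<^sub>1 = ?d i\<^sub>1 (g i\<^sub>1) *\<^sub>R e" unfolding \<tau>_def by simp
      then have x1: "\<tau> g $ i\<^sub>1 = (2 * real (fst (g i\<^sub>1)) + 1) *\<^sub>R e" unfolding test_freq_def[OF ctx] by (simp add: split_beta)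
      have dist: "norm ((1/32) ^ ?\<nu> *\<^sub>R \<tau> g - \<eta>) \<le> ?m * (3 * real M * (1/32) ^ M)"
        unfolding \<tau>_def \<eta>_def by (rule test_freq_distance[OF ctx e1 g])
      have vv: "v ?\<nu> (fst (g i\<^sub>1)) = test_phase M (\<epsilon> M) (fst (g i2)) (fst (g i\<^sub>1))" unfolding v_def by simp
      have *: "isCont \<sigma> (\<tau> g) \<and> norm (\<sigma> (\<tau> g) - v ?\<nu> (fst (g i\<^sub>1))) \<le> L * ((1/2) ^ ?\<nu> + norm ((1/32) ^ ?\<nu> *\<^sub>R \<tau> g - \<eta>))"
        by (rule L[rule_format]) (use a x1 dist Md in auto)
      moreover have "L * ((1/2) ^ ?\<nu> + norm ((1/32) ^ ?\<nu> *\<^sub>R \<tau> g - \<eta>)) \<le> \<kappa>"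
        unfolding \<kappa>_def by (intro mult_left_mono add_mono dist L0 power_decreasing le_prod_encode_1) auto
      ultimately show ?thesis unfolding vv by linarith
    qed
    have h1: "norm ?h \<le> 1" using e1 by simp
    have cont: "isCont \<sigma> (\<chi> j. ?d j (g j) *\<^sub>R e)" if "g \<in> PiE UNIV ?A" for g using near[OF that] unfolding \<tau>_def by blast
    obtain E where E: "E \<longlonglongrightarrow> 0" and Eb: "\<forall>R\<ge>1. \<forall>x.
      norm (multiplier_op \<sigma> (\<lambda>j. gaussian_trig_poly (?A j) (?c j) (?d j) e ?h (1 / real R) (K j)) x
        - of_real (exp (- pi * ?m * (norm x / R)\<^sup>2)) * (\<Sum>g\<in>PiE UNIV ?A. (\<Prod>j\<in>UNIV. ?c j (g j)) * \<sigma> (\<tau> g) * cis (2 * pi * (\<Sum>j\<in>UNIV. ?d j (g j) * (e \<bullet> x))))) \<le> E R"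
      by (rule exE[OF gaussian_transference[where A="?A" and c="?c" and d="?d" and e=e and h="?h" and K=K, OF \<sigma>m S test_index_finite[OF ctx] h1]], erule cont, erule conjE, rule that, assumption, unfold \<tau>_def, assumption)
    have "\<forall>\<^sub>F R in sequentially. E R < c0 * sqrt (real M) / 16 \<and> R \<ge> 1"
      by (intro eventually_conj eventually_ge_at_top order_tendstoD(2)[OF E]) (use c0 M1 in simp)
    \<comment> \<open>\<open>R\<close> is chosen last: the transference error tends to
      \<open>0\<close> for the trigonometric polynomials belonging to the given \<open>M\<close>,
      with no control of the rate.\<close>
    then obtain R where R: "E R < c0 * sqrt (real M) / 16" "R \<ge> 1"
      using eventually_happens'[OF sequentially_bot] by blast
    define f where "f j = gaussian_trig_poly (?A j) (?c j) (?d j) e ?h (1 / real R) (K j)" for j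
    let ?poly = "test_poly i\<^sub>1 i2 M (\<epsilon> M)"
    have fP: "f j = (\<lambda>y. ?poly j (e \<bullet> y) * of_real (averaged_gaussian ?h (1 / real R) (K j) y))" for j
      unfolding f_def by (rule ext) (simp only: gaussian_trig_poly_def test_poly_def[OF ctx])
    have fs: "schwartz (f j)" for j
      unfolding f_def by (rule gaussian_trig_poly_schwartz) (use R test_index_finite[OF ctx] in auto)
    have fh: "hardy_norm \<phi> (P j) (f j) \<le> ennreal (D j * real R powr (?n * enn2real (1 / P j)))" for j
    proof -
      have "continuous_on UNIV (\<lambda>y. ?poly j (e \<bullet> y))"
        unfolding test_poly_def[OF ctx] cis_conv_exp by (intro continuous_intros)
      moreover have "norm (?poly j (e \<bullet> x)) \<le> 1" for x by (rule test_poly_bound[OF ctx])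
      moreover have "?poly j (e \<bullet> (x + ?h)) = - ?poly j (e \<bullet> x)" for x
        using test_poly_antiperiodic[OF ctx, of j "e \<bullet> x"] by (simp add: inner_add_right ee)
      ultimately have "hardy_norm \<phi> (P j) (\<lambda>y. ?poly j (e \<bullet> y) * of_real (averaged_gaussian ?h (1 / real R) (K j) y)) \<le> ennreal (D j * real R powr (real DIM(real^'n) * enn2real (1 / P j)))"
        using D R(2) by blast
      then show ?thesis unfolding fP by simp
    qed
    let ?T = "\<lambda>x. multiplier_op \<sigma> f x"
    have R0: "real R > 0" using R by simp
    \<comment> \<open>By the relation between the exponents the Hardy norms contribute exactly the
      power \<open>R powr (n / p)\<close> of the lower bound, so \<open>R\<close> cancels in the
      end.\<close>
    have sumP: "(\<Sum>j\<in>UNIV. enn2real (1 / P j)) = 1 / p"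
    proof -
      have "1 / ennreal p = ennreal (1 / p)" using assms(7) by (subst ennreal_1[symmetric], subst divide_ennreal) auto
      moreover have "1 / P j < \<infinity>" for j using assms(6)[of j] by (auto simp: less_top[symmetric] ennreal_divide_eq_top_iff)
      then have "enn2real (\<Sum>j\<in>UNIV. 1 / P j) = (\<Sum>j\<in>UNIV. enn2real (1 / P j))" by (subst enn2real_sum) auto
      ultimately show ?thesis using assms(7,8) by simp
    qed
    have upper: "Lnorm (ennreal p) (\<lambda>x. ennreal (norm (?T x))) \<le> ennreal (C * (\<Prod>i\<in>UNIV. D i) * real R powr (?n / p))"
    proof -
      have "hardy_norm \<phi> (P i) (f i) < \<infinity>" for i using fh[of i] by (rule order_le_less_trans) simp
      then have "Lnorm (ennreal p) (\<lambda>x. ennreal (norm (?T x))) \<le> ennreal C * (\<Prod>i\<in>UNIV. hardy_norm \<phi> (P i) (f i))"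
        using C0 fs C(2) by simp
      also have "\<dots> \<le> ennreal C * (\<Prod>i\<in>UNIV. ennreal (D i * real R powr (?n * enn2real (1 / P i))))"
        by (intro mult_left_mono prod_mono_ennreal fh) simp
      also have "\<dots> = ennreal C * ennreal (\<Prod>i\<in>UNIV. D i * real R powr (?n * enn2real (1 / P i)))"
        by (subst prod_ennreal) (use D in auto)
      also have "(\<Prod>i\<in>UNIV. D i * real R powr (?n * enn2real (1 / P i))) = (\<Prod>i\<in>UNIV. D i) * real R powr (?n / p)"
        unfolding prod.distrib using R0 by (simp add: powr_sum[symmetric] sum_distrib_left[symmetric] sumP)
      also have "ennreal C * ennreal ((\<Prod>i\<in>UNIV. D i) * real R powr (?n / p)) = ennreal (C * ((\<Prod>i\<in>UNIV. D i) * real R powr (?n / p)))"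
        by (rule ennreal_mult[symmetric]) (use C D in \<open>auto intro!: mult_nonneg_nonneg prod_nonneg\<close>)
      finally show ?thesis by (simp only: mult.assoc)
    qed
    obtain V where V: "V \<in> sets borel" "ennreal (real R ^ DIM(real^'n) / 100) \<le> emeasure lborel V"
      and Vx: "\<forall>x\<in>V. norm x \<le> real DIM(real^'n) * real R \<and> (\<exists>k::nat. \<bar>real M * (2 * (e \<bullet> x)) - real k\<bar> \<le> 1 / 100)"
      using periodic_slab[OF eB M1] by blast
    \<comment> \<open>The main term \<open>sqrt M / 4\<close> loses at most half to the deviation of
      the multiplier; the envelope costs the factor \<open>c0\<close>, and the transference error
      takes at most half of what is left.\<close>
    have low: "c0 * sqrt (real M) / 16 \<le> norm (?T x)" if x: "x \<in> V" for x
    proof -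
      obtain k :: nat where k: "\<bar>real M * (2 * (e \<bullet> x)) - real k\<bar> \<le> 1 / 100" using Vx x by blast
      have nx: "norm x \<le> ?n * real R" using Vx x by simp
      let ?G = "PiE UNIV ?A" and ?w = "\<lambda>g. cis (2 * pi * (\<Sum>j\<in>UNIV. ?d j (g j) * (e \<bullet> x)))" and ?C = "\<lambda>g. \<Prod>j\<in>UNIV. ?c j (g j)"
      let ?v = "\<lambda>g. test_phase M (\<epsilon> M) (fst (g i2)) (fst (g i\<^sub>1))"
      have m1: "sqrt (real M) / 4 \<le> norm (\<Sum>g\<in>?G. ?C g * ?v g * ?w g)" by (rule test_main_lower_bound[OF ctx k])
      have "norm ((\<Sum>g\<in>?G. ?C g * \<sigma> (\<tau> g) * ?w g) - (\<Sum>g\<in>?G. ?C g * ?v g * ?w g)) = norm (\<Sum>g\<in>?G. ?C g * (\<sigma> (\<tau> g) - ?v g) * ?w g)"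
        unfolding sum_subtractf[symmetric] by (simp only: right_diff_distrib left_diff_distrib)
      also have "\<dots> \<le> (\<Sum>g\<in>?G. norm (?C g) * \<kappa>)"
        by (rule sum_norm_le) (unfold norm_mult norm_cis mult_1_right, rule mult_left_mono, use near in auto)
      also have "\<dots> = sqrt (real M) / 2 * real M * \<kappa>" unfolding sum_distrib_right[symmetric] test_coeff_sum[OF ctx] ..
      also have "\<dots> = sqrt (real M) / 2 * (\<kappa> * real M)" by simp
      also have "\<dots> \<le> sqrt (real M) / 2 * (1 / 4)" by (intro mult_left_mono) (use Ms in \<open>auto simp: \<kappa>_def\<close>)
      finally have m2: "norm ((\<Sum>g\<in>?G. ?C g * \<sigma> (\<tau> g) * ?w g) - (\<Sum>g\<in>?G. ?C g * ?v g * ?w g)) \<le> sqrt (real M) / 8" by simp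
      have m3: "sqrt (real M) / 8 \<le> norm (\<Sum>g\<in>?G. ?C g * \<sigma> (\<tau> g) * ?w g)"
        using m1 m2 norm_triangle_ineq2[of "\<Sum>g\<in>?G. ?C g * ?v g * ?w g" "\<Sum>g\<in>?G. ?C g * \<sigma> (\<tau> g) * ?w g"] unfolding norm_minus_commute[of "\<Sum>g\<in>?G. ?C g * ?v g * ?w g"] by linarith
      let ?g = "exp (- pi * ?m * (norm x / R)\<^sup>2)"
      have "norm x / R \<le> ?n" using nx R0 by (simp add: pos_divide_le_eq)
      then have "(norm x / R)\<^sup>2 \<le> ?n\<^sup>2" by (rule power_mono) simp
      then have "pi * ?m * (norm x / R)\<^sup>2 \<le> pi * ?m * ?n\<^sup>2" by (rule mult_left_mono) simp
      then have g: "c0 \<le> ?g" unfolding c0_def by simp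
      have "norm (?T x - of_real ?g * (\<Sum>g\<in>?G. ?C g * \<sigma> (\<tau> g) * ?w g)) \<le> E R" using Eb R(2) unfolding f_def by blast
      moreover have "c0 * (sqrt (real M) / 8) \<le> norm (of_real ?g * (\<Sum>g\<in>?G. ?C g * \<sigma> (\<tau> g) * ?w g))"
        unfolding norm_mult norm_of_real abs_exp_cancel by (rule mult_mono[OF g m3]) auto
      ultimately show ?thesis
        using R(1) norm_triangle_ineq2[of "of_real ?g * (\<Sum>g\<in>?G. ?C g * \<sigma> (\<tau> g) * ?w g)" "?T x"] unfolding norm_minus_commute[of _ "?T x"] by linarith
    qed
    have "ennreal (c0 * sqrt (real M) / 16 * (real R ^ DIM(real^'n) / 100) powr (1 / p)) \<le> Lnorm (ennreal p) (\<lambda>x. ennreal (norm (?T x)))"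
      by (rule Lnorm_lower_bound[OF assms(7) V(1) _ _ V(2)]) (use c0 low in \<open>auto intro!: ennreal_leI\<close>)
    then have "ennreal (c0 * sqrt (real M) / 16 * (real R ^ DIM(real^'n) / 100) powr (1 / p)) \<le> ennreal (C * (\<Prod>i\<in>UNIV. D i) * real R powr (?n / p))"
      using upper by (rule order_trans)
    then have le: "c0 * sqrt (real M) / 16 * (real R ^ DIM(real^'n) / 100) powr (1 / p) \<le> C * (\<Prod>i\<in>UNIV. D i) * real R powr (?n / p)"
      by (subst (asm) ennreal_le_iff) (use C D in \<open>auto intro!: mult_nonneg_nonneg prod_nonneg\<close>)
    have "(real R ^ DIM(real^'n) / 100) powr (1 / p) = (real R ^ CARD('n)) powr (1 / p) / 100 powr (1 / p)" by (simp add: powr_divide)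
    also have "(real R ^ CARD('n)) powr (1 / p) = real R powr (?n / p)"
      using powr_realpow[OF R0, of "CARD('n)"] powr_powr[of "real R" ?n "1 / p"] by simp
    finally have e: "(real R ^ DIM(real^'n) / 100) powr (1 / p) = real R powr (?n / p) / 100 powr (1 / p)" .
    have "real R powr (?n / p) * (c0 * sqrt (real M) / 16 / 100 powr (1 / p)) \<le> real R powr (?n / p) * (C * (\<Prod>i\<in>UNIV. D i))"
      using le unfolding e by (simp add: mult_ac)
    then have "c0 * sqrt (real M) / 16 / 100 powr (1 / p) \<le> C * (\<Prod>i\<in>UNIV. D i)"
      by (rule mult_left_le_imp_le) (use R0 in simp)
    then have "sqrt (real M) \<le> B" unfolding B_def using c0 by (simp add: field_simps)
    then show False using MB by simp
  qed
  moreover have "bounded (range \<sigma>)" using S by (intro boundedI[of _ S]) auto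
  ultimately show ?thesis using \<sigma>m \<sigma>s by blast
qed

end
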